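(* Let $A, C, G\in\mathbf{R}^{n\times n}$, $b\in\mathbf{R}^{n\times m}$, $\Gamma\in\mathbf{R}^{m\times m}$ be constant real matrices with $G=G^\top$, $\Gamma=\Gamma^\top$. Let $a$ be a random $n$-vector, $\mathcal{F}(0)$-measurable, independent of the Wiener process $w$, with $\mathbf{E}|a|^2<\infty$. Let $U=L^2[(0,+\infty),\mathbf{R}^m]$ be the space of deterministic controls. For $u\in U$ let $x(t)$, $t\ge 0$, be the solution of the It\^o equation $$dx(t)=(Ax(t)+bu(t))\,dt+Cx(t)\,dw(t),\qquad x(0)=a,$$ and let $$\Phi[u(\cdot)]=\int_0^\infty\left[\mathbf{E}\,x(t)^\top Gx(t)+u(t)^\top\Gamma u(t)\right]dt .$$ Assume that $A$ is a Hurwitz matrix and that for $u\equiv 0$ the system is exponentially stable in the mean square. Let $g(\lambda)=(i\lambda I-A)^{-1}$ for $\lambda\in\mathbf{R}$, let the $n\times n$ matrix $\Theta$ satisfy $$\Theta=G+\frac1{2\pi}\int_{-\infty}^{\infty}C^\top g(-\lambda)^\top\,\Theta\, g(\lambda)C\,d\lambda ,$$ and let $F(x,u)=x^*\Theta x+u^*\Gamma u$ for $(x,u)\in\mathbf{C}^n\times\mathbf{C}^m$. Then: (i) If there exists an optimal control, i.e. $u^0\in U$ with $\Phi[u^0(\cdot)]\le\Phi[u(\cdot)]$ for all $u\in U$, then $$F(g(\lambda)bu,u)\ge 0\qquad \text{for all }\lambda\in\mathbf{R},\ u\in\mathbf{C}^m .$$ (ii) If there exists a number $\delta>0$ such that $$F(g(\lambda)bu,u)\ge\delta|u|^2\qquad\text{for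 all }\lambda\in\mathbf{R},\ u\in\mathbf{C}^m,$$ then there exists an optimal control $u^0\in U$, and it is unique up to equality almost everywhere on $(0,+\infty)$.
   Context: The setting is a standard probability space $(\Omega,\mathcal{F},\mathbf{P})$ with a nondecreasing family of $\sigma$-algebras $\mathcal{F}(t)\subset\mathcal{F}$, $t\ge0$; $w(t)$ is a scalar standard Wiener process adapted to $\mathcal{F}(t)$ (with the usual convention that its increments after time $t$ are independent of $\mathcal{F}(t)$). $\mathbf{E}$ denotes expectation; $|z|$ is the square root of the sum of squared moduli of the entries of a vector or matrix $z$; $|\xi|_2=(\mathbf{E}|\xi|^2)^{1/2}$ for a random vector $\xi$; ${}^\top$ is transpose and ${}^*$ is conjugate transpose; $i$ is the imaginary unit and $I$ the identity matrix. $L^2[(0,+\infty),\mathbf{R}^m]$ is the space of deterministic (non-random) measurable functions $u:(0,+\infty)\to\mathbf{R}^m$ with $\int_0^\infty|u(t)|^2dt<\infty$. A matrix is Hurwitz if all its eigenvalues have negative real part. "Exponentially stable in the mean square for $u\equiv0$" means: there exist numbers $c,\varepsilon>0$ such that, for every initial vector $a$ as in the statement, the solution $x(t)$ with $u\equiv0$ satisfies $|x(t)|_2\le c\,e^{-\varepsilon t}|a|_2$ for all $t>0$. *)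

theory Defs
  imports "HOL-Probability.Probability" "HOL-Library.Complex_Order"
begin

section \<open>Filtration and Wiener process\<close>

definition nonneg_filtration :: "'w measure \<Rightarrow> (real \<Rightarrow> 'w measure) \<Rightarrow> bool" where
  "nonneg_filtration M F \<longleftrightarrow>
     (\<forall>t\<ge>0. subalgebra M (F t)) \<and> (\<forall>s\<ge>0. \<forall>t\<ge>s. sets (F s) \<subseteq> sets (F t))"

definition wiener_process ::
    "'w measure \<Rightarrow> (real \<Rightarrow> 'w measure) \<Rightarrow> (real \<Rightarrow> 'w \<Rightarrow> real) \<Rightarrow> bool" where
  "wiener_process M F w \<longleftrightarrow>
     (\<forall>t\<ge>0. w t \<in> borel_measurable (F t)) \<and>
     (AE \<omega> in M. w 0 \<omega> = 0) \<and>
     (AE \<omega> in M. continuous_on {0..} (\<lambda>t. w t \<omega>)) \<and>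
     (\<forall>s\<ge>0. \<forall>t>s.
        distributed M lborel (\<lambda>\<omega>. w t \<omega> - w s \<omega>) (\<lambda>z. ennreal (normal_density 0 (sqrt (t - s)) z)) \<and>
        prob_space.indep_set M (sets (F s))
          (sets (vimage_algebra (space M) (\<lambda>\<omega>. w t \<omega> - w s \<omega>) borel)))"

definition square_integrable :: "'w measure \<Rightarrow> ('w \<Rightarrow> 'b::euclidean_space) \<Rightarrow> bool" where
  "square_integrable M \<xi> \<longleftrightarrow> \<xi> \<in> borel_measurable M \<and> integrable M (\<lambda>\<omega>. (norm (\<xi> \<omega>))\<^sup>2)"

definition rms :: "'w measure \<Rightarrow> ('w \<Rightarrow> 'b::real_normed_vector) \<Rightarrow> real" where
  "rms M \<xi> = sqrt (\<integral>\<omega>. (norm (\<xi> \<omega>))\<^sup>2 \<partial>M)"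

definition initial_state ::
    "'w measure \<Rightarrow> (real \<Rightarrow> 'w measure) \<Rightarrow> (real \<Rightarrow> 'w \<Rightarrow> real) \<Rightarrow> ('w \<Rightarrow> real^'n) \<Rightarrow> bool" where
  "initial_state M F w a \<longleftrightarrow>
     a \<in> borel_measurable (F 0) \<and> square_integrable M a \<and>
     prob_space.indep_set M (sets (vimage_algebra (space M) a borel))
       (sigma_sets (space M) (\<Union>t\<in>{0..}. sets (vimage_algebra (space M) (w t) borel)))"

section \<open>Ito integral and Ito equation\<close>

text \<open>An elementary process is given by a partition \<open>\<tau>\<close> with \<open>N\<close> cells and coefficients \<open>e\<close>; on
  the cell \<open>[\<tau> k, \<tau> (k + 1))\<close> it takes the value \<open>e k\<close>, which is known at the left end point.\<close>

definition elementary ::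
    "'w measure \<Rightarrow> (real \<Rightarrow> 'w measure) \<Rightarrow> (nat \<Rightarrow> real) \<Rightarrow> nat \<Rightarrow>
     (nat \<Rightarrow> 'w \<Rightarrow> 'b::euclidean_space) \<Rightarrow> bool" where
  "elementary M F \<tau> N e \<longleftrightarrow>
     0 \<le> \<tau> 0 \<and> (\<forall>k<N. \<tau> k \<le> \<tau> (Suc k)) \<and>
     (\<forall>k<N. e k \<in> borel_measurable (F (\<tau> k)) \<and> square_integrable M (e k))"

definition elementary_process ::
    "(nat \<Rightarrow> real) \<Rightarrow> nat \<Rightarrow> (nat \<Rightarrow> 'w \<Rightarrow> 'b::euclidean_space) \<Rightarrow> real \<Rightarrow> 'w \<Rightarrow> 'b" where
  "elementary_process \<tau> N e s \<omega> = (\<Sum>k<N. indicator {\<tau> k..<\<tau> (Suc k)} s *\<^sub>R e k \<omega>)"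

definition elementary_integral ::
    "(real \<Rightarrow> 'w \<Rightarrow> real) \<Rightarrow> (nat \<Rightarrow> real) \<Rightarrow> nat \<Rightarrow> (nat \<Rightarrow> 'w \<Rightarrow> 'b::euclidean_space) \<Rightarrow>
     real \<Rightarrow> 'w \<Rightarrow> 'b" where
  "elementary_integral w \<tau> N e t \<omega> =
     (\<Sum>k<N. (w (min t (\<tau> (Suc k))) \<omega> - w (min t (\<tau> k)) \<omega>) *\<^sub>R e k \<omega>)"

definition jointly_measurable :: "'w measure \<Rightarrow> (real \<Rightarrow> 'w \<Rightarrow> 'b::euclidean_space) \<Rightarrow> bool" where
  "jointly_measurable M f \<longleftrightarrow>
     (\<lambda>(s, \<omega>). f s \<omega>) \<in> borel_measurable (restrict_space borel {0..} \<Otimes>\<^sub>M M)"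

text \<open>\<open>has_ito_integral M F w f t J\<close>: the random vector \<open>J\<close> is (a version of) the Ito integral of
  \<open>f\<close> with respect to \<open>w\<close> over \<open>[0, t]\<close>, obtained by extending the elementary integral through
  the Ito isometry. Since \<open>J\<close> is only determined almost surely, this is a relation.\<close>

definition has_ito_integral ::
    "'w measure \<Rightarrow> (real \<Rightarrow> 'w measure) \<Rightarrow> (real \<Rightarrow> 'w \<Rightarrow> real) \<Rightarrow>
     (real \<Rightarrow> 'w \<Rightarrow> 'b::euclidean_space) \<Rightarrow> real \<Rightarrow> ('w \<Rightarrow> 'b) \<Rightarrow> bool" where
  "has_ito_integral M F w f t J \<longleftrightarrow>
     jointly_measurable M f \<and> J \<in> borel_measurable M \<and>
     (\<exists>\<tau> N e.
        (\<forall>j. elementary M F (\<tau> j) (N j) (e j)) \<and>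
        (\<lambda>j. \<integral>\<^sup>+s\<in>{0..t}. (\<integral>\<^sup>+\<omega>. ennreal ((norm (f s \<omega> - elementary_process (\<tau> j) (N j) (e j) s \<omega>))\<^sup>2) \<partial>M)
           \<partial>lborel) \<longlonglongrightarrow> 0 \<and>
        (\<lambda>j. \<integral>\<^sup>+\<omega>. ennreal ((norm (J \<omega> - elementary_integral w (\<tau> j) (N j) (e j) t \<omega>))\<^sup>2) \<partial>M)
           \<longlonglongrightarrow> 0)"

text \<open>Strong solutions of \<open>dx = (A x + b u) dt + C x dw\<close>, \<open>x 0 = a\<close>, in the mean square sense.
  They are unique up to modification. Path continuity is not demanded: every solution has an
  almost surely continuous modification, and only moments at fixed times are used below.\<close>

definition ito_solution ::
    "'w measure \<Rightarrow> (real \<Rightarrow> 'w measure) \<Rightarrow> (real \<Rightarrow> 'w \<Rightarrow> real) \<Rightarrow>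
     real^'n^'n \<Rightarrow> real^'m^'n \<Rightarrow> real^'n^'n \<Rightarrow> ('w \<Rightarrow> real^'n) \<Rightarrow> (real \<Rightarrow> real^'m) \<Rightarrow>
     (real \<Rightarrow> 'w \<Rightarrow> real^'n) \<Rightarrow> bool" where
  "ito_solution M F w A b C a u x \<longleftrightarrow>
     (\<forall>t\<ge>0. x t \<in> borel_measurable (F t)) \<and>
     jointly_measurable M x \<and>
     (\<forall>t\<ge>0. (\<integral>\<^sup>+s\<in>{0..t}. (\<integral>\<^sup>+\<omega>. ennreal ((norm (x s \<omega>))\<^sup>2) \<partial>M) \<partial>lborel) < \<infinity>) \<and>
     (\<forall>t\<ge>0. \<exists>J. has_ito_integral M F w (\<lambda>s \<omega>. C *v x s \<omega>) t J \<and>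
        (AE \<omega> in M. x t \<omega> = a \<omega> + (LINT s:{0<..t}|lborel. A *v x s \<omega> + b *v u s) + J \<omega>))"

section \<open>Stability, cost and optimality\<close>

abbreviation cmat :: "real^'k^'l \<Rightarrow> complex^'k^'l" where
  "cmat \<equiv> map_matrix complex_of_real"

definition hurwitz :: "real^'n^'n \<Rightarrow> bool" where
  "hurwitz A \<longleftrightarrow> (\<forall>\<mu> v. v \<noteq> 0 \<and> cmat A *v v = \<mu> *s v \<longrightarrow> Re \<mu> < 0)"

definition mean_square_exp_stable ::
    "'w measure \<Rightarrow> (real \<Rightarrow> 'w measure) \<Rightarrow> (real \<Rightarrow> 'w \<Rightarrow> real) \<Rightarrow>
     real^'n^'n \<Rightarrow> real^'m^'n \<Rightarrow> real^'n^'n \<Rightarrow> bool" where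
  "mean_square_exp_stable M F w A b C \<longleftrightarrow>
     (\<exists>c>0. \<exists>\<epsilon>>0. \<forall>a x. initial_state M F w a \<and> ito_solution M F w A b C a (\<lambda>_. 0) x \<longrightarrow>
        (\<forall>t>0. rms M (x t) \<le> c * exp (- \<epsilon> * t) * rms M a))"

definition controls :: "(real \<Rightarrow> real^'m) set" where
  "controls = {u. set_borel_measurable lborel {0<..} u \<and>
                  set_integrable lborel {0<..} (\<lambda>t. (norm (u t))\<^sup>2)}"

definition cost ::
    "'w measure \<Rightarrow> real^'n^'n \<Rightarrow> real^'m^'m \<Rightarrow> (real \<Rightarrow> 'w \<Rightarrow> real^'n) \<Rightarrow> (real \<Rightarrow> real^'m) \<Rightarrow> real"
  where
  "cost M G \<Gamma> x u =
     (LINT t:{0<..}|lborel. (\<integral>\<omega>. x t \<omega> \<bullet> (G *v x t \<omega>) \<partial>M) + u t \<bullet> (\<Gamma> *v u t))"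

text \<open>Here \<open>x u\<close> is the state process driven by the control \<open>u\<close>.\<close>

definition optimal_control ::
    "'w measure \<Rightarrow> real^'n^'n \<Rightarrow> real^'m^'m \<Rightarrow> ((real \<Rightarrow> real^'m) \<Rightarrow> real \<Rightarrow> 'w \<Rightarrow> real^'n) \<Rightarrow>
     (real \<Rightarrow> real^'m) \<Rightarrow> bool" where
  "optimal_control M G \<Gamma> x u0 \<longleftrightarrow>
     u0 \<in> controls \<and> (\<forall>u\<in>controls. cost M G \<Gamma> (x u0) u0 \<le> cost M G \<Gamma> (x u) u)"

section \<open>Frequency domain\<close>

definition resolvent :: "real^'n^'n \<Rightarrow> real \<Rightarrow> complex^'n^'n" where
  "resolvent A \<nu> = matrix_inv (mat (\<i> * complex_of_real \<nu>) - cmat A)"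

text \<open>The value \<open>z\<^sup>* H z\<close>.\<close>

definition qform :: "complex^'k^'k \<Rightarrow> complex^'k \<Rightarrow> complex" where
  "qform H z = (\<Sum>i\<in>UNIV. cnj (z $ i) * (H *v z) $ i)"

definition theta_equation ::
    "real^'n^'n \<Rightarrow> real^'n^'n \<Rightarrow> real^'n^'n \<Rightarrow> complex^'n^'n \<Rightarrow> bool" where
  "theta_equation A C G \<Theta> \<longleftrightarrow>
     \<Theta> = cmat G + (1 / (2 * pi)) *\<^sub>R
           (LINT \<nu>|lborel. transpose (cmat C) ** transpose (resolvent A (- \<nu>)) ** \<Theta> **
              resolvent A \<nu> ** cmat C)"

text \<open>Complex values are compared in the order of \<^theory>\<open>HOL-Library.Complex_Order\<close>, in which
  \<open>r \<le> z\<close> for real \<open>r\<close> includes that \<open>z\<close> is real.\<close>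

definition freq_form :: "complex^'n^'n \<Rightarrow> real^'m^'m \<Rightarrow> complex^'n \<Rightarrow> complex^'m \<Rightarrow> complex" where
  "freq_form \<Theta> \<Gamma> x u = qform \<Theta> x + qform (cmat \<Gamma>) u"

end

theory Submission
  imports Defs
begin

text \<open>For a deterministic control only two moments of the state matter. The mean \<open>m\<close> obeys
  \<open>m' = A m + b u\<close>, and if \<open>S\<close> solves \<open>A\<^sup>T S + S A + C\<^sup>T S C = - G\<close>, then \<open>E x\<^sup>T S x - m\<^sup>T S m\<close> has the
  derivative \<open>m\<^sup>T \<Theta> m - E x\<^sup>T G x\<close> with \<open>\<Theta> = G + C\<^sup>T S C\<close>; integrating over the half line, the cost
  is, up to a constant, the integral of \<open>m\<^sup>T \<Theta> m + u\<^sup>T \<Gamma> u\<close>. By Parseval and the resolvent formula for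
  the transform of \<open>exp (t A)\<close>, this \<open>\<Theta>\<close> is the only solution of the given integral equation: mean
  square stability makes the Lyapunov operator injective, which removes the imaginary part. The
  deterministic problem is quadratic. Optimality makes its quadratic part nonnegative, and testing
  with slowly damped oscillations gives the frequency inequality; conversely a strict frequency
  inequality makes, by Parseval, the quadratic part coercive, so a minimizing sequence converges
  and the minimizer is unique.\<close>

section \<open>Square integrable functions\<close>

text \<open>The stability hypothesis speaks about solutions, so it has content only where solutions
  exist. To use it for every deterministic initial vector, solutions of the uncontrolled equation
  are constructed; this is why an Euler scheme appears. Second moments are found without the Ito
  formula: the state is split into initial value, drift integral and stochastic integral, and the
  products are treated by the isometry, the martingale property and a product rule for absolutely
  continuous paths. Controls are merely square integrable, so differential equations are kept in
  integral form (\<open>ac_rep\<close>). In place of a matrix exponential, a positive definite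
  solution of a Lyapunov equation yields stability, uniqueness and exponential decay of the mean by
  energy estimates. Parseval is proved by Gaussian regularization for bounded, integrable, almost
  everywhere continuous functions, and general controls are reached by approximation. The mean
  depends affinely on the control, so parallelogram identities replace derivatives of the
  cost.\<close>

abbreviation upto_measure :: "real \<Rightarrow> real measure" where
  "upto_measure t \<equiv> restrict_space lborel {0<..t}"

abbreviation halfline :: "real measure" where
  "halfline \<equiv> restrict_space lborel {0<..}"

lemma square_integrableD:
  "square_integrable M f \<Longrightarrow> f \<in> borel_measurable M"
  "square_integrable M f \<Longrightarrow> integrable M (\<lambda>x. (norm (f x))\<^sup>2)"
  by (auto simp: square_integrable_def)

lemma inner_le_squares: "\<bar>x \<bullet> y\<bar> \<le> ((norm x)\<^sup>2 + (norm y)\<^sup>2) / 2" for x y :: "'a::real_inner"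
proof -
  have "\<bar>x \<bullet> y\<bar> \<le> norm x * norm y" by (rule Cauchy_Schwarz_ineq2)
  also have "\<dots> \<le> ((norm x)\<^sup>2 + (norm y)\<^sup>2) / 2"
    using sum_squares_bound[of "norm x" "norm y"] by simp
  finally show ?thesis .
qed

lemma norm_add_squares: "(norm (x + y))\<^sup>2 \<le> 2 * (norm x)\<^sup>2 + 2 * (norm y)\<^sup>2"
  for x y :: "'a::real_inner"
proof -
  have "(norm (x + y))\<^sup>2 = (norm x)\<^sup>2 + (norm y)\<^sup>2 + 2 * (x \<bullet> y)"
    by (simp add: power2_norm_eq_inner inner_add inner_commute)
  then show ?thesis using inner_le_squares[of x y] unfolding abs_le_iff by argo
qed

lemma square_integrable_bound:
  fixes f :: "'a \<Rightarrow> 'b::euclidean_space" and g :: "'a \<Rightarrow> real"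
  assumes "f \<in> borel_measurable M" "integrable M g" "AE x in M. (norm (f x))\<^sup>2 \<le> g x"
  shows "square_integrable M f"
  unfolding square_integrable_def
proof
  show "integrable M (\<lambda>x. (norm (f x))\<^sup>2)"
    using assms by (intro Bochner_Integration.integrable_bound[OF assms(2)]) auto
qed (fact assms)

lemma square_integrable_add [intro]:
  assumes "square_integrable M f" "square_integrable M g"
  shows "square_integrable M (\<lambda>x. f x + g x)"
  using assms norm_add_squares
  by (intro square_integrable_bound[where g="\<lambda>x. 2 * (norm (f x))\<^sup>2 + 2 * (norm (g x))\<^sup>2"])
     (auto simp: square_integrable_def)

lemma square_integrable_bounded_linear:
  fixes h :: "'a::euclidean_space \<Rightarrow> 'b::euclidean_space"
  assumes "bounded_linear h" "square_integrable M f"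
  shows "square_integrable M (\<lambda>x. h (f x))"
proof -
  obtain K where K: "\<And>x. norm (h x) \<le> norm x * K" using bounded_linear.bounded[OF assms(1)] by blast
  have [measurable]: "h \<in> borel_measurable borel"
    using assms(1) by (intro borel_measurable_continuous_onI linear_continuous_on)
  have [measurable]: "f \<in> borel_measurable M" using assms(2) by (simp add: square_integrable_def)
  have "(norm (h (f x)))\<^sup>2 \<le> K\<^sup>2 * (norm (f x))\<^sup>2" for x
    using power_mono[OF K[of "f x"], of 2] by (simp add: power_mult_distrib mult.commute)
  then show ?thesis
    using assms(2) by (intro square_integrable_bound[where g="\<lambda>x. K\<^sup>2 * (norm (f x))\<^sup>2"])
       (auto simp: square_integrable_def)
qed

lemma bounded_linear_matrix_vector: "bounded_linear (\<lambda>v. A *v v)" for A :: "real^'n^'m"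
  by (simp add: linear_linear matrix_vector_mul_linear)

lemma square_integrable_mult_vec [intro]:
  "square_integrable M f \<Longrightarrow> square_integrable M (\<lambda>x. A *v f x)" for A :: "real^'n^'m"
  by (rule square_integrable_bounded_linear[OF bounded_linear_matrix_vector])

lemma square_integrable_scaleR [intro]:
  "square_integrable M f \<Longrightarrow> square_integrable M (\<lambda>x. c *\<^sub>R f x)"
  by (rule square_integrable_bounded_linear[OF bounded_linear_scaleR_right])

lemma square_integrable_minus [intro]:
  "square_integrable M f \<Longrightarrow> square_integrable M (\<lambda>x. - f x)"
  using square_integrable_scaleR[of M f "-1"] by simp

lemma square_integrable_diff [intro]:
  assumes "square_integrable M f" "square_integrable M g"
  shows "square_integrable M (\<lambda>x. f x - g x)"
  using square_integrable_add[OF assms(1) square_integrable_minus[OF assms(2)]] by simp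

lemma square_integrable_zero [simp, intro]: "square_integrable M (\<lambda>x. 0)"
  by (simp add: square_integrable_def)

lemma square_integrable_sum [intro]:
  "(\<And>i. i \<in> I \<Longrightarrow> square_integrable M (f i)) \<Longrightarrow> square_integrable M (\<lambda>x. \<Sum>i\<in>I. f i x)"
  by (induction I rule: infinite_finite_induct) auto

lemma square_integrable_const:
  "finite_measure M \<Longrightarrow> square_integrable M (\<lambda>x. c)"
  by (simp add: square_integrable_def finite_measure.integrable_const)

lemma integrable_inner_square_integrable [intro]:
  assumes "square_integrable M f" "square_integrable M g"
  shows "integrable M (\<lambda>x. f x \<bullet> g x)"
proof (rule Bochner_Integration.integrable_bound)
  show "integrable M (\<lambda>x. ((norm (f x))\<^sup>2 + (norm (g x))\<^sup>2) / 2)"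
    using assms by (auto simp: square_integrable_def)
  show "(\<lambda>x. f x \<bullet> g x) \<in> borel_measurable M"
    using assms by (auto simp: square_integrable_def)
  show "AE x in M. norm (f x \<bullet> g x) \<le> norm (((norm (f x))\<^sup>2 + (norm (g x))\<^sup>2) / 2)"
    using inner_le_squares by (auto simp: abs_le_iff)
qed

lemma square_integrable_norm_mult:
  assumes "square_integrable M f" "square_integrable M g"
  shows "integrable M (\<lambda>x. norm (f x) * norm (g x))"
proof -
  have "square_integrable M (\<lambda>x. norm (f x))" "square_integrable M (\<lambda>x. norm (g x))"
    using assms by (auto simp: square_integrable_def)
  from integrable_inner_square_integrable[OF this] show ?thesis by simp
qed

lemma integrable_of_square_integrable:
  assumes "finite_measure M" "square_integrable M f"
  shows "integrable M f"
proof (rule Bochner_Integration.integrable_bound)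
  show "integrable M (\<lambda>x. 1 + (norm (f x))\<^sup>2)"
    using assms by (auto simp: square_integrable_def finite_measure.integrable_const)
  show "f \<in> borel_measurable M" using assms by (simp add: square_integrable_def)
  have "norm (f x) \<le> 1 + (norm (f x))\<^sup>2" for x
    using sum_squares_bound[of 1 "norm (f x)"] zero_le_power2[of "norm (f x)"]
    by (simp add: power2_eq_square) (smt (verit) norm_ge_zero)
  then show "AE x in M. norm (f x) \<le> norm (1 + (norm (f x))\<^sup>2)" by (auto simp: abs_of_nonneg)
qed

text \<open>The integral of \<open>(l * norm (f x) - k * norm (g x))\<^sup>2\<close> is nonnegative
  for all real \<open>l\<close>, \<open>k\<close>; the inequality is the discriminant condition of
  this quadratic form.\<close>

lemma Cauchy_Schwarz_integral:
  assumes f: "square_integrable M f" and g: "square_integrable M g"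
  shows "(\<integral>x. norm (f x) * norm (g x) \<partial>M)\<^sup>2 \<le> (\<integral>x. (norm (f x))\<^sup>2 \<partial>M) * (\<integral>x. (norm (g x))\<^sup>2 \<partial>M)"
proof -
  define p q r where "p = (\<integral>x. (norm (f x))\<^sup>2 \<partial>M)" and "q = (\<integral>x. (norm (g x))\<^sup>2 \<partial>M)"
    and "r = (\<integral>x. norm (f x) * norm (g x) \<partial>M)"
  note i = square_integrable_norm_mult[OF f g] square_integrableD(2)[OF f] square_integrableD(2)[OF g]
  have nonneg: "0 \<le> l\<^sup>2 * p - 2 * l * k * r + k\<^sup>2 * q" for l k
  proof -
    have "0 \<le> (\<integral>x. (l * norm (f x) - k * norm (g x))\<^sup>2 \<partial>M)" by simp
    also have "\<dots> = (\<integral>x. l\<^sup>2 * (norm (f x))\<^sup>2 - 2 * l * k * (norm (f x) * norm (g x)) + k\<^sup>2 * (norm (g x))\<^sup>2 \<partial>M)"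
      by (intro Bochner_Integration.integral_cong) (auto simp: power2_eq_square algebra_simps)
    also have "\<dots> = l\<^sup>2 * p - 2 * l * k * r + k\<^sup>2 * q"
      using i unfolding p_def q_def r_def
      by (subst Bochner_Integration.integral_add Bochner_Integration.integral_diff; auto)+
    finally show ?thesis .
  qed
  have "r\<^sup>2 \<le> p * q"
  proof (cases "q = 0")
    case True
    have "r = 0"
    proof (rule ccontr)
      assume "r \<noteq> 0"
      \<comment> \<open>For \<open>q = 0\<close> the form is linear in \<open>k\<close>, and this
        \<open>k\<close> gives it the value -1.\<close>
      then show False using nonneg[of 1 "(p + 1) / (2 * r)"] True by (simp add: divide_simps split: if_splits)
    qed
    then show ?thesis using True by simp
  next
    case False
    then have "q > 0" unfolding q_def by (simp add: order_less_le)
    \<comment> \<open>At \<open>l = q\<close>, \<open>k = r\<close> the form equals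
      \<open>q * (p * q - r\<^sup>2)\<close>.\<close>
    from nonneg[of q r] have "0 \<le> q * (p * q - r\<^sup>2)"
      by (simp add: power2_eq_square algebra_simps)
    then show ?thesis using \<open>q > 0\<close> by (simp add: zero_le_mult_iff)
  qed
  then show ?thesis by (simp add: p_def q_def r_def)
qed

section \<open>Mean square convergence and completeness\<close>

definition l2_tendsto :: "'a measure \<Rightarrow> (nat \<Rightarrow> 'a \<Rightarrow> 'b::euclidean_space) \<Rightarrow> ('a \<Rightarrow> 'b) \<Rightarrow> bool" where
  "l2_tendsto M f g \<longleftrightarrow> (\<forall>j. square_integrable M (f j)) \<and> square_integrable M g \<and>
     (\<lambda>j. \<integral>x. (norm (f j x - g x))\<^sup>2 \<partial>M) \<longlonglongrightarrow> 0"

lemma l2_tendstoD: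
  assumes "l2_tendsto M f g"
  shows "square_integrable M (f j)" "square_integrable M g"
    "(\<lambda>j. \<integral>x. (norm (f j x - g x))\<^sup>2 \<partial>M) \<longlonglongrightarrow> 0"
  using assms by (auto simp: l2_tendsto_def)

lemma l2_tendsto_const: "square_integrable M f \<Longrightarrow> l2_tendsto M (\<lambda>j. f) f"
  by (simp add: l2_tendsto_def)

lemma l2_tendsto_bounded_linear:
  fixes h :: "'a::euclidean_space \<Rightarrow> 'b::euclidean_space"
  assumes h: "bounded_linear h" and l: "l2_tendsto M f g"
  shows "l2_tendsto M (\<lambda>j x. h (f j x)) (\<lambda>x. h (g x))"
  unfolding l2_tendsto_def
proof (intro conjI allI)
  show 1: "square_integrable M (\<lambda>x. h (f j x))" for j
    by (rule square_integrable_bounded_linear[OF h l2_tendstoD(1)[OF l]])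
  show 2: "square_integrable M (\<lambda>x. h (g x))"
    by (rule square_integrable_bounded_linear[OF h l2_tendstoD(2)[OF l]])
  obtain K where K: "\<And>x. norm (h x) \<le> norm x * K" using bounded_linear.bounded[OF h] by blast
  have "(norm (h (f j x) - h (g x)))\<^sup>2 \<le> K\<^sup>2 * (norm (f j x - g x))\<^sup>2" for j x
    using power_mono[OF K[of "f j x - g x"], of 2]
    by (simp add: power_mult_distrib mult.commute linear_diff[OF bounded_linear.linear[OF h]])
  then have le: "(\<integral>x. (norm (h (f j x) - h (g x)))\<^sup>2 \<partial>M) \<le> K\<^sup>2 * (\<integral>x. (norm (f j x - g x))\<^sup>2 \<partial>M)" for j
    using square_integrable_diff[OF 1 2] square_integrable_diff[OF l2_tendstoD(1,2)[OF l]]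
    by (subst Bochner_Integration.integral_mult_right_zero[symmetric], intro integral_mono)
      (auto simp: square_integrable_def)
  have lim: "(\<lambda>j. K\<^sup>2 * (\<integral>x. (norm (f j x - g x))\<^sup>2 \<partial>M)) \<longlonglongrightarrow> 0"
    using tendsto_mult_left[OF l2_tendstoD(3)[OF l], of "K\<^sup>2"] by simp
  show "(\<lambda>j. \<integral>x. (norm (h (f j x) - h (g x)))\<^sup>2 \<partial>M) \<longlonglongrightarrow> 0"
    by (rule tendsto_sandwich[OF _ _ tendsto_const lim]) (auto intro: always_eventually le)
qed

lemma l2_tendsto_mult_vec:
  "l2_tendsto M f g \<Longrightarrow> l2_tendsto M (\<lambda>j x. A *v f j x) (\<lambda>x. A *v g x)" for A :: "real^'n^'m"
  by (rule l2_tendsto_bounded_linear[OF bounded_linear_matrix_vector])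

text \<open>With errors \<open>d\<close>, \<open>e\<close> of the two sequences, the difference of
  the inner products is \<open>d \<bullet> e + d \<bullet> g' + f' \<bullet> e\<close>; each term
  tends to zero by Cauchy-Schwarz.\<close>

lemma l2_tendsto_inner:
  assumes f: "l2_tendsto M f f'" and g: "l2_tendsto M g g'"
  shows "(\<lambda>j. \<integral>x. f j x \<bullet> g j x \<partial>M) \<longlonglongrightarrow> (\<integral>x. f' x \<bullet> g' x \<partial>M)"
proof -
  define n where "n h = (\<integral>x. (norm (h x))\<^sup>2 \<partial>M)" for h :: "'a \<Rightarrow> 'b"
  have CS: "\<bar>\<integral>x. h x \<bullet> k x \<partial>M\<bar> \<le> sqrt (n h) * sqrt (n k)"
    if "square_integrable M h" "square_integrable M k" for h k :: "'a \<Rightarrow> 'b"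
  proof -
    have "\<bar>\<integral>x. h x \<bullet> k x \<partial>M\<bar> \<le> (\<integral>x. norm (h x) * norm (k x) \<partial>M)"
      using square_integrable_norm_mult[OF that] integrable_inner_square_integrable[OF that]
        Cauchy_Schwarz_ineq2
      by (intro integral_abs_bound[THEN order_trans] integral_mono) auto
    also have "\<dots> \<le> sqrt (n h * n k)"
      using Cauchy_Schwarz_integral[OF that] by (intro real_le_rsqrt) (simp add: n_def)
    finally show ?thesis by (simp add: real_sqrt_mult)
  qed
  let ?d = "\<lambda>j x. f j x - f' x" and ?e = "\<lambda>j x. g j x - g' x"
  note s = l2_tendstoD(1)[OF f] l2_tendstoD(2)[OF f] l2_tendstoD(1)[OF g] l2_tendstoD(2)[OF g]
  have d: "square_integrable M (?d j)" "square_integrable M (?e j)" for j using s by auto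
  have d0: "(\<lambda>j. sqrt (n (?d j))) \<longlonglongrightarrow> 0" "(\<lambda>j. sqrt (n (?e j))) \<longlonglongrightarrow> 0"
    using tendsto_real_sqrt[OF l2_tendstoD(3)[OF f]] tendsto_real_sqrt[OF l2_tendstoD(3)[OF g]]
    by (simp_all add: n_def)
  have eq: "(\<integral>x. f j x \<bullet> g j x \<partial>M) - (\<integral>x. f' x \<bullet> g' x \<partial>M)
     = (\<integral>x. ?d j x \<bullet> ?e j x \<partial>M) + (\<integral>x. ?d j x \<bullet> g' x \<partial>M) + (\<integral>x. f' x \<bullet> ?e j x \<partial>M)" for j
  proof -
    have "(\<integral>x. f j x \<bullet> g j x \<partial>M) = (\<integral>x. ?d j x \<bullet> ?e j x + ?d j x \<bullet> g' x + f' x \<bullet> ?e j x + f' x \<bullet> g' x \<partial>M)"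
      by (simp add: inner_diff_left inner_diff_right)
    also have "\<dots> = (\<integral>x. ?d j x \<bullet> ?e j x \<partial>M) + (\<integral>x. ?d j x \<bullet> g' x \<partial>M) + (\<integral>x. f' x \<bullet> ?e j x \<partial>M)
        + (\<integral>x. f' x \<bullet> g' x \<partial>M)"
      using integrable_inner_square_integrable[OF d(1,2), of j j]
        integrable_inner_square_integrable[OF d(1) s(4), of j]
        integrable_inner_square_integrable[OF s(2) d(2), of j]
        integrable_inner_square_integrable[OF s(2,4)]
      by simp
    finally show ?thesis by simp
  qed
  have "(\<lambda>j. (\<integral>x. f j x \<bullet> g j x \<partial>M) - (\<integral>x. f' x \<bullet> g' x \<partial>M)) \<longlonglongrightarrow> 0"
  proof (rule tendsto_rabs_zero_cancel, rule tendsto_sandwich[OF _ _ tendsto_const])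
    show "\<forall>\<^sub>F j in sequentially. \<bar>(\<integral>x. f j x \<bullet> g j x \<partial>M) - (\<integral>x. f' x \<bullet> g' x \<partial>M)\<bar>
       \<le> sqrt (n (?d j)) * sqrt (n (?e j)) + sqrt (n (?d j)) * sqrt (n g') + sqrt (n f') * sqrt (n (?e j))"
    proof (rule always_eventually, rule allI)
      fix j
      show "\<bar>(\<integral>x. f j x \<bullet> g j x \<partial>M) - (\<integral>x. f' x \<bullet> g' x \<partial>M)\<bar>
       \<le> sqrt (n (?d j)) * sqrt (n (?e j)) + sqrt (n (?d j)) * sqrt (n g') + sqrt (n f') * sqrt (n (?e j))"
        unfolding eq using CS[OF d(1) d(2), of j j] CS[OF d(1) s(4), of j] CS[OF s(2) d(2), of j] by linarith
    qed
    have "(\<lambda>j. sqrt (n (?d j)) * sqrt (n (?e j)) + sqrt (n (?d j)) * sqrt (n g') + sqrt (n f') * sqrt (n (?e j)))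
       \<longlonglongrightarrow> 0 * 0 + 0 * sqrt (n g') + sqrt (n f') * 0"
      by (intro tendsto_intros d0)
    then show "(\<lambda>j. sqrt (n (?d j)) * sqrt (n (?e j)) + sqrt (n (?d j)) * sqrt (n g') + sqrt (n f') * sqrt (n (?e j)))
       \<longlonglongrightarrow> 0" by simp
  qed auto
  then show ?thesis by (simp add: LIM_zero_iff)
qed

lemma square_integrable_iff_nn_integral:
  "f \<in> borel_measurable M \<Longrightarrow>
    square_integrable M f \<longleftrightarrow> (\<integral>\<^sup>+x. ennreal ((norm (f x))\<^sup>2) \<partial>M) < \<infinity>"
  unfolding square_integrable_def by (subst integrable_iff_bounded) auto

lemma nn_integral_square_integrable:
  "square_integrable M f \<Longrightarrow>
    (\<integral>\<^sup>+x. ennreal ((norm (f x))\<^sup>2) \<partial>M) = ennreal (\<integral>x. (norm (f x))\<^sup>2 \<partial>M)"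
  unfolding square_integrable_def by (intro nn_integral_eq_integral) auto

lemma square_integrable_integral_le:
  assumes "f \<in> borel_measurable M" "(\<integral>\<^sup>+x. ennreal ((norm (f x))\<^sup>2) \<partial>M) \<le> ennreal K" "0 \<le> K"
  shows "square_integrable M f \<and> (\<integral>x. (norm (f x))\<^sup>2 \<partial>M) \<le> K"
proof -
  have "square_integrable M f"
    using assms by (subst square_integrable_iff_nn_integral) (auto intro: le_less_trans)
  then show ?thesis using assms nn_integral_square_integrable[of M f] by simp
qed

text \<open>Bridge from the definition of the Ito integral, which is phrased with nonnegative
  integrals. Square integrability of the limit is a consequence: some member of the sequence lies at
  finite distance from it.\<close>

lemma l2_tendstoI_nn:
  assumes f: "\<And>j. square_integrable M (f j)" and [measurable]: "g \<in> borel_measurable M"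
    and lim: "(\<lambda>j. \<integral>\<^sup>+x. ennreal ((norm (g x - f j x))\<^sup>2) \<partial>M) \<longlonglongrightarrow> 0"
  shows "l2_tendsto M f g"
proof -
  have [measurable]: "f j \<in> borel_measurable M" for j using f square_integrable_def by blast
  have "\<forall>\<^sub>F j in sequentially. (\<integral>\<^sup>+x. ennreal ((norm (g x - f j x))\<^sup>2) \<partial>M) < 1"
    using order_tendstoD(2)[OF lim, of 1] by simp
  then obtain j where "(\<integral>\<^sup>+x. ennreal ((norm (g x - f j x))\<^sup>2) \<partial>M) < 1"
    by (auto simp: eventually_sequentially)
  then have "square_integrable M (\<lambda>x. g x - f j x)"
    by (subst square_integrable_iff_nn_integral) (auto intro: less_trans)
  from square_integrable_add[OF this f[of j]] have g: "square_integrable M g" by simp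
  have "(\<lambda>j. ennreal (\<integral>x. (norm (g x - f j x))\<^sup>2 \<partial>M)) \<longlonglongrightarrow> ennreal 0"
    using lim nn_integral_square_integrable[OF square_integrable_diff[OF g f]] by simp
  then have "(\<lambda>j. \<integral>x. (norm (g x - f j x))\<^sup>2 \<partial>M) \<longlonglongrightarrow> 0"
    by (subst (asm) tendsto_ennreal_iff) auto
  then show ?thesis using f g by (simp add: l2_tendsto_def norm_minus_commute)
qed

lemma l2_tendstoI_bound:
  assumes f: "\<And>j. square_integrable M (f j)" and g: "square_integrable M g"
    and le: "\<And>j. (\<integral>x. (norm (f j x - g x))\<^sup>2 \<partial>M) \<le> B j" and "B \<longlonglongrightarrow> 0"
  shows "l2_tendsto M f g"
  unfolding l2_tendsto_def
  using f g by (auto intro!: tendsto_sandwich[OF _ _ tendsto_const \<open>B \<longlonglongrightarrow> 0\<close>] always_eventually le)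

text \<open>Completeness of \<open>L\<^sup>2\<close>, for sequences converging so fast that they also converge almost
  everywhere: the weights \<open>(3/2)\<^sup>j\<close> keep the sum of the squared increments integrable.\<close>

lemma l2_complete:
  fixes f :: "nat \<Rightarrow> 'a \<Rightarrow> 'b::euclidean_space"
  assumes f: "\<And>j. square_integrable M (f j)"
    and le: "\<And>j l. j \<le> l \<Longrightarrow> (\<integral>x. (norm (f l x - f j x))\<^sup>2 \<partial>M) \<le> K * (1/2)^j"
  shows "AE x in M. (\<lambda>j. f j x) \<longlonglongrightarrow> lim (\<lambda>j. f j x)"
    and "square_integrable M (\<lambda>x. lim (\<lambda>j. f j x))"
    and "(\<integral>x. (norm (lim (\<lambda>j. f j x) - f j x))\<^sup>2 \<partial>M) \<le> K * (1/2)^j"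
proof -
  have [measurable]: "f j \<in> borel_measurable M" for j using f square_integrable_def by blast
  have K: "0 \<le> K" using le[of 0 0] by simp
  have nn: "(\<integral>\<^sup>+x. ennreal ((norm (f l x - f j x))\<^sup>2) \<partial>M) \<le> ennreal (K * (1/2)^j)" if "j \<le> l" for j l
    unfolding nn_integral_square_integrable[OF square_integrable_diff[OF f[of l] f[of j]]]
    by (rule ennreal_leI) (rule le[OF that])
  define h where "h j x = (3/2)^j * (norm (f (Suc j) x - f j x))\<^sup>2" for j x
  have h_nonneg: "0 \<le> h j x" for j x unfolding h_def by (intro mult_nonneg_nonneg zero_le_power) auto
  have h_int: "integrable M (h j)" for j
    unfolding h_def using square_integrableD(2)[OF square_integrable_diff[OF f f]]
    by (intro integrable_mult_right)
  have [measurable]: "h j \<in> borel_measurable M" for j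
    using h_int by (rule borel_measurable_integrable)
  have pow: "(3/2::real)^j * (1/2)^j = (3/4)^j" for j
    unfolding power_mult_distrib[symmetric] by simp
  have h_le: "(\<integral>\<^sup>+x. ennreal (h j x) \<partial>M) \<le> ennreal (K * (3/4)^j)" for j
  proof -
    have "(\<integral>x. h j x \<partial>M) = (3/2)^j * (\<integral>x. (norm (f (Suc j) x - f j x))\<^sup>2 \<partial>M)"
      unfolding h_def by (rule Bochner_Integration.integral_mult_right_zero)
    also have "\<dots> \<le> (3/2)^j * (K * (1/2)^j)" by (rule mult_left_mono[OF le]) auto
    also have "\<dots> = K * (3/4)^j" unfolding pow[symmetric] by (rule mult.left_commute)
    finally have "(\<integral>x. h j x \<partial>M) \<le> K * (3/4)^j" .
    moreover have "(\<integral>\<^sup>+x. ennreal (h j x) \<partial>M) = ennreal (\<integral>x. h j x \<partial>M)"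
      by (rule nn_integral_eq_integral[OF h_int]) (simp add: h_nonneg)
    ultimately show ?thesis by (simp only: ennreal_leI)
  qed
  have "(\<integral>\<^sup>+x. (\<Sum>j. ennreal (h j x)) \<partial>M) = (\<Sum>j. \<integral>\<^sup>+x. ennreal (h j x) \<partial>M)"
    by (rule nn_integral_suminf) measurable
  also have "\<dots> \<le> (\<Sum>j. ennreal (K * (3/4)^j))"
    by (rule suminf_le[OF h_le]) auto
  also have "\<dots> = ennreal (\<Sum>j. K * (3/4)^j)"
    by (rule suminf_ennreal2) (use K in \<open>auto intro!: summable_mult summable_geometric\<close>)
  finally have "(\<integral>\<^sup>+x. (\<Sum>j. ennreal (h j x)) \<partial>M) \<le> ennreal (\<Sum>j. K * (3/4)^j)" .
  then have "(\<integral>\<^sup>+x. (\<Sum>j. ennreal (h j x)) \<partial>M) \<noteq> \<infinity>" by (auto simp: top_unique)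
  then have "AE x in M. (\<Sum>j. ennreal (h j x)) \<noteq> \<infinity>"
    by (intro nn_integral_noteq_infinite) measurable
  then show conv: "AE x in M. (\<lambda>j. f j x) \<longlonglongrightarrow> lim (\<lambda>j. f j x)"
  proof eventually_elim
    case (elim x)
    obtain B where B': "0 \<le> B" "(\<Sum>j. ennreal (h j x)) = ennreal B"
      using elim by (cases "\<Sum>j. ennreal (h j x)") (auto simp: infinity_ennreal_def)
    have B: "(3/2)^j * (norm (f (Suc j) x - f j x))\<^sup>2 \<le> B" for j
    proof -
      have "ennreal (h j x) \<le> (\<Sum>j. ennreal (h j x))"
        using sum_le_suminf[of "\<lambda>j. ennreal (h j x)" "{j}"] by simp
      then show ?thesis using B' h_nonneg[of j x] by (simp only: h_def ennreal_le_iff)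
    qed
    \<comment> \<open>A bound for the weighted squares leaves increments dominated by a geometric
      series of ratio \<open>sqrt (2/3)\<close>, so the sequence converges at this point.\<close>
    have "norm (f (Suc j) x - f j x) \<le> sqrt B * (sqrt (2/3))^j" for j
    proof -
      have "(norm (f (Suc j) x - f j x))\<^sup>2 \<le> B * (2/3)^j"
        using B[of j] by (simp add: power_divide field_simps)
      then have "norm (f (Suc j) x - f j x) \<le> sqrt (B * (2/3)^j)" by (rule real_le_rsqrt)
      then show ?thesis by (simp add: real_sqrt_mult real_sqrt_power)
    qed
    then have "summable (\<lambda>j. f (Suc j) x - f j x)"
      by (rule summable_comparison_test'[where N=0, OF summable_mult[OF summable_geometric], rotated]) auto
    then have "convergent (\<lambda>n. \<Sum>j<n. f (Suc j) x - f j x)" by (simp add: summable_iff_convergent)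
    then have "convergent (\<lambda>n. f n x - f 0 x)"
      using sum_lessThan_telescope[of "\<lambda>j. f j x"] by simp
    from convergent_add[OF this convergent_const[of "f 0 x"]] show ?case
      by (simp add: convergent_LIMSEQ_iff)
  qed
  let ?g = "\<lambda>x. lim (\<lambda>j. f j x)"
  \<comment> \<open>Fatou in the index \<open>l\<close> carries the Cauchy estimate over to the
    limit.\<close>
  have bound: "(\<integral>\<^sup>+x. ennreal ((norm (?g x - f j x))\<^sup>2) \<partial>M) \<le> ennreal (K * (1/2)^j)" for j
  proof -
    have "(\<integral>\<^sup>+x. ennreal ((norm (?g x - f j x))\<^sup>2) \<partial>M)
       = (\<integral>\<^sup>+x. liminf (\<lambda>l. ennreal ((norm (f l x - f j x))\<^sup>2)) \<partial>M)"
      using conv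
    proof (intro nn_integral_cong_AE, eventually_elim)
      case (elim x)
      have "(\<lambda>l. ennreal ((norm (f l x - f j x))\<^sup>2)) \<longlonglongrightarrow> ennreal ((norm (?g x - f j x))\<^sup>2)"
        by (intro tendsto_ennrealI tendsto_intros elim)
      then show ?case by (rule lim_imp_Liminf[OF trivial_limit_sequentially, symmetric])
    qed
    also have "\<dots> \<le> liminf (\<lambda>l. \<integral>\<^sup>+x. ennreal ((norm (f l x - f j x))\<^sup>2) \<partial>M)"
      by (rule nn_integral_liminf) auto
    also have "\<dots> \<le> ennreal (K * (1/2)^j)"
      by (intro Liminf_le) (auto intro!: eventually_sequentiallyI[of j] nn)
    finally show ?thesis .
  qed
  have s: "square_integrable M (\<lambda>x. ?g x - f j x)
      \<and> (\<integral>x. (norm (?g x - f j x))\<^sup>2 \<partial>M) \<le> K * (1/2)^j" for j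
    using bound[of j] K by (intro square_integrable_integral_le) auto
  show "(\<integral>x. (norm (?g x - f j x))\<^sup>2 \<partial>M) \<le> K * (1/2)^j" using s by blast
  show "square_integrable M ?g" using square_integrable_add[OF conjunct1[OF s[of 0]] f[of 0]] by simp
qed

section \<open>Absolutely continuous functions on the half line\<close>

text \<open>The integral form of \<open>m' = f\<close> almost everywhere with
  \<open>m 0 = y\<close>, for nonnegative times only. A derivative in the classical sense is out of
  reach because \<open>f\<close> will contain a control that is merely square integrable.\<close>

definition ac_rep :: "'a::euclidean_space \<Rightarrow> (real \<Rightarrow> 'a) \<Rightarrow> (real \<Rightarrow> 'a) \<Rightarrow> bool" where
  "ac_rep y f m \<longleftrightarrow>
     (\<forall>t\<ge>0. integrable (upto_measure t) f \<and> m t = y + (\<integral>s. f s \<partial>upto_measure t))"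

lemma finite_measure_upto [simp, intro]: "finite_measure (upto_measure t)"
  by (rule finite_measureI, cases "0 \<le> t")
    (auto simp: emeasure_restrict_space space_restrict_space)

lemma sigma_finite_upto [simp, intro]: "sigma_finite_measure (upto_measure t)"
  by (simp add: finite_measure.axioms(1))

lemma upto_integrable_iff:
  fixes f :: "real \<Rightarrow> 'a::{banach, second_countable_topology}"
  shows "integrable (upto_measure t) f \<longleftrightarrow> integrable lborel (\<lambda>s. indicator {0<..t} s *\<^sub>R f s)"
  by (rule integrable_restrict_space) auto

lemma upto_integral:
  fixes f :: "real \<Rightarrow> 'a::{banach, second_countable_topology}"
  shows "(\<integral>s. f s \<partial>upto_measure t) = (\<integral>s. indicator {0<..t} s *\<^sub>R f s \<partial>lborel)"
  by (rule integral_restrict_space) auto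

lemma halfline_integrable_iff:
  fixes f :: "real \<Rightarrow> 'a::{banach, second_countable_topology}"
  shows "integrable halfline f \<longleftrightarrow> integrable lborel (\<lambda>s. indicator {0<..} s *\<^sub>R f s)"
  by (rule integrable_restrict_space) auto

text \<open>The case \<open>t = 0\<close> of the truncated measure, in the shape it has once the
  empty interval is simplified; it lets initial values evaluate.\<close>

lemma upto_integral_0 [simp]:
  fixes f :: "real \<Rightarrow> 'a::{banach, second_countable_topology}"
  shows "integral\<^sup>L (restrict_space lborel {}) f = 0"
  by (subst integral_restrict_space) auto

lemma halfline_integral:
  fixes f :: "real \<Rightarrow> 'a::{banach, second_countable_topology}"
  shows "(\<integral>s. f s \<partial>halfline) = (\<integral>s. indicator {0<..} s *\<^sub>R f s \<partial>lborel)"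
  by (rule integral_restrict_space) auto

lemma integrable_halfline_upto:
  fixes f :: "real \<Rightarrow> 'a::euclidean_space"
  assumes "integrable halfline f" shows "integrable (upto_measure t) f"
proof -
  have "integrable lborel (\<lambda>s. indicator {0<..t} s *\<^sub>R (indicator {0<..} s *\<^sub>R f s))"
    by (rule integrable_mult_indicator) (use assms in \<open>simp_all add: halfline_integrable_iff\<close>)
  also have "(\<lambda>s. indicator {0<..t} s *\<^sub>R (indicator {0<..} s *\<^sub>R f s)) = (\<lambda>s. indicator {0<..t} s *\<^sub>R f s)"
    by (auto simp: indicator_def)
  finally show ?thesis by (simp add: upto_integrable_iff)
qed

lemma integrable_upto_mono:
  fixes f :: "real \<Rightarrow> 'a::euclidean_space"
  assumes "integrable (upto_measure t) f" "s \<le> t" shows "integrable (upto_measure s) f"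
proof -
  have "integrable lborel (\<lambda>r. indicator {0<..s} r *\<^sub>R (indicator {0<..t} r *\<^sub>R f r))"
    by (rule integrable_mult_indicator) (use assms in \<open>simp_all add: upto_integrable_iff\<close>)
  also have "(\<lambda>r. indicator {0<..s} r *\<^sub>R (indicator {0<..t} r *\<^sub>R f r)) = (\<lambda>r. indicator {0<..s} r *\<^sub>R f r)"
    using \<open>s \<le> t\<close> by (auto simp: indicator_def)
  finally show ?thesis by (simp add: upto_integrable_iff)
qed

lemma measurable_halfline_upto:
  fixes f :: "real \<Rightarrow> 'a::euclidean_space"
  assumes "f \<in> borel_measurable halfline" shows "f \<in> borel_measurable (upto_measure t)"
proof -
  have "(\<lambda>s. indicator {0<..t} s *\<^sub>R (indicator {0<..} s *\<^sub>R f s)) \<in> borel_measurable lborel"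
  proof (rule borel_measurable_scaleR)
    show "(\<lambda>s. indicator {0<..} s *\<^sub>R f s) \<in> borel_measurable lborel"
      using assms by (simp add: borel_measurable_restrict_space_iff)
  qed (auto intro: borel_measurable_indicator)
  also have "(\<lambda>s. indicator {0<..t} s *\<^sub>R (indicator {0<..} s *\<^sub>R f s)) = (\<lambda>s. indicator {0<..t} s *\<^sub>R f s)"
    by (auto simp: indicator_def)
  finally show ?thesis by (subst borel_measurable_restrict_space_iff) auto
qed

lemma square_integrable_halfline_upto:
  "square_integrable halfline f \<Longrightarrow> square_integrable (upto_measure t) f"
  by (auto simp: square_integrable_def intro: measurable_halfline_upto integrable_halfline_upto)

lemma upto_integral_indicator:
  fixes f :: "real \<Rightarrow> 'a::euclidean_space"
  assumes "s \<le> t"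
  shows "(\<integral>r. f r \<partial>upto_measure s) = (\<integral>r. indicator {0<..s} r *\<^sub>R f r \<partial>upto_measure t)"
  unfolding upto_integral using assms
  by (intro Bochner_Integration.integral_cong) (auto simp: indicator_def)

lemma integral_upto_tendsto:
  fixes f :: "real \<Rightarrow> 'a::euclidean_space"
  assumes "integrable halfline f"
  shows "((\<lambda>t. \<integral>s. f s \<partial>upto_measure t) \<longlongrightarrow> (\<integral>s. f s \<partial>halfline)) at_top"
proof -
  have "((\<lambda>t. \<integral>s. indicator {0<..t} s *\<^sub>R f s \<partial>lborel) \<longlongrightarrow> (\<integral>s. indicator {0<..} s *\<^sub>R f s \<partial>lborel)) at_top"
  proof (rule integral_dominated_convergence_at_top[where w="\<lambda>s. norm (indicator {0<..} s *\<^sub>R f s)"])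
    show "(\<lambda>s. indicator {0<..} s *\<^sub>R f s) \<in> borel_measurable lborel"
      using assms by (auto simp: halfline_integrable_iff)
    show "(\<lambda>s. indicator {0<..t} s *\<^sub>R f s) \<in> borel_measurable lborel" for t
      using integrable_halfline_upto[OF assms, of t] by (auto simp: upto_integrable_iff)
    show "integrable lborel (\<lambda>s. norm (indicator {0<..} s *\<^sub>R f s))"
      using assms unfolding halfline_integrable_iff by (rule integrable_norm)
    show "AE s in lborel. ((\<lambda>t. indicator {0<..t} s *\<^sub>R f s) \<longlongrightarrow> indicator {0<..} s *\<^sub>R f s) at_top"
    proof (rule AE_I2)
      fix s :: real
      have "\<forall>\<^sub>F t in at_top. indicator {0<..t} s *\<^sub>R f s = indicator {0<..} s *\<^sub>R f s"
        using eventually_ge_at_top[of s] by eventually_elim (auto simp: indicator_def)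
      then show "((\<lambda>t. indicator {0<..t} s *\<^sub>R f s) \<longlongrightarrow> indicator {0<..} s *\<^sub>R f s) at_top"
        by (rule tendsto_eventually)
    qed
    show "\<forall>\<^sub>F t in at_top. AE s in lborel. norm (indicator {0<..t} s *\<^sub>R f s) \<le> norm (indicator {0<..} s *\<^sub>R f s)"
      by (auto simp: indicator_def intro!: always_eventually)
  qed
  then show ?thesis unfolding upto_integral halfline_integral .
qed

text \<open>Fatou along integer end points: a uniform bound for the truncated integrals of a
  nonnegative function is a bound for the full one. Measurability on the half line is also inherited
  from the truncations.\<close>

lemma integrable_halfline_nonneg:
  fixes f :: "real \<Rightarrow> real"
  assumes i: "\<And>t. 0 \<le> t \<Longrightarrow> integrable (upto_measure t) f" and nn: "\<And>s. 0 < s \<Longrightarrow> 0 \<le> f s"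
    and b: "\<And>t. 0 \<le> t \<Longrightarrow> (\<integral>s. f s \<partial>upto_measure t) \<le> B"
  shows "integrable halfline f \<and> (\<integral>s. f s \<partial>halfline) \<le> B"
proof -
  have B: "0 \<le> B" using b[of 0] by simp
  have 1: "(\<lambda>s. indicator {0<..t} s *\<^sub>R f s) \<in> borel_measurable lborel" if "0 \<le> t" for t
    using i[OF that] by (auto simp: upto_integrable_iff)
  have lim: "(\<lambda>n::nat. indicator {0<..real n} s *\<^sub>R f s) \<longlonglongrightarrow> indicator {0<..} s *\<^sub>R f s" for s
  proof (rule tendsto_eventually)
    obtain N :: nat where "s \<le> real N" using real_arch_simple by blast
    then show "\<forall>\<^sub>F n in sequentially. indicator {0<..real n} s *\<^sub>R f s = indicator {0<..} s *\<^sub>R f s"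
      by (intro eventually_sequentiallyI[of N]) (auto simp: indicator_def)
  qed
  have m: "(\<lambda>s. indicator {0<..} s *\<^sub>R f s) \<in> borel_measurable lborel"
    by (rule borel_measurable_LIMSEQ_metric[OF _ lim]) (use 1 in auto)
  have "(\<integral>\<^sup>+s. ennreal (norm (indicator {0<..} s *\<^sub>R f s)) \<partial>lborel)
     = (\<integral>\<^sup>+s. liminf (\<lambda>n::nat. ennreal (norm (indicator {0<..real n} s *\<^sub>R f s))) \<partial>lborel)"
    by (intro nn_integral_cong lim_imp_Liminf[symmetric] tendsto_ennrealI tendsto_norm lim) auto
  also have "\<dots> \<le> liminf (\<lambda>n::nat. \<integral>\<^sup>+s. ennreal (norm (indicator {0<..real n} s *\<^sub>R f s)) \<partial>lborel)"
    using 1 by (intro nn_integral_liminf) auto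
  also have "\<dots> \<le> ennreal B"
  proof (intro Liminf_le always_eventually allI)
    fix n :: nat
    have "(\<integral>\<^sup>+s. ennreal (norm (indicator {0<..real n} s *\<^sub>R f s)) \<partial>lborel)
       = (\<integral>\<^sup>+s. ennreal (indicator {0<..real n} s *\<^sub>R f s) \<partial>lborel)"
      using nn by (intro nn_integral_cong) (auto simp: indicator_def)
    also have "\<dots> = ennreal (\<integral>s. indicator {0<..real n} s *\<^sub>R f s \<partial>lborel)"
      using i[of "real n"] nn by (intro nn_integral_eq_integral) (auto simp: upto_integrable_iff indicator_def)
    also have "\<dots> \<le> ennreal B" using b[of "real n"] by (simp add: upto_integral ennreal_leI)
    finally show "(\<integral>\<^sup>+s. ennreal (norm (indicator {0<..real n} s *\<^sub>R f s)) \<partial>lborel) \<le> ennreal B" .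
  qed auto
  finally have "integrable halfline f" unfolding halfline_integrable_iff
    using m by (intro integrableI_bounded) (auto intro: le_less_trans)
  moreover from integral_upto_tendsto[OF this] have "(\<integral>s. f s \<partial>halfline) \<le> B"
    by (rule tendsto_upperbound) (auto intro: eventually_at_top_linorderI[of 0] b)
  ultimately show ?thesis ..
qed

section \<open>Calculus of the integral representation\<close>

lemma ac_repD:
  assumes "ac_rep y f m" "0 \<le> t"
  shows "integrable (upto_measure t) f" "m t = y + (\<integral>s. f s \<partial>upto_measure t)"
  using assms by (auto simp: ac_rep_def)

lemma ac_rep_cong:
  assumes "ac_rep y f m" "\<And>s. 0 < s \<Longrightarrow> f s = g s" "\<And>t. 0 \<le> t \<Longrightarrow> m t = m' t" "y = y'"
  shows "ac_rep y' g m'"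
  unfolding ac_rep_def
proof (intro allI impI)
  fix t :: real assume t: "0 \<le> t"
  have "integrable (upto_measure t) f \<longleftrightarrow> integrable (upto_measure t) g"
    using assms(2) by (intro Bochner_Integration.integrable_cong) (auto simp: space_restrict_space)
  moreover have "(\<integral>s. f s \<partial>upto_measure t) = (\<integral>s. g s \<partial>upto_measure t)"
    using assms(2) by (intro Bochner_Integration.integral_cong) (auto simp: space_restrict_space)
  ultimately show "integrable (upto_measure t) g \<and> m' t = y' + (\<integral>s. g s \<partial>upto_measure t)"
    using ac_repD[OF assms(1) t] assms(3)[OF t] assms(4) by simp
qed

lemma ac_rep_add:
  "ac_rep y f m \<Longrightarrow> ac_rep z g k \<Longrightarrow> ac_rep (y + z) (\<lambda>s. f s + g s) (\<lambda>t. m t + k t)"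
  by (auto simp: ac_rep_def)

lemma ac_rep_bounded_linear:
  assumes "bounded_linear h" "ac_rep y f m"
  shows "ac_rep (h y) (\<lambda>s. h (f s)) (\<lambda>t. h (m t))"
  using assms unfolding ac_rep_def
  by (auto simp: linear_add[OF bounded_linear.linear] integral_bounded_linear integrable_bounded_linear)

lemma ac_rep_scaleR: "ac_rep y f m \<Longrightarrow> ac_rep (c *\<^sub>R y) (\<lambda>s. c *\<^sub>R f s) (\<lambda>t. c *\<^sub>R m t)"
  by (rule ac_rep_bounded_linear[OF bounded_linear_scaleR_right])

lemma ac_rep_diff:
  "ac_rep y f m \<Longrightarrow> ac_rep z g k \<Longrightarrow> ac_rep (y - z) (\<lambda>s. f s - g s) (\<lambda>t. m t - k t)"
  by (auto simp: ac_rep_def)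

lemma ac_rep_const: "ac_rep y (\<lambda>s. 0) (\<lambda>t. y)"
  by (auto simp: ac_rep_def)

lemma ac_rep_sum:
  assumes "\<And>i. i \<in> I \<Longrightarrow> ac_rep (y i) (f i) (m i)"
  shows "ac_rep (\<Sum>i\<in>I. y i) (\<lambda>s. \<Sum>i\<in>I. f i s) (\<lambda>t. \<Sum>i\<in>I. m i t)"
  using assms by (induction I rule: infinite_finite_induct) (auto intro: ac_rep_const ac_rep_add)

text \<open>Continuity of the indefinite integral, obtained by passing to the gauge integral on each
  \<open>{0..b}\<close>; the missing end point 0 is negligible.\<close>

lemma ac_rep_continuous:
  assumes "ac_rep y f m" shows "continuous_on {0..} m"
proof -
  have *: "continuous_on {0..b} m" if "0 \<le> b" for b
  proof -
    have s: "set_integrable lborel {0<..t} f" if "0 \<le> t" for t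
      using ac_repD(1)[OF assms that] by (simp add: upto_integrable_iff set_integrable_def)
    have eq: "m t = y + integral {0..t} f" if "t \<in> {0..b}" for t
    proof -
      have "m t = y + (LINT s:{0<..t}|lborel. f s)"
        using ac_repD(2)[OF assms, of t] that by (simp add: upto_integral set_lebesgue_integral_def)
      also have "(LINT s:{0<..t}|lborel. f s) = integral {0<..t} f"
        using s that by (intro set_borel_integral_eq_integral) auto
      also have "\<dots> = integral {0..t} f"
        using that by (intro integral_spike_set)
          (auto intro!: negligible_subset[OF negligible_sing[of 0]])
      finally show ?thesis .
    qed
    have "f integrable_on {0<..b}" using set_borel_integral_eq_integral(1)[OF s[OF that]] .
    then have "f integrable_on {0..b}"
      by (rule integrable_spike_set) (auto intro!: negligible_subset[OF negligible_sing[of 0]])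
    then have "continuous_on {0..b} (\<lambda>t. y + integral {0..t} f)"
      by (intro continuous_intros indefinite_integral_continuous_1)
    then show ?thesis by (subst continuous_on_cong[OF refl eq])
  qed
  show ?thesis
    unfolding continuous_on_eq_continuous_within
  proof
    fix t :: real assume t: "t \<in> {0..}"
    have "continuous (at t within {0..t + 1}) m"
      using *[of "t + 1"] t by (auto simp: continuous_on_eq_continuous_within)
    moreover have "at t within {0..t + 1} = at t within {0..}"
      using t by (intro at_within_nhd[of t "{..<t + 1}"]) auto
    ultimately show "continuous (at t within {0..}) m" by simp
  qed
qed

text \<open>Product rule by Fubini. For the primitives \<open>F\<close>, \<open>G\<close> that
  vanish at 0, \<open>B (F t) (G t)\<close> is the integral of \<open>B (f r) (g s)\<close> over a
  square. The triangle \<open>r \<le> s\<close> contributes the integral of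
  \<open>B (F s) (g s)\<close>, the triangle \<open>s < r\<close> that of
  \<open>B (f r) (G r)\<close>.\<close>

lemma ac_rep_bilinear:
  assumes B: "bounded_bilinear B" and 1: "ac_rep y f m" and 2: "ac_rep z g k"
  shows "ac_rep (B y z) (\<lambda>s. B (f s) (k s) + B (m s) (g s)) (\<lambda>t. B (m t) (k t))"
proof -
  interpret B: bounded_bilinear B by fact
  obtain K where K: "\<And>a b. norm (B a b) \<le> norm a * norm b * K" using B.bounded by blast
  define F where "F t = (\<integral>s. f s \<partial>upto_measure t)" for t
  define G where "G t = (\<integral>s. g s \<partial>upto_measure t)" for t
  have main: "integrable (upto_measure t) (\<lambda>s. B (F s) (g s)) \<and> integrable (upto_measure t) (\<lambda>s. B (f s) (G s))
      \<and> B (F t) (G t) = (\<integral>s. B (F s) (g s) \<partial>upto_measure t) + (\<integral>s. B (f s) (G s) \<partial>upto_measure t)"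
    if t: "0 \<le> t" for t
  proof -
    let ?N = "upto_measure t"
    interpret N: sigma_finite_measure ?N by simp
    interpret NN: pair_sigma_finite ?N ?N by unfold_locales
    note f = ac_repD(1)[OF 1 t] and g = ac_repD(1)[OF 2 t]
    have [measurable]: "f \<in> borel_measurable ?N" "g \<in> borel_measurable ?N" using f g by auto
    have Bm: "(\<lambda>x. B (fst x) (snd x)) \<in> borel_measurable borel"
      by (intro borel_measurable_continuous_onI B.continuous_on continuous_intros)
    have meas[measurable]: "(\<lambda>(r, s). B (f r) (g s)) \<in> borel_measurable (?N \<Otimes>\<^sub>M ?N)"
    proof -
      have "(\<lambda>p. (f (fst p), g (snd p))) \<in> borel_measurable (?N \<Otimes>\<^sub>M ?N)"
        unfolding borel_prod[symmetric] by measurable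
      from measurable_compose[OF this Bm] show ?thesis by (simp add: case_prod_beta')
    qed
    have int: "integrable (?N \<Otimes>\<^sub>M ?N) (\<lambda>(r, s). norm (f r) * norm (g s) * K)"
    proof (rule NN.Fubini_integrable)
      show "AE r in ?N. integrable ?N (\<lambda>s. case (r, s) of (r, s) \<Rightarrow> norm (f r) * norm (g s) * K)"
        using g by auto
      have "(\<lambda>r. \<integral>s. norm (case (r, s) of (r, s) \<Rightarrow> norm (f r) * norm (g s) * K) \<partial>?N)
          = (\<lambda>r. norm (f r) * ((\<integral>s. norm (g s) \<partial>?N) * \<bar>K\<bar>))"
        by (simp add: abs_mult mult.assoc)
      then show "integrable ?N (\<lambda>r. \<integral>s. norm (case (r, s) of (r, s) \<Rightarrow> norm (f r) * norm (g s) * K) \<partial>?N)"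
        using f by simp
    qed measurable
    have "{p \<in> space (?N \<Otimes>\<^sub>M ?N). fst p \<le> snd p} \<in> sets (?N \<Otimes>\<^sub>M ?N)"
    proof -
      have [measurable]: "(\<lambda>x. x) \<in> borel_measurable ?N" by (rule measurable_restrict_space1) simp
      show ?thesis by measurable
    qed
    note le[measurable] = this
    define P where "P = (\<lambda>(r, s). if r \<le> s then B (f r) (g s) else 0)"
    define Q where "Q = (\<lambda>(r, s). if r \<le> s then 0 else B (f r) (g s))"
    have [measurable]: "(\<lambda>x. x) \<in> borel_measurable ?N" by (rule measurable_restrict_space1) simp
    have Pm: "P \<in> borel_measurable (?N \<Otimes>\<^sub>M ?N)" and Qm: "Q \<in> borel_measurable (?N \<Otimes>\<^sub>M ?N)"
      unfolding P_def Q_def case_prod_beta' using meas by (simp_all add: case_prod_beta')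
    have PI: "integrable (?N \<Otimes>\<^sub>M ?N) P"
      by (rule Bochner_Integration.integrable_bound[OF int Pm])
        (auto simp: P_def intro!: AE_I2 order_trans[OF K] order_trans[OF norm_ge_zero K])
    have QI: "integrable (?N \<Otimes>\<^sub>M ?N) Q"
      by (rule Bochner_Integration.integrable_bound[OF int Qm])
        (auto simp: Q_def intro!: AE_I2 order_trans[OF K] order_trans[OF norm_ge_zero K])
    have Pin: "(\<integral>r. P (r, s) \<partial>?N) = B (F s) (g s)" if s: "s \<in> {0<..t}" for s
    proof -
      have "(\<integral>r. P (r, s) \<partial>?N) = (\<integral>r. B (indicator {0<..s} r *\<^sub>R f r) (g s) \<partial>?N)"
        by (intro Bochner_Integration.integral_cong) (auto simp: P_def space_restrict_space indicator_def B.zero_left)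
      also have "\<dots> = B (\<integral>r. indicator {0<..s} r *\<^sub>R f r \<partial>?N) (g s)"
        using f s by (intro integral_bounded_linear[OF B.bounded_linear_left] integrable_mult_indicator)
          (auto simp: sets_restrict_space_iff)
      also have "\<dots> = B (F s) (g s)" using s by (simp add: F_def upto_integral_indicator[of s t])
      finally show ?thesis .
    qed
    have Qin: "(\<integral>s. Q (r, s) \<partial>?N) = B (f r) (G r)" if r: "r \<in> {0<..t}" for r
    proof -
      \<comment> \<open>\<open>Q\<close> omits the diagonal, while the interval defining
        \<open>G r\<close> contains its end point \<open>r\<close>; a single point does not affect
        the integral.\<close>
      have ae: "AE s in ?N. s \<noteq> r"
        using AE_lborel_singleton[of r] by (subst AE_restrict_space_iff) auto
      have "(\<integral>s. Q (r, s) \<partial>?N) = (\<integral>s. B (f r) (indicator {0<..r} s *\<^sub>R g s) \<partial>?N)"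
      proof (rule integral_cong_AE)
        show "(\<lambda>s. Q (r, s)) \<in> borel_measurable ?N"
          using r by (intro measurable_Pair2[OF Qm]) (auto simp: space_restrict_space)
        show "(\<lambda>s. B (f r) (indicator {0<..r} s *\<^sub>R g s)) \<in> borel_measurable ?N"
          using r by (intro borel_measurable_continuous_on[where f="B (f r)"] B.continuous_on continuous_intros)
             (auto intro!: borel_measurable_scaleR borel_measurable_indicator simp: sets_restrict_space_iff)
        show "AE s in ?N. Q (r, s) = B (f r) (indicator {0<..r} s *\<^sub>R g s)"
          using ae AE_space by eventually_elim (auto simp: Q_def space_restrict_space indicator_def B.zero_right)
      qed
      also have "\<dots> = B (f r) (\<integral>s. indicator {0<..r} s *\<^sub>R g s \<partial>?N)"
        using g r by (intro integral_bounded_linear[OF B.bounded_linear_right] integrable_mult_indicator)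
          (auto simp: sets_restrict_space_iff)
      also have "\<dots> = B (f r) (G r)" using r by (simp add: G_def upto_integral_indicator[of r t])
      finally show ?thesis .
    qed
    have i1: "integrable ?N (\<lambda>s. \<integral>r. P (r, s) \<partial>?N)" by (rule NN.integrable_snd) (use PI in simp)
    have i2: "integrable ?N (\<lambda>r. \<integral>s. Q (r, s) \<partial>?N)" by (rule NN.integrable_fst') (use QI in simp)
    have c1: "integrable ?N (\<lambda>s. B (F s) (g s))"
      using i1 by (rule Bochner_Integration.integrable_cong[THEN iffD1, rotated -1]) (auto simp: space_restrict_space Pin)
    have c2: "integrable ?N (\<lambda>s. B (f s) (G s))"
      using i2 by (rule Bochner_Integration.integrable_cong[THEN iffD1, rotated -1]) (auto simp: space_restrict_space Qin)
    have "B (F t) (G t) = (\<integral>s. B (F t) (g s) \<partial>?N)"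
      unfolding G_def using g by (simp add: integral_bounded_linear[OF B.bounded_linear_right])
    also have "\<dots> = (\<integral>s. (\<integral>r. B (f r) (g s) \<partial>?N) \<partial>?N)"
      unfolding F_def using f by (simp add: integral_bounded_linear[OF B.bounded_linear_left])
    also have "\<dots> = (\<integral>s. (\<integral>r. (P (r, s) + Q (r, s)) \<partial>?N) \<partial>?N)"
      by (intro Bochner_Integration.integral_cong) (auto simp: P_def Q_def)
    also have "\<dots> = integral\<^sup>L (?N \<Otimes>\<^sub>M ?N) (\<lambda>p. P p + Q p)"
    proof -
      have eq: "(\<lambda>(r, s). P (r, s) + Q (r, s)) = (\<lambda>p. P p + Q p)" by auto
      show ?thesis using NN.integral_snd[of "\<lambda>r s. P (r, s) + Q (r, s)"]
          Bochner_Integration.integrable_add[OF PI QI]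
        unfolding eq by blast
    qed
    also have "\<dots> = integral\<^sup>L (?N \<Otimes>\<^sub>M ?N) P + integral\<^sup>L (?N \<Otimes>\<^sub>M ?N) Q"
      using PI QI by simp
    also have "integral\<^sup>L (?N \<Otimes>\<^sub>M ?N) P = (\<integral>s. (\<integral>r. P (r, s) \<partial>?N) \<partial>?N)"
      using NN.integral_snd[of "\<lambda>r s. P (r, s)"] PI by simp
    also have "\<dots> = (\<integral>s. B (F s) (g s) \<partial>?N)"
      by (intro Bochner_Integration.integral_cong) (auto simp: space_restrict_space Pin)
    also have "integral\<^sup>L (?N \<Otimes>\<^sub>M ?N) Q = (\<integral>r. (\<integral>s. Q (r, s) \<partial>?N) \<partial>?N)"
      using NN.integral_fst'[OF QI] by simp
    also have "\<dots> = (\<integral>s. B (f s) (G s) \<partial>?N)"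
      by (intro Bochner_Integration.integral_cong) (auto simp: space_restrict_space Qin)
    finally show ?thesis using c1 c2 by simp
  qed
  have m: "m t = y + F t" "k t = z + G t" if "0 \<le> t" for t
    using ac_repD(2)[OF 1 that] ac_repD(2)[OF 2 that] by (auto simp: F_def G_def)
  have 0: "ac_rep (0 + 0) (\<lambda>s. B (F s) (g s) + B (f s) (G s)) (\<lambda>t. B (F t) (G t))"
    unfolding ac_rep_def using main by simp
  \<comment> \<open>The initial values return through \<open>m = y + F\<close>,
    \<open>k = z + G\<close>: the products with a constant factor are linear and add to the case of
    vanishing initial values.\<close>
  have "ac_rep (0 + B y z + (0 + 0)) (\<lambda>s. B (f s) z + B y (g s) + (B (F s) (g s) + B (f s) (G s)))
       (\<lambda>t. B (F t) z + B y (k t) + B (F t) (G t))"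
  proof (intro ac_rep_add 0)
    have "ac_rep 0 f F" using 1 by (auto simp: ac_rep_def F_def)
    from ac_rep_bounded_linear[OF B.bounded_linear_left this, of z]
    show "ac_rep 0 (\<lambda>s. B (f s) z) (\<lambda>t. B (F t) z)" by (simp add: B.zero_left)
    show "ac_rep (B y z) (\<lambda>s. B y (g s)) (\<lambda>t. B y (k t))"
      by (rule ac_rep_bounded_linear[OF B.bounded_linear_right 2])
  qed
  then show ?thesis
    by (rule ac_rep_cong) (auto simp: m B.add_left B.add_right)
qed

lemma bounded_bilinear_inner_matrix: "bounded_bilinear (\<lambda>x y. x \<bullet> (H *v y))" for H :: "real^'n^'m"
  by (rule bounded_bilinear.comp[OF bounded_bilinear_inner bounded_linear_ident bounded_linear_matrix_vector])

lemmas ac_rep_inner_matrix = ac_rep_bilinear[OF bounded_bilinear_inner_matrix]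

lemma ac_rep_derivative:
  fixes m :: "real \<Rightarrow> 'a::euclidean_space"
  assumes d: "\<And>t. (m has_vector_derivative f t) (at t)" and c: "continuous_on UNIV f"
  shows "ac_rep (m 0) f m"
  unfolding ac_rep_def
proof (intro allI impI)
  fix t :: real assume t: "0 \<le> t"
  have 1: "has_bochner_integral lborel (\<lambda>x. indicator {0..t} x *\<^sub>R f x) (m t - m 0)"
    using d c t by (intro has_bochner_integral_FTC_Icc) 
      (auto intro: has_vector_derivative_at_within continuous_on_subset)
  have ae: "AE x in lborel. indicator {0..t} x *\<^sub>R f x = indicator {0<..t} x *\<^sub>R f x"
    using AE_lborel_singleton[of 0] by eventually_elim (auto simp: indicator_def)
  have [measurable]: "f \<in> borel_measurable borel" using c by (rule borel_measurable_continuous_onI)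
  have "has_bochner_integral lborel (\<lambda>x. indicator {0<..t} x *\<^sub>R f x) (m t - m 0)"
    by (rule has_bochner_integral_cong_AE[THEN iffD1, OF _ _ ae 1]) auto
  then show "integrable (upto_measure t) f \<and> m t = m 0 + (\<integral>s. f s \<partial>upto_measure t)"
    by (auto simp: upto_integrable_iff upto_integral has_bochner_integral_iff)
qed

section \<open>Elementary integrals and the Ito isometry\<close>

lemma pair_product_integrable:
  fixes f :: "'a \<Rightarrow> real" and g :: "'b \<Rightarrow> real"
  assumes "sigma_finite_measure N" "sigma_finite_measure M" "integrable N f" "integrable M g"
  shows "integrable (N \<Otimes>\<^sub>M M) (\<lambda>(s, \<omega>). f s * g \<omega>)"
    and "(\<integral>(s, \<omega>). f s * g \<omega> \<partial>(N \<Otimes>\<^sub>M M)) = (\<integral>s. f s \<partial>N) * (\<integral>\<omega>. g \<omega> \<partial>M)"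
proof -
  interpret N: sigma_finite_measure N by fact
  interpret M: sigma_finite_measure M by fact
  interpret NM: pair_sigma_finite N M by unfold_locales
  have [measurable]: "f \<in> borel_measurable N" "g \<in> borel_measurable M" using assms by auto
  show *: "integrable (N \<Otimes>\<^sub>M M) (\<lambda>(s, \<omega>). f s * g \<omega>)"
  proof (rule NM.Fubini_integrable)
    have "(\<lambda>x. \<integral>y. norm (case (x, y) of (s, \<omega>) \<Rightarrow> f s * g \<omega>) \<partial>M) = (\<lambda>x. \<bar>f x\<bar> * (\<integral>y. \<bar>g y\<bar> \<partial>M))"
      by (simp add: abs_mult)
    then show "integrable N (\<lambda>x. \<integral>y. norm (case (x, y) of (s, \<omega>) \<Rightarrow> f s * g \<omega>) \<partial>M)"
      using assms(3) by simp
  qed (use assms(4) in auto)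
  show "(\<integral>(s, \<omega>). f s * g \<omega> \<partial>(N \<Otimes>\<^sub>M M)) = (\<integral>s. f s \<partial>N) * (\<integral>\<omega>. g \<omega> \<partial>M)"
    using NM.integral_fst'[OF *] by simp
qed

lemma integral_double_sum:
  fixes f :: "nat \<Rightarrow> nat \<Rightarrow> 'a \<Rightarrow> real"
  assumes "\<And>k l. k < N \<Longrightarrow> l < N' \<Longrightarrow> integrable M (f k l)"
  shows "(\<integral>x. (\<Sum>k<N. \<Sum>l<N'. f k l x) \<partial>M) = (\<Sum>k<N. \<Sum>l<N'. \<integral>x. f k l x \<partial>M)"
proof -
  have "(\<integral>x. (\<Sum>k<N. \<Sum>l<N'. f k l x) \<partial>M) = (\<Sum>k<N. \<integral>x. (\<Sum>l<N'. f k l x) \<partial>M)"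
    by (rule Bochner_Integration.integral_sum) (use assms in auto)
  also have "\<dots> = (\<Sum>k<N. \<Sum>l<N'. \<integral>x. f k l x \<partial>M)"
    by (intro sum.cong refl Bochner_Integration.integral_sum) (use assms in auto)
  finally show ?thesis .
qed

lemma dot_matrix_transpose: "x \<bullet> (H *v y) = (transpose H *v x) \<bullet> y" for H :: "real^'n^'m"
  by (simp add: dot_lmul_matrix[symmetric])

section \<open>Adapted random variables and Wiener increments\<close>

locale wiener_space =
  fixes M :: "'w measure" and F :: "real \<Rightarrow> 'w measure" and w :: "real \<Rightarrow> 'w \<Rightarrow> real"
  assumes prob: "prob_space M" and filt: "nonneg_filtration M F" and wiener: "wiener_process M F w"
begin

sublocale prob_space M by (rule prob)

definition adapted_l2 :: "real \<Rightarrow> ('w \<Rightarrow> 'b::euclidean_space) \<Rightarrow> bool" where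
  "adapted_l2 t f \<longleftrightarrow> f \<in> borel_measurable (F t) \<and> square_integrable M f"

lemma F_measurable: "0 \<le> t \<Longrightarrow> f \<in> borel_measurable (F t) \<Longrightarrow> f \<in> borel_measurable M"
  using filt measurable_from_subalg unfolding nonneg_filtration_def by blast

lemma F_mono:
  assumes "0 \<le> s" "s \<le> t" "f \<in> borel_measurable (F s)" shows "f \<in> borel_measurable (F t)"
proof -
  have "subalgebra (F t) (F s)"
    using filt assms unfolding nonneg_filtration_def subalgebra_def by auto
  then show ?thesis using assms(3) by (rule measurable_from_subalg)
qed

lemma w_measurable: "0 \<le> s \<Longrightarrow> s \<le> t \<Longrightarrow> w s \<in> borel_measurable (F t)"
  using wiener F_mono unfolding wiener_process_def by blast

lemma w_measurable_M: "0 \<le> s \<Longrightarrow> w s \<in> borel_measurable M"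
  using w_measurable F_measurable by blast

lemma adapted_l2_mono: "0 \<le> s \<Longrightarrow> s \<le> t \<Longrightarrow> adapted_l2 s f \<Longrightarrow> adapted_l2 t f"
  using F_mono unfolding adapted_l2_def by blast

lemma adapted_l2_mult_vec: "adapted_l2 t f \<Longrightarrow> adapted_l2 t (\<lambda>x. H *v f x)" for H :: "real^'n^'m"
  unfolding adapted_l2_def
  by (auto intro!: borel_measurable_continuous_on[where f="\<lambda>v. H *v v"] linear_continuous_on
      bounded_linear_matrix_vector)

lemma adapted_l2_const: "adapted_l2 t (\<lambda>\<omega>. c)"
  by (auto simp: adapted_l2_def square_integrable_const finite_measure_axioms)

lemma adapted_l2_add: "adapted_l2 t f \<Longrightarrow> adapted_l2 t g \<Longrightarrow> adapted_l2 t (\<lambda>x. f x + g x)"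
  unfolding adapted_l2_def by auto

lemma adapted_l2_sum:
  "(\<And>i. i \<in> I \<Longrightarrow> adapted_l2 t (f i)) \<Longrightarrow> adapted_l2 t (\<lambda>x. \<Sum>i\<in>I. f i x)"
  unfolding adapted_l2_def by (auto intro!: borel_measurable_sum square_integrable_sum)

text \<open>Independence is assumed between the sigma-algebra at time \<open>s\<close> and the one
  generated by the increment. It passes to \<open>\<xi>\<close> and the increment because both
  generated sigma-algebras are contained in these, and then to a measurable function of the
  increment; expectations factorize.\<close>

lemma independent_increment:
  fixes \<xi> :: "'w \<Rightarrow> real" and h :: "real \<Rightarrow> real"
  assumes st: "0 \<le> s" "s < t" and xi: "\<xi> \<in> borel_measurable (F s)" "integrable M \<xi>"
    and h: "h \<in> borel_measurable borel" "integrable M (\<lambda>\<omega>. h (w t \<omega> - w s \<omega>))"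
  shows "integrable M (\<lambda>\<omega>. \<xi> \<omega> * h (w t \<omega> - w s \<omega>)) \<and>
    (\<integral>\<omega>. \<xi> \<omega> * h (w t \<omega> - w s \<omega>) \<partial>M) = (\<integral>\<omega>. \<xi> \<omega> \<partial>M) * (\<integral>\<omega>. h (w t \<omega> - w s \<omega>) \<partial>M)"
proof -
  let ?D = "\<lambda>\<omega>. w t \<omega> - w s \<omega>"
  have [measurable]: "?D \<in> borel_measurable M" "\<xi> \<in> borel_measurable M"
    using w_measurable_M st xi by auto
  have sp: "space (F s) = space M" using filt st(1) by (auto simp: nonneg_filtration_def subalgebra_def)
  have "indep_set (sets (F s)) (sets (vimage_algebra (space M) ?D borel))"
    using wiener st unfolding wiener_process_def by blast
  then have "indep_set (sigma_sets (space M) {\<xi> -` A \<inter> space M | A. A \<in> sets borel})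
      (sigma_sets (space M) {?D -` A \<inter> space M | A. A \<in> sets borel})"
    unfolding indep_set_def
  proof (rule indep_sets_mono_sets)
    fix i :: bool
    have "sigma_sets (space M) {\<xi> -` A \<inter> space M | A. A \<in> sets borel} \<subseteq> sets (F s)"
      unfolding sp[symmetric] by (rule sets.sigma_sets_subset) (use xi in \<open>auto intro: measurable_sets\<close>)
    moreover have "sigma_sets (space M) {?D -` A \<inter> space M | A. A \<in> sets borel}
        \<subseteq> sets (vimage_algebra (space M) ?D borel)"
      by (simp add: sets_vimage_algebra)
    ultimately show "case_bool (sigma_sets (space M) {\<xi> -` A \<inter> space M | A. A \<in> sets borel})
      (sigma_sets (space M) {?D -` A \<inter> space M | A. A \<in> sets borel}) i
       \<subseteq> case_bool (sets (F s)) (sets (vimage_algebra (space M) ?D borel)) i"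
      by (cases i) auto
  qed
  then have "indep_var borel \<xi> borel ?D" by (simp add: indep_var_eq)
  from indep_var_compose[OF this measurable_ident h(1)]
  have "indep_var borel \<xi> borel (\<lambda>\<omega>. h (?D \<omega>))" by (simp add: comp_def)
  from indep_var_integrable[OF this xi(2) h(2)] indep_var_lebesgue_integral[OF this xi(2) h(2)]
  show ?thesis by simp
qed

lemma increment_moments:
  assumes "0 \<le> s" "s < t"
  shows "integrable M (\<lambda>\<omega>. w t \<omega> - w s \<omega>)" "(\<integral>\<omega>. w t \<omega> - w s \<omega> \<partial>M) = 0"
    "integrable M (\<lambda>\<omega>. (w t \<omega> - w s \<omega>)\<^sup>2)" "(\<integral>\<omega>. (w t \<omega> - w s \<omega>)\<^sup>2 \<partial>M) = t - s"
proof -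
  let ?s = "sqrt (t - s)"
  have D: "distributed M lborel (\<lambda>\<omega>. w t \<omega> - w s \<omega>) (\<lambda>z. ennreal (normal_density 0 ?s z))"
    using wiener assms unfolding wiener_process_def by blast
  have pos: "0 < ?s" using assms by simp
  have 1: "integrable lborel (\<lambda>x. normal_density 0 ?s x * x)"
    and 2: "integrable lborel (\<lambda>x. normal_density 0 ?s x * x\<^sup>2)"
    using integrable_normal_moment[OF pos, of 0 1] integrable_normal_moment[OF pos, of 0 2] by simp_all
  show "integrable M (\<lambda>\<omega>. w t \<omega> - w s \<omega>)"
    using distributed_integrable[OF D, of "\<lambda>x. x"] 1 by simp
  show "integrable M (\<lambda>\<omega>. (w t \<omega> - w s \<omega>)\<^sup>2)"
    using distributed_integrable[OF D, of "\<lambda>x. x\<^sup>2"] 2 by simp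
  show E: "(\<integral>\<omega>. w t \<omega> - w s \<omega> \<partial>M) = 0"
    by (rule normal_distributed_expectation[OF pos D])
  show "(\<integral>\<omega>. (w t \<omega> - w s \<omega>)\<^sup>2 \<partial>M) = t - s"
    using normal_distributed_variance[OF pos D] E assms by simp
qed

lemma increment_orthogonal:
  fixes \<xi> :: "'w \<Rightarrow> real"
  assumes "0 \<le> s" "s \<le> t" "\<xi> \<in> borel_measurable (F s)" "integrable M \<xi>"
  shows "integrable M (\<lambda>\<omega>. \<xi> \<omega> * (w t \<omega> - w s \<omega>))" "(\<integral>\<omega>. \<xi> \<omega> * (w t \<omega> - w s \<omega>) \<partial>M) = 0"
proof -
  have "integrable M (\<lambda>\<omega>. \<xi> \<omega> * (w t \<omega> - w s \<omega>)) \<and> (\<integral>\<omega>. \<xi> \<omega> * (w t \<omega> - w s \<omega>) \<partial>M) = 0"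
  proof (cases "s = t")
    case False
    then have st: "s < t" using assms by simp
    show ?thesis
      using independent_increment[OF assms(1) st assms(3,4), of "\<lambda>x. x"] increment_moments[OF assms(1) st]
      by simp
  qed auto
  then show "integrable M (\<lambda>\<omega>. \<xi> \<omega> * (w t \<omega> - w s \<omega>))" "(\<integral>\<omega>. \<xi> \<omega> * (w t \<omega> - w s \<omega>) \<partial>M) = 0"
    by auto
qed

lemma increment_square:
  fixes \<xi> :: "'w \<Rightarrow> real"
  assumes "0 \<le> s" "s \<le> t" "\<xi> \<in> borel_measurable (F s)" "integrable M \<xi>"
  shows "integrable M (\<lambda>\<omega>. \<xi> \<omega> * (w t \<omega> - w s \<omega>)\<^sup>2)"
    "(\<integral>\<omega>. \<xi> \<omega> * (w t \<omega> - w s \<omega>)\<^sup>2 \<partial>M) = (t - s) * (\<integral>\<omega>. \<xi> \<omega> \<partial>M)"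
proof -
  have "integrable M (\<lambda>\<omega>. \<xi> \<omega> * (w t \<omega> - w s \<omega>)\<^sup>2) \<and>
    (\<integral>\<omega>. \<xi> \<omega> * (w t \<omega> - w s \<omega>)\<^sup>2 \<partial>M) = (t - s) * (\<integral>\<omega>. \<xi> \<omega> \<partial>M)"
  proof (cases "s = t")
    case False
    then have st: "s < t" using assms by simp
    show ?thesis
      using independent_increment[OF assms(1) st assms(3,4), of "\<lambda>x. x\<^sup>2"] increment_moments[OF assms(1) st]
      by simp
  qed auto
  then show "integrable M (\<lambda>\<omega>. \<xi> \<omega> * (w t \<omega> - w s \<omega>)\<^sup>2)"
    "(\<integral>\<omega>. \<xi> \<omega> * (w t \<omega> - w s \<omega>)\<^sup>2 \<partial>M) = (t - s) * (\<integral>\<omega>. \<xi> \<omega> \<partial>M)"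
    by auto
qed

lemma adapted_l2_increment:
  assumes "0 \<le> s" "s \<le> t" "adapted_l2 s e"
  shows "adapted_l2 t (\<lambda>\<omega>. (w t \<omega> - w s \<omega>) *\<^sub>R e \<omega>)"
    and "(\<integral>\<omega>. (norm ((w t \<omega> - w s \<omega>) *\<^sub>R e \<omega>))\<^sup>2 \<partial>M) = (t - s) * (\<integral>\<omega>. (norm (e \<omega>))\<^sup>2 \<partial>M)"
proof -
  have e: "e \<in> borel_measurable (F s)" "integrable M (\<lambda>\<omega>. (norm (e \<omega>))\<^sup>2)"
    using assms unfolding adapted_l2_def square_integrable_def by auto
  have "(\<lambda>\<omega>. (norm (e \<omega>))\<^sup>2) \<in> borel_measurable (F s)" using e by simp
  note sq = increment_square[OF assms(1,2) this e(2)]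
  have eq: "(norm ((w t \<omega> - w s \<omega>) *\<^sub>R e \<omega>))\<^sup>2 = (norm (e \<omega>))\<^sup>2 * (w t \<omega> - w s \<omega>)\<^sup>2" for \<omega>
    by (simp add: power_mult_distrib)
  have m: "(\<lambda>\<omega>. (w t \<omega> - w s \<omega>) *\<^sub>R e \<omega>) \<in> borel_measurable (F t)"
    using F_mono[OF assms(1,2) e(1)] w_measurable[of s t] w_measurable[of t t] assms by auto
  show "adapted_l2 t (\<lambda>\<omega>. (w t \<omega> - w s \<omega>) *\<^sub>R e \<omega>)"
    unfolding adapted_l2_def square_integrable_def eq using m sq(1) F_measurable[OF _ m] assms by auto
  show "(\<integral>\<omega>. (norm ((w t \<omega> - w s \<omega>) *\<^sub>R e \<omega>))\<^sup>2 \<partial>M) = (t - s) * (\<integral>\<omega>. (norm (e \<omega>))\<^sup>2 \<partial>M)"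
    unfolding eq by (rule sq(2))
qed

lemma adapted_inner:
  assumes "0 \<le> s" "adapted_l2 s f" "adapted_l2 s g"
  shows "(\<lambda>\<omega>. f \<omega> \<bullet> g \<omega>) \<in> borel_measurable (F s)" "integrable M (\<lambda>\<omega>. f \<omega> \<bullet> g \<omega>)"
  using assms unfolding adapted_l2_def by auto

lemma adapted_increment_orthogonal:
  assumes "0 \<le> s" "s \<le> t" "adapted_l2 s \<xi>" "adapted_l2 s e"
  shows "(\<integral>\<omega>. \<xi> \<omega> \<bullet> ((w t \<omega> - w s \<omega>) *\<^sub>R e \<omega>) \<partial>M) = 0"
  using increment_orthogonal(2)[OF assms(1,2) adapted_inner[OF assms(1,3,4)]]
  by (simp add: mult.commute)

text \<open>Covariance of two weighted increments is the length of the overlap times the covariance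
  of the weights. The earlier increment is cut at \<open>\<gamma>\<close>: its part before
  \<open>\<gamma>\<close> is known when the second cell starts, hence orthogonal to the second
  increment.\<close>

lemma increment_pair_ordered:
  assumes "0 \<le> \<alpha>" "\<alpha> \<le> \<gamma>" "\<alpha> \<le> \<beta>" "\<gamma> \<le> \<delta>" "adapted_l2 \<alpha> e" "adapted_l2 \<gamma> e'"
  shows "(\<integral>\<omega>. ((w \<beta> \<omega> - w \<alpha> \<omega>) *\<^sub>R e \<omega>) \<bullet> ((w \<delta> \<omega> - w \<gamma> \<omega>) *\<^sub>R e' \<omega>) \<partial>M)
    = measure lborel ({\<alpha>..<\<beta>} \<inter> {\<gamma>..<\<delta>}) * (\<integral>\<omega>. e \<omega> \<bullet> e' \<omega> \<partial>M)"
proof (cases "\<beta> \<le> \<gamma>")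
  case True
  have 0: "0 \<le> \<beta>" "0 \<le> \<gamma>" using assms by auto
  have "adapted_l2 \<gamma> (\<lambda>\<omega>. (w \<beta> \<omega> - w \<alpha> \<omega>) *\<^sub>R e \<omega>)"
    using adapted_l2_mono[OF 0(1) True adapted_l2_increment(1)[OF assms(1,3,5)]] .
  from adapted_increment_orthogonal[OF 0(2) assms(4) this assms(6)]
  show ?thesis using True by (simp add: Int_absorb)
next
  case False
  \<comment> \<open>After the cut both increments start at \<open>\<gamma>\<close>;
    \<open>\<mu>\<close> and \<open>\<nu>\<close> are the smaller and larger right end. The product
    is the square of the increment up to \<open>\<mu>\<close> plus a product with the increment from
    \<open>\<mu>\<close> to \<open>\<nu>\<close>, whose expectation vanishes.\<close>
  define \<mu> where "\<mu> = min \<beta> \<delta>"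
  define \<nu> where "\<nu> = max \<beta> \<delta>"
  have o: "0 \<le> \<gamma>" "\<gamma> \<le> \<mu>" "\<mu> \<le> \<nu>" "0 \<le> \<mu>" "\<gamma> \<le> \<beta>" using assms False by (auto simp: \<mu>_def \<nu>_def)
  have e: "adapted_l2 \<gamma> e" by (rule adapted_l2_mono[OF assms(1,2,5)])
  define \<xi> where "\<xi> \<omega> = e \<omega> \<bullet> e' \<omega>" for \<omega>
  have xi: "\<xi> \<in> borel_measurable (F \<gamma>)" "integrable M \<xi>"
    using adapted_inner[OF o(1) e assms(6)] by (simp_all add: \<xi>_def[abs_def])
  have xim: "(\<lambda>\<omega>. \<xi> \<omega> * (w \<mu> \<omega> - w \<gamma> \<omega>)) \<in> borel_measurable (F \<mu>)"
    using F_mono[OF o(1,2) xi(1)] w_measurable o by auto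
  have 1: "integrable M (\<lambda>\<omega>. ((w \<gamma> \<omega> - w \<alpha> \<omega>) *\<^sub>R e \<omega>) \<bullet> ((w \<delta> \<omega> - w \<gamma> \<omega>) *\<^sub>R e' \<omega>))"
    by (rule integrable_inner_square_integrable)
      (use adapted_l2_increment(1)[OF assms(1,2,5)] adapted_l2_increment(1)[OF o(1) assms(4,6)]
        in \<open>auto simp: adapted_l2_def\<close>)
  have z1: "(\<integral>\<omega>. ((w \<gamma> \<omega> - w \<alpha> \<omega>) *\<^sub>R e \<omega>) \<bullet> ((w \<delta> \<omega> - w \<gamma> \<omega>) *\<^sub>R e' \<omega>) \<partial>M) = 0"
    by (rule adapted_increment_orthogonal[OF o(1) assms(4) adapted_l2_increment(1)[OF assms(1,2,5)] assms(6)])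
  note 2 = increment_square[OF o(1,2) xi]
  note 3 = increment_orthogonal[OF o(4,3) xim increment_orthogonal(1)[OF o(1,2) xi]]
  have eq: "((w \<beta> \<omega> - w \<alpha> \<omega>) *\<^sub>R e \<omega>) \<bullet> ((w \<delta> \<omega> - w \<gamma> \<omega>) *\<^sub>R e' \<omega>) =
     ((w \<gamma> \<omega> - w \<alpha> \<omega>) *\<^sub>R e \<omega>) \<bullet> ((w \<delta> \<omega> - w \<gamma> \<omega>) *\<^sub>R e' \<omega>)
     + (\<xi> \<omega> * (w \<mu> \<omega> - w \<gamma> \<omega>)\<^sup>2 + \<xi> \<omega> * (w \<mu> \<omega> - w \<gamma> \<omega>) * (w \<nu> \<omega> - w \<mu> \<omega>))" for \<omega>
  proof -
    have "(w \<beta> \<omega> - w \<gamma> \<omega>) * (w \<delta> \<omega> - w \<gamma> \<omega>) = (w \<mu> \<omega> - w \<gamma> \<omega>) * (w \<nu> \<omega> - w \<gamma> \<omega>)"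
      by (auto simp: \<mu>_def \<nu>_def min_def max_def mult.commute)
    then have "\<xi> \<omega> * ((w \<beta> \<omega> - w \<gamma> \<omega>) * (w \<delta> \<omega> - w \<gamma> \<omega>)) = \<xi> \<omega> * ((w \<mu> \<omega> - w \<gamma> \<omega>) * (w \<nu> \<omega> - w \<gamma> \<omega>))"
      by simp
    then show ?thesis by (simp add: \<xi>_def algebra_simps power2_eq_square)
  qed
  have "(\<integral>\<omega>. ((w \<beta> \<omega> - w \<alpha> \<omega>) *\<^sub>R e \<omega>) \<bullet> ((w \<delta> \<omega> - w \<gamma> \<omega>) *\<^sub>R e' \<omega>) \<partial>M)
     = 0 + ((\<mu> - \<gamma>) * (\<integral>\<omega>. \<xi> \<omega> \<partial>M) + 0)"
    unfolding eq
    by (subst Bochner_Integration.integral_add[OF 1 Bochner_Integration.integrable_add[OF 2(1) 3(1)]],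
        subst Bochner_Integration.integral_add[OF 2(1) 3(1)]) (simp only: z1 2(2) 3(2))
  moreover have "{\<alpha>..<\<beta>} \<inter> {\<gamma>..<\<delta>} = {\<gamma>..<\<mu>}" using assms o by (auto simp: \<mu>_def)
  ultimately show ?thesis using o by (simp add: \<xi>_def)
qed

lemma increment_pair:
  assumes "0 \<le> \<alpha>" "0 \<le> \<gamma>" "\<alpha> \<le> \<beta>" "\<gamma> \<le> \<delta>" "adapted_l2 \<alpha> e" "adapted_l2 \<gamma> e'"
  shows "(\<integral>\<omega>. ((w \<beta> \<omega> - w \<alpha> \<omega>) *\<^sub>R e \<omega>) \<bullet> ((w \<delta> \<omega> - w \<gamma> \<omega>) *\<^sub>R e' \<omega>) \<partial>M)
    = measure lborel ({\<alpha>..<\<beta>} \<inter> {\<gamma>..<\<delta>}) * (\<integral>\<omega>. e \<omega> \<bullet> e' \<omega> \<partial>M)"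
proof (cases "\<alpha> \<le> \<gamma>")
  case True
  then show ?thesis using assms by (intro increment_pair_ordered)
next
  case False
  then have le: "\<gamma> \<le> \<alpha>" by simp
  show ?thesis
    using increment_pair_ordered[OF assms(2) le assms(4,3,6,5)]
    by (simp only: inner_commute Int_commute)
qed

section \<open>Elementary integrals: martingale property and isometry\<close>

text \<open>Right end of the cell cut off at time \<open>t\<close>, but never left of
  \<open>\<tau> k\<close>: a cell beyond \<open>t\<close> becomes empty with its left end kept. Each
  term of the elementary integral is then an increment starting at the time at which its coefficient
  is known.\<close>

definition cell_end :: "(nat \<Rightarrow> real) \<Rightarrow> real \<Rightarrow> nat \<Rightarrow> real" where
  "cell_end \<tau> t k = max (\<tau> k) (min t (\<tau> (Suc k)))"

lemma elementaryD:
  assumes "elementary M F \<tau> N e" "k < N"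
  shows "0 \<le> \<tau> k" "\<tau> k \<le> \<tau> (Suc k)" "adapted_l2 (\<tau> k) (e k)"
proof -
  have "0 \<le> \<tau> 0" and mono: "\<And>k. k < N \<Longrightarrow> \<tau> k \<le> \<tau> (Suc k)" using assms by (auto simp: elementary_def)
  have "j \<le> N \<Longrightarrow> 0 \<le> \<tau> j" for j
  proof (induction j)
    case (Suc j)
    then show ?case using mono[of j] by auto
  qed (use \<open>0 \<le> \<tau> 0\<close> in auto)
  then show "0 \<le> \<tau> k" using assms by auto
  show "\<tau> k \<le> \<tau> (Suc k)" "adapted_l2 (\<tau> k) (e k)"
    using assms by (auto simp: elementary_def adapted_l2_def)
qed

lemma elementary_integral_cell_end:
  assumes "elementary M F \<tau> N e"
  shows "elementary_integral w \<tau> N e t \<omega> = (\<Sum>k<N. (w (cell_end \<tau> t k) \<omega> - w (\<tau> k) \<omega>) *\<^sub>R e k \<omega>)"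
  unfolding elementary_integral_def
proof (intro sum.cong refl)
  fix k assume "k \<in> {..<N}"
  then show "(w (min t (\<tau> (Suc k))) \<omega> - w (min t (\<tau> k)) \<omega>) *\<^sub>R e k \<omega>
     = (w (cell_end \<tau> t k) \<omega> - w (\<tau> k) \<omega>) *\<^sub>R e k \<omega>"
    using elementaryD(2)[OF assms, of k] by (cases "t \<le> \<tau> k") (auto simp: cell_end_def min_def max_def)
qed

lemma elementary_integral_adapted:
  assumes el: "elementary M F \<tau> N e" and t: "0 \<le> t"
  shows "adapted_l2 t (elementary_integral w \<tau> N e t)"
proof -
  have "adapted_l2 t (\<lambda>\<omega>. \<Sum>k<N. (w (cell_end \<tau> t k) \<omega> - w (\<tau> k) \<omega>) *\<^sub>R e k \<omega>)"
  proof (rule adapted_l2_sum)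
    fix k assume "k \<in> {..<N}"
    then have k: "k < N" by simp
    note d = elementaryD[OF el k]
    show "adapted_l2 t (\<lambda>\<omega>. (w (cell_end \<tau> t k) \<omega> - w (\<tau> k) \<omega>) *\<^sub>R e k \<omega>)"
    proof (cases "t \<le> \<tau> k")
      case True
      then have "cell_end \<tau> t k = \<tau> k" by (auto simp: cell_end_def)
      then show ?thesis using adapted_l2_const[of t "0::'a"] by simp
    next
      case False
      then have c: "\<tau> k \<le> cell_end \<tau> t k" "cell_end \<tau> t k \<le> t" by (auto simp: cell_end_def)
      have "0 \<le> cell_end \<tau> t k" using c(1) d(1) by linarith
      from adapted_l2_mono[OF this c(2) adapted_l2_increment(1)[OF d(1) c(1) d(3)]] show ?thesis .
    qed
  qed
  then show ?thesis by (simp add: elementary_integral_cell_end[OF el, abs_def])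
qed

text \<open>The martingale property tested against \<open>\<xi>\<close>. Between \<open>s\<close>
  and \<open>t\<close> a cell contributes an increment starting at the later of \<open>s\<close> and
  \<open>\<tau> k\<close>, when both \<open>\<xi>\<close> and \<open>e k\<close> are known, or
  nothing if it ends before \<open>s\<close>.\<close>

lemma elementary_integral_orthogonal:
  assumes el: "elementary M F \<tau> N e" and st: "0 \<le> s" "s \<le> t" and xi: "adapted_l2 s \<xi>"
  shows "(\<integral>\<omega>. \<xi> \<omega> \<bullet> elementary_integral w \<tau> N e t \<omega> \<partial>M) = (\<integral>\<omega>. \<xi> \<omega> \<bullet> elementary_integral w \<tau> N e s \<omega> \<partial>M)"
proof -
  let ?c = "cell_end \<tau>"
  have sx: "square_integrable M \<xi>" using xi by (simp add: adapted_l2_def)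
  have int: "integrable M (\<lambda>\<omega>. \<xi> \<omega> \<bullet> ((w (?c r k) \<omega> - w (\<tau> k) \<omega>) *\<^sub>R e k \<omega>))" if "k < N" for r k
  proof -
    have "\<tau> k \<le> ?c r k" by (simp add: cell_end_def)
    from adapted_l2_increment(1)[OF elementaryD(1)[OF el that] this elementaryD(3)[OF el that]]
    have "square_integrable M (\<lambda>\<omega>. (w (?c r k) \<omega> - w (\<tau> k) \<omega>) *\<^sub>R e k \<omega>)"
      unfolding adapted_l2_def by blast
    from integrable_inner_square_integrable[OF sx this] show ?thesis .
  qed
  have zero: "(\<integral>\<omega>. \<xi> \<omega> \<bullet> ((w (?c t k) \<omega> - w (\<tau> k) \<omega>) *\<^sub>R e k \<omega>) \<partial>M)
     = (\<integral>\<omega>. \<xi> \<omega> \<bullet> ((w (?c s k) \<omega> - w (\<tau> k) \<omega>) *\<^sub>R e k \<omega>) \<partial>M)" if k: "k < N" for k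
  proof -
    note d = elementaryD[OF el k]
    have "(\<integral>\<omega>. \<xi> \<omega> \<bullet> ((w (?c t k) \<omega> - w (?c s k) \<omega>) *\<^sub>R e k \<omega>) \<partial>M) = 0"
    proof (cases "s \<le> \<tau> k")
      case True
      then have "?c s k = \<tau> k" "\<tau> k \<le> ?c t k" by (auto simp: cell_end_def)
      then show ?thesis
        using adapted_increment_orthogonal[OF d(1) _ adapted_l2_mono[OF st(1) True xi] d(3)] by simp
    next
      case False
      show ?thesis
      proof (cases "\<tau> (Suc k) \<le> s")
        case True
        then have "?c t k = ?c s k" using st d by (auto simp: cell_end_def)
        then show ?thesis by simp
      next
        case F2: False
        then have "?c s k = s" "s \<le> ?c t k" using False st by (auto simp: cell_end_def)
        then show ?thesis
          using adapted_increment_orthogonal[OF st(1) _ xi adapted_l2_mono[OF d(1) _ d(3)]] False by simp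
      qed
    qed
    moreover have "(\<integral>\<omega>. \<xi> \<omega> \<bullet> ((w (?c t k) \<omega> - w (?c s k) \<omega>) *\<^sub>R e k \<omega>) \<partial>M)
       = (\<integral>\<omega>. \<xi> \<omega> \<bullet> ((w (?c t k) \<omega> - w (\<tau> k) \<omega>) *\<^sub>R e k \<omega>) \<partial>M)
         - (\<integral>\<omega>. \<xi> \<omega> \<bullet> ((w (?c s k) \<omega> - w (\<tau> k) \<omega>) *\<^sub>R e k \<omega>) \<partial>M)"
      by (subst Bochner_Integration.integral_diff[OF int[OF k] int[OF k], symmetric])
        (simp add: algebra_simps inner_diff_right)
    ultimately show ?thesis by simp
  qed
  have "(\<integral>\<omega>. \<xi> \<omega> \<bullet> elementary_integral w \<tau> N e r \<omega> \<partial>M)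
     = (\<Sum>k<N. \<integral>\<omega>. \<xi> \<omega> \<bullet> ((w (?c r k) \<omega> - w (\<tau> k) \<omega>) *\<^sub>R e k \<omega>) \<partial>M)" for r
    unfolding elementary_integral_cell_end[OF el] inner_sum_right
    by (rule Bochner_Integration.integral_sum) (use int in auto)
  then show ?thesis using zero by simp
qed

abbreviation time_prob :: "real \<Rightarrow> (real \<times> 'w) measure" where
  "time_prob t \<equiv> upto_measure t \<Otimes>\<^sub>M M"

lemma pair_sigma_finite_time: "pair_sigma_finite (upto_measure t) M"
  by (simp add: pair_sigma_finite_def sigma_finite_measure_axioms)

text \<open>The overlap of two truncated cells as a time integral of indicators. The cells are
  closed on the left and the time domain is open at 0 and closed at \<open>t\<close>, so the two
  sets may differ at these two points.\<close>

lemma measure_cells: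
  fixes a b c d :: real
  assumes "0 \<le> t" and that: "0 \<le> a" "0 \<le> c"
  shows "measure lborel ({a..<max a (min t b)} \<inter> {c..<max c (min t d)})
    = (\<integral>s. indicator {a..<b} s * indicator {c..<d} s \<partial>upto_measure t)"
proof -
  have "(\<integral>s. indicator {a..<b} s * indicator {c..<d} s \<partial>upto_measure t)
     = (\<integral>s. indicat_real ({a..<b} \<inter> {c..<d} \<inter> {0<..t}) s \<partial>lborel)"
    unfolding upto_integral by (intro Bochner_Integration.integral_cong) (auto simp: indicator_def)
  also have "\<dots> = measure lborel ({a..<b} \<inter> {c..<d} \<inter> {0<..t})" by simp
  also have "\<dots> = measure lborel ({a..<max a (min t b)} \<inter> {c..<max c (min t d)})"
  proof (rule measure_eq_AE)
    show "AE s in lborel. (s \<in> {a..<b} \<inter> {c..<d} \<inter> {0<..t}) =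
        (s \<in> {a..<max a (min t b)} \<inter> {c..<max c (min t d)})"
      using AE_lborel_singleton[of 0] AE_lborel_singleton[of t]
      by eventually_elim (use that in auto)
  qed auto
  finally show ?thesis by simp
qed

lemma elementary_process_square_integrable:
  assumes el: "elementary M F \<tau> N e"
  shows "square_integrable (time_prob t) (\<lambda>(s, \<omega>). elementary_process \<tau> N e s \<omega>)"
proof -
  have "square_integrable (time_prob t) (\<lambda>p. indicator {\<tau> k..<\<tau> (Suc k)} (fst p) *\<^sub>R e k (snd p))"
    if k: "k < N" for k
  proof -
    have e: "square_integrable M (e k)" using elementaryD(3)[OF el k] by (simp add: adapted_l2_def)
    have [measurable]: "e k \<in> borel_measurable M" using e by (simp add: square_integrable_def)
    have i: "integrable (upto_measure t) (indicator {\<tau> k..<\<tau> (Suc k)} :: real \<Rightarrow> real)"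
      by (rule finite_measure.integrable_const_bound[where B=1]) (auto simp: measurable_restrict_space1)
    have [measurable]: "(\<lambda>p. indicat_real {\<tau> k..<\<tau> (Suc k)} (fst p)) \<in> borel_measurable (time_prob t)"
      using i by (intro measurable_compose[OF measurable_fst]) auto
    have "integrable (time_prob t) (\<lambda>p. indicator {\<tau> k..<\<tau> (Suc k)} (fst p) * (norm (e k (snd p)))\<^sup>2)"
      using pair_product_integrable(1)[OF sigma_finite_upto sigma_finite_measure_axioms i square_integrableD(2)[OF e]]
      by (simp add: case_prod_beta')
    moreover have "(norm (indicat_real {\<tau> k..<\<tau> (Suc k)} (fst p) *\<^sub>R e k (snd p)))\<^sup>2
       = indicat_real {\<tau> k..<\<tau> (Suc k)} (fst p) * (norm (e k (snd p)))\<^sup>2" for p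
      by (simp add: indicator_def)
    ultimately show ?thesis unfolding square_integrable_def by simp
  qed
  then show ?thesis
    unfolding elementary_process_def case_prod_beta' by (intro square_integrable_sum) auto
qed

text \<open>The isometry in polarized form and for two unrelated partitions. The overlap formula for
  single cells is summed over all pairs, which avoids a common refinement.\<close>

lemma elementary_isometry:
  assumes el: "elementary M F \<tau> N e" and el': "elementary M F \<tau>' N' e'" and t: "0 \<le> t"
  shows "(\<integral>\<omega>. elementary_integral w \<tau> N e t \<omega> \<bullet> elementary_integral w \<tau>' N' e' t \<omega> \<partial>M)
    = (\<integral>(s, \<omega>). elementary_process \<tau> N e s \<omega> \<bullet> elementary_process \<tau>' N' e' s \<omega> \<partial>time_prob t)"
proof -
  let ?I = "\<lambda>k \<omega>. (w (cell_end \<tau> t k) \<omega> - w (\<tau> k) \<omega>) *\<^sub>R e k \<omega>"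
  let ?J = "\<lambda>l \<omega>. (w (cell_end \<tau>' t l) \<omega> - w (\<tau>' l) \<omega>) *\<^sub>R e' l \<omega>"
  let ?i = "\<lambda>k s. indicat_real {\<tau> k..<\<tau> (Suc k)} s"
  let ?j = "\<lambda>l s. indicat_real {\<tau>' l..<\<tau>' (Suc l)} s"
  have c: "\<tau> k \<le> cell_end \<tau> t k" "\<tau>' k \<le> cell_end \<tau>' t k" for k by (auto simp: cell_end_def)
  have SI: "square_integrable M (?I k)" if "k < N" for k
    using adapted_l2_increment(1)[OF elementaryD(1)[OF el that] c(1) elementaryD(3)[OF el that]]
    by (simp add: adapted_l2_def)
  have SJ: "square_integrable M (?J k)" if "k < N'" for k
    using adapted_l2_increment(1)[OF elementaryD(1)[OF el' that] c(2) elementaryD(3)[OF el' that]]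
    by (simp add: adapted_l2_def)
  have ee: "integrable M (\<lambda>\<omega>. e k \<omega> \<bullet> e' l \<omega>)" if "k < N" "l < N'" for k l
    using elementaryD(3)[OF el that(1)] elementaryD(3)[OF el' that(2)] unfolding adapted_l2_def by auto
  have ij: "integrable (upto_measure t) (\<lambda>s. ?i k s * ?j l s)" for k l
    by (rule finite_measure.integrable_const_bound[where B=1])
      (auto simp: indicator_def intro!: measurable_restrict_space1)
  have "(\<integral>\<omega>. elementary_integral w \<tau> N e t \<omega> \<bullet> elementary_integral w \<tau>' N' e' t \<omega> \<partial>M)
     = (\<integral>\<omega>. (\<Sum>k<N. \<Sum>l<N'. ?I k \<omega> \<bullet> ?J l \<omega>) \<partial>M)"
    unfolding elementary_integral_cell_end[OF el] elementary_integral_cell_end[OF el']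
    unfolding inner_sum_left unfolding inner_sum_right by (rule refl)
  also have "\<dots> = (\<Sum>k<N. \<Sum>l<N'. \<integral>\<omega>. ?I k \<omega> \<bullet> ?J l \<omega> \<partial>M)"
    by (rule integral_double_sum, rule integrable_inner_square_integrable, erule SI, erule SJ)
  also have "\<dots> = (\<Sum>k<N. \<Sum>l<N'. \<integral>(s, \<omega>). (?i k s * ?j l s) * (e k \<omega> \<bullet> e' l \<omega>) \<partial>time_prob t)"
  proof (intro sum.cong refl)
    fix k l assume kl: "k \<in> {..<N}" "l \<in> {..<N'}"
    then have k: "k < N" and l: "l < N'" by auto
    note d = elementaryD[OF el k] and d' = elementaryD[OF el' l]
    have "(\<integral>\<omega>. ?I k \<omega> \<bullet> ?J l \<omega> \<partial>M) = (\<integral>s. ?i k s * ?j l s \<partial>upto_measure t) * (\<integral>\<omega>. e k \<omega> \<bullet> e' l \<omega> \<partial>M)"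
      using increment_pair[OF d(1) d'(1) c(1) c(2) d(3) d'(3)] measure_cells[OF t d(1) d'(1)]
      by (simp only: cell_end_def)
    then show "(\<integral>\<omega>. ?I k \<omega> \<bullet> ?J l \<omega> \<partial>M) = (\<integral>(s, \<omega>). (?i k s * ?j l s) * (e k \<omega> \<bullet> e' l \<omega>) \<partial>time_prob t)"
      by (simp only: pair_product_integrable(2)[OF sigma_finite_upto sigma_finite_measure_axioms ij ee[OF k l]])
  qed
  also have "\<dots> = (\<integral>p. (\<Sum>k<N. \<Sum>l<N'. (\<lambda>(s, \<omega>). (?i k s * ?j l s) * (e k \<omega> \<bullet> e' l \<omega>)) p) \<partial>time_prob t)"
    using pair_product_integrable(1)[OF sigma_finite_upto sigma_finite_measure_axioms ij ee]
    by (rule integral_double_sum[symmetric])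
  also have "\<dots> = (\<integral>(s, \<omega>). elementary_process \<tau> N e s \<omega> \<bullet> elementary_process \<tau>' N' e' s \<omega> \<partial>time_prob t)"
  proof -
    have "(\<Sum>k<N. \<Sum>l<N'. (\<lambda>(s, \<omega>). (?i k s * ?j l s) * (e k \<omega> \<bullet> e' l \<omega>)) p)
      = (\<lambda>(s, \<omega>). elementary_process \<tau> N e s \<omega> \<bullet> elementary_process \<tau>' N' e' s \<omega>) p" for p
      unfolding elementary_process_def case_prod_beta' inner_sum_left
      unfolding inner_sum_right
      by (intro sum.cong refl) (simp only: inner_scaleR_left inner_scaleR_right mult_ac)
    then show ?thesis by (simp only:)
  qed
  finally show ?thesis .
qed

text \<open>Expanding the square reduces the difference of two elementary integrals to the polarized
  isometry, so the difference need not be presented as an elementary integral itself.\<close>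

lemma elementary_isometry_diff:
  assumes el: "elementary M F \<tau> N e" and el': "elementary M F \<tau>' N' e'" and t: "0 \<le> t"
  shows "(\<integral>\<omega>. (norm (elementary_integral w \<tau> N e t \<omega> - elementary_integral w \<tau>' N' e' t \<omega>))\<^sup>2 \<partial>M)
    = (\<integral>(s, \<omega>). (norm (elementary_process \<tau> N e s \<omega> - elementary_process \<tau>' N' e' s \<omega>))\<^sup>2 \<partial>time_prob t)"
proof -
  have expand: "(\<integral>x. (norm (f x - g x))\<^sup>2 \<partial>R) = (\<integral>x. f x \<bullet> f x \<partial>R) - 2 * (\<integral>x. f x \<bullet> g x \<partial>R) + (\<integral>x. g x \<bullet> g x \<partial>R)"
    if "square_integrable R f" "square_integrable R g" for R :: "'x measure" and f g :: "'x \<Rightarrow> 'a"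
  proof -
    note i = integrable_inner_square_integrable[OF that(1) that(1)]
      integrable_inner_square_integrable[OF that(1) that(2)] integrable_inner_square_integrable[OF that(2) that(2)]
    have "(norm (f x - g x))\<^sup>2 = f x \<bullet> f x - 2 * (f x \<bullet> g x) + g x \<bullet> g x" for x
      by (simp add: power2_norm_eq_inner inner_diff inner_commute)
    then show ?thesis using i by simp
  qed
  note s = elementary_integral_adapted[OF el t] elementary_integral_adapted[OF el' t]
  have s': "square_integrable M (elementary_integral w \<tau> N e t)"
    "square_integrable M (elementary_integral w \<tau>' N' e' t)"
    using s by (auto simp: adapted_l2_def)
  note p = elementary_process_square_integrable[OF el, of t] elementary_process_square_integrable[OF el', of t]
  have "(\<integral>\<omega>. (norm (elementary_integral w \<tau> N e t \<omega> - elementary_integral w \<tau>' N' e' t \<omega>))\<^sup>2 \<partial>M)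
    = (\<integral>p. (norm ((\<lambda>(s, \<omega>). elementary_process \<tau> N e s \<omega>) p - (\<lambda>(s, \<omega>). elementary_process \<tau>' N' e' s \<omega>) p))\<^sup>2 \<partial>time_prob t)"
    unfolding expand[OF s'] expand[OF p] elementary_isometry[OF el el t] elementary_isometry[OF el el' t]
        elementary_isometry[OF el' el' t] by (simp only: case_prod_beta')
  then show ?thesis by (simp add: case_prod_beta')
qed

end

section \<open>Moment identities for solutions of the Ito equation\<close>

lemma norm_diff_squares: "(norm (a - c))\<^sup>2 \<le> 2 * (norm (a - b))\<^sup>2 + 2 * (norm (b - c))\<^sup>2"
  for a b c :: "'a::real_inner"
  using norm_add_squares[of "a - b" "b - c"] by simp

lemma square_integral_triangle:
  assumes "square_integrable R a" "square_integrable R b" "square_integrable R c"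
  shows "(\<integral>x. (norm (a x - c x))\<^sup>2 \<partial>R)
    \<le> 2 * (\<integral>x. (norm (a x - b x))\<^sup>2 \<partial>R) + 2 * (\<integral>x. (norm (b x - c x))\<^sup>2 \<partial>R)"
proof -
  note i = square_integrableD(2)[OF square_integrable_diff[OF assms(1,2)]]
    square_integrableD(2)[OF square_integrable_diff[OF assms(2,3)]]
    square_integrableD(2)[OF square_integrable_diff[OF assms(1,3)]]
  have "(\<integral>x. (norm (a x - c x))\<^sup>2 \<partial>R) \<le> (\<integral>x. 2 * (norm (a x - b x))\<^sup>2 + 2 * (norm (b x - c x))\<^sup>2 \<partial>R)"
    using i norm_diff_squares by (intro integral_mono) auto
  also have "\<dots> = 2 * (\<integral>x. (norm (a x - b x))\<^sup>2 \<partial>R) + 2 * (\<integral>x. (norm (b x - c x))\<^sup>2 \<partial>R)"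
    using i by simp
  finally show ?thesis .
qed

section \<open>From elementary integrals to the Ito integral\<close>

context wiener_space
begin

text \<open>Compares the norm on the product space over \<open>{0<..t}\<close> with the iterated
  integral over \<open>{0..t}\<close> used in the definitions; an upper bound is all that the limits
  below require.\<close>

lemma time_prob_nn_integral:
  fixes f :: "real \<Rightarrow> 'w \<Rightarrow> 'b::euclidean_space"
  assumes [measurable]: "(\<lambda>(s, \<omega>). f s \<omega>) \<in> borel_measurable (time_prob t)"
  shows "(\<integral>\<^sup>+p. ennreal ((norm ((\<lambda>(s, \<omega>). f s \<omega>) p))\<^sup>2) \<partial>time_prob t)
    \<le> (\<integral>\<^sup>+s\<in>{0..t}. (\<integral>\<^sup>+\<omega>. ennreal ((norm (f s \<omega>))\<^sup>2) \<partial>M) \<partial>lborel)"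
proof -
  have "(\<integral>\<^sup>+p. ennreal ((norm ((\<lambda>(s, \<omega>). f s \<omega>) p))\<^sup>2) \<partial>time_prob t)
    = (\<integral>\<^sup>+s. (\<integral>\<^sup>+\<omega>. ennreal ((norm (f s \<omega>))\<^sup>2) \<partial>M) \<partial>upto_measure t)"
    by (subst nn_integral_fst[symmetric]) auto
  also have "\<dots> = (\<integral>\<^sup>+s. (\<integral>\<^sup>+\<omega>. ennreal ((norm (f s \<omega>))\<^sup>2) \<partial>M) * indicator {0<..t} s \<partial>lborel)"
    by (rule nn_integral_restrict_space) auto
  also have "\<dots> \<le> (\<integral>\<^sup>+s\<in>{0..t}. (\<integral>\<^sup>+\<omega>. ennreal ((norm (f s \<omega>))\<^sup>2) \<partial>M) \<partial>lborel)"
    by (intro nn_integral_mono) (auto simp: indicator_def)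
  finally show ?thesis .
qed

lemma jointly_measurable_time_prob:
  assumes "jointly_measurable M f"
  shows "(\<lambda>(s, \<omega>). f s \<omega>) \<in> borel_measurable (time_prob t)"
proof -
  have "(\<lambda>s. s) \<in> upto_measure t \<rightarrow>\<^sub>M restrict_space borel {0..}"
    by (rule measurable_restrict_space2)
      (auto simp: space_restrict_space intro!: measurable_restrict_space1)
  then have "(\<lambda>p. (fst p, snd p)) \<in> time_prob t \<rightarrow>\<^sub>M restrict_space borel {0..} \<Otimes>\<^sub>M M"
    by (intro measurable_Pair measurable_compose[OF measurable_fst] measurable_snd)
  from measurable_compose[OF this] assms show ?thesis
    unfolding jointly_measurable_def by (simp add: case_prod_beta')
qed

lemma has_ito_approx:
  assumes "has_ito_integral M F w f t J" "0 \<le> t"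
  obtains \<tau> N e where "\<And>j. elementary M F (\<tau> j) (N j) (e j)"
    "l2_tendsto (time_prob t) (\<lambda>j (s, \<omega>). elementary_process (\<tau> j) (N j) (e j) s \<omega>) (\<lambda>(s, \<omega>). f s \<omega>)"
    "l2_tendsto M (\<lambda>j. elementary_integral w (\<tau> j) (N j) (e j) t) J"
proof -
  from assms(1) obtain \<tau> N e where el: "\<And>j. elementary M F (\<tau> j) (N j) (e j)"
    and f: "jointly_measurable M f" and J: "J \<in> borel_measurable M"
    and lf: "(\<lambda>j. \<integral>\<^sup>+s\<in>{0..t}. (\<integral>\<^sup>+\<omega>. ennreal ((norm (f s \<omega> - elementary_process (\<tau> j) (N j) (e j) s \<omega>))\<^sup>2) \<partial>M)
           \<partial>lborel) \<longlonglongrightarrow> 0"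
    and lJ: "(\<lambda>j. \<integral>\<^sup>+\<omega>. ennreal ((norm (J \<omega> - elementary_integral w (\<tau> j) (N j) (e j) t \<omega>))\<^sup>2) \<partial>M)
           \<longlonglongrightarrow> 0"
    unfolding has_ito_integral_def by blast
  have "l2_tendsto M (\<lambda>j. elementary_integral w (\<tau> j) (N j) (e j) t) J"
    using elementary_integral_adapted[OF el assms(2)] unfolding adapted_l2_def
    by (intro l2_tendstoI_nn[OF _ J lJ]) auto
  moreover have "l2_tendsto (time_prob t) (\<lambda>j (s, \<omega>). elementary_process (\<tau> j) (N j) (e j) s \<omega>) (\<lambda>(s, \<omega>). f s \<omega>)"
  proof (rule l2_tendstoI_nn[OF elementary_process_square_integrable[OF el] jointly_measurable_time_prob[OF f]])
    have m: "(\<lambda>(s, \<omega>). f s \<omega> - elementary_process (\<tau> j) (N j) (e j) s \<omega>) \<in> borel_measurable (time_prob t)" for j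
      using borel_measurable_diff[OF jointly_measurable_time_prob[OF f]
          square_integrableD(1)[OF elementary_process_square_integrable[OF el]]]
      by (simp add: case_prod_beta')
    show "(\<lambda>j. \<integral>\<^sup>+p. ennreal ((norm ((\<lambda>(s, \<omega>). f s \<omega>) p
         - (\<lambda>(s, \<omega>). elementary_process (\<tau> j) (N j) (e j) s \<omega>) p))\<^sup>2) \<partial>time_prob t) \<longlonglongrightarrow> 0"
      by (rule tendsto_sandwich[OF _ _ tendsto_const lf])
        (use time_prob_nn_integral[OF m] in \<open>auto intro!: always_eventually simp: case_prod_beta'\<close>)
  qed
  ultimately show ?thesis using that el by blast
qed

lemma has_ito_square_integrable:
  assumes "has_ito_integral M F w f t J" "0 \<le> t"
  shows "square_integrable M J" "square_integrable (time_prob t) (\<lambda>(s, \<omega>). f s \<omega>)"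
proof -
  obtain \<tau> N e where "\<And>j. elementary M F (\<tau> j) (N j) (e j)"
    and l: "l2_tendsto (time_prob t) (\<lambda>j (s, \<omega>). elementary_process (\<tau> j) (N j) (e j) s \<omega>) (\<lambda>(s, \<omega>). f s \<omega>)"
    "l2_tendsto M (\<lambda>j. elementary_integral w (\<tau> j) (N j) (e j) t) J"
    by (rule has_ito_approx[OF assms], rule that)
  show "square_integrable M J" "square_integrable (time_prob t) (\<lambda>(s, \<omega>). f s \<omega>)"
    by (rule l2_tendstoD(2)[OF l(2)], rule l2_tendstoD(2)[OF l(1)])
qed

text \<open>Elementary integrals vanish at time 0, so the martingale property makes their products
  with a variable known at time 0 have mean zero; this survives the mean square limit.\<close>

lemma has_ito_orthogonal_init:
  assumes J: "has_ito_integral M F w f t J" and t: "0 \<le> t" and xi: "adapted_l2 0 \<xi>"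
  shows "(\<integral>\<omega>. \<xi> \<omega> \<bullet> J \<omega> \<partial>M) = 0"
proof -
  obtain \<tau> N e where el: "\<And>j. elementary M F (\<tau> j) (N j) (e j)"
    and lim: "l2_tendsto M (\<lambda>j. elementary_integral w (\<tau> j) (N j) (e j) t) J"
    by (rule has_ito_approx[OF J t], rule that)
  have "(\<integral>\<omega>. \<xi> \<omega> \<bullet> elementary_integral w (\<tau> j) (N j) (e j) t \<omega> \<partial>M) = 0" for j
  proof -
    have "elementary_integral w (\<tau> j) (N j) (e j) 0 \<omega> = 0" for \<omega>
      unfolding elementary_integral_cell_end[OF el]
      using elementaryD(1,2)[OF el] by (intro sum.neutral) (force simp: cell_end_def)
    then show ?thesis using elementary_integral_orthogonal[OF el order_refl t xi, of j] by simp
  qed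
  moreover have "square_integrable M \<xi>" using xi by (simp add: adapted_l2_def)
  ultimately have "(\<lambda>j. 0) \<longlonglongrightarrow> (\<integral>\<omega>. \<xi> \<omega> \<bullet> J \<omega> \<partial>M)"
    using l2_tendsto_inner[OF l2_tendsto_const lim, of \<xi>] by simp
  then show ?thesis by (simp add: LIMSEQ_const_iff)
qed

text \<open>The two Ito integrals may have been obtained from different approximating sequences; the
  isometry shows that the sequence for time \<open>t\<close> can be used at time \<open>s\<close> as well.\<close>

lemma has_ito_orthogonal:
  assumes J: "has_ito_integral M F w f t J" and J': "has_ito_integral M F w f s J'"
    and st: "0 \<le> s" "s \<le> t" and xi: "adapted_l2 s \<xi>"
  shows "(\<integral>\<omega>. \<xi> \<omega> \<bullet> J \<omega> \<partial>M) = (\<integral>\<omega>. \<xi> \<omega> \<bullet> J' \<omega> \<partial>M)"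
proof -
  have t: "0 \<le> t" using st by simp
  obtain \<tau> N e where el: "\<And>j. elementary M F (\<tau> j) (N j) (e j)"
    and lf: "l2_tendsto (time_prob t) (\<lambda>j (s, \<omega>). elementary_process (\<tau> j) (N j) (e j) s \<omega>) (\<lambda>(s, \<omega>). f s \<omega>)"
    and lim: "l2_tendsto M (\<lambda>j. elementary_integral w (\<tau> j) (N j) (e j) t) J"
    by (rule has_ito_approx[OF J t], rule that)
  obtain \<tau>' N' e' where el': "\<And>j. elementary M F (\<tau>' j) (N' j) (e' j)"
    and lf': "l2_tendsto (time_prob s) (\<lambda>j (s, \<omega>). elementary_process (\<tau>' j) (N' j) (e' j) s \<omega>) (\<lambda>(s, \<omega>). f s \<omega>)"
    and lim': "l2_tendsto M (\<lambda>j. elementary_integral w (\<tau>' j) (N' j) (e' j) s) J'"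
    by (rule has_ito_approx[OF J' st(1)], rule that)
  let ?P = "\<lambda>j p. (\<lambda>(s, \<omega>). elementary_process (\<tau> j) (N j) (e j) s \<omega>) p"
  let ?P' = "\<lambda>j p. (\<lambda>(s, \<omega>). elementary_process (\<tau>' j) (N' j) (e' j) s \<omega>) p"
  let ?f = "\<lambda>p. (\<lambda>(s, \<omega>). f s \<omega>) p"
  let ?I = "\<lambda>j. elementary_integral w (\<tau> j) (N j) (e j) s"
  let ?I' = "\<lambda>j. elementary_integral w (\<tau>' j) (N' j) (e' j) s"
  have sI: "square_integrable M (?I j)" "square_integrable M (?I' j)" for j
    using elementary_integral_adapted[OF el st(1)] elementary_integral_adapted[OF el' st(1)]
    by (auto simp: adapted_l2_def)
  have sJ: "square_integrable M J'" by (rule l2_tendstoD(2)[OF lim'])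
  note sP = elementary_process_square_integrable[OF el] elementary_process_square_integrable[OF el']
  note sf = l2_tendstoD(2)[OF lf] l2_tendstoD(2)[OF lf']
  \<comment> \<open>The approximation chosen for the longer interval approximates the integrand at
    least as well on the shorter one.\<close>
  have mono: "(\<integral>p. (norm (?P j p - ?f p))\<^sup>2 \<partial>time_prob s) \<le> (\<integral>p. (norm (?P j p - ?f p))\<^sup>2 \<partial>time_prob t)" for j
  proof -
    let ?h = "\<lambda>p. (norm (?P j p - ?f p))\<^sup>2"
    have it: "integrable (time_prob r) ?h" if "r = s \<or> r = t" for r
      using square_integrable_diff[OF sP(1) sf(1), of j] square_integrable_diff[OF sP(1) sf(2), of j] that
      by (auto simp: square_integrable_def)
    interpret t: pair_sigma_finite "upto_measure t" M by (rule pair_sigma_finite_time)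
    interpret s: pair_sigma_finite "upto_measure s" M by (rule pair_sigma_finite_time)
    let ?g = "\<lambda>r. \<integral>\<omega>. ?h (r, \<omega>) \<partial>M"
    have i: "integrable (upto_measure t) ?g" using t.integrable_fst'[OF it] by simp
    have "integral\<^sup>L (time_prob s) ?h = (\<integral>r. ?g r \<partial>upto_measure s)"
      using s.integral_fst'[OF it] by simp
    also have "\<dots> = (\<integral>r. indicator {0<..s} r *\<^sub>R ?g r \<partial>upto_measure t)"
      by (rule upto_integral_indicator[OF st(2)])
    also have "\<dots> \<le> (\<integral>r. ?g r \<partial>upto_measure t)"
    proof (rule integral_mono)
      show "integrable (upto_measure t) (\<lambda>r. indicator {0<..s} r *\<^sub>R ?g r)"
        by (rule integrable_mult_indicator[OF _ i]) (use st in \<open>auto simp: sets_restrict_space_iff\<close>)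
    qed (use i in \<open>auto simp: indicator_def\<close>)
    also have "\<dots> = integral\<^sup>L (time_prob t) ?h" using t.integral_fst'[OF it] by simp
    finally show ?thesis .
  qed
  have bound: "(\<integral>\<omega>. (norm (?I j \<omega> - J' \<omega>))\<^sup>2 \<partial>M)
     \<le> 4 * (\<integral>p. (norm (?P j p - ?f p))\<^sup>2 \<partial>time_prob t) + 4 * (\<integral>p. (norm (?P' j p - ?f p))\<^sup>2 \<partial>time_prob s)
        + 2 * (\<integral>\<omega>. (norm (?I' j \<omega> - J' \<omega>))\<^sup>2 \<partial>M)" for j
  proof -
    have "(\<integral>\<omega>. (norm (?I j \<omega> - ?I' j \<omega>))\<^sup>2 \<partial>M) = (\<integral>p. (norm (?P j p - ?P' j p))\<^sup>2 \<partial>time_prob s)"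
      unfolding elementary_isometry_diff[OF el el' st(1)] by (simp only: case_prod_beta')
    also have "\<dots> \<le> 2 * (\<integral>p. (norm (?P j p - ?f p))\<^sup>2 \<partial>time_prob s) + 2 * (\<integral>p. (norm (?P' j p - ?f p))\<^sup>2 \<partial>time_prob s)"
      unfolding norm_minus_commute[of "?P' j _" "?f _"] by (rule square_integral_triangle[OF sP(1) sf(2) sP(2)])
    finally have "(\<integral>\<omega>. (norm (?I j \<omega> - ?I' j \<omega>))\<^sup>2 \<partial>M)
      \<le> 2 * (\<integral>p. (norm (?P j p - ?f p))\<^sup>2 \<partial>time_prob t) + 2 * (\<integral>p. (norm (?P' j p - ?f p))\<^sup>2 \<partial>time_prob s)"
      using mono[of j] by linarith
    with square_integral_triangle[OF sI(1) sI(2) sJ, of j j] show ?thesis by linarith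
  qed
  \<comment> \<open>The isometry at time \<open>s\<close> bounds the distance between the two
    approximating integrals by the distances of their integrands to \<open>f\<close>, so both
    sequences have the limit \<open>J'\<close>.\<close>
  have limI: "l2_tendsto M ?I J'"
  proof (rule l2_tendstoI_bound[OF sI(1) sJ bound])
    have "(\<lambda>j. 4 * (\<integral>p. (norm (?P j p - ?f p))\<^sup>2 \<partial>time_prob t) + 4 * (\<integral>p. (norm (?P' j p - ?f p))\<^sup>2 \<partial>time_prob s)
        + 2 * (\<integral>\<omega>. (norm (?I' j \<omega> - J' \<omega>))\<^sup>2 \<partial>M)) \<longlonglongrightarrow> 4 * 0 + 4 * 0 + 2 * 0"
      by (intro tendsto_intros l2_tendstoD(3)[OF lf] l2_tendstoD(3)[OF lf'] l2_tendstoD(3)[OF lim'])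
    then show "(\<lambda>j. 4 * (\<integral>p. (norm (?P j p - ?f p))\<^sup>2 \<partial>time_prob t) + 4 * (\<integral>p. (norm (?P' j p - ?f p))\<^sup>2 \<partial>time_prob s)
        + 2 * (\<integral>\<omega>. (norm (?I' j \<omega> - J' \<omega>))\<^sup>2 \<partial>M)) \<longlonglongrightarrow> 0" by simp
  qed
  have sx: "square_integrable M \<xi>" using xi by (simp add: adapted_l2_def)
  have "(\<lambda>j. \<integral>\<omega>. \<xi> \<omega> \<bullet> ?I j \<omega> \<partial>M) \<longlonglongrightarrow> (\<integral>\<omega>. \<xi> \<omega> \<bullet> J' \<omega> \<partial>M)"
    by (rule l2_tendsto_inner[OF l2_tendsto_const[OF sx] limI])
  moreover have "(\<lambda>j. \<integral>\<omega>. \<xi> \<omega> \<bullet> ?I j \<omega> \<partial>M) \<longlonglongrightarrow> (\<integral>\<omega>. \<xi> \<omega> \<bullet> J \<omega> \<partial>M)"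
    using l2_tendsto_inner[OF l2_tendsto_const[OF sx] lim] elementary_integral_orthogonal[OF el st xi]
    by simp
  ultimately show ?thesis by (rule LIMSEQ_unique[rotated])
qed

lemma elementary_mult_vec:
  fixes H :: "real^'n^'k"
  assumes "elementary M F \<tau> N e"
  shows "elementary M F \<tau> N (\<lambda>k \<omega>. H *v e k \<omega>)"
    and "elementary_integral w \<tau> N (\<lambda>k \<omega>. H *v e k \<omega>) t \<omega> = H *v elementary_integral w \<tau> N e t \<omega>"
    and "elementary_process \<tau> N (\<lambda>k \<omega>. H *v e k \<omega>) t \<omega> = H *v elementary_process \<tau> N e t \<omega>"
proof -
  show "elementary M F \<tau> N (\<lambda>k \<omega>. H *v e k \<omega>)"
    using assms adapted_l2_mult_vec[of _ _ H] unfolding elementary_def adapted_l2_def by blast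
  show "elementary_integral w \<tau> N (\<lambda>k \<omega>. H *v e k \<omega>) t \<omega> = H *v elementary_integral w \<tau> N e t \<omega>"
    "elementary_process \<tau> N (\<lambda>k \<omega>. H *v e k \<omega>) t \<omega> = H *v elementary_process \<tau> N e t \<omega>"
    unfolding elementary_integral_def elementary_process_def
    by (simp_all add: linear_sum[OF matrix_vector_mul_linear] matrix_vector_mult_scaleR)
qed

lemma has_ito_isometry:
  fixes H :: "real^'n^'k"
  assumes J: "has_ito_integral M F w f t J" and J': "has_ito_integral M F w f' t J'" and t: "0 \<le> t"
  shows "(\<integral>\<omega>. J \<omega> \<bullet> (H *v J' \<omega>) \<partial>M) = (\<integral>(s, \<omega>). f s \<omega> \<bullet> (H *v f' s \<omega>) \<partial>time_prob t)"
proof -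
  obtain \<tau> N e where el: "\<And>j. elementary M F (\<tau> j) (N j) (e j)"
    and lf: "l2_tendsto (time_prob t) (\<lambda>j (s, \<omega>). elementary_process (\<tau> j) (N j) (e j) s \<omega>) (\<lambda>(s, \<omega>). f s \<omega>)"
    and lim: "l2_tendsto M (\<lambda>j. elementary_integral w (\<tau> j) (N j) (e j) t) J"
    by (rule has_ito_approx[OF J t], rule that)
  obtain \<tau>' N' e' where el': "\<And>j. elementary M F (\<tau>' j) (N' j) (e' j)"
    and lf': "l2_tendsto (time_prob t) (\<lambda>j (s, \<omega>). elementary_process (\<tau>' j) (N' j) (e' j) s \<omega>) (\<lambda>(s, \<omega>). f' s \<omega>)"
    and lim': "l2_tendsto M (\<lambda>j. elementary_integral w (\<tau>' j) (N' j) (e' j) t) J'"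
    by (rule has_ito_approx[OF J' t], rule that)
  note iso = elementary_isometry[OF el elementary_mult_vec(1)[OF el'] t, of _ _ H,
      unfolded elementary_mult_vec(2)[OF el'] elementary_mult_vec(3)[OF el'] case_prod_beta']
  have "(\<lambda>j. \<integral>\<omega>. elementary_integral w (\<tau> j) (N j) (e j) t \<omega>
      \<bullet> (H *v elementary_integral w (\<tau>' j) (N' j) (e' j) t \<omega>) \<partial>M) \<longlonglongrightarrow> (\<integral>\<omega>. J \<omega> \<bullet> (H *v J' \<omega>) \<partial>M)"
    by (rule l2_tendsto_inner[OF lim l2_tendsto_mult_vec[OF lim']])
  moreover have "(\<lambda>j. \<integral>\<omega>. elementary_integral w (\<tau> j) (N j) (e j) t \<omega>
      \<bullet> (H *v elementary_integral w (\<tau>' j) (N' j) (e' j) t \<omega>) \<partial>M)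
      \<longlonglongrightarrow> (\<integral>(s, \<omega>). f s \<omega> \<bullet> (H *v f' s \<omega>) \<partial>time_prob t)"
    using l2_tendsto_inner[OF lf l2_tendsto_mult_vec[OF lf', of H]] iso
    by (simp add: case_prod_beta')
  ultimately show ?thesis by (rule LIMSEQ_unique)
qed

lemma has_ito_cong_AE:
  assumes "has_ito_integral M F w f t J" "J' \<in> borel_measurable M" "AE \<omega> in M. J \<omega> = J' \<omega>"
  shows "has_ito_integral M F w f t J'"
proof -
  have "(\<integral>\<^sup>+\<omega>. ennreal ((norm (J \<omega> - g \<omega>))\<^sup>2) \<partial>M) = (\<integral>\<^sup>+\<omega>. ennreal ((norm (J' \<omega> - g \<omega>))\<^sup>2) \<partial>M)" for g
    using assms(3) by (intro nn_integral_cong_AE) (auto elim!: AE_mp)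
  then show ?thesis using assms(1,2) unfolding has_ito_integral_def by simp
qed

end

lemma upto_measure_measure: "0 \<le> t \<Longrightarrow> measure (upto_measure t) (space (upto_measure t)) = t"
  by (simp add: space_restrict_space measure_restrict_space)

lemma norm_integral_upto_square:
  assumes "0 \<le> t" "square_integrable (upto_measure t) f"
  shows "(norm (\<integral>s. f s \<partial>upto_measure t))\<^sup>2 \<le> t * (\<integral>s. (norm (f s))\<^sup>2 \<partial>upto_measure t)"
proof -
  have one: "square_integrable (upto_measure t) (\<lambda>s. 1 :: real)"
    by (rule square_integrable_const) simp
  have "norm (\<integral>s. f s \<partial>upto_measure t) \<le> (\<integral>s. norm (f s) \<partial>upto_measure t)"
    by (rule integral_norm_bound)
  then have "(norm (\<integral>s. f s \<partial>upto_measure t))\<^sup>2 \<le> (\<integral>s. norm (f s) \<partial>upto_measure t)\<^sup>2"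
    by (intro power_mono) auto
  also have "\<dots> \<le> (\<integral>s. (norm (f s))\<^sup>2 \<partial>upto_measure t) * t"
    using Cauchy_Schwarz_integral[OF assms(2) one] assms(1) upto_measure_measure[OF assms(1)] by simp
  finally show ?thesis by (simp add: mult.commute)
qed

section \<open>Time integrals of processes on the product space\<close>

context wiener_space
begin

lemma square_integrable_fst:
  fixes f :: "real \<Rightarrow> 'b::euclidean_space"
  assumes "square_integrable (upto_measure t) f"
  shows "square_integrable (time_prob t) (\<lambda>(s, \<omega>). f s)"
proof -
  have "integrable (time_prob t) (\<lambda>(s, \<omega>). (norm (f s))\<^sup>2 * 1)"
    by (rule pair_product_integrable(1)) (use assms in \<open>auto simp: square_integrable_def sigma_finite_measure_axioms\<close>)
  then show ?thesis using assms unfolding square_integrable_def case_prod_beta'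
    by (auto intro!: measurable_compose[OF measurable_fst])
qed

lemma square_integrable_snd:
  fixes f :: "'w \<Rightarrow> 'b::euclidean_space"
  assumes "square_integrable M f"
  shows "square_integrable (time_prob t) (\<lambda>(s, \<omega>). f \<omega>)"
proof -
  have "integrable (time_prob t) (\<lambda>(s, \<omega>). 1 * (norm (f \<omega>))\<^sup>2)"
    by (rule pair_product_integrable(1))
      (use assms in \<open>auto simp: square_integrable_def sigma_finite_measure_axioms finite_measure.integrable_const\<close>)
  then show ?thesis using assms unfolding square_integrable_def case_prod_beta'
    by (auto intro!: measurable_compose[OF measurable_snd])
qed

lemma finite_measure_time_prob: "finite_measure (time_prob t)"
  by (rule finite_measure_pair_measure) (auto simp: finite_measure_axioms)

lemma AE_section_square_integrable:
  fixes y :: "real \<Rightarrow> 'w \<Rightarrow> 'b::euclidean_space"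
  assumes y: "square_integrable (time_prob t) (\<lambda>(s, \<omega>). y s \<omega>)"
  shows "AE \<omega> in M. square_integrable (upto_measure t) (\<lambda>s. y s \<omega>)"
    and "integrable M (\<lambda>\<omega>. \<integral>s. (norm (y s \<omega>))\<^sup>2 \<partial>upto_measure t)"
proof -
  interpret t: pair_sigma_finite "upto_measure t" M by (rule pair_sigma_finite_time)
  have i: "integrable (time_prob t) (\<lambda>(s, \<omega>). (norm (y s \<omega>))\<^sup>2)"
    using y by (simp add: square_integrable_def case_prod_beta')
  have m: "(\<lambda>s. y s \<omega>) \<in> borel_measurable (upto_measure t)" if "\<omega> \<in> space M" for \<omega>
    using measurable_Pair1[OF square_integrableD(1)[OF y] that] by simp
  show "AE \<omega> in M. square_integrable (upto_measure t) (\<lambda>s. y s \<omega>)"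
    using t.AE_integrable_snd[OF i] AE_space
    by eventually_elim (auto simp: square_integrable_def m)
  show "integrable M (\<lambda>\<omega>. \<integral>s. (norm (y s \<omega>))\<^sup>2 \<partial>upto_measure t)"
    using t.integrable_snd[OF i] by simp
qed

text \<open>Cauchy-Schwarz along each path bounds the squared integral up to any
  \<open>s \<le> t\<close> by \<open>Z\<close>, which does not depend on \<open>s\<close> and is
  integrable by Fubini.\<close>

lemma square_integrable_time_integral:
  fixes y :: "real \<Rightarrow> 'w \<Rightarrow> 'b::euclidean_space"
  assumes t: "0 \<le> t" and y: "square_integrable (time_prob t) (\<lambda>(s, \<omega>). y s \<omega>)"
  shows "square_integrable M (\<lambda>\<omega>. \<integral>s. y s \<omega> \<partial>upto_measure t)"
    and "square_integrable (time_prob t) (\<lambda>(s, \<omega>). \<integral>r. y r \<omega> \<partial>upto_measure s)"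
proof -
  interpret t: pair_sigma_finite "upto_measure t" M by (rule pair_sigma_finite_time)
  have ym[measurable]: "(\<lambda>p. y (fst p) (snd p)) \<in> borel_measurable (time_prob t)"
    using square_integrableD(1)[OF y] by (simp add: case_prod_beta')
  define Z where "Z \<omega> = t * (\<integral>s. (norm (y s \<omega>))\<^sup>2 \<partial>upto_measure t)" for \<omega>
  have Z: "integrable M Z" unfolding Z_def using AE_section_square_integrable(2)[OF y] by simp
  have le: "(norm (\<integral>r. y r \<omega> \<partial>upto_measure s))\<^sup>2 \<le> Z \<omega>"
    if sq: "square_integrable (upto_measure t) (\<lambda>s. y s \<omega>)" and s: "0 \<le> s" "s \<le> t" for s \<omega>
  proof -
    have sq': "square_integrable (upto_measure s) (\<lambda>s. y s \<omega>)"
    proof -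
      have "(\<lambda>s. y s \<omega>) \<in> borel_measurable (upto_measure s)"
        using integrable_upto_mono[OF integrable_of_square_integrable[OF finite_measure_upto sq] s(2)] by auto
      then show ?thesis using integrable_upto_mono[OF square_integrableD(2)[OF sq] s(2)]
        by (simp add: square_integrable_def)
    qed
    have "(norm (\<integral>r. y r \<omega> \<partial>upto_measure s))\<^sup>2 \<le> s * (\<integral>r. (norm (y r \<omega>))\<^sup>2 \<partial>upto_measure s)"
      by (rule norm_integral_upto_square[OF s(1) sq'])
    also have "\<dots> \<le> t * (\<integral>s. (norm (y s \<omega>))\<^sup>2 \<partial>upto_measure t)"
    proof (rule mult_mono[OF s(2) _ t])
      have "(\<integral>r. (norm (y r \<omega>))\<^sup>2 \<partial>upto_measure s) = (\<integral>r. indicator {0<..s} r *\<^sub>R (norm (y r \<omega>))\<^sup>2 \<partial>upto_measure t)"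
        by (rule upto_integral_indicator[OF s(2)])
      also have "\<dots> \<le> (\<integral>s. (norm (y s \<omega>))\<^sup>2 \<partial>upto_measure t)"
      proof (rule integral_mono)
        show "integrable (upto_measure t) (\<lambda>r. indicator {0<..s} r *\<^sub>R (norm (y r \<omega>))\<^sup>2)"
          by (rule integrable_mult_indicator[OF _ square_integrableD(2)[OF sq]])
            (use s in \<open>auto simp: sets_restrict_space_iff\<close>)
      qed (use square_integrableD(2)[OF sq] in \<open>auto simp: indicator_def\<close>)
      finally show "(\<integral>r. (norm (y r \<omega>))\<^sup>2 \<partial>upto_measure s) \<le> (\<integral>s. (norm (y s \<omega>))\<^sup>2 \<partial>upto_measure t)" .
    qed auto
    finally show ?thesis by (simp add: Z_def)
  qed
  have m1: "(\<lambda>\<omega>. \<integral>s. y s \<omega> \<partial>upto_measure t) \<in> borel_measurable M"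
    by (rule t.M1.borel_measurable_lebesgue_integral)
      (use measurable_compose[OF measurable_pair_swap' ym] in \<open>simp add: case_prod_beta'\<close>)
  show "square_integrable M (\<lambda>\<omega>. \<integral>s. y s \<omega> \<partial>upto_measure t)"
    using AE_section_square_integrable(1)[OF y]
    by (intro square_integrable_bound[OF m1 Z]) (auto elim!: AE_mp intro: le[OF _ t order_refl])
  have m2: "(\<lambda>(s, \<omega>). \<integral>r. y r \<omega> \<partial>upto_measure s) \<in> borel_measurable (time_prob t)"
  proof -
    have [measurable]: "(\<lambda>x. x) \<in> borel_measurable (upto_measure t)" by (rule measurable_restrict_space1) simp
    \<comment> \<open>Joint measurability: the variable upper limit is moved into the integrand, so
      that the measure of integration is fixed.\<close>
    have "(\<lambda>p. \<integral>r. (if r \<le> fst p then y r (snd p) else 0) \<partial>upto_measure t) \<in> borel_measurable (time_prob t)"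
    proof (rule t.M1.borel_measurable_lebesgue_integral)
      have [measurable]: "(\<lambda>x. y (snd x) (snd (fst x))) \<in> borel_measurable (time_prob t \<Otimes>\<^sub>M upto_measure t)"
        using measurable_compose[of "\<lambda>x. (snd x, snd (fst x))" "time_prob t \<Otimes>\<^sub>M upto_measure t" "time_prob t", OF _ ym]
        by simp
      show "(\<lambda>(p, r). if r \<le> fst p then y r (snd p) else 0) \<in> borel_measurable (time_prob t \<Otimes>\<^sub>M upto_measure t)"
        by (simp add: case_prod_beta')
    qed
    also have "?this \<longleftrightarrow> (\<lambda>(s, \<omega>). \<integral>r. y r \<omega> \<partial>upto_measure s) \<in> borel_measurable (time_prob t)"
    proof (rule measurable_cong)
      fix p assume "p \<in> space (time_prob t)"
      then have p: "fst p \<le> t" "0 < fst p" by (auto simp: space_pair_measure space_restrict_space)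
      have "(\<integral>r. (if r \<le> fst p then y r (snd p) else 0) \<partial>upto_measure t)
        = (\<integral>r. indicator {0<..fst p} r *\<^sub>R y r (snd p) \<partial>upto_measure t)"
        by (intro Bochner_Integration.integral_cong) (auto simp: space_restrict_space indicator_def)
      also have "\<dots> = (\<integral>r. y r (snd p) \<partial>upto_measure (fst p))"
        by (rule upto_integral_indicator[OF p(1), symmetric])
      finally show "(\<integral>r. (if r \<le> fst p then y r (snd p) else 0) \<partial>upto_measure t)
        = (\<lambda>(s, \<omega>). \<integral>r. y r \<omega> \<partial>upto_measure s) p" by (simp add: case_prod_beta')
    qed
    finally show ?thesis .
  qed
  have Z2: "integrable (time_prob t) (\<lambda>(s, \<omega>). 1 * Z \<omega>)"
    by (rule pair_product_integrable(1))
      (use Z in \<open>auto simp: sigma_finite_measure_axioms finite_measure.integrable_const\<close>)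
  define D where "D p = (\<lambda>(s, \<omega>). \<integral>r. y r \<omega> \<partial>upto_measure s) p" for p
  define R where "R p \<longleftrightarrow> (norm (D p))\<^sup>2 \<le> (\<lambda>(s, \<omega>). 1 * Z \<omega>) p" for p
  have R: "{p \<in> space (time_prob t). R p} \<in> sets (time_prob t)"
    unfolding R_def
    by (rule borel_measurable_le) (use m2 Z2 in \<open>simp_all add: D_def[abs_def]\<close>)
  \<comment> \<open>For almost every path the bound holds at all times. Exchanging the two
    quantifiers is legitimate because the set \<open>R\<close> is measurable, and gives the bound
    almost everywhere on the product.\<close>
  have "AE \<omega> in M. AE s in upto_measure t. R (s, \<omega>)"
    using AE_section_square_integrable(1)[OF y]
  proof eventually_elim
    case (elim \<omega>)
    show ?case by (rule AE_I2) (use le[OF elim] in \<open>auto simp: space_restrict_space R_def D_def\<close>)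
  qed
  then have "AE s in upto_measure t. AE \<omega> in M. R (s, \<omega>)"
    by (subst t.AE_commute) (use R in simp_all)
  then have "AE p in time_prob t. R p" by (intro t.AE_pair_measure[OF R])
  then have "AE p in time_prob t. (norm ((\<lambda>(s, \<omega>). \<integral>r. y r \<omega> \<partial>upto_measure s) p))\<^sup>2 \<le> (\<lambda>(s, \<omega>). 1 * Z \<omega>) p"
    unfolding R_def D_def .
  then show "square_integrable (time_prob t) (\<lambda>(s, \<omega>). \<integral>r. y r \<omega> \<partial>upto_measure s)"
    by (rule square_integrable_bound[OF m2 Z2])
qed

lemma time_prob_inner:
  fixes f g :: "real \<Rightarrow> 'w \<Rightarrow> 'b::euclidean_space"
  assumes f: "square_integrable (time_prob t) (\<lambda>(s, \<omega>). f s \<omega>)"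
    and g: "square_integrable (time_prob t) (\<lambda>(s, \<omega>). g s \<omega>)"
  shows "integrable (time_prob t) (\<lambda>(s, \<omega>). f s \<omega> \<bullet> g s \<omega>)"
    and "integrable (upto_measure t) (\<lambda>s. \<integral>\<omega>. f s \<omega> \<bullet> g s \<omega> \<partial>M)"
    and "(\<integral>(s, \<omega>). f s \<omega> \<bullet> g s \<omega> \<partial>time_prob t) = (\<integral>s. (\<integral>\<omega>. f s \<omega> \<bullet> g s \<omega> \<partial>M) \<partial>upto_measure t)"
    and "(\<integral>(s, \<omega>). f s \<omega> \<bullet> g s \<omega> \<partial>time_prob t) = (\<integral>\<omega>. (\<integral>s. f s \<omega> \<bullet> g s \<omega> \<partial>upto_measure t) \<partial>M)"
proof -
  interpret t: pair_sigma_finite "upto_measure t" M by (rule pair_sigma_finite_time)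
  show *: "integrable (time_prob t) (\<lambda>(s, \<omega>). f s \<omega> \<bullet> g s \<omega>)"
    using integrable_inner_square_integrable[OF f g] by (simp add: case_prod_beta')
  show "integrable (upto_measure t) (\<lambda>s. \<integral>\<omega>. f s \<omega> \<bullet> g s \<omega> \<partial>M)"
    using t.integrable_fst'[OF *] by simp
  show "(\<integral>(s, \<omega>). f s \<omega> \<bullet> g s \<omega> \<partial>time_prob t) = (\<integral>s. (\<integral>\<omega>. f s \<omega> \<bullet> g s \<omega> \<partial>M) \<partial>upto_measure t)"
    using t.integral_fst'[OF *] by simp
  show "(\<integral>(s, \<omega>). f s \<omega> \<bullet> g s \<omega> \<partial>time_prob t) = (\<integral>\<omega>. (\<integral>s. f s \<omega> \<bullet> g s \<omega> \<partial>upto_measure t) \<partial>M)"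
    using t.integral_snd[OF *] by simp
qed

end

section \<open>Mean and second moments of solutions\<close>

context wiener_space
begin

definition drift :: "real^'n^'n \<Rightarrow> real^'m^'n \<Rightarrow> (real \<Rightarrow> real^'m) \<Rightarrow> (real \<Rightarrow> 'w \<Rightarrow> real^'n) \<Rightarrow> real \<Rightarrow> 'w \<Rightarrow> real^'n"
  where "drift A b u x s \<omega> = A *v x s \<omega> + b *v u s"

definition drift_integral ::
  "real^'n^'n \<Rightarrow> real^'m^'n \<Rightarrow> (real \<Rightarrow> real^'m) \<Rightarrow> (real \<Rightarrow> 'w \<Rightarrow> real^'n) \<Rightarrow> real \<Rightarrow> 'w \<Rightarrow> real^'n"
  where "drift_integral A b u x t \<omega> = (\<integral>s. drift A b u x s \<omega> \<partial>upto_measure t)"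

text \<open>Defined as a residual, so that the decomposition of the state holds at every point; the
  Ito equation then says that this particular version is an Ito integral.\<close>

definition noise_part ::
  "real^'n^'n \<Rightarrow> real^'m^'n \<Rightarrow> ('w \<Rightarrow> real^'n) \<Rightarrow> (real \<Rightarrow> real^'m) \<Rightarrow> (real \<Rightarrow> 'w \<Rightarrow> real^'n) \<Rightarrow> real \<Rightarrow> 'w \<Rightarrow> real^'n"
  where "noise_part A b a u x t \<omega> = x t \<omega> - a \<omega> - drift_integral A b u x t \<omega>"

lemma ito_solution_square_integrable:
  assumes sol: "ito_solution M F w A b C a u x" and a: "adapted_l2 0 a"
    and u: "square_integrable halfline u" and t: "0 \<le> t"
  shows "square_integrable (time_prob t) (\<lambda>(s, \<omega>). x s \<omega>)"
    and "square_integrable (time_prob t) (\<lambda>(s, \<omega>). drift A b u x s \<omega>)"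
    and "square_integrable M (drift_integral A b u x t)"
    and "square_integrable (time_prob t) (\<lambda>(s, \<omega>). drift_integral A b u x s \<omega>)"
    and "has_ito_integral M F w (\<lambda>s \<omega>. C *v x s \<omega>) t (noise_part A b a u x t)"
    and "square_integrable M (noise_part A b a u x t)"
    and "adapted_l2 t (x t)"
proof -
  have jm: "(\<lambda>(s, \<omega>). x s \<omega>) \<in> borel_measurable (time_prob t)"
    using sol jointly_measurable_time_prob unfolding ito_solution_def by blast
  show x: "square_integrable (time_prob t) (\<lambda>(s, \<omega>). x s \<omega>)"
    unfolding square_integrable_iff_nn_integral[OF jm]
    using time_prob_nn_integral[OF jm] sol t unfolding ito_solution_def by (meson le_less_trans)
  have "square_integrable (time_prob t) (\<lambda>(s, \<omega>). b *v u s)"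
    by (rule square_integrable_fst) (use square_integrable_halfline_upto[OF u] in blast)
  from square_integrable_add[OF square_integrable_mult_vec[OF x, of A] this]
  show d: "square_integrable (time_prob t) (\<lambda>(s, \<omega>). drift A b u x s \<omega>)"
    by (simp add: drift_def case_prod_beta')
  show D: "square_integrable M (drift_integral A b u x t)"
    and "square_integrable (time_prob t) (\<lambda>(s, \<omega>). drift_integral A b u x s \<omega>)"
    using square_integrable_time_integral[OF t d] by (simp_all add: drift_integral_def[abs_def])
  obtain J where J: "has_ito_integral M F w (\<lambda>s \<omega>. C *v x s \<omega>) t J"
    and ae: "AE \<omega> in M. x t \<omega> = a \<omega> + (LINT s:{0<..t}|lborel. A *v x s \<omega> + b *v u s) + J \<omega>"
    using sol t unfolding ito_solution_def by blast
  have D_eq: "drift_integral A b u x t \<omega> = (LINT s:{0<..t}|lborel. A *v x s \<omega> + b *v u s)" for \<omega>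
    by (simp add: drift_integral_def drift_def upto_integral set_lebesgue_integral_def)
  have xm: "x t \<in> borel_measurable (F t)" using sol t unfolding ito_solution_def by blast
  have ae': "AE \<omega> in M. J \<omega> = noise_part A b a u x t \<omega>"
    using ae by eventually_elim (simp add: noise_part_def D_eq)
  have am: "a \<in> borel_measurable M" using a by (simp add: adapted_l2_def square_integrable_def)
  have nm: "noise_part A b a u x t \<in> borel_measurable M"
    unfolding noise_part_def[abs_def]
    by (intro borel_measurable_diff F_measurable[OF t xm] am square_integrableD(1)[OF D])
  show n: "has_ito_integral M F w (\<lambda>s \<omega>. C *v x s \<omega>) t (noise_part A b a u x t)"
    by (rule has_ito_cong_AE[OF J nm ae'])
  show N: "square_integrable M (noise_part A b a u x t)" by (rule has_ito_square_integrable(1)[OF n t])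
  have "square_integrable M (\<lambda>\<omega>. a \<omega> + (drift_integral A b u x t \<omega> + noise_part A b a u x t \<omega>))"
    using a by (intro square_integrable_add D N) (simp add: adapted_l2_def)
  then have "square_integrable M (x t)" by (simp add: noise_part_def)
  with xm show "adapted_l2 t (x t)" by (simp add: adapted_l2_def)
qed

lemma expectation_inner_zero:
  fixes J :: "'w \<Rightarrow> 'b::euclidean_space"
  assumes "square_integrable M J" "\<And>c. (\<integral>\<omega>. c \<bullet> J \<omega> \<partial>M) = 0"
  shows "(\<integral>\<omega>. J \<omega> \<partial>M) = 0"
proof -
  have "integrable M J" by (rule integrable_of_square_integrable[OF finite_measure_axioms assms(1)])
  then have "(\<integral>\<omega>. J \<omega> \<partial>M) \<bullet> (\<integral>\<omega>. J \<omega> \<partial>M) = (\<integral>\<omega>. (\<integral>\<omega>. J \<omega> \<partial>M) \<bullet> J \<omega> \<partial>M)" by simp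
  also have "\<dots> = 0" by (rule assms(2))
  finally show ?thesis by simp
qed

text \<open>The stochastic integral is orthogonal to constants known at time 0, hence has mean zero;
  Fubini exchanges expectation and drift integral.\<close>

lemma ito_solution_mean:
  assumes sol: "ito_solution M F w A b C a u x" and a: "adapted_l2 0 a"
    and u: "square_integrable halfline u"
  shows "ac_rep (\<integral>\<omega>. a \<omega> \<partial>M) (\<lambda>s. A *v (\<integral>\<omega>. x s \<omega> \<partial>M) + b *v u s) (\<lambda>t. \<integral>\<omega>. x t \<omega> \<partial>M)"
  unfolding ac_rep_def
proof (intro allI impI)
  fix t :: real assume t: "0 \<le> t"
  interpret t: pair_sigma_finite "upto_measure t" M by (rule pair_sigma_finite_time)
  note S = ito_solution_square_integrable[OF sol a u]
  let ?y = "drift A b u x"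
  have iy: "integrable (time_prob t) (\<lambda>(s, \<omega>). ?y s \<omega>)"
    by (rule integrable_of_square_integrable[OF finite_measure_time_prob S(2)[OF t]])
  have ix: "integrable M (x s)" if "0 \<le> s" for s
    using integrable_of_square_integrable[OF finite_measure_axioms, of "x s"] S(7)[OF that]
    by (simp add: adapted_l2_def)
  have Ey: "(\<integral>\<omega>. ?y s \<omega> \<partial>M) = A *v (\<integral>\<omega>. x s \<omega> \<partial>M) + b *v u s" if "0 \<le> s" for s
    unfolding drift_def
    using integral_bounded_linear[OF bounded_linear_matrix_vector ix[OF that], of A]
      integrable_bounded_linear[OF bounded_linear_matrix_vector ix[OF that], of A]
    by (simp add: finite_measure.integrable_const prob_space)
  have sp: "s \<in> space (upto_measure t) \<Longrightarrow> 0 \<le> s" for s by (auto simp: space_restrict_space)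
  have "integrable (upto_measure t) (\<lambda>s. \<integral>\<omega>. ?y s \<omega> \<partial>M)" using t.integrable_fst'[OF iy] by simp
  then have i: "integrable (upto_measure t) (\<lambda>s. A *v (\<integral>\<omega>. x s \<omega> \<partial>M) + b *v u s)"
    by (rule Bochner_Integration.integrable_cong[THEN iffD1, rotated -1]) (auto simp: Ey sp)
  have "(\<integral>\<omega>. drift_integral A b u x t \<omega> \<partial>M) = (\<integral>s. (\<integral>\<omega>. ?y s \<omega> \<partial>M) \<partial>upto_measure t)"
    unfolding drift_integral_def by (rule t.Fubini_integral[OF iy])
  also have "\<dots> = (\<integral>s. A *v (\<integral>\<omega>. x s \<omega> \<partial>M) + b *v u s \<partial>upto_measure t)"
    by (intro Bochner_Integration.integral_cong refl) (auto simp: Ey sp)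
  finally have ED: "(\<integral>\<omega>. drift_integral A b u x t \<omega> \<partial>M) = (\<integral>s. A *v (\<integral>\<omega>. x s \<omega> \<partial>M) + b *v u s \<partial>upto_measure t)" .
  have EN: "(\<integral>\<omega>. noise_part A b a u x t \<omega> \<partial>M) = 0"
    by (rule expectation_inner_zero[OF S(6)[OF t]])
      (rule has_ito_orthogonal_init[OF S(5)[OF t] t adapted_l2_const])
  have "square_integrable M a" using a by (simp add: adapted_l2_def)
  from integrable_of_square_integrable[OF finite_measure_axioms this]
    integrable_of_square_integrable[OF finite_measure_axioms S(3)[OF t]]
    integrable_of_square_integrable[OF finite_measure_axioms S(6)[OF t]]
  have "(\<integral>\<omega>. a \<omega> + drift_integral A b u x t \<omega> + noise_part A b a u x t \<omega> \<partial>M)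
    = (\<integral>\<omega>. a \<omega> \<partial>M) + (\<integral>s. A *v (\<integral>\<omega>. x s \<omega> \<partial>M) + b *v u s \<partial>upto_measure t)"
    by (simp add: ED EN)
  then show "integrable (upto_measure t) (\<lambda>s. A *v (\<integral>\<omega>. x s \<omega> \<partial>M) + b *v u s) \<and>
    (\<integral>\<omega>. x t \<omega> \<partial>M) = (\<integral>\<omega>. a \<omega> \<partial>M) + (\<integral>s. A *v (\<integral>\<omega>. x s \<omega> \<partial>M) + b *v u s \<partial>upto_measure t)"
    using i by (simp add: noise_part_def)
qed

text \<open>Fubini brings the time integral outside. Under it, \<open>y s\<close> is known at time
  \<open>s\<close>, so the martingale property replaces \<open>J t\<close> by \<open>J s\<close>;
  the matrix is first moved onto \<open>y s\<close> by transposition.\<close>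

lemma drift_noise_expectation:
  fixes H :: "real^'k^'n" and y :: "real \<Rightarrow> 'w \<Rightarrow> real^'n"
  assumes y: "\<And>s. 0 \<le> s \<Longrightarrow> adapted_l2 s (y s)" "square_integrable (time_prob t) (\<lambda>(s, \<omega>). y s \<omega>)"
    and J: "\<And>s. 0 \<le> s \<Longrightarrow> has_ito_integral M F w f s (J s)" and a: "adapted_l2 0 a" and t: "0 \<le> t"
  shows "integrable (upto_measure t) (\<lambda>s. \<integral>\<omega>. y s \<omega> \<bullet> (H *v (a \<omega> + J s \<omega>)) \<partial>M)"
    and "(\<integral>\<omega>. (\<integral>s. y s \<omega> \<partial>upto_measure t) \<bullet> (H *v (a \<omega> + J t \<omega>)) \<partial>M)
      = (\<integral>s. (\<integral>\<omega>. y s \<omega> \<bullet> (H *v (a \<omega> + J s \<omega>)) \<partial>M) \<partial>upto_measure t)"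
proof -
  have sa: "square_integrable M a" using a by (simp add: adapted_l2_def)
  have sJ: "square_integrable M (J s)" if "0 \<le> s" for s by (rule has_ito_square_integrable(1)[OF J[OF that] that])
  let ?K = "\<lambda>s \<omega>. H *v (a \<omega> + J s \<omega>)"
  have sK: "square_integrable M (?K s)" if "0 \<le> s" for s
    by (intro square_integrable_mult_vec square_integrable_add sa sJ[OF that])
  have sK2: "square_integrable (time_prob t) (\<lambda>(s, \<omega>). ?K t \<omega>)"
    by (rule square_integrable_snd[OF sK[OF t]])
  note tp = time_prob_inner[OF y(2) sK2]
  have eq: "(\<integral>\<omega>. y s \<omega> \<bullet> ?K t \<omega> \<partial>M) = (\<integral>\<omega>. y s \<omega> \<bullet> ?K s \<omega> \<partial>M)" if s: "0 \<le> s" "s \<le> t" for s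
  proof -
    have "adapted_l2 s (\<lambda>\<omega>. transpose H *v y s \<omega>)" by (rule adapted_l2_mult_vec[OF y(1)[OF s(1)]])
    from has_ito_orthogonal[OF J[OF t] J[OF s(1)] s this]
    have 1: "(\<integral>\<omega>. y s \<omega> \<bullet> (H *v J t \<omega>) \<partial>M) = (\<integral>\<omega>. y s \<omega> \<bullet> (H *v J s \<omega>) \<partial>M)"
      by (simp add: dot_matrix_transpose)
    have sy: "square_integrable M (y s)" using y(1)[OF s(1)] by (simp add: adapted_l2_def)
    have "(\<integral>\<omega>. y s \<omega> \<bullet> ?K r \<omega> \<partial>M) = (\<integral>\<omega>. y s \<omega> \<bullet> (H *v a \<omega>) \<partial>M) + (\<integral>\<omega>. y s \<omega> \<bullet> (H *v J r \<omega>) \<partial>M)"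
      if r: "0 \<le> r" for r
      unfolding matrix_vector_right_distrib inner_add_right
      by (rule Bochner_Integration.integral_add)
        (use sy sa sJ[OF r] in \<open>auto intro!: integrable_inner_square_integrable\<close>)
    then show ?thesis using s t 1 by simp
  qed
  have sp: "s \<in> space (upto_measure t) \<Longrightarrow> 0 \<le> s \<and> s \<le> t" for s by (auto simp: space_restrict_space)
  show "integrable (upto_measure t) (\<lambda>s. \<integral>\<omega>. y s \<omega> \<bullet> ?K s \<omega> \<partial>M)"
    using tp(2) by (rule Bochner_Integration.integrable_cong[THEN iffD1, rotated -1])
      (use sp in \<open>auto intro: eq\<close>)
  have "(\<integral>\<omega>. (\<integral>s. y s \<omega> \<partial>upto_measure t) \<bullet> ?K t \<omega> \<partial>M) = (\<integral>\<omega>. (\<integral>s. y s \<omega> \<bullet> ?K t \<omega> \<partial>upto_measure t) \<partial>M)"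
  proof (rule integral_cong_AE)
    have "square_integrable M (\<lambda>\<omega>. \<integral>s. y s \<omega> \<partial>upto_measure t)" by (rule square_integrable_time_integral(1)[OF t y(2)])
    from integrable_inner_square_integrable[OF this sK[OF t]]
    show "(\<lambda>\<omega>. (\<integral>s. y s \<omega> \<partial>upto_measure t) \<bullet> ?K t \<omega>) \<in> borel_measurable M" by (rule borel_measurable_integrable)
    interpret t: pair_sigma_finite "upto_measure t" M by (rule pair_sigma_finite_time)
    show "(\<lambda>\<omega>. \<integral>s. y s \<omega> \<bullet> ?K t \<omega> \<partial>upto_measure t) \<in> borel_measurable M"
      using t.integrable_snd[OF tp(1)] by auto
    show "AE \<omega> in M. (\<integral>s. y s \<omega> \<partial>upto_measure t) \<bullet> ?K t \<omega> = (\<integral>s. y s \<omega> \<bullet> ?K t \<omega> \<partial>upto_measure t)"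
      using AE_section_square_integrable(1)[OF y(2)]
      by eventually_elim (simp add: integrable_of_square_integrable)
  qed
  also have "\<dots> = (\<integral>s. (\<integral>\<omega>. y s \<omega> \<bullet> ?K t \<omega> \<partial>M) \<partial>upto_measure t)" using tp(3,4) by simp
  also have "\<dots> = (\<integral>s. (\<integral>\<omega>. y s \<omega> \<bullet> ?K s \<omega> \<partial>M) \<partial>upto_measure t)"
    by (rule Bochner_Integration.integral_cong[OF refl], rule eq) (use sp in auto)
  finally show "(\<integral>\<omega>. (\<integral>s. y s \<omega> \<partial>upto_measure t) \<bullet> ?K t \<omega> \<partial>M)
      = (\<integral>s. (\<integral>\<omega>. y s \<omega> \<bullet> ?K s \<omega> \<partial>M) \<partial>upto_measure t)" .
qed

text \<open>For almost every path both factors are absolutely continuous, so the product rule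
  applies path by path before expectations are taken.\<close>

lemma drift_drift_expectation:
  fixes H :: "real^'k^'n" and y :: "real \<Rightarrow> 'w \<Rightarrow> real^'n" and y' :: "real \<Rightarrow> 'w \<Rightarrow> real^'k"
  assumes y: "\<And>t. 0 \<le> t \<Longrightarrow> square_integrable (time_prob t) (\<lambda>(s, \<omega>). y s \<omega>)"
    and y': "\<And>t. 0 \<le> t \<Longrightarrow> square_integrable (time_prob t) (\<lambda>(s, \<omega>). y' s \<omega>)" and t: "0 \<le> t"
  defines "D \<equiv> \<lambda>t \<omega>. \<integral>s. y s \<omega> \<partial>upto_measure t" and "D' \<equiv> \<lambda>t \<omega>. \<integral>s. y' s \<omega> \<partial>upto_measure t"
  shows "integrable (upto_measure t) (\<lambda>s. \<integral>\<omega>. y s \<omega> \<bullet> (H *v D' s \<omega>) \<partial>M)"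
    and "integrable (upto_measure t) (\<lambda>s. \<integral>\<omega>. D s \<omega> \<bullet> (H *v y' s \<omega>) \<partial>M)"
    and "(\<integral>\<omega>. D t \<omega> \<bullet> (H *v D' t \<omega>) \<partial>M)
      = (\<integral>s. (\<integral>\<omega>. y s \<omega> \<bullet> (H *v D' s \<omega>) \<partial>M) \<partial>upto_measure t)
        + (\<integral>s. (\<integral>\<omega>. D s \<omega> \<bullet> (H *v y' s \<omega>) \<partial>M) \<partial>upto_measure t)"
proof -
  interpret t: pair_sigma_finite "upto_measure t" M by (rule pair_sigma_finite_time)
  have D: "square_integrable (time_prob t) (\<lambda>(s, \<omega>). D s \<omega>)"
    unfolding D_def by (rule square_integrable_time_integral(2)[OF t y[OF t]])
  have HD': "square_integrable (time_prob t) (\<lambda>(s, \<omega>). H *v D' s \<omega>)"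
    using square_integrable_mult_vec[OF square_integrable_time_integral(2)[OF t y'[OF t]], of H]
    by (simp add: D'_def case_prod_beta')
  have Hy': "square_integrable (time_prob t) (\<lambda>(s, \<omega>). H *v y' s \<omega>)"
    using square_integrable_mult_vec[OF y'[OF t], of H] by (simp add: case_prod_beta')
  note 1 = time_prob_inner[OF y[OF t] HD'] and 2 = time_prob_inner[OF D Hy']
  show "integrable (upto_measure t) (\<lambda>s. \<integral>\<omega>. y s \<omega> \<bullet> (H *v D' s \<omega>) \<partial>M)"
    "integrable (upto_measure t) (\<lambda>s. \<integral>\<omega>. D s \<omega> \<bullet> (H *v y' s \<omega>) \<partial>M)" by (rule 1(2), rule 2(2))
  \<comment> \<open>The product rule needs integrability up to every time simultaneously. Integer
    times give one null set for all of them.\<close>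
  have ae: "AE \<omega> in M. \<forall>n::nat. square_integrable (upto_measure (real n)) (\<lambda>s. y s \<omega>)
      \<and> square_integrable (upto_measure (real n)) (\<lambda>s. y' s \<omega>)"
    unfolding AE_all_countable
    using AE_section_square_integrable(1)[OF y] AE_section_square_integrable(1)[OF y'] by auto
  have i: "integrable M (\<lambda>\<omega>. \<integral>s. y s \<omega> \<bullet> (H *v D' s \<omega>) \<partial>upto_measure t)"
    "integrable M (\<lambda>\<omega>. \<integral>s. D s \<omega> \<bullet> (H *v y' s \<omega>) \<partial>upto_measure t)"
    using t.integrable_snd[OF 1(1)] t.integrable_snd[OF 2(1)] by auto
  have "(\<integral>\<omega>. D t \<omega> \<bullet> (H *v D' t \<omega>) \<partial>M)
    = (\<integral>\<omega>. (\<integral>s. y s \<omega> \<bullet> (H *v D' s \<omega>) \<partial>upto_measure t) + (\<integral>s. D s \<omega> \<bullet> (H *v y' s \<omega>) \<partial>upto_measure t) \<partial>M)"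
  proof (rule integral_cong_AE)
    show "(\<lambda>\<omega>. D t \<omega> \<bullet> (H *v D' t \<omega>)) \<in> borel_measurable M"
      unfolding D_def D'_def
      by (rule borel_measurable_integrable, intro integrable_inner_square_integrable square_integrable_mult_vec
          square_integrable_time_integral(1)[OF t y[OF t]] square_integrable_time_integral(1)[OF t y'[OF t]])
    show "(\<lambda>\<omega>. (\<integral>s. y s \<omega> \<bullet> (H *v D' s \<omega>) \<partial>upto_measure t) + (\<integral>s. D s \<omega> \<bullet> (H *v y' s \<omega>) \<partial>upto_measure t))
      \<in> borel_measurable M" using i by auto
    show "AE \<omega> in M. D t \<omega> \<bullet> (H *v D' t \<omega>)
      = (\<integral>s. y s \<omega> \<bullet> (H *v D' s \<omega>) \<partial>upto_measure t) + (\<integral>s. D s \<omega> \<bullet> (H *v y' s \<omega>) \<partial>upto_measure t)"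
      using ae t.AE_integrable_snd[OF 1(1)] t.AE_integrable_snd[OF 2(1)]
    proof eventually_elim
      case (elim \<omega>)
      have int: "integrable (upto_measure r) (\<lambda>s. y s \<omega>)" "integrable (upto_measure r) (\<lambda>s. y' s \<omega>)" for r
      proof -
        obtain n :: nat where n: "r \<le> real n" using real_arch_simple by blast
        have "integrable (upto_measure (real n)) (\<lambda>s. y s \<omega>)" "integrable (upto_measure (real n)) (\<lambda>s. y' s \<omega>)"
          using elim(1) by (auto intro: integrable_of_square_integrable)
        with n show "integrable (upto_measure r) (\<lambda>s. y s \<omega>)" "integrable (upto_measure r) (\<lambda>s. y' s \<omega>)"
          by (auto intro: integrable_upto_mono)
      qed
      have "ac_rep 0 (\<lambda>s. y s \<omega>) (\<lambda>t. D t \<omega>)" "ac_rep 0 (\<lambda>s. y' s \<omega>) (\<lambda>t. D' t \<omega>)"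
        using int by (auto simp: ac_rep_def D_def D'_def)
      from ac_repD(2)[OF ac_rep_inner_matrix[OF this] t, of H]
      show ?case using elim(2,3) by simp
    qed
  qed
  also have "\<dots> = (\<integral>s. (\<integral>\<omega>. y s \<omega> \<bullet> (H *v D' s \<omega>) \<partial>M) \<partial>upto_measure t)
        + (\<integral>s. (\<integral>\<omega>. D s \<omega> \<bullet> (H *v y' s \<omega>) \<partial>M) \<partial>upto_measure t)"
    using i 1(3,4) 2(3,4) by simp
  finally show "(\<integral>\<omega>. D t \<omega> \<bullet> (H *v D' t \<omega>) \<partial>M)
      = (\<integral>s. (\<integral>\<omega>. y s \<omega> \<bullet> (H *v D' s \<omega>) \<partial>M) \<partial>upto_measure t)
        + (\<integral>s. (\<integral>\<omega>. D s \<omega> \<bullet> (H *v y' s \<omega>) \<partial>M) \<partial>upto_measure t)" .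
qed

lemma ito_solution_second_moment:
  fixes H :: "real^'k^'n"
  assumes sol: "ito_solution M F w A b C a u x" and a: "adapted_l2 0 a" and u: "square_integrable halfline u"
    and sol': "ito_solution M F w A' b' C' a' u' x'" and a': "adapted_l2 0 a'" and u': "square_integrable halfline u'"
  shows "ac_rep (\<integral>\<omega>. a \<omega> \<bullet> (H *v a' \<omega>) \<partial>M)
    (\<lambda>s. (\<integral>\<omega>. drift A b u x s \<omega> \<bullet> (H *v x' s \<omega>) \<partial>M) + (\<integral>\<omega>. x s \<omega> \<bullet> (H *v drift A' b' u' x' s \<omega>) \<partial>M)
       + (\<integral>\<omega>. (C *v x s \<omega>) \<bullet> (H *v (C' *v x' s \<omega>)) \<partial>M))
    (\<lambda>t. \<integral>\<omega>. x t \<omega> \<bullet> (H *v x' t \<omega>) \<partial>M)"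
  unfolding ac_rep_def
proof (intro allI impI)
  fix t :: real assume t: "0 \<le> t"
  note S = ito_solution_square_integrable[OF sol a u] and S' = ito_solution_square_integrable[OF sol' a' u']
  let ?y = "drift A b u x" and ?y' = "drift A' b' u' x'"
  let ?D = "drift_integral A b u x" and ?D' = "drift_integral A' b' u' x'"
  let ?J = "noise_part A b a u x" and ?J' = "noise_part A' b' a' u' x'"
  let ?K = "\<lambda>t \<omega>. a \<omega> + ?J t \<omega>" and ?K' = "\<lambda>t \<omega>. a' \<omega> + ?J' t \<omega>"
  have sa: "square_integrable M a" "square_integrable M a'" using a a' by (auto simp: adapted_l2_def)
  have ya: "adapted_l2 s (?y s)" "adapted_l2 s (?y' s)" if "0 \<le> s" for s
    unfolding drift_def[abs_def]
    by (intro adapted_l2_add adapted_l2_mult_vec adapted_l2_const S(7)[OF that] S'(7)[OF that])+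
  have sy: "square_integrable M (?y s)" "square_integrable M (?y' s)" if "0 \<le> s" for s
    using ya[OF that] by (auto simp: adapted_l2_def)
  have sK: "square_integrable M (?K s)" "square_integrable M (?K' s)" if "0 \<le> s" for s
    using sa S(6)[OF that] S'(6)[OF that] by auto
  have xK: "x s \<omega> = ?K s \<omega> + ?D s \<omega>" "x' s \<omega> = ?K' s \<omega> + ?D' s \<omega>" for s \<omega>
    by (auto simp: noise_part_def)
  note DK' = drift_noise_expectation[OF ya(1) S(2)[OF t] S'(5) a' t, of H]
  note KD' = drift_noise_expectation[OF ya(2) S'(2)[OF t] S(5) a t, of "transpose H"]
  note DD' = drift_drift_expectation[OF S(2) S'(2) t, of H, folded drift_integral_def]
  have CC': "(\<integral>(s, \<omega>). (C *v x s \<omega>) \<bullet> (H *v (C' *v x' s \<omega>)) \<partial>time_prob t)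
      = (\<integral>s. (\<integral>\<omega>. (C *v x s \<omega>) \<bullet> (H *v (C' *v x' s \<omega>)) \<partial>M) \<partial>upto_measure t)"
    "integrable (upto_measure t) (\<lambda>s. \<integral>\<omega>. (C *v x s \<omega>) \<bullet> (H *v (C' *v x' s \<omega>)) \<partial>M)"
  proof -
    have 1: "square_integrable (time_prob t) (\<lambda>(s, \<omega>). C *v x s \<omega>)"
      using square_integrable_mult_vec[OF S(1)[OF t], of C] by (simp add: case_prod_beta')
    have 2: "square_integrable (time_prob t) (\<lambda>(s, \<omega>). H *v (C' *v x' s \<omega>))"
      using square_integrable_mult_vec[OF square_integrable_mult_vec[OF S'(1)[OF t], of C'], of H]
      by (simp add: case_prod_beta')
    show "(\<integral>(s, \<omega>). (C *v x s \<omega>) \<bullet> (H *v (C' *v x' s \<omega>)) \<partial>time_prob t)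
      = (\<integral>s. (\<integral>\<omega>. (C *v x s \<omega>) \<bullet> (H *v (C' *v x' s \<omega>)) \<partial>M) \<partial>upto_measure t)"
      "integrable (upto_measure t) (\<lambda>s. \<integral>\<omega>. (C *v x s \<omega>) \<bullet> (H *v (C' *v x' s \<omega>)) \<partial>M)"
      by (rule time_prob_inner(3)[OF 1 2], rule time_prob_inner(2)[OF 1 2])
  qed
  \<comment> \<open>The mixed products of initial values with stochastic integrals have mean
    zero.\<close>
  have KK: "(\<integral>\<omega>. ?K t \<omega> \<bullet> (H *v ?K' t \<omega>) \<partial>M) = (\<integral>\<omega>. a \<omega> \<bullet> (H *v a' \<omega>) \<partial>M)
     + (\<integral>s. (\<integral>\<omega>. (C *v x s \<omega>) \<bullet> (H *v (C' *v x' s \<omega>)) \<partial>M) \<partial>upto_measure t)"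
  proof -
    have "(\<integral>\<omega>. ?K t \<omega> \<bullet> (H *v ?K' t \<omega>) \<partial>M)
      = (\<integral>\<omega>. a \<omega> \<bullet> (H *v a' \<omega>) + (transpose H *v a \<omega>) \<bullet> ?J' t \<omega> + (H *v a' \<omega>) \<bullet> ?J t \<omega> + ?J t \<omega> \<bullet> (H *v ?J' t \<omega>) \<partial>M)"
      by (intro Bochner_Integration.integral_cong refl)
        (simp add: inner_add_left inner_add_right matrix_vector_right_distrib
          dot_lmul_matrix inner_commute)
    also have "\<dots> = (\<integral>\<omega>. a \<omega> \<bullet> (H *v a' \<omega>) \<partial>M) + (\<integral>\<omega>. (transpose H *v a \<omega>) \<bullet> ?J' t \<omega> \<partial>M)
      + (\<integral>\<omega>. (H *v a' \<omega>) \<bullet> ?J t \<omega> \<partial>M) + (\<integral>\<omega>. ?J t \<omega> \<bullet> (H *v ?J' t \<omega>) \<partial>M)"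
      using integrable_inner_square_integrable[OF sa(1) square_integrable_mult_vec[OF sa(2), of H]]
        integrable_inner_square_integrable[OF square_integrable_mult_vec[OF sa(1), of "transpose H"] S'(6)[OF t]]
        integrable_inner_square_integrable[OF square_integrable_mult_vec[OF sa(2), of H] S(6)[OF t]]
        integrable_inner_square_integrable[OF S(6)[OF t] square_integrable_mult_vec[OF S'(6)[OF t], of H]]
      by simp
    also have "(\<integral>\<omega>. (transpose H *v a \<omega>) \<bullet> ?J' t \<omega> \<partial>M) = 0"
      by (rule has_ito_orthogonal_init[OF S'(5)[OF t] t adapted_l2_mult_vec[OF a]])
    also have "(\<integral>\<omega>. (H *v a' \<omega>) \<bullet> ?J t \<omega> \<partial>M) = 0"
      by (rule has_ito_orthogonal_init[OF S(5)[OF t] t adapted_l2_mult_vec[OF a']])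
    also have "(\<integral>\<omega>. ?J t \<omega> \<bullet> (H *v ?J' t \<omega>) \<partial>M)
        = (\<integral>s. (\<integral>\<omega>. (C *v x s \<omega>) \<bullet> (H *v (C' *v x' s \<omega>)) \<partial>M) \<partial>upto_measure t)"
      unfolding has_ito_isometry[OF S(5)[OF t] S'(5)[OF t] t] by (rule CC'(1))
    finally show ?thesis by simp
  qed
  let ?k1 = "\<lambda>s. \<integral>\<omega>. ?y s \<omega> \<bullet> (H *v ?K' s \<omega>) \<partial>M"
  let ?k2 = "\<lambda>s. \<integral>\<omega>. ?y' s \<omega> \<bullet> (transpose H *v ?K s \<omega>) \<partial>M"
  let ?d1 = "\<lambda>s. \<integral>\<omega>. ?y s \<omega> \<bullet> (H *v ?D' s \<omega>) \<partial>M"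
  let ?d2 = "\<lambda>s. \<integral>\<omega>. ?D s \<omega> \<bullet> (H *v ?y' s \<omega>) \<partial>M"
  let ?c = "\<lambda>s. \<integral>\<omega>. (C *v x s \<omega>) \<bullet> (H *v (C' *v x' s \<omega>)) \<partial>M"
  let ?r = "\<lambda>s. (\<integral>\<omega>. ?y s \<omega> \<bullet> (H *v x' s \<omega>) \<partial>M) + (\<integral>\<omega>. x s \<omega> \<bullet> (H *v ?y' s \<omega>) \<partial>M) + ?c s"
  \<comment> \<open>Regroups the pieces: noise and drift parts of the second factor add up to the
    state at the same time \<open>s\<close>.\<close>
  have req: "?r s = ?k1 s + ?d1 s + (?k2 s + ?d2 s) + ?c s" if s: "0 \<le> s" for s
  proof -
    have 1: "(\<integral>\<omega>. ?y s \<omega> \<bullet> (H *v x' s \<omega>) \<partial>M) = ?k1 s + ?d1 s"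
      unfolding xK(2)[of s] matrix_vector_right_distrib[of H "?K' s _"] inner_add_right[of _ "H *v ?K' s _"]
      by (rule Bochner_Integration.integral_add)
        (use sy(1)[OF s] sK(2)[OF s] S'(3)[OF s] in \<open>auto intro!: integrable_inner_square_integrable\<close>)
    have comm: "?y' s \<omega> \<bullet> (transpose H *v v) = v \<bullet> (H *v ?y' s \<omega>)" for v \<omega>
      using dot_matrix_transpose[of v H "?y' s \<omega>"] by (simp add: inner_commute)
    have 2: "(\<integral>\<omega>. x s \<omega> \<bullet> (H *v ?y' s \<omega>) \<partial>M) = ?k2 s + ?d2 s"
      unfolding xK(1)[of s] comm inner_add_left[of "?K s _"]
      by (rule Bochner_Integration.integral_add)
        (use sy(2)[OF s] sK(1)[OF s] S(3)[OF s] in \<open>auto intro!: integrable_inner_square_integrable\<close>)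
    show ?thesis by (simp only: 1 2)
  qed
  have i: "integrable (upto_measure t) (\<lambda>s. ?k1 s + ?d1 s + (?k2 s + ?d2 s) + ?c s)"
    by (intro Bochner_Integration.integrable_add DK'(1) KD'(1) DD'(1,2) CC'(2))
  have sp: "s \<in> space (upto_measure t) \<Longrightarrow> 0 \<le> s" for s by (auto simp: space_restrict_space)
  have ir: "integrable (upto_measure t) ?r"
    using i by (rule Bochner_Integration.integrable_cong[THEN iffD1, rotated -1]) (auto simp: req sp)
  have "(\<integral>s. ?r s \<partial>upto_measure t) = (\<integral>s. ?k1 s + ?d1 s + (?k2 s + ?d2 s) + ?c s \<partial>upto_measure t)"
    by (intro Bochner_Integration.integral_cong refl req sp)
  also have "\<dots> = (\<integral>s. ?k1 s \<partial>upto_measure t) + (\<integral>s. ?d1 s \<partial>upto_measure t)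
      + ((\<integral>s. ?k2 s \<partial>upto_measure t) + (\<integral>s. ?d2 s \<partial>upto_measure t)) + (\<integral>s. ?c s \<partial>upto_measure t)"
    by (simp only: Bochner_Integration.integral_add Bochner_Integration.integrable_add
        DK'(1) KD'(1) DD'(1,2) CC'(2))
  finally have Ir: "(\<integral>s. ?r s \<partial>upto_measure t) = (\<integral>s. ?k1 s \<partial>upto_measure t) + (\<integral>s. ?d1 s \<partial>upto_measure t)
      + ((\<integral>s. ?k2 s \<partial>upto_measure t) + (\<integral>s. ?d2 s \<partial>upto_measure t)) + (\<integral>s. ?c s \<partial>upto_measure t)" .
  have "(\<integral>\<omega>. x t \<omega> \<bullet> (H *v x' t \<omega>) \<partial>M)
    = (\<integral>\<omega>. ?K t \<omega> \<bullet> (H *v ?K' t \<omega>) + ?D t \<omega> \<bullet> (H *v ?K' t \<omega>) + ?D' t \<omega> \<bullet> (transpose H *v ?K t \<omega>)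
        + ?D t \<omega> \<bullet> (H *v ?D' t \<omega>) \<partial>M)"
  proof (rule Bochner_Integration.integral_cong[OF refl])
    fix \<omega>
    have comm: "?D' t \<omega> \<bullet> (transpose H *v ?K t \<omega>) = ?K t \<omega> \<bullet> (H *v ?D' t \<omega>)"
      using dot_matrix_transpose[of "?K t \<omega>" H "?D' t \<omega>"] by (simp add: inner_commute)
    show "x t \<omega> \<bullet> (H *v x' t \<omega>) = ?K t \<omega> \<bullet> (H *v ?K' t \<omega>) + ?D t \<omega> \<bullet> (H *v ?K' t \<omega>) + ?D' t \<omega> \<bullet> (transpose H *v ?K t \<omega>)
        + ?D t \<omega> \<bullet> (H *v ?D' t \<omega>)"
      unfolding comm xK(1)[of t \<omega>] xK(2)[of t \<omega>] matrix_vector_right_distrib[of H "?K' t \<omega>"]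
        inner_add_left[of "?K t \<omega>"] inner_add_right by linarith
  qed
  also have "\<dots> = (\<integral>\<omega>. ?K t \<omega> \<bullet> (H *v ?K' t \<omega>) \<partial>M) + (\<integral>\<omega>. ?D t \<omega> \<bullet> (H *v ?K' t \<omega>) \<partial>M)
      + (\<integral>\<omega>. ?D' t \<omega> \<bullet> (transpose H *v ?K t \<omega>) \<partial>M) + (\<integral>\<omega>. ?D t \<omega> \<bullet> (H *v ?D' t \<omega>) \<partial>M)"
    using integrable_inner_square_integrable[OF sK(1)[OF t] square_integrable_mult_vec[OF sK(2)[OF t], of H]]
      integrable_inner_square_integrable[OF S(3)[OF t] square_integrable_mult_vec[OF sK(2)[OF t], of H]]
      integrable_inner_square_integrable[OF S'(3)[OF t] square_integrable_mult_vec[OF sK(1)[OF t], of "transpose H"]]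
      integrable_inner_square_integrable[OF S(3)[OF t] square_integrable_mult_vec[OF S'(3)[OF t], of H]]
    by (simp only: Bochner_Integration.integral_add Bochner_Integration.integrable_add)
  also have "\<dots> = (\<integral>\<omega>. a \<omega> \<bullet> (H *v a' \<omega>) \<partial>M) + (\<integral>s. ?r s \<partial>upto_measure t)"
  proof -
    have e1: "(\<integral>\<omega>. ?D t \<omega> \<bullet> (H *v ?K' t \<omega>) \<partial>M) = (\<integral>s. ?k1 s \<partial>upto_measure t)"
      using DK'(2) by (simp only: drift_integral_def)
    have e2: "(\<integral>\<omega>. ?D' t \<omega> \<bullet> (transpose H *v ?K t \<omega>) \<partial>M) = (\<integral>s. ?k2 s \<partial>upto_measure t)"
      using KD'(2) by (simp only: drift_integral_def)
    have e3: "(\<integral>\<omega>. ?D t \<omega> \<bullet> (H *v ?D' t \<omega>) \<partial>M) = (\<integral>s. ?d1 s \<partial>upto_measure t) + (\<integral>s. ?d2 s \<partial>upto_measure t)"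
      using DD'(3) by (simp only: drift_integral_def)
    show ?thesis unfolding Ir KK e1 e2 e3 by linarith
  qed
  finally show "integrable (upto_measure t) ?r \<and>
    (\<integral>\<omega>. x t \<omega> \<bullet> (H *v x' t \<omega>) \<partial>M) = (\<integral>\<omega>. a \<omega> \<bullet> (H *v a' \<omega>) \<partial>M) + (\<integral>s. ?r s \<partial>upto_measure t)"
    using ir by blast
qed

end

section \<open>Existence of solutions by the Euler scheme\<close>

lemma matrix_vector_bound: "\<exists>K\<ge>0. \<forall>v. norm (A *v v) \<le> K * norm v" for A :: "real^'n^'m"
  using bounded_linear.nonneg_bounded[OF bounded_linear_matrix_vector[of A]]
  by (auto simp: mult.commute)

lemma norm_square_add: "(norm (p + q))\<^sup>2 = (norm p)\<^sup>2 + 2 * (p \<bullet> q) + (norm q)\<^sup>2"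
  for p q :: "'a::real_inner"
  by (simp add: power2_norm_eq_inner inner_add inner_commute)

lemma norm_square_le: "0 \<le> K \<Longrightarrow> norm a \<le> K * norm b \<Longrightarrow> (norm a)\<^sup>2 \<le> K\<^sup>2 * (norm b)\<^sup>2"
  using power_mono[of "norm a" "K * norm b" 2] by (simp add: power_mult_distrib)

text \<open>Weighting with \<open>exp (- 2 g s)\<close> makes the integral operator a contraction of
  factor 1/2 for the supremum norm, so the weighted supremum is at most \<open>2 * \<alpha>\<close>.
  No continuity of \<open>f\<close> enters; the crude bound \<open>B\<close> ensures that the
  supremum is finite.\<close>

lemma gronwall_bound:
  fixes f :: "real \<Rightarrow> real"
  assumes f: "\<And>t. 0 \<le> t \<Longrightarrow> t < T \<Longrightarrow> integrable (upto_measure t) f"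
    and nn: "\<And>t. 0 \<le> f t" and bd: "\<And>t. 0 \<le> t \<Longrightarrow> t < T \<Longrightarrow> f t \<le> B" and g: "0 < g"
    and le: "\<And>t. 0 \<le> t \<Longrightarrow> t < T \<Longrightarrow> f t \<le> \<alpha> + g * (\<integral>s. f s \<partial>upto_measure t)"
    and t: "0 \<le> t" "t < T"
  shows "f t \<le> 2 * \<alpha> * exp (2 * g * T)"
proof -
  define S where "S = (SUP s\<in>{0..<T}. f s * exp (- (2 * g * s)))"
  have bdd: "bdd_above ((\<lambda>s. f s * exp (- (2 * g * s))) ` {0..<T})"
  proof (rule bdd_aboveI2[where M=B])
    fix s assume s: "s \<in> {0..<T}"
    have "f s * exp (- (2 * g * s)) \<le> f s * 1"
      by (rule mult_left_mono) (use s g nn in auto)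
    also have "\<dots> \<le> B" using bd s by auto
    finally show "f s * exp (- (2 * g * s)) \<le> B" .
  qed
  have up: "f s \<le> S * exp (2 * g * s)" if "0 \<le> s" "s < T" for s
  proof -
    have "f s * exp (- (2 * g * s)) \<le> S" unfolding S_def by (rule cSUP_upper[OF _ bdd]) (use that in auto)
    then show ?thesis by (simp add: exp_minus field_simps)
  qed
  have S0: "0 \<le> S" using up[OF t] nn[of t] by (meson exp_gt_zero order_trans zero_le_mult_iff not_le)
  \<comment> \<open>The primitive of \<open>exp (2 g r)\<close> carries the factor
    \<open>1 / (2 g)\<close>, which against \<open>g\<close> leaves one half.\<close>
  have ineq: "f s \<le> \<alpha> + S * (exp (2 * g * s) / 2)" if s: "0 \<le> s" "s < T" for s
  proof -
    have ac: "ac_rep (S * exp (2 * g * 0) / (2 * g)) (\<lambda>r. S * exp (2 * g * r)) (\<lambda>r. S * exp (2 * g * r) / (2 * g))"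
      by (rule ac_rep_derivative)
        (use g in \<open>auto intro!: continuous_intros derivative_eq_intros
          simp: has_real_derivative_iff_has_vector_derivative[symmetric]\<close>)
    have "(\<integral>r. f r \<partial>upto_measure s) \<le> (\<integral>r. S * exp (2 * g * r) \<partial>upto_measure s)"
      by (intro integral_mono f ac_repD(1)[OF ac] s) (use up s in \<open>auto simp: space_restrict_space\<close>)
    also have "\<dots> \<le> S * exp (2 * g * s) / (2 * g)"
      using ac_repD(2)[OF ac s(1)] S0 g by simp
    finally have "g * (\<integral>r. f r \<partial>upto_measure s) \<le> S * (exp (2 * g * s) / 2)"
      using g by (simp add: field_simps)
    then show ?thesis using le[OF s] by linarith
  qed
  have a0: "0 \<le> \<alpha>" using le[of 0] nn[of 0] t by simp
  have "S \<le> \<alpha> + S / 2" unfolding S_def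
  proof (rule cSUP_least)
    fix s assume s: "s \<in> {0..<T}"
    have "f s * exp (- (2 * g * s)) \<le> (\<alpha> + S * (exp (2 * g * s) / 2)) * exp (- (2 * g * s))"
      using ineq[of s] s by (intro mult_right_mono) auto
    also have "\<dots> = \<alpha> * exp (- (2 * g * s)) + S / 2" by (simp add: exp_minus field_simps)
    also have "\<dots> \<le> \<alpha> + S / 2" using s g a0 by (simp add: mult_left_le)
    finally show "f s * exp (- (2 * g * s)) \<le> \<alpha> + (SUP s\<in>{0..<T}. f s * exp (- (2 * g * s))) / 2"
      unfolding S_def .
  qed (use t in auto)
  then have "S \<le> 2 * \<alpha>" by simp
  have "f t \<le> S * exp (2 * g * t)" by (rule up[OF t])
  also have "\<dots> \<le> 2 * \<alpha> * exp (2 * g * T)"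
    using \<open>S \<le> 2 * \<alpha>\<close> S0 a0 t g by (intro mult_mono) auto
  finally show ?thesis .
qed

text \<open>For a time in cell \<open>k\<close>, earlier cells count in full and later ones vanish.
  It is stated for an arbitrary function \<open>\<phi>\<close>, since both the identity and a Wiener
  path will be inserted.\<close>

lemma sum_cells:
  fixes e :: "nat \<Rightarrow> 'b::real_vector" and \<phi> :: "real \<Rightarrow> real"
  assumes mono: "\<And>i. \<tau> i \<le> \<tau> (Suc i)" and k: "k < N" "\<tau> k \<le> t" "t \<le> \<tau> (Suc k)"
  shows "(\<Sum>i<N. (\<phi> (min t (\<tau> (Suc i))) - \<phi> (min t (\<tau> i))) *\<^sub>R e i)
    = (\<Sum>i<k. (\<phi> (\<tau> (Suc i)) - \<phi> (\<tau> i)) *\<^sub>R e i) + (\<phi> t - \<phi> (\<tau> k)) *\<^sub>R e k"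
proof -
  have m: "\<tau> i \<le> \<tau> j" if "i \<le> j" for i j using lift_Suc_mono_le[of \<tau>, OF mono that] .
  have "{..<N} = {..<k} \<union> {k} \<union> {k<..<N}" using k by auto
  then have "(\<Sum>i<N. (\<phi> (min t (\<tau> (Suc i))) - \<phi> (min t (\<tau> i))) *\<^sub>R e i)
    = (\<Sum>i\<in>{..<k} \<union> {k} \<union> {k<..<N}. (\<phi> (min t (\<tau> (Suc i))) - \<phi> (min t (\<tau> i))) *\<^sub>R e i)" by simp
  also have "\<dots> = (\<Sum>i<k. (\<phi> (min t (\<tau> (Suc i))) - \<phi> (min t (\<tau> i))) *\<^sub>R e i)
      + (\<phi> (min t (\<tau> (Suc k))) - \<phi> (min t (\<tau> k))) *\<^sub>R e k
      + (\<Sum>i\<in>{k<..<N}. (\<phi> (min t (\<tau> (Suc i))) - \<phi> (min t (\<tau> i))) *\<^sub>R e i)"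
    by (subst sum.union_disjoint; auto)+
  also have "(\<Sum>i<k. (\<phi> (min t (\<tau> (Suc i))) - \<phi> (min t (\<tau> i))) *\<^sub>R e i) = (\<Sum>i<k. (\<phi> (\<tau> (Suc i)) - \<phi> (\<tau> i)) *\<^sub>R e i)"
  proof (intro sum.cong refl)
    fix i assume "i \<in> {..<k}"
    then have "\<tau> (Suc i) \<le> t" "\<tau> i \<le> t" using m[of "Suc i" k] m[of i k] k by auto
    then show "(\<phi> (min t (\<tau> (Suc i))) - \<phi> (min t (\<tau> i))) *\<^sub>R e i = (\<phi> (\<tau> (Suc i)) - \<phi> (\<tau> i)) *\<^sub>R e i"
      by (simp add: min_def)
  qed
  also have "(\<Sum>i\<in>{k<..<N}. (\<phi> (min t (\<tau> (Suc i))) - \<phi> (min t (\<tau> i))) *\<^sub>R e i) = 0"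
  proof (intro sum.neutral ballI)
    fix i assume "i \<in> {k<..<N}"
    then have "t \<le> \<tau> i" "t \<le> \<tau> (Suc i)" using m[of "Suc k" i] m[of "Suc k" "Suc i"] k by auto
    then show "(\<phi> (min t (\<tau> (Suc i))) - \<phi> (min t (\<tau> i))) *\<^sub>R e i = 0" by (simp add: min_def)
  qed
  also have "(\<phi> (min t (\<tau> (Suc k))) - \<phi> (min t (\<tau> k))) *\<^sub>R e k = (\<phi> t - \<phi> (\<tau> k)) *\<^sub>R e k"
    using k by (simp add: min_absorb1 min_absorb2)
  finally show ?thesis by simp
qed

section \<open>The dyadic scheme and its interpolation\<close>

context wiener_space
begin

lemma time_integral_square_bound:
  fixes y :: "real \<Rightarrow> 'w \<Rightarrow> 'b::euclidean_space"
  assumes t: "0 \<le> t" and y: "square_integrable (time_prob t) (\<lambda>(s, \<omega>). y s \<omega>)"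
  shows "(\<integral>\<omega>. (norm (\<integral>s. y s \<omega> \<partial>upto_measure t))\<^sup>2 \<partial>M)
    \<le> t * (\<integral>s. (\<integral>\<omega>. (norm (y s \<omega>))\<^sup>2 \<partial>M) \<partial>upto_measure t)"
proof -
  have "(\<integral>\<omega>. (norm (\<integral>s. y s \<omega> \<partial>upto_measure t))\<^sup>2 \<partial>M) \<le> (\<integral>\<omega>. t * (\<integral>s. (norm (y s \<omega>))\<^sup>2 \<partial>upto_measure t) \<partial>M)"
    using AE_section_square_integrable(1)[OF y]
    by (intro integral_mono_AE square_integrableD(2)[OF square_integrable_time_integral(1)[OF t y]]
        integrable_mult_right AE_section_square_integrable(2)[OF y])
      (auto elim!: AE_mp intro: norm_integral_upto_square[OF t])
  also have "\<dots> = t * (\<integral>s. (\<integral>\<omega>. (norm (y s \<omega>))\<^sup>2 \<partial>M) \<partial>upto_measure t)"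
    using time_prob_inner(3)[OF y y] time_prob_inner(4)[OF y y] by (simp add: power2_norm_eq_inner)
  finally show ?thesis .
qed

text \<open>With dyadic meshes the mean square error of level \<open>j\<close> is of order
  \<open>(1/2)^j\<close>, the rate that \<open>l2_complete\<close> requires for convergence almost
  everywhere.\<close>

definition grid :: "nat \<Rightarrow> nat \<Rightarrow> real" where "grid j k = real k * (1/2)^j"

definition grid_index :: "nat \<Rightarrow> real \<Rightarrow> nat" where "grid_index j t = nat \<lfloor>t * 2^j\<rfloor>"

primrec euler :: "real^'n^'n \<Rightarrow> real^'n^'n \<Rightarrow> real^'n \<Rightarrow> nat \<Rightarrow> nat \<Rightarrow> 'w \<Rightarrow> real^'n" where
  "euler A C v j 0 = (\<lambda>\<omega>. v)"
| "euler A C v j (Suc k) = (\<lambda>\<omega>. euler A C v j k \<omega> + (1/2)^j *\<^sub>R (A *v euler A C v j k \<omega>)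
     + (w (grid j (Suc k)) \<omega> - w (grid j k) \<omega>) *\<^sub>R (C *v euler A C v j k \<omega>))"

lemma grid_nonneg: "0 \<le> grid j k" and grid_Suc: "grid j k \<le> grid j (Suc k)"
  and grid_diff: "grid j (Suc k) - grid j k = (1/2)^j"
  by (auto simp: grid_def algebra_simps)

lemma grid_index_iff:
  assumes "0 \<le> s" shows "grid j k \<le> s \<and> s < grid j (Suc k) \<longleftrightarrow> k = grid_index j s"
proof -
  have "grid j k \<le> s \<and> s < grid j (Suc k) \<longleftrightarrow> real k \<le> s * 2^j \<and> s * 2^j < real k + 1"
    by (simp add: grid_def power_one_over field_simps)
  also have "\<dots> \<longleftrightarrow> \<lfloor>s * 2^j\<rfloor> = int k" by (simp add: floor_eq_iff)
  also have "\<dots> \<longleftrightarrow> k = grid_index j s"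
    using assms by (auto simp: grid_index_def nat_eq_iff)
  finally show ?thesis .
qed

lemma euler_adapted: "adapted_l2 (grid j k) (euler A C v j k)"
proof (induction k)
  case 0
  then show ?case using adapted_l2_const by simp
next
  case (Suc k)
  note m = adapted_l2_mono[OF grid_nonneg grid_Suc]
  \<comment> \<open>The scalar mesh width is written as a matrix so that the rule for matrix
    multiples applies.\<close>
  have "adapted_l2 (grid j (Suc k)) (\<lambda>\<omega>. ((1/2)^j *\<^sub>R mat 1) *v (A *v euler A C v j k \<omega>))"
    by (intro adapted_l2_mult_vec m Suc)
  then have "adapted_l2 (grid j (Suc k)) (\<lambda>\<omega>. (1/2)^j *\<^sub>R (A *v euler A C v j k \<omega>))"
    by (simp add: scaleR_matrix_vector_assoc[symmetric])
  moreover have "adapted_l2 (grid j (Suc k)) (\<lambda>\<omega>. (w (grid j (Suc k)) \<omega> - w (grid j k) \<omega>) *\<^sub>R (C *v euler A C v j k \<omega>))"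
    by (intro adapted_l2_increment(1)[OF grid_nonneg grid_Suc] adapted_l2_mult_vec Suc)
  moreover have "adapted_l2 (grid j (Suc k)) (euler A C v j k)" by (rule m[OF Suc])
  ultimately show ?case
    unfolding euler.simps by (intro adapted_l2_add)
qed

lemma euler_square_integrable: "square_integrable M (euler A C v j k)"
  using euler_adapted unfolding adapted_l2_def by blast

text \<open>The noise of one step is orthogonal to everything known before it, so second moments add
  and one step multiplies them by at most \<open>(1 + h K)\<^sup>2 + h K\<^sup>2\<close>, where
  \<open>h\<close> is the mesh width.\<close>

lemma euler_moment_bound:
  assumes K: "0 \<le> K" "\<And>z. norm (A *v z) \<le> K * norm z" "\<And>z. norm (C *v z) \<le> K * norm z"
  shows "(\<integral>\<omega>. (norm (euler A C v j k \<omega>))\<^sup>2 \<partial>M) \<le> exp ((2 * K + 2 * K\<^sup>2) * grid j k) * (norm v)\<^sup>2"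
proof (induction k)
  case 0
  then show ?case by (simp add: grid_def prob_space)
next
  case (Suc k)
  let ?E = "euler A C v j k" and ?h = "(1/2::real)^j"
  let ?P = "\<lambda>\<omega>. ?E \<omega> + ?h *\<^sub>R (A *v ?E \<omega>)"
  let ?Q = "\<lambda>\<omega>. (w (grid j (Suc k)) \<omega> - w (grid j k) \<omega>) *\<^sub>R (C *v ?E \<omega>)"
  have h: "0 < ?h" "?h \<le> 1" by (auto simp: power_le_one)
  note ae = euler_adapted[of j k A C v]
  note CE = adapted_l2_mult_vec[OF ae, of C]
  have "adapted_l2 (grid j k) (\<lambda>\<omega>. (?h *\<^sub>R mat 1) *v (A *v ?E \<omega>))"
    by (intro adapted_l2_mult_vec ae)
  then have aP: "adapted_l2 (grid j k) ?P"
    by (intro adapted_l2_add ae) (simp add: scaleR_matrix_vector_assoc[symmetric])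
  have sP: "square_integrable M ?P" using aP by (simp add: adapted_l2_def)
  have sQ: "square_integrable M ?Q"
    using adapted_l2_increment(1)[OF grid_nonneg grid_Suc CE] by (simp add: adapted_l2_def)
  have sE: "square_integrable M ?E" by (rule euler_square_integrable)
  have "(\<integral>\<omega>. (norm (euler A C v j (Suc k) \<omega>))\<^sup>2 \<partial>M) = (\<integral>\<omega>. (norm (?P \<omega>))\<^sup>2 + 2 * (?P \<omega> \<bullet> ?Q \<omega>) + (norm (?Q \<omega>))\<^sup>2 \<partial>M)"
    unfolding euler.simps norm_square_add ..
  also have "\<dots> = (\<integral>\<omega>. (norm (?P \<omega>))\<^sup>2 \<partial>M) + 2 * (\<integral>\<omega>. ?P \<omega> \<bullet> ?Q \<omega> \<partial>M) + (\<integral>\<omega>. (norm (?Q \<omega>))\<^sup>2 \<partial>M)"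
    using square_integrableD(2)[OF sP] square_integrableD(2)[OF sQ] integrable_inner_square_integrable[OF sP sQ]
    by (simp only: Bochner_Integration.integral_add Bochner_Integration.integrable_add
        Bochner_Integration.integral_mult_right_zero integrable_mult_right)
  also have "(\<integral>\<omega>. ?P \<omega> \<bullet> ?Q \<omega> \<partial>M) = 0"
    by (rule adapted_increment_orthogonal[OF grid_nonneg grid_Suc aP CE])
  also have "(\<integral>\<omega>. (norm (?Q \<omega>))\<^sup>2 \<partial>M) = ?h * (\<integral>\<omega>. (norm (C *v ?E \<omega>))\<^sup>2 \<partial>M)"
    using adapted_l2_increment(2)[OF grid_nonneg grid_Suc CE] by (simp only: grid_diff)
  also have "(\<integral>\<omega>. (norm (C *v ?E \<omega>))\<^sup>2 \<partial>M) \<le> (\<integral>\<omega>. K\<^sup>2 * (norm (?E \<omega>))\<^sup>2 \<partial>M)"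
    by (intro integral_mono integrable_mult_right square_integrableD(2) square_integrable_mult_vec sE
        norm_square_le K)
  also have "(\<integral>\<omega>. (norm (?P \<omega>))\<^sup>2 \<partial>M) \<le> (\<integral>\<omega>. (1 + ?h * K)\<^sup>2 * (norm (?E \<omega>))\<^sup>2 \<partial>M)"
  proof (intro integral_mono)
    fix \<omega>
    have "norm (?P \<omega>) \<le> norm (?E \<omega>) + ?h * norm (A *v ?E \<omega>)"
      using norm_triangle_ineq[of "?E \<omega>" "?h *\<^sub>R (A *v ?E \<omega>)"] by simp
    also have "\<dots> \<le> (1 + ?h * K) * norm (?E \<omega>)"
      using mult_left_mono[OF K(2)[of "?E \<omega>"], of ?h] by (simp add: algebra_simps)
    finally show "(norm (?P \<omega>))\<^sup>2 \<le> (1 + ?h * K)\<^sup>2 * (norm (?E \<omega>))\<^sup>2"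
      by (simp add: power_mono power_mult_distrib[symmetric])
  qed (use square_integrableD(2)[OF sP] square_integrableD(2)[OF sE] in auto)
  finally have "(\<integral>\<omega>. (norm (euler A C v j (Suc k) \<omega>))\<^sup>2 \<partial>M)
    \<le> ((1 + ?h * K)\<^sup>2 + ?h * K\<^sup>2) * (\<integral>\<omega>. (norm (?E \<omega>))\<^sup>2 \<partial>M)"
    using h by (simp add: algebra_simps)
  also have "\<dots> \<le> exp ((2 * K + 2 * K\<^sup>2) * ?h) * (exp ((2 * K + 2 * K\<^sup>2) * grid j k) * (norm v)\<^sup>2)"
  proof (rule mult_mono[OF _ Suc])
    \<comment> \<open>Mesh widths do not exceed 1, so the quadratic term is absorbed into the linear
      one and the growth factor lies below an exponential.\<close>
    have "?h * ?h \<le> ?h * 1" using h by (intro mult_left_mono) auto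
    then have "?h * ?h * K\<^sup>2 \<le> ?h * K\<^sup>2" by (intro mult_right_mono) auto
    then have "(1 + ?h * K)\<^sup>2 + ?h * K\<^sup>2 \<le> 1 + (2 * K + 2 * K\<^sup>2) * ?h"
      by (simp add: power2_eq_square algebra_simps)
    also have "\<dots> \<le> exp ((2 * K + 2 * K\<^sup>2) * ?h)" by (rule exp_ge_add_one_self)
    finally show "(1 + ?h * K)\<^sup>2 + ?h * K\<^sup>2 \<le> exp ((2 * K + 2 * K\<^sup>2) * ?h)" .
  qed auto
  also have "\<dots> = exp ((2 * K + 2 * K\<^sup>2) * grid j (Suc k)) * (norm v)\<^sup>2"
    using grid_diff[of j k] by (simp add: exp_add[symmetric] algebra_simps)
  finally show ?case .
qed

lemma euler_sum:
  "euler A C v j k \<omega> = v + (\<Sum>i<k. (grid j (Suc i) - grid j i) *\<^sub>R (A *v euler A C v j i \<omega>))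
     + (\<Sum>i<k. (w (grid j (Suc i)) \<omega> - w (grid j i) \<omega>) *\<^sub>R (C *v euler A C v j i \<omega>))"
  by (induction k) (auto simp: grid_diff)

abbreviation cells :: "nat \<Rightarrow> nat \<Rightarrow> nat" where "cells T j \<equiv> T * 2^j"

lemma euler_elementary: "elementary M F (grid j) N (euler A C v j)"
  using euler_adapted[of j _ A C v, unfolded adapted_l2_def] grid_Suc grid_nonneg
  unfolding elementary_def by auto

lemma elementary_process_euler:
  assumes "0 \<le> s" "s < real T"
  shows "elementary_process (grid j) (cells T j) e s \<omega> = e (grid_index j s) \<omega>"
proof -
  have "s * 2^j < real T * 2^j" using assms by simp
  then have lt: "grid_index j s < cells T j"
    using assms unfolding grid_index_def by (subst nat_less_iff) (auto simp: floor_less_iff)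
  have "elementary_process (grid j) (cells T j) e s \<omega> = (\<Sum>k<cells T j. if k = grid_index j s then e k \<omega> else 0)"
    unfolding elementary_process_def
    by (intro sum.cong refl) (use grid_index_iff[OF assms(1)] in \<open>auto simp: indicator_def\<close>)
  also have "\<dots> = e (grid_index j s) \<omega>" using lt by (simp add: sum.delta')
  finally show ?thesis .
qed

lemma time_integral_elementary:
  assumes el: "elementary M F \<tau> N e" and t: "0 \<le> t"
  shows "(\<integral>s. elementary_process \<tau> N e s \<omega> \<partial>upto_measure t) = (\<Sum>k<N. (min t (\<tau> (Suc k)) - min t (\<tau> k)) *\<^sub>R e k \<omega>)"
    and "integrable (upto_measure t) (\<lambda>s. elementary_process \<tau> N e s \<omega>)"
proof -
  have i: "integrable (upto_measure t) (\<lambda>s. indicat_real {a..<b} s)" for a b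
    by (rule finite_measure.integrable_const_bound[where B=1]) (auto intro: measurable_restrict_space1)
  show "integrable (upto_measure t) (\<lambda>s. elementary_process \<tau> N e s \<omega>)"
    unfolding elementary_process_def using i by (intro Bochner_Integration.integrable_sum) auto
  have "(\<integral>s. elementary_process \<tau> N e s \<omega> \<partial>upto_measure t)
    = (\<Sum>k<N. (\<integral>s. indicat_real {\<tau> k..<\<tau> (Suc k)} s \<partial>upto_measure t) *\<^sub>R e k \<omega>)"
    unfolding elementary_process_def
    by (subst Bochner_Integration.integral_sum) (use i in \<open>auto intro!: integral_scaleR_left\<close>)
  also have "\<dots> = (\<Sum>k<N. (min t (\<tau> (Suc k)) - min t (\<tau> k)) *\<^sub>R e k \<omega>)"
  proof (intro sum.cong refl)
    fix k assume "k \<in> {..<N}"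
    then have k: "k < N" by simp
    note d = elementaryD[OF el k]
    have "(\<integral>s. indicat_real {\<tau> k..<\<tau> (Suc k)} s \<partial>upto_measure t)
       = (\<integral>s. indicat_real {\<tau> k..<\<tau> (Suc k)} s * indicat_real {\<tau> k..<\<tau> (Suc k)} s \<partial>upto_measure t)"
      by (intro Bochner_Integration.integral_cong) (auto simp: indicator_def)
    also have "\<dots> = min t (\<tau> (Suc k)) - min t (\<tau> k)"
      unfolding measure_cells[OF t d(1) d(1), symmetric] using d by (auto simp: min_def max_def)
    finally show "(\<integral>s. indicat_real {\<tau> k..<\<tau> (Suc k)} s \<partial>upto_measure t) *\<^sub>R e k \<omega>
      = (min t (\<tau> (Suc k)) - min t (\<tau> k)) *\<^sub>R e k \<omega>" by simp
  qed
  finally show "(\<integral>s. elementary_process \<tau> N e s \<omega> \<partial>upto_measure t) = (\<Sum>k<N. (min t (\<tau> (Suc k)) - min t (\<tau> k)) *\<^sub>R e k \<omega>)" .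
qed

text \<open>The interpolated scheme in integral form: its drift and noise are integrals of
  elementary processes, so two levels can be compared by Cauchy-Schwarz and the isometry.
  \<open>T\<close> is the horizon covered by the partition.\<close>

definition euler_path :: "nat \<Rightarrow> real^'n^'n \<Rightarrow> real^'n^'n \<Rightarrow> real^'n \<Rightarrow> nat \<Rightarrow> real \<Rightarrow> 'w \<Rightarrow> real^'n" where
  "euler_path T A C v j t \<omega> =
     v + (\<integral>s. elementary_process (grid j) (cells T j) (\<lambda>k \<omega>. A *v euler A C v j k \<omega>) s \<omega> \<partial>upto_measure t)
       + elementary_integral w (grid j) (cells T j) (\<lambda>k \<omega>. C *v euler A C v j k \<omega>) t \<omega>"

definition euler_step :: "real^'n^'n \<Rightarrow> real^'n^'n \<Rightarrow> real^'n \<Rightarrow> nat \<Rightarrow> real \<Rightarrow> 'w \<Rightarrow> real^'n" where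
  "euler_step A C v j t \<omega> = euler A C v j (grid_index j t) \<omega>"

text \<open>The integral form unwinds to the value at the last grid point plus the drift and noise
  collected since then; this shows that interpolation and step process are close.\<close>

lemma euler_path_eq:
  fixes A C :: "real^'n^'n" and v :: "real^'n"
  assumes t: "0 \<le> t" "t < real T"
  shows "euler_path T A C v j t \<omega> = euler_step A C v j t \<omega>
     + (t - grid j (grid_index j t)) *\<^sub>R (A *v euler_step A C v j t \<omega>)
     + (w t \<omega> - w (grid j (grid_index j t)) \<omega>) *\<^sub>R (C *v euler_step A C v j t \<omega>)"
proof -
  let ?k = "grid_index j t"
  have k: "grid j ?k \<le> t" "t \<le> grid j (Suc ?k)" using grid_index_iff[OF t(1), of j ?k] by auto
  have "t * 2^j < real T * 2^j" using t by simp
  then have lt: "?k < cells T j"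
    using t unfolding grid_index_def by (subst nat_less_iff) (auto simp: floor_less_iff)
  note s1 = sum_cells[OF grid_Suc lt k, of "\<lambda>x. x" "\<lambda>i. A *v euler A C v j i \<omega>"]
  note s2 = sum_cells[OF grid_Suc lt k, of "\<lambda>t. w t \<omega>" "\<lambda>i. C *v euler A C v j i \<omega>"]
  have aux: "p + (q + r) + (s + t) = p + q + s + r + t" for p q r s t :: "real^'n" by simp
  show ?thesis
    unfolding euler_path_def time_integral_elementary(1)[OF elementary_mult_vec(1)[OF euler_elementary] t(1)]
      elementary_integral_def s1 s2 euler_step_def
    unfolding aux euler_sum[of A C v j ?k \<omega>, symmetric] ..
qed


lemma euler_step_adapted:
  assumes "0 \<le> t" shows "adapted_l2 t (euler_step A C v j t)"
proof -
  have "grid j (grid_index j t) \<le> t" using grid_index_iff[OF assms, of j] by blast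
  from adapted_l2_mono[OF grid_nonneg this euler_adapted] show ?thesis
    by (simp add: euler_step_def[abs_def])
qed

lemma euler_step_square_integrable: "square_integrable M (euler_step A C v j t)"
  unfolding euler_step_def[abs_def] by (rule euler_square_integrable)

lemma elementary_process_euler_step:
  assumes "0 \<le> s" "s < real T"
  shows "elementary_process (grid j) (cells T j) (\<lambda>k \<omega>. H *v euler A C v j k \<omega>) s \<omega> = H *v euler_step A C v j s \<omega>"
  using elementary_process_euler[OF assms, of j "\<lambda>k \<omega>. H *v euler A C v j k \<omega>" \<omega>] by (simp add: euler_step_def)

text \<open>Step process and interpolation differ by an amount of order \<open>(1/2)^j\<close> in
  mean square. The difference of two interpolations is controlled by the time integral of the
  difference of the step processes. Together these form a Gronwall inequality for that
  difference.\<close>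

lemma euler_estimates:
  fixes A C :: "real^'n^'n" and v :: "real^'n"
  obtains L where "0 \<le> L"
    "\<And>j t. 0 \<le> t \<Longrightarrow> t < real T \<Longrightarrow> (\<integral>\<omega>. (norm (euler_step A C v j t \<omega>))\<^sup>2 \<partial>M) \<le> L"
    "\<And>j t. 0 \<le> t \<Longrightarrow> t < real T \<Longrightarrow>
       (\<integral>\<omega>. (norm (euler_path T A C v j t \<omega> - euler_step A C v j t \<omega>))\<^sup>2 \<partial>M) \<le> L * (1/2)^j"
    "\<And>j l t. 0 \<le> t \<Longrightarrow> t < real T \<Longrightarrow> j \<le> l \<Longrightarrow>
       (\<integral>\<omega>. (norm (euler_step A C v l t \<omega> - euler_step A C v j t \<omega>))\<^sup>2 \<partial>M) \<le> L * (1/2)^j"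
    "\<And>j t. 0 \<le> t \<Longrightarrow> t < real T \<Longrightarrow> square_integrable M (euler_path T A C v j t)"
proof -
  obtain KA KC where KA: "0 \<le> KA" "\<And>z. norm (A *v z) \<le> KA * norm z"
    and KC: "0 \<le> KC" "\<And>z. norm (C *v z) \<le> KC * norm z"
    using matrix_vector_bound[of A] matrix_vector_bound[of C] by blast
  define K where "K = max KA KC"
  have mono: "KA * norm z \<le> K * norm z" "KC * norm z \<le> K * norm z" for z :: "real^'n"
    by (auto simp: K_def intro!: mult_right_mono)
  have K: "0 \<le> K" "\<And>z. norm (A *v z) \<le> K * norm z" "\<And>z. norm (C *v z) \<le> K * norm z"
    using KA(1) order_trans[OF KA(2) mono(1)] order_trans[OF KC(2) mono(2)] by (auto simp: K_def)
  define B where "B = exp ((2 * K + 2 * K\<^sup>2) * real T) * (norm v)\<^sup>2"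
  have B0: "0 \<le> B" by (simp add: B_def)
  let ?st = "euler_step A C v" and ?pa = "euler_path T A C v"
  have st: "square_integrable M (?st j t)" for j t by (rule euler_step_square_integrable)
  have bB: "(\<integral>\<omega>. (norm (?st j t \<omega>))\<^sup>2 \<partial>M) \<le> B" if t: "0 \<le> t" "t < real T" for j t
  proof -
    have g: "grid j (grid_index j t) \<le> real T" using grid_index_iff[OF t(1), of j "grid_index j t"] t by simp
    have "(\<integral>\<omega>. (norm (?st j t \<omega>))\<^sup>2 \<partial>M) \<le> exp ((2 * K + 2 * K\<^sup>2) * grid j (grid_index j t)) * (norm v)\<^sup>2"
      unfolding euler_step_def by (rule euler_moment_bound[OF K])
    also have "\<dots> \<le> B" unfolding B_def using g K(1) by (intro mult_right_mono) (auto intro!: mult_left_mono)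
    finally show ?thesis .
  qed
  have mB: "(\<integral>\<omega>. (norm (D *v ?st j t \<omega>))\<^sup>2 \<partial>M) \<le> K\<^sup>2 * B"
    if t: "0 \<le> t" "t < real T" and D: "\<And>z. norm (D *v z) \<le> K * norm z" for D :: "real^'n^'n" and j t
  proof -
    have "(\<integral>\<omega>. (norm (D *v ?st j t \<omega>))\<^sup>2 \<partial>M) \<le> (\<integral>\<omega>. K\<^sup>2 * (norm (?st j t \<omega>))\<^sup>2 \<partial>M)"
      by (intro integral_mono integrable_mult_right square_integrableD(2) square_integrable_mult_vec st
          norm_square_le K(1) D)
    also have "\<dots> \<le> K\<^sup>2 * B" using bB[OF t] by (simp add: mult_left_mono)
    finally show ?thesis .
  qed
  have path: "square_integrable M (?pa j t) \<and> (\<integral>\<omega>. (norm (?pa j t \<omega> - ?st j t \<omega>))\<^sup>2 \<partial>M) \<le> 4 * K\<^sup>2 * B * (1/2)^j"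
    if t: "0 \<le> t" "t < real T" for j t
  proof -
    let ?g = "grid j (grid_index j t)"
    have g: "0 \<le> ?g" "?g \<le> t" "t - ?g \<le> (1/2)^j" "(1/2::real)^j \<le> 1"
      using grid_index_iff[OF t(1), of j "grid_index j t"] grid_nonneg[of j "grid_index j t"]
        grid_diff[of j "grid_index j t"] by (auto simp: power_le_one)
    let ?a = "\<lambda>\<omega>. (t - ?g) *\<^sub>R (A *v ?st j t \<omega>)" and ?b = "\<lambda>\<omega>. (w t \<omega> - w ?g \<omega>) *\<^sub>R (C *v ?st j t \<omega>)"
    have ad: "adapted_l2 ?g (\<lambda>\<omega>. C *v ?st j t \<omega>)"
      unfolding euler_step_def by (rule adapted_l2_mult_vec[OF euler_adapted])
    have sa: "square_integrable M ?a" by (intro square_integrable_scaleR square_integrable_mult_vec st)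
    have sb: "square_integrable M ?b" using adapted_l2_increment(1)[OF g(1,2) ad] by (simp add: adapted_l2_def)
    have eq: "?pa j t \<omega> = ?st j t \<omega> + (?a \<omega> + ?b \<omega>)" for \<omega>
      unfolding euler_path_eq[OF t] by (simp only: add.assoc)
    have sp: "square_integrable M (?pa j t)"
      unfolding eq[abs_def] by (intro square_integrable_add st sa sb)
    have "(\<integral>\<omega>. (norm (?a \<omega>))\<^sup>2 \<partial>M) = (t - ?g)\<^sup>2 * (\<integral>\<omega>. (norm (A *v ?st j t \<omega>))\<^sup>2 \<partial>M)"
      by (simp add: power_mult_distrib)
    also have "\<dots> \<le> (1/2)^j * (K\<^sup>2 * B)"
    proof (intro mult_mono mB[OF t K(2)])
      have "(t - ?g)\<^sup>2 \<le> (1/2)^j * (1/2)^j" unfolding power2_eq_square using g by (intro mult_mono) auto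
      also have "\<dots> \<le> (1/2)^j * 1" using g(4) by (intro mult_left_mono) auto
      finally show "(t - ?g)\<^sup>2 \<le> (1/2)^j" by simp
    qed auto
    finally have a: "(\<integral>\<omega>. (norm (?a \<omega>))\<^sup>2 \<partial>M) \<le> (1/2)^j * (K\<^sup>2 * B)" .
    have b: "(\<integral>\<omega>. (norm (?b \<omega>))\<^sup>2 \<partial>M) \<le> (1/2)^j * (K\<^sup>2 * B)"
      unfolding adapted_l2_increment(2)[OF g(1,2) ad] using g(3) mB[OF t K(3)] by (intro mult_mono) auto
    have "(\<integral>\<omega>. (norm (?pa j t \<omega> - ?st j t \<omega>))\<^sup>2 \<partial>M) \<le> (\<integral>\<omega>. 2 * (norm (?a \<omega>))\<^sup>2 + 2 * (norm (?b \<omega>))\<^sup>2 \<partial>M)"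
    proof (rule integral_mono)
      show "integrable M (\<lambda>\<omega>. (norm (?pa j t \<omega> - ?st j t \<omega>))\<^sup>2)"
        by (intro square_integrableD(2) square_integrable_diff sp st)
      show "integrable M (\<lambda>\<omega>. 2 * (norm (?a \<omega>))\<^sup>2 + 2 * (norm (?b \<omega>))\<^sup>2)"
        by (intro Bochner_Integration.integrable_add integrable_mult_right square_integrableD(2) sa sb)
      show "(norm (?pa j t \<omega> - ?st j t \<omega>))\<^sup>2 \<le> 2 * (norm (?a \<omega>))\<^sup>2 + 2 * (norm (?b \<omega>))\<^sup>2" for \<omega>
        unfolding eq using norm_add_squares[of "?a \<omega>" "?b \<omega>"] by (simp only: add_diff_cancel_left')
    qed
    also have "\<dots> = 2 * (\<integral>\<omega>. (norm (?a \<omega>))\<^sup>2 \<partial>M) + 2 * (\<integral>\<omega>. (norm (?b \<omega>))\<^sup>2 \<partial>M)"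
      by (simp only: Bochner_Integration.integral_add integrable_mult_right square_integrableD(2)[OF sa]
          square_integrableD(2)[OF sb] Bochner_Integration.integral_mult_right_zero)
    also have "\<dots> \<le> 2 * ((1/2)^j * (K\<^sup>2 * B)) + 2 * ((1/2)^j * (K\<^sup>2 * B))"
      using a b by linarith
    also have "\<dots> = 4 * K\<^sup>2 * B * (1/2)^j" by simp
    finally show ?thesis using sp by blast
  qed
  have pathdiff: "(\<integral>\<omega>. (norm (?pa j t \<omega> - ?pa l t \<omega>))\<^sup>2 \<partial>M)
      \<le> (2 * real T * K\<^sup>2 + 2 * K\<^sup>2) * (\<integral>s. (\<integral>\<omega>. (norm (?st j s \<omega> - ?st l s \<omega>))\<^sup>2 \<partial>M) \<partial>upto_measure t)
     \<and> integrable (upto_measure t) (\<lambda>s. \<integral>\<omega>. (norm (?st j s \<omega> - ?st l s \<omega>))\<^sup>2 \<partial>M)"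
    if t: "0 \<le> t" "t < real T" for j l t
  proof -
    let ?p = "\<lambda>H j s \<omega>. elementary_process (grid j) (cells T j) (\<lambda>k \<omega>. H *v euler A C v j k \<omega>) s \<omega>"
    let ?f = "\<lambda>s. \<integral>\<omega>. (norm (?st j s \<omega> - ?st l s \<omega>))\<^sup>2 \<partial>M"
    have el: "elementary M F (grid j) N (\<lambda>k \<omega>. H *v euler A C v j k \<omega>)" for H :: "real^'n^'n" and j N
      by (rule elementary_mult_vec(1)[OF euler_elementary])
    have sp: "square_integrable (time_prob t) (\<lambda>(s, \<omega>). ?p H j s \<omega> - ?p H l s \<omega>)" for H :: "real^'n^'n"
      using square_integrable_diff[OF elementary_process_square_integrable[OF el] elementary_process_square_integrable[OF el]]
      by (simp add: case_prod_beta')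
    have pd: "?p H j s \<omega> - ?p H l s \<omega> = H *v (?st j s \<omega> - ?st l s \<omega>)" if "s \<in> space (upto_measure t)"
      for H :: "real^'n^'n" and s \<omega>
      using that t elementary_process_euler_step[of s T _ H A C v]
      by (simp add: space_restrict_space matrix_vector_mult_diff_distrib)
    have sd: "square_integrable M (\<lambda>\<omega>. ?st j s \<omega> - ?st l s \<omega>)" for s by (intro square_integrable_diff st)
    have pd1: "?p (mat 1) j s \<omega> - ?p (mat 1) l s \<omega> = ?st j s \<omega> - ?st l s \<omega>"
      if "s \<in> space (upto_measure t)" for s \<omega>
      unfolding pd[OF that] by (simp only: matrix_vector_mul_lid)
    \<comment> \<open>With \<open>H = mat 1\<close> the step processes themselves are elementary
      processes, which gives integrability in time.\<close>
    have if_: "integrable (upto_measure t) ?f"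
      using time_prob_inner(2)[OF sp[of "mat 1"] sp[of "mat 1"]]
      by (rule Bochner_Integration.integrable_cong[THEN iffD1, rotated -1])
        (simp_all only: pd1 power2_norm_eq_inner)
    have le: "(\<integral>s. (\<integral>\<omega>. (norm (?p H j s \<omega> - ?p H l s \<omega>))\<^sup>2 \<partial>M) \<partial>upto_measure t) \<le> K\<^sup>2 * (\<integral>s. ?f s \<partial>upto_measure t)"
      if H: "\<And>z. norm (H *v z) \<le> K * norm z" for H :: "real^'n^'n"
    proof -
      have "(\<integral>s. (\<integral>\<omega>. (norm (?p H j s \<omega> - ?p H l s \<omega>))\<^sup>2 \<partial>M) \<partial>upto_measure t) \<le> (\<integral>s. K\<^sup>2 * ?f s \<partial>upto_measure t)"
      proof (rule integral_mono)
        show "integrable (upto_measure t) (\<lambda>s. \<integral>\<omega>. (norm (?p H j s \<omega> - ?p H l s \<omega>))\<^sup>2 \<partial>M)"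
          using time_prob_inner(2)[OF sp[of H] sp[of H]] by (simp only: power2_norm_eq_inner)
        fix s assume s: "s \<in> space (upto_measure t)"
        have "(\<integral>\<omega>. (norm (H *v (?st j s \<omega> - ?st l s \<omega>)))\<^sup>2 \<partial>M) \<le> (\<integral>\<omega>. K\<^sup>2 * (norm (?st j s \<omega> - ?st l s \<omega>))\<^sup>2 \<partial>M)"
          by (intro integral_mono integrable_mult_right square_integrableD(2) square_integrable_mult_vec sd
            norm_square_le K(1) H)
        then show "(\<integral>\<omega>. (norm (?p H j s \<omega> - ?p H l s \<omega>))\<^sup>2 \<partial>M) \<le> K\<^sup>2 * ?f s"
          by (simp only: pd[OF s] Bochner_Integration.integral_mult_right_zero)
      qed (use if_ in simp)
      then show ?thesis by simp
    qed
    let ?a = "\<lambda>\<omega>. \<integral>s. ?p A j s \<omega> - ?p A l s \<omega> \<partial>upto_measure t"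
    let ?I = "\<lambda>j. elementary_integral w (grid j) (cells T j) (\<lambda>k \<omega>. C *v euler A C v j k \<omega>) t"
    have eq: "?pa j t \<omega> - ?pa l t \<omega> = ?a \<omega> + (?I j \<omega> - ?I l \<omega>)" for \<omega>
      unfolding euler_path_def
      by (subst Bochner_Integration.integral_diff[OF time_integral_elementary(2)[OF el t(1)] time_integral_elementary(2)[OF el t(1)]])
        simp
    have sI: "square_integrable M (?I j)" for j
      using elementary_integral_adapted[OF el t(1)] by (simp add: adapted_l2_def)
    have saa: "square_integrable M ?a" by (rule square_integrable_time_integral(1)[OF t(1) sp])
    have a: "(\<integral>\<omega>. (norm (?a \<omega>))\<^sup>2 \<partial>M) \<le> real T * (K\<^sup>2 * (\<integral>s. ?f s \<partial>upto_measure t))"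
      using time_integral_square_bound[OF t(1) sp[of A]]
        mult_mono[of t "real T", OF _ le[OF K(2)]] t by (force intro: order_trans)
    have b: "(\<integral>\<omega>. (norm (?I j \<omega> - ?I l \<omega>))\<^sup>2 \<partial>M) \<le> K\<^sup>2 * (\<integral>s. ?f s \<partial>upto_measure t)"
      unfolding elementary_isometry_diff[OF el el t(1)]
      using le[OF K(3)] time_prob_inner(3)[OF sp[of C] sp[of C]] by (simp only: power2_norm_eq_inner)
    have "(\<integral>\<omega>. (norm (?pa j t \<omega> - ?pa l t \<omega>))\<^sup>2 \<partial>M) \<le> (\<integral>\<omega>. 2 * (norm (?a \<omega>))\<^sup>2 + 2 * (norm (?I j \<omega> - ?I l \<omega>))\<^sup>2 \<partial>M)"
      unfolding eq
      by (intro integral_mono norm_add_squares Bochner_Integration.integrable_add integrable_mult_right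
          square_integrableD(2) square_integrable_add square_integrable_diff saa sI)
    also have "\<dots> = 2 * (\<integral>\<omega>. (norm (?a \<omega>))\<^sup>2 \<partial>M) + 2 * (\<integral>\<omega>. (norm (?I j \<omega> - ?I l \<omega>))\<^sup>2 \<partial>M)"
      by (simp only: Bochner_Integration.integral_add integrable_mult_right square_integrableD(2)[OF saa]
          square_integrableD(2)[OF square_integrable_diff[OF sI sI]] Bochner_Integration.integral_mult_right_zero)
    also have "\<dots> \<le> (2 * real T * K\<^sup>2 + 2 * K\<^sup>2) * (\<integral>s. ?f s \<partial>upto_measure t)"
      using a b by (simp add: algebra_simps)
    finally show ?thesis using if_ by blast
  qed
  \<comment> \<open>Two triangle inequalities multiply the constant
    \<open>2 T K\<^sup>2 + 2 K\<^sup>2\<close> by 4; the summand 1 keeps \<open>g\<close> positive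
    when \<open>K = 0\<close>.\<close>
  define g where "g = 8 * (real T + 1) * K\<^sup>2 + 1"
  have g0: "0 < g" unfolding g_def by (intro add_nonneg_pos) auto
  define L where "L = 64 * K\<^sup>2 * B * exp (2 * g * real T)"
  have cauchy: "(\<integral>\<omega>. (norm (?st l t \<omega> - ?st j t \<omega>))\<^sup>2 \<partial>M) \<le> L * (1/2)^j"
    if t: "0 \<le> t" "t < real T" and jl: "j \<le> l" for j l t
  proof -
    define f where "f s = (\<integral>\<omega>. (norm (?st l s \<omega> - ?st j s \<omega>))\<^sup>2 \<partial>M)" for s
    \<comment> \<open>Eight times the distance bound between interpolation and step at the coarser
      level. The triangle inequalities produce that bound with total factor 6.\<close>
    define \<alpha> where "\<alpha> = 32 * K\<^sup>2 * B * (1/2)^j"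
    have jl': "(1/2::real)^l \<le> (1/2)^j" using jl by (intro power_decreasing) auto
    have "f t \<le> 2 * \<alpha> * exp (2 * g * real T)"
    proof (rule gronwall_bound[OF _ _ _ g0 _ t, where B="4 * B"])
      fix s assume s: "0 \<le> s" "s < real T"
      show "integrable (upto_measure s) f" unfolding f_def[abs_def] using pathdiff[OF s] by blast
      have "f s \<le> 2 * (\<integral>\<omega>. (norm (?st l s \<omega> - 0))\<^sup>2 \<partial>M) + 2 * (\<integral>\<omega>. (norm (0 - ?st j s \<omega>))\<^sup>2 \<partial>M)"
        unfolding f_def by (rule square_integral_triangle[OF st square_integrable_zero st])
      then show "f s \<le> 4 * B" using bB[OF s, of l] bB[OF s, of j] by simp
      have p: "square_integrable M (?pa j s)" for j using path[OF s] by blast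
      have le: "(\<integral>\<omega>. (norm (?pa i s \<omega> - ?st i s \<omega>))\<^sup>2 \<partial>M) \<le> 4 * K\<^sup>2 * B * (1/2)^j" if "i = j \<or> i = l" for i
      proof -
        have "4 * K\<^sup>2 * B * (1/2)^i \<le> 4 * K\<^sup>2 * B * (1/2)^j" using that jl' B0 by (intro mult_left_mono) auto
        then show ?thesis using path[OF s, of i] by linarith
      qed
      define X where "X = 4 * K\<^sup>2 * B * (1/2)^j"
      have X0: "0 \<le> X" using B0 by (simp add: X_def)
      have \<alpha>X: "\<alpha> = 8 * X" by (simp add: \<alpha>_def X_def)
      have le4: "i = j \<or> i = l \<Longrightarrow> (\<integral>\<omega>. (norm (?pa i s \<omega> - ?st i s \<omega>))\<^sup>2 \<partial>M) \<le> X" for i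
        unfolding X_def by (rule le)
      have "f s \<le> 2 * (\<integral>\<omega>. (norm (?st l s \<omega> - ?pa l s \<omega>))\<^sup>2 \<partial>M) + 2 * (\<integral>\<omega>. (norm (?pa l s \<omega> - ?st j s \<omega>))\<^sup>2 \<partial>M)"
        unfolding f_def by (rule square_integral_triangle[OF st p st])
      moreover have "(\<integral>\<omega>. (norm (?pa l s \<omega> - ?st j s \<omega>))\<^sup>2 \<partial>M)
        \<le> 2 * (\<integral>\<omega>. (norm (?pa l s \<omega> - ?pa j s \<omega>))\<^sup>2 \<partial>M) + 2 * (\<integral>\<omega>. (norm (?pa j s \<omega> - ?st j s \<omega>))\<^sup>2 \<partial>M)"
        by (rule square_integral_triangle[OF p p st])
      moreover have "(\<integral>\<omega>. (norm (?st l s \<omega> - ?pa l s \<omega>))\<^sup>2 \<partial>M) = (\<integral>\<omega>. (norm (?pa l s \<omega> - ?st l s \<omega>))\<^sup>2 \<partial>M)"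
        by (simp add: norm_minus_commute)
      moreover have "(\<integral>\<omega>. (norm (?pa l s \<omega> - ?pa j s \<omega>))\<^sup>2 \<partial>M) \<le> (2 * real T * K\<^sup>2 + 2 * K\<^sup>2) * (\<integral>r. f r \<partial>upto_measure s)"
        unfolding f_def using pathdiff[OF s] by blast
      ultimately have "f s \<le> \<alpha> + 4 * ((2 * real T * K\<^sup>2 + 2 * K\<^sup>2) * (\<integral>r. f r \<partial>upto_measure s))"
        using le4[of j] le4[of l] X0 \<alpha>X by simp
      also have "4 * ((2 * real T * K\<^sup>2 + 2 * K\<^sup>2) * (\<integral>r. f r \<partial>upto_measure s)) = (g - 1) * (\<integral>r. f r \<partial>upto_measure s)"
        by (simp add: g_def algebra_simps)
      also have "\<dots> \<le> g * (\<integral>r. f r \<partial>upto_measure s)"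
        by (intro mult_right_mono) (auto simp: f_def)
      finally show "f s \<le> \<alpha> + g * (\<integral>r. f r \<partial>upto_measure s)" by simp
    qed (auto simp: f_def)
    then show ?thesis by (simp add: f_def \<alpha>_def L_def mult_ac)
  qed
  show thesis
  proof (rule that[of "B + 4 * K\<^sup>2 * B + L"])
    have L0: "0 \<le> L" "0 \<le> 4 * K\<^sup>2 * B" using B0 by (auto simp: L_def)
    show "0 \<le> B + 4 * K\<^sup>2 * B + L" using L0 B0 by simp
    fix j l :: nat and t :: real assume t: "0 \<le> t" "t < real T"
    show "(\<integral>\<omega>. (norm (?st j t \<omega>))\<^sup>2 \<partial>M) \<le> B + 4 * K\<^sup>2 * B + L" using bB[OF t, of j] L0 by linarith
    show "square_integrable M (?pa j t)" using path[OF t] by blast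
    have "4 * K\<^sup>2 * B * (1/2)^j \<le> (B + 4 * K\<^sup>2 * B + L) * (1/2)^j" "L * (1/2)^j \<le> (B + 4 * K\<^sup>2 * B + L) * (1/2)^j"
      using L0 B0 by (intro mult_right_mono; simp)+
    then show "(\<integral>\<omega>. (norm (?pa j t \<omega> - ?st j t \<omega>))\<^sup>2 \<partial>M) \<le> (B + 4 * K\<^sup>2 * B + L) * (1/2)^j"
      "j \<le> l \<Longrightarrow> (\<integral>\<omega>. (norm (?st l t \<omega> - ?st j t \<omega>))\<^sup>2 \<partial>M) \<le> (B + 4 * K\<^sup>2 * B + L) * (1/2)^j"
      using path[OF t, of j] cauchy[OF t, of j l] by linarith+
  qed
qed

end

section \<open>The limit of the scheme solves the equation\<close>

context wiener_space
begin

text \<open>A pointwise limit rather than a limit in the mean: it is jointly measurable and adapted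
  without choosing versions. No horizon enters, so one process serves for all times.\<close>

definition euler_limit :: "real^'n^'n \<Rightarrow> real^'n^'n \<Rightarrow> real^'n \<Rightarrow> real \<Rightarrow> 'w \<Rightarrow> real^'n" where
  "euler_limit A C v t \<omega> = lim (\<lambda>j. euler_step A C v j t \<omega>)"

lemma euler_limit_adapted:
  assumes "0 \<le> t" shows "euler_limit A C v t \<in> borel_measurable (F t)"
  unfolding euler_limit_def[abs_def]
  using euler_step_adapted[OF assms, of A C v] unfolding adapted_l2_def
  by (intro borel_measurable_lim_metric) auto

lemma euler_limit_jointly_measurable: "jointly_measurable M (euler_limit A C v)"
proof -
  have "(\<lambda>p. euler_step A C v j (fst p) (snd p)) \<in> borel_measurable (restrict_space borel {0..} \<Otimes>\<^sub>M M)" for j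
    unfolding euler_step_def
  proof (rule measurable_compose_countable)
    show "(\<lambda>p. euler A C v j k (snd p)) \<in> borel_measurable (restrict_space borel {0..} \<Otimes>\<^sub>M M)" for k
      using square_integrableD(1)[OF euler_square_integrable] by (rule measurable_compose[OF measurable_snd])
    have "(\<lambda>s. s) \<in> borel_measurable (restrict_space borel {0..})" by (rule measurable_restrict_space1) simp
    then have "grid_index j \<in> restrict_space borel {0..} \<rightarrow>\<^sub>M count_space UNIV"
      unfolding grid_index_def[abs_def] by measurable
    then show "(\<lambda>p. grid_index j (fst p)) \<in> restrict_space borel {0..} \<Otimes>\<^sub>M M \<rightarrow>\<^sub>M count_space UNIV"
      by (rule measurable_compose[OF measurable_fst])
  qed
  then show ?thesis
    unfolding jointly_measurable_def euler_limit_def case_prod_beta'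
    by (intro borel_measurable_lim_metric) auto
qed

lemma euler_limit_estimates:
  fixes A C :: "real^'n^'n" and v :: "real^'n"
  obtains L where "0 \<le> L"
    "\<And>t. 0 \<le> t \<Longrightarrow> t < real T \<Longrightarrow> square_integrable M (euler_limit A C v t)"
    "\<And>t. 0 \<le> t \<Longrightarrow> t < real T \<Longrightarrow> (\<integral>\<omega>. (norm (euler_limit A C v t \<omega>))\<^sup>2 \<partial>M) \<le> L"
    "\<And>j t. 0 \<le> t \<Longrightarrow> t < real T \<Longrightarrow>
       (\<integral>\<omega>. (norm (euler_limit A C v t \<omega> - euler_step A C v j t \<omega>))\<^sup>2 \<partial>M) \<le> L * (1/2)^j"
    "\<And>j t. 0 \<le> t \<Longrightarrow> t < real T \<Longrightarrow> square_integrable M (euler_path T A C v j t) \<and>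
       (\<integral>\<omega>. (norm (euler_limit A C v t \<omega> - euler_path T A C v j t \<omega>))\<^sup>2 \<partial>M) \<le> L * (1/2)^j"
proof -
  obtain L where L: "0 \<le> L"
    "\<And>j t. 0 \<le> t \<Longrightarrow> t < real T \<Longrightarrow> (\<integral>\<omega>. (norm (euler_step A C v j t \<omega>))\<^sup>2 \<partial>M) \<le> L"
    "\<And>j t. 0 \<le> t \<Longrightarrow> t < real T \<Longrightarrow>
       (\<integral>\<omega>. (norm (euler_path T A C v j t \<omega> - euler_step A C v j t \<omega>))\<^sup>2 \<partial>M) \<le> L * (1/2)^j"
    "\<And>j l t. 0 \<le> t \<Longrightarrow> t < real T \<Longrightarrow> j \<le> l \<Longrightarrow>
       (\<integral>\<omega>. (norm (euler_step A C v l t \<omega> - euler_step A C v j t \<omega>))\<^sup>2 \<partial>M) \<le> L * (1/2)^j"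
    "\<And>j t. 0 \<le> t \<Longrightarrow> t < real T \<Longrightarrow> square_integrable M (euler_path T A C v j t)"
    by (rule euler_estimates[of T A C v], rule that)
  show thesis
  proof (rule that[of "4 * L"])
    show "0 \<le> 4 * L" using L(1) by simp
    fix t :: real assume t: "0 \<le> t" "t < real T"
    note st = euler_step_square_integrable[of A C v]
    note lc = l2_complete[OF st[where t=t] L(4)[OF t], folded euler_limit_def]
    show s: "square_integrable M (euler_limit A C v t)" using lc(2) by (simp add: euler_limit_def[abs_def])
    have "(\<integral>\<omega>. (norm (euler_limit A C v t \<omega> - 0))\<^sup>2 \<partial>M)
      \<le> 2 * (\<integral>\<omega>. (norm (euler_limit A C v t \<omega> - euler_step A C v 0 t \<omega>))\<^sup>2 \<partial>M) + 2 * (\<integral>\<omega>. (norm (euler_step A C v 0 t \<omega> - 0))\<^sup>2 \<partial>M)"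
      by (rule square_integral_triangle[OF s st square_integrable_zero])
    then show "(\<integral>\<omega>. (norm (euler_limit A C v t \<omega>))\<^sup>2 \<partial>M) \<le> 4 * L"
      using lc(3)[of 0] L(2)[OF t, of 0] by simp
    fix j :: nat
    have p: "0 \<le> L * (1/2)^j" using L(1) by simp
    show "(\<integral>\<omega>. (norm (euler_limit A C v t \<omega> - euler_step A C v j t \<omega>))\<^sup>2 \<partial>M) \<le> 4 * L * (1/2)^j"
      using lc(3)[of j] p by linarith
    have "(\<integral>\<omega>. (norm (euler_limit A C v t \<omega> - euler_path T A C v j t \<omega>))\<^sup>2 \<partial>M)
      \<le> 2 * (\<integral>\<omega>. (norm (euler_limit A C v t \<omega> - euler_step A C v j t \<omega>))\<^sup>2 \<partial>M)
        + 2 * (\<integral>\<omega>. (norm (euler_step A C v j t \<omega> - euler_path T A C v j t \<omega>))\<^sup>2 \<partial>M)"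
      by (rule square_integral_triangle[OF s st L(5)[OF t]])
    moreover have "(\<integral>\<omega>. (norm (euler_step A C v j t \<omega> - euler_path T A C v j t \<omega>))\<^sup>2 \<partial>M) \<le> L * (1/2)^j"
      using L(3)[OF t, of j] by (simp only: norm_minus_commute)
    ultimately show "square_integrable M (euler_path T A C v j t) \<and>
       (\<integral>\<omega>. (norm (euler_limit A C v t \<omega> - euler_path T A C v j t \<omega>))\<^sup>2 \<partial>M) \<le> 4 * L * (1/2)^j"
      using lc(3)[of j] L(5)[OF t] by auto
  qed
qed

lemma euler_limit_nn_integral:
  assumes "square_integrable M f" "(\<integral>\<omega>. (norm (f \<omega>))\<^sup>2 \<partial>M) \<le> B"
  shows "(\<integral>\<^sup>+\<omega>. ennreal ((norm (f \<omega>))\<^sup>2) \<partial>M) \<le> ennreal B"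
  unfolding nn_integral_square_integrable[OF assms(1)] by (rule ennreal_leI[OF assms(2)])

lemma nn_integral_time_bound:
  assumes t: "0 \<le> t" and B: "0 \<le> B" and le: "\<And>s. 0 \<le> s \<Longrightarrow> s \<le> t \<Longrightarrow> f s \<le> ennreal B"
  shows "(\<integral>\<^sup>+s\<in>{0..t}. f s \<partial>lborel) \<le> ennreal (B * t)"
proof -
  have "(\<integral>\<^sup>+s\<in>{0..t}. f s \<partial>lborel) \<le> (\<integral>\<^sup>+s. ennreal B * indicator {0..t} s \<partial>lborel)"
    using le by (intro nn_integral_mono) (auto simp: indicator_def)
  also have "\<dots> = ennreal B * ennreal t" using t by (simp add: nn_integral_cmult_indicator)
  also have "\<dots> = ennreal (B * t)" by (rule ennreal_mult[OF B t, symmetric])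
  finally show ?thesis .
qed

lemma tendsto_zero_ennreal_bound:
  assumes "\<And>j. f j \<le> ennreal (B * (1/2)^j)"
  shows "f \<longlonglongrightarrow> 0"
proof (rule tendsto_sandwich[OF _ _ tendsto_const])
  have "(\<lambda>j. B * (1/2)^j) \<longlonglongrightarrow> B * 0"
    by (intro tendsto_mult tendsto_const LIMSEQ_realpow_zero) auto
  then show "(\<lambda>j. ennreal (B * (1/2)^j)) \<longlonglongrightarrow> 0" using tendsto_ennrealI by fastforce
qed (use assms in \<open>auto intro: always_eventually\<close>)

text \<open>The Euler coefficients, multiplied by \<open>C\<close>, are the elementary integrands
  that the definition of the Ito integral asks for; their integrals converge because interpolation
  and drift integral do. The control is zero, so \<open>b\<close> is arbitrary.\<close>

theorem ito_solution_exists: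
  fixes A C :: "real^'n^'n" and b :: "real^'m^'n" and v :: "real^'n"
  shows "ito_solution M F w A b C (\<lambda>\<omega>. v) (\<lambda>_. 0) (euler_limit A C v)"
  unfolding ito_solution_def
proof (intro conjI allI impI)
  let ?x = "euler_limit A C v"
  show "jointly_measurable M ?x" by (rule euler_limit_jointly_measurable)
  fix t :: real assume t: "0 \<le> t"
  show "?x t \<in> borel_measurable (F t)" by (rule euler_limit_adapted[OF t])
  obtain T :: nat where T: "t < real T" using reals_Archimedean2 by blast
  obtain L where L: "0 \<le> L"
    "\<And>t. 0 \<le> t \<Longrightarrow> t < real T \<Longrightarrow> square_integrable M (?x t)"
    "\<And>t. 0 \<le> t \<Longrightarrow> t < real T \<Longrightarrow> (\<integral>\<omega>. (norm (?x t \<omega>))\<^sup>2 \<partial>M) \<le> L"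
    "\<And>j t. 0 \<le> t \<Longrightarrow> t < real T \<Longrightarrow>
       (\<integral>\<omega>. (norm (?x t \<omega> - euler_step A C v j t \<omega>))\<^sup>2 \<partial>M) \<le> L * (1/2)^j"
    "\<And>j t. 0 \<le> t \<Longrightarrow> t < real T \<Longrightarrow> square_integrable M (euler_path T A C v j t) \<and>
       (\<integral>\<omega>. (norm (?x t \<omega> - euler_path T A C v j t \<omega>))\<^sup>2 \<partial>M) \<le> L * (1/2)^j"
    by (rule euler_limit_estimates[of T A C v], rule that)
  note st = euler_step_square_integrable[of A C v]
  have fin: "(\<integral>\<^sup>+s\<in>{0..t}. (\<integral>\<^sup>+\<omega>. ennreal ((norm (?x s \<omega>))\<^sup>2) \<partial>M) \<partial>lborel) \<le> ennreal (L * t)"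
    by (rule nn_integral_time_bound[OF t L(1)]) (use T in \<open>auto intro!: euler_limit_nn_integral L\<close>)
  then show "(\<integral>\<^sup>+s\<in>{0..t}. (\<integral>\<^sup>+\<omega>. ennreal ((norm (?x s \<omega>))\<^sup>2) \<partial>M) \<partial>lborel) < \<infinity>"
    by (rule le_less_trans) simp
  have xm: "(\<lambda>(s, \<omega>). ?x s \<omega>) \<in> borel_measurable (time_prob t)"
    by (rule jointly_measurable_time_prob[OF euler_limit_jointly_measurable])
  have xs: "square_integrable (time_prob t) (\<lambda>(s, \<omega>). ?x s \<omega>)"
    unfolding square_integrable_iff_nn_integral[OF xm]
    using order_trans[OF time_prob_nn_integral[OF xm] fin] by (rule le_less_trans) simp
  have Axs: "square_integrable (time_prob t) (\<lambda>(s, \<omega>). A *v ?x s \<omega>)"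
    using square_integrable_mult_vec[OF xs, of A] by (simp add: case_prod_beta')
  obtain K where K: "0 \<le> K" "\<And>z. norm (A *v z) \<le> K * norm z"
    using matrix_vector_bound[of A] by blast
  obtain KC where KC: "0 \<le> KC" "\<And>z. norm (C *v z) \<le> KC * norm z"
    using matrix_vector_bound[of C] by blast
  have mbound: "square_integrable M (\<lambda>\<omega>. D *v (?x s \<omega> - euler_step A C v j s \<omega>)) \<and>
    (\<integral>\<omega>. (norm (D *v (?x s \<omega> - euler_step A C v j s \<omega>)))\<^sup>2 \<partial>M) \<le> k\<^sup>2 * L * (1/2)^j"
    if s: "0 \<le> s" "s \<le> t" and D: "0 \<le> k" "\<And>z. norm (D *v z) \<le> k * norm z" for D :: "real^'n^'n" and s k j
  proof -
    have sT: "s < real T" using s T by simp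
    have sd: "square_integrable M (\<lambda>\<omega>. ?x s \<omega> - euler_step A C v j s \<omega>)"
      by (intro square_integrable_diff L(2)[OF s(1) sT] st)
    have "(\<integral>\<omega>. (norm (D *v (?x s \<omega> - euler_step A C v j s \<omega>)))\<^sup>2 \<partial>M)
       \<le> (\<integral>\<omega>. k\<^sup>2 * (norm (?x s \<omega> - euler_step A C v j s \<omega>))\<^sup>2 \<partial>M)"
      by (intro integral_mono integrable_mult_right square_integrableD(2) square_integrable_mult_vec sd
          norm_square_le D)
    also have "\<dots> \<le> k\<^sup>2 * (L * (1/2)^j)"
      unfolding Bochner_Integration.integral_mult_right_zero
      by (intro mult_left_mono L(4)[OF s(1) sT]) simp
    finally show ?thesis using square_integrable_mult_vec[OF sd, of D] by (simp add: mult.assoc)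
  qed
  have el: "elementary M F (grid j) (cells T j) (\<lambda>k \<omega>. D *v euler A C v j k \<omega>)" for D :: "real^'n^'n" and j
    by (rule elementary_mult_vec(1)[OF euler_elementary])
  let ?p = "\<lambda>D j s \<omega>. elementary_process (grid j) (cells T j) (\<lambda>k \<omega>. D *v euler A C v j k \<omega>) s \<omega>"
  have pd: "D *v ?x s \<omega> - ?p D j s \<omega> = D *v (?x s \<omega> - euler_step A C v j s \<omega>)"
    if "0 \<le> s" "s \<le> t" for D :: "real^'n^'n" and j s \<omega>
    using that T elementary_process_euler_step[of s T j D A C v \<omega>] by (simp add: matrix_vector_mult_diff_distrib)
  let ?a = "\<lambda>\<omega>. \<integral>s. A *v ?x s \<omega> \<partial>upto_measure t"
  \<comment> \<open>The candidate for the stochastic integral is what remains of the equation, so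
    the equation holds by construction and only the convergence of the integrals must be
    shown.\<close>
  define J where "J \<omega> = ?x t \<omega> - v - ?a \<omega>" for \<omega>
  have sa: "square_integrable M ?a" by (rule square_integrable_time_integral(1)[OF t Axs])
  have sJ: "square_integrable M J"
    unfolding J_def[abs_def]
    by (intro square_integrable_diff L(2) t T sa square_integrable_const finite_measure_axioms)
  let ?I = "\<lambda>j. elementary_integral w (grid j) (cells T j) (\<lambda>k \<omega>. C *v euler A C v j k \<omega>) t"
  have sI: "square_integrable M (?I j)" for j
    using elementary_integral_adapted[OF el t] by (simp add: adapted_l2_def)
  have "(\<integral>\<omega>. (norm (J \<omega> - ?I j \<omega>))\<^sup>2 \<partial>M) \<le> (2 * L + 2 * (t * (t * (K\<^sup>2 * L)))) * (1/2)^j" for j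
  proof -
    have spp: "square_integrable (time_prob t) (\<lambda>(s, \<omega>). A *v ?x s \<omega> - ?p A j s \<omega>)"
      using square_integrable_diff[OF Axs elementary_process_square_integrable[OF el]]
      by (simp add: case_prod_beta')
    let ?d = "\<lambda>\<omega>. \<integral>s. A *v ?x s \<omega> - ?p A j s \<omega> \<partial>upto_measure t"
    let ?e = "\<lambda>\<omega>. ?x t \<omega> - euler_path T A C v j t \<omega>"
    have sd: "square_integrable M ?d" by (rule square_integrable_time_integral(1)[OF t spp])
    have se: "square_integrable M ?e" using L(2,5)[OF t T] by auto
    have i1: "integrable (upto_measure t) (\<lambda>s. \<integral>\<omega>. (norm (A *v ?x s \<omega> - ?p A j s \<omega>))\<^sup>2 \<partial>M)"
      using time_prob_inner(2)[OF spp spp] by (simp only: power2_norm_eq_inner)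
    have "(\<integral>s. (\<integral>\<omega>. (norm (A *v ?x s \<omega> - ?p A j s \<omega>))\<^sup>2 \<partial>M) \<partial>upto_measure t)
      \<le> (\<integral>s. K\<^sup>2 * L * (1/2)^j \<partial>upto_measure t)"
    proof (rule integral_mono[OF i1])
      show "integrable (upto_measure t) (\<lambda>s. K\<^sup>2 * L * (1/2)^j)" by (simp add: finite_measure.integrable_const)
      fix s assume "s \<in> space (upto_measure t)"
      then have s: "0 \<le> s" "s \<le> t" by (auto simp: space_restrict_space)
      show "(\<integral>\<omega>. (norm (A *v ?x s \<omega> - ?p A j s \<omega>))\<^sup>2 \<partial>M) \<le> K\<^sup>2 * L * (1/2)^j"
        unfolding pd[OF s] using mbound[OF s K] by blast
    qed
    also have "\<dots> = t * (K\<^sup>2 * L * (1/2)^j)" using upto_measure_measure[OF t] by simp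
    finally have "t * (\<integral>s. (\<integral>\<omega>. (norm (A *v ?x s \<omega> - ?p A j s \<omega>))\<^sup>2 \<partial>M) \<partial>upto_measure t)
        \<le> t * (t * (K\<^sup>2 * L * (1/2)^j))" by (rule mult_left_mono[OF _ t])
    with time_integral_square_bound[OF t spp]
    have d: "(\<integral>\<omega>. (norm (?d \<omega>))\<^sup>2 \<partial>M) \<le> t * (t * (K\<^sup>2 * L * (1/2)^j))" by linarith
    have e: "(\<integral>\<omega>. (norm (?e \<omega>))\<^sup>2 \<partial>M) \<le> L * (1/2)^j" using L(5)[OF t T] by blast
    \<comment> \<open>The error of the stochastic integral is the error of the interpolation minus
      the integrated error of the drift.\<close>
    have ae: "AE \<omega> in M. J \<omega> - ?I j \<omega> = ?e \<omega> + (- ?d \<omega>)"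
      using AE_section_square_integrable(1)[OF Axs]
    proof eventually_elim
      case (elim \<omega>)
      then have "integrable (upto_measure t) (\<lambda>s. A *v ?x s \<omega>)" by (simp add: integrable_of_square_integrable)
      then show ?case
        unfolding J_def euler_path_def
        by (subst Bochner_Integration.integral_diff[OF _ time_integral_elementary(2)[OF el t]]) auto
    qed
    have "(\<integral>\<omega>. (norm (J \<omega> - ?I j \<omega>))\<^sup>2 \<partial>M) \<le> (\<integral>\<omega>. 2 * (norm (?e \<omega>))\<^sup>2 + 2 * (norm (- ?d \<omega>))\<^sup>2 \<partial>M)"
    proof (rule integral_mono_AE)
      show "integrable M (\<lambda>\<omega>. (norm (J \<omega> - ?I j \<omega>))\<^sup>2)"
        by (intro square_integrableD(2) square_integrable_diff sJ sI)
      show "integrable M (\<lambda>\<omega>. 2 * (norm (?e \<omega>))\<^sup>2 + 2 * (norm (- ?d \<omega>))\<^sup>2)"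
        by (intro Bochner_Integration.integrable_add integrable_mult_right square_integrableD(2) se
            square_integrable_minus sd)
      show "AE \<omega> in M. (norm (J \<omega> - ?I j \<omega>))\<^sup>2 \<le> 2 * (norm (?e \<omega>))\<^sup>2 + 2 * (norm (- ?d \<omega>))\<^sup>2"
        using ae by eventually_elim (simp only: norm_add_squares)
    qed
    also have "\<dots> = 2 * (\<integral>\<omega>. (norm (?e \<omega>))\<^sup>2 \<partial>M) + 2 * (\<integral>\<omega>. (norm (?d \<omega>))\<^sup>2 \<partial>M)"
      by (simp only: norm_minus_cancel Bochner_Integration.integral_add integrable_mult_right
          square_integrableD(2)[OF se] square_integrableD(2)[OF sd] Bochner_Integration.integral_mult_right_zero)
    also have "\<dots> \<le> 2 * (L * (1/2)^j) + 2 * (t * (t * (K\<^sup>2 * L * (1/2)^j)))" using d e by linarith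
    also have "\<dots> = (2 * L + 2 * (t * (t * (K\<^sup>2 * L)))) * (1/2)^j" by (simp only: algebra_simps)
    finally show ?thesis .
  qed
  then have lJ: "(\<lambda>j. \<integral>\<^sup>+\<omega>. ennreal ((norm (J \<omega> - ?I j \<omega>))\<^sup>2) \<partial>M) \<longlonglongrightarrow> 0"
    by (intro tendsto_zero_ennreal_bound euler_limit_nn_integral square_integrable_diff sJ sI)
  have "(\<integral>\<^sup>+s\<in>{0..t}. (\<integral>\<^sup>+\<omega>. ennreal ((norm (C *v ?x s \<omega> - ?p C j s \<omega>))\<^sup>2) \<partial>M) \<partial>lborel)
     \<le> ennreal (KC\<^sup>2 * L * t * (1/2)^j)" for j
  proof -
    have "(\<integral>\<^sup>+s\<in>{0..t}. (\<integral>\<^sup>+\<omega>. ennreal ((norm (C *v ?x s \<omega> - ?p C j s \<omega>))\<^sup>2) \<partial>M) \<partial>lborel)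
       \<le> ennreal (KC\<^sup>2 * L * (1/2)^j * t)"
    proof (rule nn_integral_time_bound[OF t])
      show "0 \<le> KC\<^sup>2 * L * (1/2)^j" using L(1) by simp
      fix s :: real assume s: "0 \<le> s" "s \<le> t"
      show "(\<integral>\<^sup>+\<omega>. ennreal ((norm (C *v ?x s \<omega> - ?p C j s \<omega>))\<^sup>2) \<partial>M) \<le> ennreal (KC\<^sup>2 * L * (1/2)^j)"
        unfolding pd[OF s] using mbound[OF s KC] by (intro euler_limit_nn_integral) blast+
    qed
    then show ?thesis by (simp only: mult_ac)
  qed
  then have lC: "(\<lambda>j. \<integral>\<^sup>+s\<in>{0..t}. (\<integral>\<^sup>+\<omega>. ennreal ((norm (C *v ?x s \<omega> - ?p C j s \<omega>))\<^sup>2) \<partial>M) \<partial>lborel) \<longlonglongrightarrow> 0"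
    by (rule tendsto_zero_ennreal_bound)
  have jC: "jointly_measurable M (\<lambda>s \<omega>. C *v ?x s \<omega>)"
    using euler_limit_jointly_measurable[of A C v] unfolding jointly_measurable_def case_prod_beta'
    by (intro borel_measurable_continuous_on[where f="\<lambda>z. C *v z"] linear_continuous_on bounded_linear_matrix_vector)
  have "has_ito_integral M F w (\<lambda>s \<omega>. C *v ?x s \<omega>) t J"
    unfolding has_ito_integral_def
    using jC square_integrableD(1)[OF sJ] el[of _ C] lC lJ
    by (intro conjI exI[of _ grid] exI[of _ "cells T"] exI[of _ "\<lambda>j k \<omega>. C *v euler A C v j k \<omega>"]) auto
  moreover have "?x t \<omega> = v + (LINT s:{0<..t}|lborel. A *v ?x s \<omega> + b *v 0) + J \<omega>" for \<omega>
    unfolding J_def upto_integral set_lebesgue_integral_def by simp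
  ultimately show "\<exists>J. has_ito_integral M F w (\<lambda>s \<omega>. C *v ?x s \<omega>) t J \<and>
      (AE \<omega> in M. ?x t \<omega> = v + (LINT s:{0<..t}|lborel. A *v ?x s \<omega> + b *v 0) + J \<omega>)"
    by blast
qed

text \<open>A constant generates the trivial sigma-algebra, which is independent of every other
  one.\<close>

lemma initial_state_const: "initial_state M F w (\<lambda>\<omega>. v)"
proof -
  have sq: "square_integrable M (\<lambda>\<omega>. v)" by (rule square_integrable_const[OF finite_measure_axioms])
  have "indep_set (sets (vimage_algebra (space M) (\<lambda>\<omega>. v) borel))
       (sigma_sets (space M) (\<Union>t\<in>{0..}. sets (vimage_algebra (space M) (w t) borel)))"
  proof (rule indep_setI)
    have triv: "a = {} \<or> a = space M" if "a \<in> sets (vimage_algebra (space M) (\<lambda>\<omega>. v) borel)" for a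
    proof -
      have vf: "(\<lambda>\<omega>. v) \<in> space M \<rightarrow> space borel" by simp
      from that obtain B where "a = (\<lambda>\<omega>. v) -` B \<inter> space M"
        unfolding sets_vimage_algebra2[OF vf] by auto
      then show ?thesis by (cases "v \<in> B") auto
    qed
    show "sets (vimage_algebra (space M) (\<lambda>\<omega>. v) borel) \<subseteq> events" using triv by auto
    show *: "sigma_sets (space M) (\<Union>t\<in>{0..}. sets (vimage_algebra (space M) (w t) borel)) \<subseteq> events"
    proof (rule sets.sigma_sets_subset, rule UN_least)
      fix t :: real assume "t \<in> {0..}"
      then have "w t \<in> borel_measurable M" using w_measurable_M by simp
      then show "sets (vimage_algebra (space M) (w t) borel) \<subseteq> events"
        by (subst sets_vimage_algebra2) (auto intro: measurable_sets)
    qed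
    fix a b assume a: "a \<in> sets (vimage_algebra (space M) (\<lambda>\<omega>. v) borel)"
      and b: "b \<in> sigma_sets (space M) (\<Union>t\<in>{0..}. sets (vimage_algebra (space M) (w t) borel))"
    have "b \<in> events" using b * by blast
    then have "space M \<inter> b = b" using sets.sets_into_space by blast
    then show "prob (a \<inter> b) = prob a * prob b" using triv[OF a] by (auto simp: prob_space)
  qed
  then show ?thesis using sq unfolding initial_state_def by auto
qed

end

section \<open>The Parseval identity for cosine and sine transforms\<close>

definition cos_transform :: "(real \<Rightarrow> real) \<Rightarrow> real \<Rightarrow> real" where
  "cos_transform f \<nu> = (\<integral>t. cos (\<nu> * t) * f t \<partial>lborel)"

definition sin_transform :: "(real \<Rightarrow> real) \<Rightarrow> real \<Rightarrow> real" where
  "sin_transform f \<nu> = (\<integral>t. sin (\<nu> * t) * f t \<partial>lborel)"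

lemma integrable_bounded_mult:
  fixes f c :: "'a \<Rightarrow> real"
  assumes "integrable M f" "c \<in> borel_measurable M" "\<And>t. \<bar>c t\<bar> \<le> B"
  shows "integrable M (\<lambda>t. c t * f t)"
proof (rule Bochner_Integration.integrable_bound)
  show "integrable M (\<lambda>t. B * f t)" using assms(1) by simp
  show "(\<lambda>t. c t * f t) \<in> borel_measurable M" using assms by auto
  have "\<bar>c t\<bar> \<le> \<bar>B\<bar>" for t using assms(3)[of t] by linarith
  then show "AE t in M. norm (c t * f t) \<le> norm (B * f t)"
    by (auto simp: abs_mult intro!: mult_right_mono)
qed

lemma integral_bounded_mult_le:
  fixes f c :: "'a \<Rightarrow> real"
  assumes "integrable M f" "c \<in> borel_measurable M" "\<And>t. \<bar>c t\<bar> \<le> B"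
  shows "\<bar>\<integral>t. c t * f t \<partial>M\<bar> \<le> B * (\<integral>t. \<bar>f t\<bar> \<partial>M)"
proof -
  have "\<bar>\<integral>t. c t * f t \<partial>M\<bar> \<le> (\<integral>t. \<bar>c t * f t\<bar> \<partial>M)" by (rule integral_abs_bound)
  also have "\<dots> \<le> (\<integral>t. B * \<bar>f t\<bar> \<partial>M)"
    using assms by (intro integral_mono integrable_abs integrable_bounded_mult[OF assms])
      (auto simp: abs_mult intro!: mult_right_mono)
  finally show ?thesis by simp
qed

lemma
  assumes f: "integrable lborel f"
  shows cos_transform_measurable: "cos_transform f \<in> borel_measurable borel"
    and sin_transform_measurable: "sin_transform f \<in> borel_measurable borel"
    and cos_transform_bound: "\<bar>cos_transform f \<nu>\<bar> \<le> (\<integral>t. \<bar>f t\<bar> \<partial>lborel)"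
    and sin_transform_bound: "\<bar>sin_transform f \<nu>\<bar> \<le> (\<integral>t. \<bar>f t\<bar> \<partial>lborel)"
proof -
  have [measurable]: "f \<in> borel_measurable borel" using f by auto
  show "cos_transform f \<in> borel_measurable borel" "sin_transform f \<in> borel_measurable borel"
    unfolding cos_transform_def[abs_def] sin_transform_def[abs_def] by measurable
  show "\<bar>cos_transform f \<nu>\<bar> \<le> (\<integral>t. \<bar>f t\<bar> \<partial>lborel)" "\<bar>sin_transform f \<nu>\<bar> \<le> (\<integral>t. \<bar>f t\<bar> \<partial>lborel)"
    unfolding cos_transform_def sin_transform_def
    using integral_bounded_mult_le[OF f, of "\<lambda>t. cos (\<nu> * t)" 1]
      integral_bounded_mult_le[OF f, of "\<lambda>t. sin (\<nu> * t)" 1] by auto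
qed

text \<open>The real part of the characteristic function of the standard normal
  distribution.\<close>

lemma cos_std_normal: "(\<integral>x. cos (r * x) * std_normal_density x \<partial>lborel) = exp (- r\<^sup>2 / 2)"
proof -
  interpret prob_space std_normal_distribution
    by (rule prob_space_normal_density) simp
  have "(\<integral>x. cos (r * x) * std_normal_density x \<partial>lborel) = (\<integral>x. cos (r * x) \<partial>std_normal_distribution)"
    by (subst integral_density) (auto simp: mult.commute)
  also have "\<dots> = (\<integral>x. Re (iexp (r * x)) \<partial>std_normal_distribution)"
    by (simp add: Re_exp)
  also have "\<dots> = Re (char std_normal_distribution r)"
    unfolding char_def
    by (rule integral_Re) (rule integrable_const_bound[where B=1]; simp)
  also have "\<dots> = exp (- r\<^sup>2 / 2)" by (simp add: char_std_normal_distribution)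
  finally show ?thesis .
qed

definition gauss_weight :: "real \<Rightarrow> real \<Rightarrow> real" where
  "gauss_weight \<sigma> \<nu> = exp (- (\<sigma> * \<nu>)\<^sup>2 / 2)"

lemma gauss_weight_std_normal: "gauss_weight \<sigma> \<nu> = sqrt (2 * pi) * std_normal_density (\<sigma> * \<nu>)"
  by (simp add: gauss_weight_def std_normal_density_def)

lemma gauss_weight_integrable: "0 < \<sigma> \<Longrightarrow> integrable lborel (gauss_weight \<sigma>)"
proof -
  assume s: "0 < \<sigma>"
  have "integrable lborel (\<lambda>x. std_normal_density (0 + \<sigma> * x))"
    by (subst lborel_integrable_real_affine_iff) (use s in auto)
  then show ?thesis unfolding gauss_weight_std_normal[abs_def] by simp
qed

text \<open>The transform of the weight is \<open>2 * pi\<close> times the normal density of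
  deviation \<open>\<sigma>\<close>, an approximate identity as \<open>\<sigma>\<close> tends to
  0.\<close>

lemma gauss_weight_cos:
  assumes s: "0 < \<sigma>"
  shows "(\<integral>\<nu>. cos (\<nu> * r) * gauss_weight \<sigma> \<nu> \<partial>lborel) = 2 * pi * (std_normal_density (r / \<sigma>) / \<sigma>)"
proof -
  have "(\<integral>\<nu>. cos (\<nu> * r) * gauss_weight \<sigma> \<nu> \<partial>lborel)
    = \<bar>1 / \<sigma>\<bar> *\<^sub>R (\<integral>x. cos ((0 + (1/\<sigma>) * x) * r) * gauss_weight \<sigma> (0 + (1/\<sigma>) * x) \<partial>lborel)"
    by (rule lborel_integral_real_affine) (use s in auto)
  also have "\<dots> = (1 / \<sigma>) * (\<integral>x. sqrt (2 * pi) * (cos ((r / \<sigma>) * x) * std_normal_density x) \<partial>lborel)"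
    using s by (simp add: gauss_weight_std_normal mult_ac)
  also have "\<dots> = (1 / \<sigma>) * (sqrt (2 * pi) * exp (- (r / \<sigma>)\<^sup>2 / 2))"
    by (simp only: Bochner_Integration.integral_mult_right_zero cos_std_normal)
  also have "\<dots> = 2 * pi * (std_normal_density (r / \<sigma>) / \<sigma>)"
  proof -
    have k1: "2 * pi * (1 / sqrt (2 * pi)) = sqrt (2 * pi)"
      using real_div_sqrt[of "2 * pi"] by simp
    have k2: "2 * pi * (std_normal_density (r / \<sigma>) / \<sigma>)
      = (2 * pi * (1 / sqrt (2 * pi))) * exp (- (r / \<sigma>)\<^sup>2 / 2) / \<sigma>"
      by (simp add: std_normal_density_def)
    show ?thesis unfolding k2 k1 by simp
  qed
  finally show ?thesis .
qed

text \<open>The real part of the Fourier transform of \<open>f\<close> times the conjugate of that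
  of \<open>g\<close>.\<close>

definition spectral_product :: "(real \<Rightarrow> real) \<Rightarrow> (real \<Rightarrow> real) \<Rightarrow> real \<Rightarrow> real" where
  "spectral_product f g \<nu> = cos_transform f \<nu> * cos_transform g \<nu> + sin_transform f \<nu> * sin_transform g \<nu>"

text \<open>The weight makes the multiple integrals absolutely convergent. By the addition theorem
  the trigonometric factors combine to \<open>cos (\<nu> * (x - t))\<close>, whose integral against
  the weight is a Gaussian, so \<open>f\<close> is integrated against a mollified
  \<open>g\<close>.\<close>

lemma weighted_parseval:
  assumes f: "integrable lborel f" and g: "integrable lborel g" and s: "0 < \<sigma>"
  shows "(\<integral>\<nu>. spectral_product f g \<nu> * gauss_weight \<sigma> \<nu> \<partial>lborel)
    = 2 * pi * (\<integral>x. f x * (\<integral>y. g (x - \<sigma> * y) * std_normal_density y \<partial>lborel) \<partial>lborel)"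
proof -
  let ?W = "gauss_weight \<sigma>"
  have [measurable]: "f \<in> borel_measurable borel" "g \<in> borel_measurable borel" using f g by auto
  have W: "integrable lborel ?W" by (rule gauss_weight_integrable[OF s])
  have [measurable]: "?W \<in> borel_measurable borel" using W by auto
  have W0: "0 \<le> ?W \<nu>" for \<nu> by (simp add: gauss_weight_def)
  define c where "c \<nu> x = (\<integral>t. cos (\<nu> * (x - t)) * g t \<partial>lborel)" for \<nu> x
  have cm[measurable]: "(\<lambda>p. c (fst p) (snd p)) \<in> borel_measurable (lborel \<Otimes>\<^sub>M lborel)"
    unfolding c_def by measurable
  have cb: "\<bar>c \<nu> x\<bar> \<le> (\<integral>t. \<bar>g t\<bar> \<partial>lborel)" for \<nu> x
    unfolding c_def using integral_bounded_mult_le[OF g, of "\<lambda>t. cos (\<nu> * (x - t))" 1] by simp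
  have sp: "spectral_product f g \<nu> = (\<integral>x. c \<nu> x * f x \<partial>lborel)" for \<nu>
  proof -
    have ic: "integrable lborel (\<lambda>t. cos (\<nu> * t) * g t)" "integrable lborel (\<lambda>t. sin (\<nu> * t) * g t)"
      "integrable lborel (\<lambda>t. cos (\<nu> * t) * f t)" "integrable lborel (\<lambda>t. sin (\<nu> * t) * f t)"
      by (rule integrable_bounded_mult[OF g, where B=1] integrable_bounded_mult[OF f, where B=1]; simp)+
    have "c \<nu> x = (\<integral>t. cos (\<nu> * x) * (cos (\<nu> * t) * g t) + sin (\<nu> * x) * (sin (\<nu> * t) * g t) \<partial>lborel)" for x
      unfolding c_def by (intro Bochner_Integration.integral_cong refl) (simp add: right_diff_distrib cos_diff distrib_right)
    then have "c \<nu> x = cos (\<nu> * x) * cos_transform g \<nu> + sin (\<nu> * x) * sin_transform g \<nu>" for x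
      using ic by (simp add: cos_transform_def sin_transform_def)
    then have "(\<integral>x. c \<nu> x * f x \<partial>lborel)
      = (\<integral>x. cos_transform g \<nu> * (cos (\<nu> * x) * f x) + sin_transform g \<nu> * (sin (\<nu> * x) * f x) \<partial>lborel)"
      by (intro Bochner_Integration.integral_cong refl) (simp add: algebra_simps)
    also have "\<dots> = spectral_product f g \<nu>"
      using ic by (simp add: spectral_product_def cos_transform_def sin_transform_def mult.commute)
    finally show ?thesis by simp
  qed
  have i1: "integrable (lborel \<Otimes>\<^sub>M lborel) (\<lambda>(\<nu>, x). c \<nu> x * (?W \<nu> * f x))"
  proof (rule lborel_pair.Fubini_integrable)
    have m: "(\<lambda>x. c \<nu> x) \<in> borel_measurable borel" for \<nu> unfolding c_def by measurable
    have iW: "integrable lborel (\<lambda>x. c \<nu> x * (?W \<nu> * f x))" for \<nu>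
      by (rule integrable_bounded_mult[OF _ _ cb]) (use m f in auto)
    then show "AE \<nu> in lborel. integrable lborel (\<lambda>x. case (\<nu>, x) of (\<nu>, x) \<Rightarrow> c \<nu> x * (?W \<nu> * f x))" by simp
    show "integrable lborel (\<lambda>\<nu>. \<integral>x. norm (case (\<nu>, x) of (\<nu>, x) \<Rightarrow> c \<nu> x * (?W \<nu> * f x)) \<partial>lborel)"
    proof (rule Bochner_Integration.integrable_bound)
      show "integrable lborel (\<lambda>\<nu>. (\<integral>t. \<bar>g t\<bar> \<partial>lborel) * ((\<integral>x. \<bar>f x\<bar> \<partial>lborel) * ?W \<nu>))" using W by simp
      show "(\<lambda>\<nu>. \<integral>x. norm (case (\<nu>, x) of (\<nu>, x) \<Rightarrow> c \<nu> x * (?W \<nu> * f x)) \<partial>lborel) \<in> borel_measurable lborel"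
        by measurable
      show "AE \<nu> in lborel. norm (\<integral>x. norm (case (\<nu>, x) of (\<nu>, x) \<Rightarrow> c \<nu> x * (?W \<nu> * f x)) \<partial>lborel)
         \<le> norm ((\<integral>t. \<bar>g t\<bar> \<partial>lborel) * ((\<integral>x. \<bar>f x\<bar> \<partial>lborel) * ?W \<nu>))"
      proof (rule AE_I2)
        fix \<nu>
        have "(\<integral>x. \<bar>c \<nu> x * (?W \<nu> * f x)\<bar> \<partial>lborel) \<le> (\<integral>x. (\<integral>t. \<bar>g t\<bar> \<partial>lborel) * (?W \<nu> * \<bar>f x\<bar>) \<partial>lborel)"
        proof (rule integral_mono)
          show "integrable lborel (\<lambda>x. \<bar>c \<nu> x * (?W \<nu> * f x)\<bar>)" by (rule integrable_abs[OF iW])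
          show "integrable lborel (\<lambda>x. (\<integral>t. \<bar>g t\<bar> \<partial>lborel) * (?W \<nu> * \<bar>f x\<bar>))" using f by simp
          show "\<bar>c \<nu> x * (?W \<nu> * f x)\<bar> \<le> (\<integral>t. \<bar>g t\<bar> \<partial>lborel) * (?W \<nu> * \<bar>f x\<bar>)" for x
            unfolding abs_mult abs_of_nonneg[OF W0] by (intro mult_right_mono cb mult_nonneg_nonneg W0 abs_ge_zero)
        qed
        also have "\<dots> = (\<integral>t. \<bar>g t\<bar> \<partial>lborel) * ((\<integral>x. \<bar>f x\<bar> \<partial>lborel) * ?W \<nu>)" by simp
        finally show "norm (\<integral>x. norm (case (\<nu>, x) of (\<nu>, x) \<Rightarrow> c \<nu> x * (?W \<nu> * f x)) \<partial>lborel)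
         \<le> norm ((\<integral>t. \<bar>g t\<bar> \<partial>lborel) * ((\<integral>x. \<bar>f x\<bar> \<partial>lborel) * ?W \<nu>))"
          by (simp add: abs_of_nonneg W0)
      qed
    qed
  qed measurable
  have i2: "integrable (lborel \<Otimes>\<^sub>M lborel) (\<lambda>(\<nu>, t). cos (\<nu> * (x - t)) * (?W \<nu> * g t))" for x
  proof (rule Bochner_Integration.integrable_bound)
    show "integrable (lborel \<Otimes>\<^sub>M lborel) (\<lambda>(\<nu>, t). ?W \<nu> * g t)"
    proof (rule lborel_pair.Fubini_integrable)
      show "integrable lborel (\<lambda>\<nu>. \<integral>t. norm (case (\<nu>, t) of (\<nu>, t) \<Rightarrow> ?W \<nu> * g t) \<partial>lborel)"
        using W by (simp add: abs_mult W0)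
    qed (use g in auto)
  qed (auto simp: abs_mult mult_left_le_one_le)
  have inner: "(\<integral>\<nu>. c \<nu> x * ?W \<nu> \<partial>lborel) = 2 * pi * (\<integral>y. g (x - \<sigma> * y) * std_normal_density y \<partial>lborel)" for x
  proof -
    have "(\<integral>\<nu>. c \<nu> x * ?W \<nu> \<partial>lborel) = (\<integral>\<nu>. (\<integral>t. cos (\<nu> * (x - t)) * (?W \<nu> * g t) \<partial>lborel) \<partial>lborel)"
      unfolding c_def Bochner_Integration.integral_mult_left_zero[symmetric] by (simp only: mult_ac)
    also have "\<dots> = (\<integral>t. (\<integral>\<nu>. cos (\<nu> * (x - t)) * (?W \<nu> * g t) \<partial>lborel) \<partial>lborel)"
      by (rule lborel_pair.Fubini_integral[OF i2, symmetric])
    also have "\<dots> = (\<integral>t. g t * (\<integral>\<nu>. cos (\<nu> * (x - t)) * ?W \<nu> \<partial>lborel) \<partial>lborel)"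
      unfolding Bochner_Integration.integral_mult_right_zero[symmetric] by (simp only: mult_ac)
    also have "\<dots> = 2 * pi * (\<integral>t. g t * (std_normal_density ((x - t) / \<sigma>) / \<sigma>) \<partial>lborel)"
      unfolding gauss_weight_cos[OF s] Bochner_Integration.integral_mult_right_zero[symmetric]
      by (simp only: mult_ac)
    \<comment> \<open>Substitution \<open>t = x - \<sigma> y\<close>.\<close>
    also have "(\<integral>t. g t * (std_normal_density ((x - t) / \<sigma>) / \<sigma>) \<partial>lborel)
      = \<bar>- \<sigma>\<bar> *\<^sub>R (\<integral>y. g (x + (- \<sigma>) * y) * (std_normal_density ((x - (x + (- \<sigma>) * y)) / \<sigma>) / \<sigma>) \<partial>lborel)"
      by (rule lborel_integral_real_affine) (use s in auto)
    also have "\<dots> = (\<integral>y. g (x - \<sigma> * y) * std_normal_density y \<partial>lborel)"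
      unfolding real_scaleR_def Bochner_Integration.integral_mult_right_zero[symmetric]
      using s by (intro Bochner_Integration.integral_cong refl) simp
    finally show ?thesis .
  qed
  have "(\<integral>\<nu>. spectral_product f g \<nu> * ?W \<nu> \<partial>lborel) = (\<integral>\<nu>. (\<integral>x. c \<nu> x * (?W \<nu> * f x) \<partial>lborel) \<partial>lborel)"
    unfolding sp Bochner_Integration.integral_mult_left_zero[symmetric] by (simp only: mult_ac)
  also have "\<dots> = (\<integral>x. (\<integral>\<nu>. c \<nu> x * (?W \<nu> * f x) \<partial>lborel) \<partial>lborel)"
    by (rule lborel_pair.Fubini_integral[OF i1, symmetric])
  also have "\<dots> = (\<integral>x. f x * (\<integral>\<nu>. c \<nu> x * ?W \<nu> \<partial>lborel) \<partial>lborel)"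
    unfolding Bochner_Integration.integral_mult_right_zero[symmetric] by (simp only: mult_ac)
  also have "\<dots> = 2 * pi * (\<integral>x. f x * (\<integral>y. g (x - \<sigma> * y) * std_normal_density y \<partial>lborel) \<partial>lborel)"
    unfolding inner Bochner_Integration.integral_mult_right_zero[symmetric] by (simp only: mult_ac)
  finally show ?thesis .
qed

text \<open>Chosen so that Gaussian mollification converges almost everywhere and boundedly, while
  functions with a jump, such as extensions by zero and cut-off controls, still qualify.\<close>

definition nice :: "(real \<Rightarrow> real) \<Rightarrow> bool" where
  "nice f \<longleftrightarrow> integrable lborel f \<and> (\<exists>B. \<forall>t. \<bar>f t\<bar> \<le> B) \<and> (AE t in lborel. isCont f t)"

abbreviation weight_seq :: "nat \<Rightarrow> real \<Rightarrow> real" where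
  "weight_seq n \<equiv> gauss_weight (1 / real (Suc n))"

text \<open>At a continuity point of \<open>g\<close> the mollified values converge by dominated
  convergence; a second dominated limit, with the bound of \<open>g\<close> times \<open>f\<close>
  as majorant, gives the claim.\<close>

lemma weighted_parseval_limit:
  assumes f: "nice f" and g: "nice g"
  shows "(\<lambda>n. \<integral>\<nu>. spectral_product f g \<nu> * weight_seq n \<nu> \<partial>lborel) \<longlonglongrightarrow> 2 * pi * (\<integral>t. f t * g t \<partial>lborel)"
proof -
  have fi: "integrable lborel f" and gi: "integrable lborel g" and gc: "AE t in lborel. isCont g t"
    using f g by (auto simp: nice_def)
  obtain B where B: "\<And>t. \<bar>g t\<bar> \<le> B" using g by (auto simp: nice_def)
  have [measurable]: "f \<in> borel_measurable borel" "g \<in> borel_measurable borel" using fi gi by auto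
  let ?h = "\<lambda>n x. \<integral>y. g (x - 1 / real (Suc n) * y) * std_normal_density y \<partial>lborel"
  have phi: "integrable lborel std_normal_density" "(\<integral>y. std_normal_density y \<partial>lborel) = 1" by simp_all
  have lim0: "(\<lambda>n. 1 / real (Suc n)) \<longlonglongrightarrow> 0" by (rule LIMSEQ_Suc[OF lim_1_over_n])
  have hb: "\<bar>?h n x\<bar> \<le> B" for n x
    using integral_bounded_mult_le[OF phi(1), of "\<lambda>y. g (x - 1 / real (Suc n) * y)" B] B phi(2)
    by (simp add: abs_of_nonneg)
  have h: "(\<lambda>n. ?h n x) \<longlonglongrightarrow> g x" if "isCont g x" for x
  proof -
    have "(\<lambda>n. ?h n x) \<longlonglongrightarrow> (\<integral>y. g x * std_normal_density y \<partial>lborel)"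
    proof (rule integral_dominated_convergence[where w="\<lambda>y. B * std_normal_density y"])
      show "AE y in lborel. (\<lambda>n. g (x - 1 / real (Suc n) * y) * std_normal_density y) \<longlonglongrightarrow> g x * std_normal_density y"
      proof (rule AE_I2)
        fix y :: real
        have "(\<lambda>n. x - 1 / real (Suc n) * y) \<longlonglongrightarrow> x - 0 * y" by (intro tendsto_intros lim0)
        then have "(\<lambda>n. g (x - 1 / real (Suc n) * y)) \<longlonglongrightarrow> g x"
          using isCont_tendsto_compose[OF that] by simp
        then show "(\<lambda>n. g (x - 1 / real (Suc n) * y) * std_normal_density y) \<longlonglongrightarrow> g x * std_normal_density y"
          by (intro tendsto_intros)
      qed
      show "AE y in lborel. norm (g (x - 1 / real (Suc n) * y) * std_normal_density y) \<le> B * std_normal_density y" for n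
        using B by (auto simp: abs_mult intro!: mult_right_mono)
    qed (use phi in auto)
    then show ?thesis by simp
  qed
  have "(\<lambda>n. \<integral>x. f x * ?h n x \<partial>lborel) \<longlonglongrightarrow> (\<integral>x. f x * g x \<partial>lborel)"
  proof (rule integral_dominated_convergence[where w="\<lambda>x. B * \<bar>f x\<bar>"])
    show "AE x in lborel. (\<lambda>n. f x * ?h n x) \<longlonglongrightarrow> f x * g x"
      using gc by eventually_elim (intro tendsto_intros h)
    show "AE x in lborel. norm (f x * ?h n x) \<le> B * \<bar>f x\<bar>" for n
      unfolding real_norm_def abs_mult mult.commute[of B]
      by (intro AE_I2 mult_left_mono hb abs_ge_zero)
  qed (use fi in auto)
  then have "(\<lambda>n. 2 * pi * (\<integral>x. f x * ?h n x \<partial>lborel)) \<longlonglongrightarrow> 2 * pi * (\<integral>x. f x * g x \<partial>lborel)"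
    by (intro tendsto_intros)
  then show ?thesis by (subst weighted_parseval[OF fi gi]) auto
qed

lemma weight_seq_tendsto: "(\<lambda>n. weight_seq n \<nu>) \<longlonglongrightarrow> 1"
proof -
  have "(\<lambda>n. exp (- (1 / real (Suc n) * \<nu>)\<^sup>2 / 2)) \<longlonglongrightarrow> exp (- (0 * \<nu>)\<^sup>2 / 2)"
    by (intro tendsto_intros LIMSEQ_Suc[OF lim_1_over_n]) simp
  then show ?thesis by (simp add: gauss_weight_def)
qed

lemma weight_seq_bounds: "0 \<le> weight_seq n \<nu>" "weight_seq n \<nu> \<le> 1"
  by (auto simp: gauss_weight_def)

text \<open>The weights increase to 1 and the weighted integrals converge to a finite limit, so
  monotone convergence applies; the transforms are a priori only bounded.\<close>

lemma spectral_square_integrable: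
  assumes f: "nice f"
  shows "integrable lborel (spectral_product f f)"
proof -
  have fi: "integrable lborel f" using f by (simp add: nice_def)
  note [measurable] = cos_transform_measurable[OF fi] sin_transform_measurable[OF fi]
  have nn: "0 \<le> spectral_product f f \<nu>" for \<nu> by (simp add: spectral_product_def)
  have m: "spectral_product f f \<in> borel_measurable borel" unfolding spectral_product_def[abs_def] by measurable
  show ?thesis
  proof (rule integrable_monotone_convergence[where f="\<lambda>n \<nu>. spectral_product f f \<nu> * weight_seq n \<nu>"])
    let ?N = "\<integral>t. \<bar>f t\<bar> \<partial>lborel"
    show "integrable lborel (\<lambda>\<nu>. spectral_product f f \<nu> * weight_seq n \<nu>)" for n
    proof (rule integrable_bounded_mult[where B="?N * ?N + ?N * ?N"])
      show "integrable lborel (weight_seq n)" by (rule gauss_weight_integrable) simp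
      show "spectral_product f f \<in> borel_measurable lborel" using m by simp
      have "\<bar>cos_transform f \<nu>\<bar> * \<bar>cos_transform f \<nu>\<bar> \<le> ?N * ?N" "\<bar>sin_transform f \<nu>\<bar> * \<bar>sin_transform f \<nu>\<bar> \<le> ?N * ?N" for \<nu>
        by (intro mult_mono cos_transform_bound[OF fi] sin_transform_bound[OF fi]; simp)+
      moreover have "\<bar>spectral_product f f \<nu>\<bar>
        = \<bar>cos_transform f \<nu>\<bar> * \<bar>cos_transform f \<nu>\<bar> + \<bar>sin_transform f \<nu>\<bar> * \<bar>sin_transform f \<nu>\<bar>" for \<nu>
        by (simp add: spectral_product_def)
      ultimately show "\<bar>spectral_product f f \<nu>\<bar> \<le> ?N * ?N + ?N * ?N" for \<nu>
        by (simp only: add_mono)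
    qed
    show "AE \<nu> in lborel. mono (\<lambda>n. spectral_product f f \<nu> * weight_seq n \<nu>)"
    proof (rule AE_I2, rule monoI)
      fix \<nu> and n k :: nat assume "n \<le> k"
      then have "1 / real (Suc k) \<le> 1 / real (Suc n)" by (simp add: field_simps)
      then have "(1 / real (Suc k))\<^sup>2 * \<nu>\<^sup>2 \<le> (1 / real (Suc n))\<^sup>2 * \<nu>\<^sup>2"
        by (intro mult_right_mono power_mono) auto
      then have "weight_seq n \<nu> \<le> weight_seq k \<nu>"
        unfolding gauss_weight_def power_mult_distrib exp_le_cancel_iff by linarith
      then show "spectral_product f f \<nu> * weight_seq n \<nu> \<le> spectral_product f f \<nu> * weight_seq k \<nu>"
        by (intro mult_left_mono nn)
    qed
    show "AE \<nu> in lborel. (\<lambda>n. spectral_product f f \<nu> * weight_seq n \<nu>) \<longlonglongrightarrow> spectral_product f f \<nu>"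
      using tendsto_mult[OF tendsto_const weight_seq_tendsto] by fastforce
    show "(\<lambda>n. \<integral>\<nu>. spectral_product f f \<nu> * weight_seq n \<nu> \<partial>lborel) \<longlonglongrightarrow> 2 * pi * (\<integral>t. f t * f t \<partial>lborel)"
      by (rule weighted_parseval_limit[OF f f])
    show "spectral_product f f \<in> borel_measurable lborel" using m by simp
  qed
qed

text \<open>Products of transforms are dominated by the sum of the two squared moduli, so the weight
  can be removed by dominated convergence. The mixed cosine-sine products are included because they
  make up the imaginary part of complex spectral integrals.\<close>

theorem parseval:
  assumes f: "nice f" and g: "nice g"
  shows "integrable lborel (\<lambda>\<nu>. cos_transform f \<nu> * cos_transform g \<nu>)"
    and "integrable lborel (\<lambda>\<nu>. sin_transform f \<nu> * sin_transform g \<nu>)"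
    and "integrable lborel (\<lambda>\<nu>. cos_transform f \<nu> * sin_transform g \<nu>)"
    and "integrable lborel (\<lambda>\<nu>. sin_transform f \<nu> * cos_transform g \<nu>)"
    and "integrable lborel (spectral_product f g)"
    and "(\<integral>\<nu>. spectral_product f g \<nu> \<partial>lborel) = 2 * pi * (\<integral>t. f t * g t \<partial>lborel)"
proof -
  have fi: "integrable lborel f" and gi: "integrable lborel g" using f g by (auto simp: nice_def)
  note [measurable] = cos_transform_measurable[OF fi] sin_transform_measurable[OF fi]
    cos_transform_measurable[OF gi] sin_transform_measurable[OF gi]
  have S: "integrable lborel (\<lambda>\<nu>. spectral_product f f \<nu> + spectral_product g g \<nu>)"
    by (intro Bochner_Integration.integrable_add spectral_square_integrable f g)
  have b: "\<bar>p * q\<bar> \<le> p * p + q * q" for p q :: real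
    using sum_squares_bound[of "\<bar>p\<bar>" "\<bar>q\<bar>"] mult_nonneg_nonneg[OF abs_ge_zero[of p] abs_ge_zero[of q]]
    unfolding power2_eq_square abs_mult abs_mult_self_eq by linarith
  have i: "integrable lborel (\<lambda>\<nu>. p \<nu> * q \<nu>)"
    if "p \<in> borel_measurable borel" "q \<in> borel_measurable borel"
      "\<And>\<nu>. p \<nu> * p \<nu> \<le> spectral_product f f \<nu>" "\<And>\<nu>. q \<nu> * q \<nu> \<le> spectral_product g g \<nu>" for p q
  proof (rule Bochner_Integration.integrable_bound[OF S])
    show "(\<lambda>\<nu>. p \<nu> * q \<nu>) \<in> borel_measurable lborel" using that by simp
    show "AE \<nu> in lborel. norm (p \<nu> * q \<nu>) \<le> norm (spectral_product f f \<nu> + spectral_product g g \<nu>)"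
      using b[of "p _" "q _"] that(3,4) by (intro AE_I2) (smt (verit) real_norm_def)
  qed
  have le: "cos_transform h \<nu> * cos_transform h \<nu> \<le> spectral_product h h \<nu>"
    "sin_transform h \<nu> * sin_transform h \<nu> \<le> spectral_product h h \<nu>" for h \<nu>
    by (auto simp: spectral_product_def)
  show 1: "integrable lborel (\<lambda>\<nu>. cos_transform f \<nu> * cos_transform g \<nu>)"
    "integrable lborel (\<lambda>\<nu>. sin_transform f \<nu> * sin_transform g \<nu>)"
    "integrable lborel (\<lambda>\<nu>. cos_transform f \<nu> * sin_transform g \<nu>)"
    "integrable lborel (\<lambda>\<nu>. sin_transform f \<nu> * cos_transform g \<nu>)"
    by (intro i le; measurable)+
  show 2: "integrable lborel (spectral_product f g)"
    unfolding spectral_product_def[abs_def] by (intro Bochner_Integration.integrable_add 1)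
  have "(\<lambda>n. \<integral>\<nu>. spectral_product f g \<nu> * weight_seq n \<nu> \<partial>lborel) \<longlonglongrightarrow> (\<integral>\<nu>. spectral_product f g \<nu> \<partial>lborel)"
  proof (rule integral_dominated_convergence[where w="\<lambda>\<nu>. \<bar>spectral_product f g \<nu>\<bar>"])
    show "AE \<nu> in lborel. (\<lambda>n. spectral_product f g \<nu> * weight_seq n \<nu>) \<longlonglongrightarrow> spectral_product f g \<nu>"
      using tendsto_mult[OF tendsto_const weight_seq_tendsto] by fastforce
    show "AE \<nu> in lborel. norm (spectral_product f g \<nu> * weight_seq n \<nu>) \<le> \<bar>spectral_product f g \<nu>\<bar>" for n
      using weight_seq_bounds[of n] by (auto simp: abs_mult intro!: mult_left_le)
    show "(\<lambda>\<nu>. spectral_product f g \<nu> * weight_seq n \<nu>) \<in> borel_measurable lborel" for n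
      using 2 gauss_weight_integrable[of "1 / real (Suc n)"] by (intro borel_measurable_times) auto
  qed (use 2 in auto)
  then show "(\<integral>\<nu>. spectral_product f g \<nu> \<partial>lborel) = 2 * pi * (\<integral>t. f t * g t \<partial>lborel)"
    by (rule LIMSEQ_unique[OF _ weighted_parseval_limit[OF f g]])
qed

section \<open>The deterministic linear-quadratic problem\<close>

lemma controls_iff: "u \<in> controls \<longleftrightarrow> square_integrable halfline u"
  unfolding controls_def square_integrable_def set_borel_measurable_def set_integrable_def
  by (simp add: borel_measurable_restrict_space_iff halfline_integrable_iff)

lemma dot_matrix_symmetric: "transpose H = H \<Longrightarrow> x \<bullet> (H *v y) = (H *v x) \<bullet> y" for H :: "real^'n^'n"
  by (metis dot_lmul_matrix transpose_matrix_vector)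

text \<open>Young's inequality with weight \<open>\<alpha>\<close>.\<close>

lemma dot_matrix_bound:
  fixes H :: "real^'n^'m"
  assumes "0 < \<alpha>" "\<And>v. norm (H *v v) \<le> K * norm v"
  shows "\<bar>2 * (x \<bullet> (H *v y))\<bar> \<le> \<alpha> * (norm y)\<^sup>2 + K\<^sup>2 / \<alpha> * (norm x)\<^sup>2"
proof -
  define p where "p = sqrt \<alpha> * norm y"
  define q where "q = K * norm x / sqrt \<alpha>"
  have "\<bar>x \<bullet> (H *v y)\<bar> \<le> norm x * norm (H *v y)" by (rule Cauchy_Schwarz_ineq2)
  also have "\<dots> \<le> norm x * (K * norm y)" by (intro mult_left_mono assms) simp
  also have "\<dots> = p * q" using assms(1) by (simp add: p_def q_def)
  finally have "\<bar>2 * (x \<bullet> (H *v y))\<bar> \<le> 2 * p * q" by simp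
  also have "\<dots> \<le> p\<^sup>2 + q\<^sup>2" by (rule sum_squares_bound)
  also have "\<dots> = \<alpha> * (norm y)\<^sup>2 + K\<^sup>2 / \<alpha> * (norm x)\<^sup>2"
    using assms(1) by (simp add: p_def q_def power_mult_distrib power_divide)
  finally show ?thesis .
qed

lemma continuous_halfline_measurable:
  fixes d :: "real \<Rightarrow> 'a::euclidean_space"
  assumes "continuous_on {0..} d" shows "d \<in> borel_measurable halfline"
proof -
  have "continuous_on {0<..} d" using assms by (rule continuous_on_subset) auto
  then show ?thesis
    by (subst borel_measurable_restrict_space_iff)
      (auto intro: borel_measurable_continuous_on_indicator simp: mult.commute)
qed

lemma continuous_square_integrable_upto:
  fixes d :: "real \<Rightarrow> 'a::euclidean_space"
  assumes "continuous_on {0..} d" shows "square_integrable (upto_measure t) d"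
proof -
  have "compact (d ` {0..t})"
    by (rule compact_continuous_image[OF continuous_on_subset[OF assms]]) auto
  then obtain B where B: "\<And>s. s \<in> {0..t} \<Longrightarrow> norm (d s) \<le> B"
    unfolding bounded_iff using compact_imp_bounded bounded_iff by (metis imageI)
  show ?thesis
  proof (rule square_integrable_bound[where g="\<lambda>s. B\<^sup>2"])
    show "d \<in> borel_measurable (upto_measure t)"
      by (rule measurable_halfline_upto[OF continuous_halfline_measurable[OF assms]])
    show "integrable (upto_measure t) (\<lambda>s. B\<^sup>2)" by (simp add: finite_measure.integrable_const)
    show "AE s in upto_measure t. (norm (d s))\<^sup>2 \<le> B\<^sup>2"
      by (rule AE_I2) (auto simp: space_restrict_space intro!: power_mono B)
  qed
qed

text \<open>Differentiates \<open>d \<bullet> (H *v d)\<close> along \<open>d' = A d + f\<close>.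
  Half of the dissipation \<open>\<alpha>\<close> absorbs the cross term with the forcing, which
  leaves the constant \<open>K\<^sup>2 / (\<alpha> / 2)\<close>.\<close>

lemma energy_estimate:
  fixes A H :: "real^'n^'n"
  assumes H: "transpose H = H" "\<And>v. norm (H *v v) \<le> K * norm v" and \<alpha>: "0 < \<alpha>"
    and lyap: "\<And>v. 2 * ((A *v v) \<bullet> (H *v v)) \<le> - \<alpha> * (norm v)\<^sup>2"
    and d: "ac_rep d0 (\<lambda>s. A *v d s + f s) d" and f: "\<And>t. square_integrable (upto_measure t) f" and t: "0 \<le> t"
  shows "d t \<bullet> (H *v d t) + \<alpha> / 2 * (\<integral>s. (norm (d s))\<^sup>2 \<partial>upto_measure t)
    \<le> d0 \<bullet> (H *v d0) + 2 * K\<^sup>2 / \<alpha> * (\<integral>s. (norm (f s))\<^sup>2 \<partial>upto_measure t)"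
proof -
  let ?N = "upto_measure t"
  have ds: "square_integrable ?N d" by (rule continuous_square_integrable_upto[OF ac_rep_continuous[OF d]])
  note i = square_integrableD(2)[OF ds] square_integrableD(2)[OF f[of t]]
  let ?g = "\<lambda>s. (A *v d s + f s) \<bullet> (H *v d s) + d s \<bullet> (H *v (A *v d s + f s))"
  let ?h = "\<lambda>s. 2 * K\<^sup>2 / \<alpha> * (norm (f s))\<^sup>2 - \<alpha> / 2 * (norm (d s))\<^sup>2"
  note r = ac_rep_inner_matrix[OF d d, of H]
  have "(\<integral>s. ?g s \<partial>?N) \<le> (\<integral>s. ?h s \<partial>?N)"
  proof (rule integral_mono[OF ac_repD(1)[OF r t]])
    show "integrable ?N ?h" using i by simp
    fix s
    have "?g s = 2 * ((A *v d s) \<bullet> (H *v d s)) + 2 * (f s \<bullet> (H *v d s))"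
      using dot_matrix_symmetric[OF H(1), of "d s" "A *v d s + f s"]
      by (simp add: inner_add_left inner_add_right inner_commute[of "H *v d s"])
    moreover have "2 * (f s \<bullet> (H *v d s)) \<le> \<alpha> / 2 * (norm (d s))\<^sup>2 + K\<^sup>2 / (\<alpha> / 2) * (norm (f s))\<^sup>2"
      using dot_matrix_bound[of "\<alpha> / 2" H K "f s" "d s"] \<alpha> H(2) by (simp add: abs_le_iff)
    ultimately show "?g s \<le> ?h s" using lyap[of "d s"] by (simp add: mult.commute)
  qed
  also have "\<dots> = 2 * K\<^sup>2 / \<alpha> * (\<integral>s. (norm (f s))\<^sup>2 \<partial>?N) - \<alpha> / 2 * (\<integral>s. (norm (d s))\<^sup>2 \<partial>?N)"
    using i by simp
  finally show ?thesis using ac_repD(2)[OF r t] by simp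
qed

text \<open>\<open>\<mu>\<close> is the minimum of the form on the unit sphere, attained by
  compactness; homogeneity extends the bound.\<close>

lemma positive_definite_bound:
  fixes H :: "real^'n^'n"
  assumes pos: "\<And>v. v \<noteq> 0 \<Longrightarrow> 0 < v \<bullet> (H *v v)"
  obtains \<mu> where "0 < \<mu>" "\<And>v. \<mu> * (norm v)\<^sup>2 \<le> v \<bullet> (H *v v)"
proof -
  let ?f = "\<lambda>v. v \<bullet> (H *v v)"
  have "continuous_on (sphere 0 1) ?f"
    by (intro continuous_intros linear_continuous_on bounded_linear_matrix_vector)
  moreover have "sphere (0 :: real^'n) 1 \<noteq> {}" by simp
  ultimately obtain v0 where v0: "v0 \<in> sphere 0 1" "\<And>v. v \<in> sphere 0 1 \<Longrightarrow> ?f v0 \<le> ?f v"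
    using continuous_attains_inf[of "sphere 0 1" ?f] by auto
  show thesis
  proof (rule that[of "?f v0"])
    show "0 < ?f v0" using v0 by (intro pos) auto
    fix v :: "real^'n"
    show "?f v0 * (norm v)\<^sup>2 \<le> ?f v"
    proof (cases "v = 0")
      case False
      define z where "z = (1 / norm v) *\<^sub>R v"
      have "?f v0 \<le> ?f z" using False by (intro v0) (simp add: z_def)
      then have "?f v0 * (norm v)\<^sup>2 \<le> ?f z * (norm v)\<^sup>2" by (intro mult_right_mono) auto
      also have "\<dots> = ?f v" using False
        by (simp add: z_def matrix_vector_mult_scaleR power2_eq_square)
      finally show ?thesis .
    qed simp
  qed
qed

text \<open>\<open>H\<close> is a quadratic Lyapunov function for \<open>A\<close> and is the source
  of all stability estimates. Trajectories are a given family identified by their integral equation;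
  later they are the means of the stochastic states.\<close>

locale lq_problem =
  fixes A H \<Theta> :: "real^'n^'n" and \<Gamma> :: "real^'m^'m" and b :: "real^'m^'n" and m0 :: "real^'n"
    and m :: "(real \<Rightarrow> real^'m) \<Rightarrow> real \<Rightarrow> real^'n"
  assumes H_sym: "transpose H = H" and H_pos: "\<And>v. v \<noteq> 0 \<Longrightarrow> 0 < v \<bullet> (H *v v)"
    and H_lyap: "\<And>v. 2 * ((A *v v) \<bullet> (H *v v)) \<le> - (norm v)\<^sup>2"
    and \<Theta>_sym: "transpose \<Theta> = \<Theta>" and \<Gamma>_sym: "transpose \<Gamma> = \<Gamma>"
    and traj: "\<And>u. square_integrable halfline u \<Longrightarrow> ac_rep m0 (\<lambda>s. A *v m u s + b *v u s) (m u)"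
begin

definition response :: "(real \<Rightarrow> real^'m) \<Rightarrow> real \<Rightarrow> real^'n" where
  "response u t = m u t - m (\<lambda>_. 0) t"

definition quad_cost :: "(real \<Rightarrow> real^'m) \<Rightarrow> (real \<Rightarrow> real^'n) \<Rightarrow> real" where
  "quad_cost u d = (\<integral>s. d s \<bullet> (\<Theta> *v d s) + u s \<bullet> (\<Gamma> *v u s) \<partial>halfline)"

text \<open>The energy estimate with dissipation 1, uniformly in the final time. The constant comes
  from \<open>d0 \<bullet> (H *v d0) \<le> K * (norm d0)\<^sup>2\<close> and a doubling that
  isolates the integral.\<close>

lemma l2_stability:
  obtains c where "0 \<le> c"
    "\<And>d0 f d. ac_rep d0 (\<lambda>s. A *v d s + f s) d \<Longrightarrow> square_integrable halfline f \<Longrightarrow>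
       square_integrable halfline d \<and>
       (\<integral>s. (norm (d s))\<^sup>2 \<partial>halfline) \<le> c * ((norm d0)\<^sup>2 + (\<integral>s. (norm (f s))\<^sup>2 \<partial>halfline))"
proof -
  obtain K where K: "0 \<le> K" "\<And>v. norm (H *v v) \<le> K * norm v" using matrix_vector_bound[of H] by blast
  define c where "c = 2 * K + 4 * K\<^sup>2"
  have c0: "0 \<le> c" using K(1) by (simp add: c_def)
  have "square_integrable halfline d \<and>
      (\<integral>s. (norm (d s))\<^sup>2 \<partial>halfline) \<le> c * ((norm d0)\<^sup>2 + (\<integral>s. (norm (f s))\<^sup>2 \<partial>halfline))"
    if d: "ac_rep d0 (\<lambda>s. A *v d s + f s) d" and f: "square_integrable halfline f" for d0 f d
  proof -
    have bound: "(\<integral>s. (norm (d s))\<^sup>2 \<partial>upto_measure t) \<le> c * ((norm d0)\<^sup>2 + (\<integral>s. (norm (f s))\<^sup>2 \<partial>halfline))"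
      if t: "0 \<le> t" for t
    proof -
      have "(\<integral>s. (norm (f s))\<^sup>2 \<partial>upto_measure t) \<le> (\<integral>s. (norm (f s))\<^sup>2 \<partial>halfline)"
      proof -
        have "integrable lborel (\<lambda>s. indicat_real {0<..t} s *\<^sub>R (norm (f s))\<^sup>2)"
          using integrable_halfline_upto[OF square_integrableD(2)[OF f]] by (simp only: upto_integrable_iff)
        moreover have "integrable lborel (\<lambda>s. indicat_real {0<..} s *\<^sub>R (norm (f s))\<^sup>2)"
          using square_integrableD(2)[OF f] by (simp only: halfline_integrable_iff)
        ultimately show ?thesis unfolding upto_integral halfline_integral
          by (rule integral_mono) (auto simp: indicator_def)
      qed
      then have 1: "4 * K\<^sup>2 * (\<integral>s. (norm (f s))\<^sup>2 \<partial>upto_measure t) \<le> 4 * K\<^sup>2 * (\<integral>s. (norm (f s))\<^sup>2 \<partial>halfline)"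
        by (intro mult_left_mono) auto
      have "d0 \<bullet> (H *v d0) \<le> norm d0 * (K * norm d0)"
        using norm_cauchy_schwarz[of d0 "H *v d0"] K(2)[of d0] by (meson mult_left_mono norm_ge_zero order_trans)
      then have 2: "d0 \<bullet> (H *v d0) \<le> K * (norm d0)\<^sup>2" by (simp add: power2_eq_square mult_ac)
      have 3: "0 \<le> d t \<bullet> (H *v d t)" using H_pos[of "d t"] by (cases "d t = 0") auto
      have "d t \<bullet> (H *v d t) + 1 / 2 * (\<integral>s. (norm (d s))\<^sup>2 \<partial>upto_measure t)
        \<le> d0 \<bullet> (H *v d0) + 2 * K\<^sup>2 / 1 * (\<integral>s. (norm (f s))\<^sup>2 \<partial>upto_measure t)"
        by (rule energy_estimate[OF H_sym K(2) _ _ d square_integrable_halfline_upto[OF f] t]) (use H_lyap in auto)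
      then have "(\<integral>s. (norm (d s))\<^sup>2 \<partial>upto_measure t) \<le> 2 * K * (norm d0)\<^sup>2 + 4 * K\<^sup>2 * (\<integral>s. (norm (f s))\<^sup>2 \<partial>halfline)"
        using 1 2 3 by simp
      also have "\<dots> \<le> c * (norm d0)\<^sup>2 + c * (\<integral>s. (norm (f s))\<^sup>2 \<partial>halfline)"
        unfolding c_def using K(1) by (intro add_mono mult_right_mono) auto
      finally show ?thesis by (simp add: distrib_left)
    qed
    have cd: "continuous_on {0..} d" by (rule ac_rep_continuous[OF d])
    have "integrable halfline (\<lambda>s. (norm (d s))\<^sup>2) \<and> (\<integral>s. (norm (d s))\<^sup>2 \<partial>halfline)
        \<le> c * ((norm d0)\<^sup>2 + (\<integral>s. (norm (f s))\<^sup>2 \<partial>halfline))"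
      using square_integrableD(2)[OF continuous_square_integrable_upto[OF cd]] bound
      by (intro integrable_halfline_nonneg) auto
    then show ?thesis using continuous_halfline_measurable[OF cd] by (simp add: square_integrable_def)
  qed
  with c0 show thesis by (rule that)
qed

text \<open>The difference of two solutions starts at 0 and has no forcing, so its energy cannot
  become positive.\<close>

lemma ac_rep_unique:
  assumes "ac_rep y (\<lambda>s. A *v d s + f s) d" "ac_rep y (\<lambda>s. A *v d' s + f s) d'" "0 \<le> t"
  shows "d t = d' t"
proof -
  let ?e = "\<lambda>t. d t - d' t"
  have e: "ac_rep 0 (\<lambda>s. A *v ?e s + 0) ?e"
    by (rule ac_rep_cong[OF ac_rep_diff[OF assms(1,2)]]) (auto simp: matrix_vector_mult_diff_distrib)
  obtain K where K: "0 \<le> K" "\<And>v. norm (H *v v) \<le> K * norm v" using matrix_vector_bound[of H] by blast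
  have "?e t \<bullet> (H *v ?e t) + 1 / 2 * (\<integral>s. (norm (?e s))\<^sup>2 \<partial>upto_measure t)
      \<le> 0 \<bullet> (H *v 0) + 2 * K\<^sup>2 / 1 * (\<integral>s. (norm (0 :: real^'n))\<^sup>2 \<partial>upto_measure t)"
    by (rule energy_estimate[OF H_sym K(2) _ _ e square_integrable_zero assms(3)]) (use H_lyap in auto)
  then have "?e t \<bullet> (H *v ?e t) + 1 / 2 * (\<integral>s. (norm (?e s))\<^sup>2 \<partial>upto_measure t) \<le> 0" by simp
  moreover have "0 \<le> (\<integral>s. (norm (?e s))\<^sup>2 \<partial>upto_measure t)" by simp
  ultimately have "?e t \<bullet> (H *v ?e t) \<le> 0" by linarith
  then have "?e t = 0" using H_pos[of "?e t"] by (meson not_le)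
  then show ?thesis by simp
qed

lemma response_ac_rep:
  assumes "square_integrable halfline u"
  shows "ac_rep 0 (\<lambda>s. A *v response u s + b *v u s) (response u)"
  by (rule ac_rep_cong[OF ac_rep_diff[OF traj[OF assms] traj[OF square_integrable_zero]]])
    (auto simp: response_def matrix_vector_mult_diff_distrib)

lemma traj_add:
  assumes "square_integrable halfline u" "square_integrable halfline v" "0 \<le> t"
  shows "m (\<lambda>s. v s + c *\<^sub>R u s) t = m v t + c *\<^sub>R response u t"
proof -
  have s: "square_integrable halfline (\<lambda>s. v s + c *\<^sub>R u s)" using assms by auto
  have "ac_rep m0 (\<lambda>s. A *v (m v s + c *\<^sub>R response u s) + b *v (v s + c *\<^sub>R u s)) (\<lambda>t. m v t + c *\<^sub>R response u t)"
    by (rule ac_rep_cong[OF ac_rep_add[OF traj[OF assms(2)] ac_rep_scaleR[OF response_ac_rep[OF assms(1)], of c]]])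
      (auto simp: matrix_vector_right_distrib matrix_vector_mult_scaleR scaleR_add_right)
  from ac_rep_unique[OF traj[OF s] this assms(3)] show ?thesis .
qed

lemma traj_square_integrable:
  assumes "square_integrable halfline u"
  shows "square_integrable halfline (m u)"
  using l2_stability traj[OF assms] square_integrable_mult_vec[OF assms, of b] by metis

lemma response_square_integrable:
  assumes "square_integrable halfline u"
  shows "square_integrable halfline (response u)"
  using l2_stability response_ac_rep[OF assms] square_integrable_mult_vec[OF assms, of b] by metis

lemma quad_cost_integrable:
  assumes "square_integrable halfline u" "square_integrable halfline d"
  shows "integrable halfline (\<lambda>s. d s \<bullet> (\<Theta> *v d s) + u s \<bullet> (\<Gamma> *v u s))"
  using assms by (intro Bochner_Integration.integrable_add integrable_inner_square_integrable square_integrable_mult_vec)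

lemma quad_cost_cong:
  assumes "\<And>s. 0 < s \<Longrightarrow> u s = u' s" "\<And>s. 0 < s \<Longrightarrow> d s = d' s"
  shows "quad_cost u d = quad_cost u' d'"
  unfolding quad_cost_def using assms
  by (intro Bochner_Integration.integral_cong refl) (auto simp: space_restrict_space)

lemma quad_cost_parallelogram:
  assumes u: "square_integrable halfline u" "square_integrable halfline d"
    and v: "square_integrable halfline v" "square_integrable halfline e"
  shows "quad_cost (\<lambda>s. v s + u s) (\<lambda>s. e s + d s) + quad_cost (\<lambda>s. v s - u s) (\<lambda>s. e s - d s)
    = 2 * quad_cost v e + 2 * quad_cost u d"
proof -
  have "quad_cost (\<lambda>s. v s + u s) (\<lambda>s. e s + d s) + quad_cost (\<lambda>s. v s - u s) (\<lambda>s. e s - d s)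
    = (\<integral>s. ((e s + d s) \<bullet> (\<Theta> *v (e s + d s)) + (v s + u s) \<bullet> (\<Gamma> *v (v s + u s)))
        + ((e s - d s) \<bullet> (\<Theta> *v (e s - d s)) + (v s - u s) \<bullet> (\<Gamma> *v (v s - u s))) \<partial>halfline)"
    unfolding quad_cost_def using u v
    by (intro Bochner_Integration.integral_add[symmetric] quad_cost_integrable) auto
  also have "\<dots> = (\<integral>s. 2 * (e s \<bullet> (\<Theta> *v e s) + v s \<bullet> (\<Gamma> *v v s)) + 2 * (d s \<bullet> (\<Theta> *v d s) + u s \<bullet> (\<Gamma> *v u s)) \<partial>halfline)"
    by (intro Bochner_Integration.integral_cong refl)
      (simp add: matrix_vector_right_distrib matrix_vector_mult_diff_distrib inner_add_left inner_add_right
        inner_diff_left inner_diff_right)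
  also have "\<dots> = 2 * quad_cost v e + 2 * quad_cost u d"
    unfolding quad_cost_def
    by (simp only: Bochner_Integration.integral_add integrable_mult_right quad_cost_integrable[OF u]
        quad_cost_integrable[OF v] Bochner_Integration.integral_mult_right_zero)
  finally show ?thesis .
qed

text \<open>The trajectory is affine in the control, so in the symmetric sum the terms linear in
  \<open>u\<close> cancel and twice the purely quadratic cost of \<open>u\<close> remains.\<close>

lemma cost_parallelogram:
  assumes u: "square_integrable halfline u" and v: "square_integrable halfline v"
  shows "quad_cost (\<lambda>s. v s + u s) (m (\<lambda>s. v s + u s)) + quad_cost (\<lambda>s. v s - u s) (m (\<lambda>s. v s - u s))
    = 2 * quad_cost v (m v) + 2 * quad_cost u (response u)"
proof -
  have "quad_cost (\<lambda>s. v s + u s) (m (\<lambda>s. v s + u s)) = quad_cost (\<lambda>s. v s + u s) (\<lambda>s. m v s + response u s)"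
    using traj_add[OF u v, of _ 1] by (intro quad_cost_cong) auto
  moreover have "quad_cost (\<lambda>s. v s - u s) (m (\<lambda>s. v s - u s)) = quad_cost (\<lambda>s. v s - u s) (\<lambda>s. m v s - response u s)"
    using traj_add[OF u v, of _ "-1"] by (intro quad_cost_cong) auto
  ultimately show ?thesis
    using quad_cost_parallelogram[OF u response_square_integrable[OF u] v traj_square_integrable[OF v]] by simp
qed

text \<open>Both \<open>u0 + u\<close> and \<open>u0 - u\<close> cost at least as much as
  \<open>u0\<close>; the parallelogram identity leaves the quadratic part of
  \<open>u\<close>.\<close>

lemma optimal_imp_nonneg:
  assumes u0: "square_integrable halfline u0"
    and opt: "\<And>u. square_integrable halfline u \<Longrightarrow> quad_cost u0 (m u0) \<le> quad_cost u (m u)"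
    and u: "square_integrable halfline u"
  shows "0 \<le> quad_cost u (response u)"
  using cost_parallelogram[OF u u0] opt[OF square_integrable_add[OF u0 u]] opt[OF square_integrable_diff[OF u0 u]]
  by simp

end

section \<open>Damped oscillations as test controls\<close>

lemma exp_halfline:
  assumes "0 < c"
  shows "integrable halfline (\<lambda>s. exp (- c * s))" "(\<integral>s. exp (- c * s) \<partial>halfline) = 1 / c"
proof -
  have ac: "ac_rep (- exp (- c * 0) / c) (\<lambda>s. exp (- c * s)) (\<lambda>s. - exp (- c * s) / c)"
    by (rule ac_rep_derivative)
      (use assms in \<open>auto intro!: continuous_intros derivative_eq_intros
        simp: has_real_derivative_iff_has_vector_derivative[symmetric]\<close>)
  have eq: "(\<integral>s. exp (- c * s) \<partial>upto_measure t) = 1 / c - exp (- c * t) / c" if "0 \<le> t" for t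
    using ac_repD(2)[OF ac that] by simp
  have "integrable halfline (\<lambda>s. exp (- c * s)) \<and> (\<integral>s. exp (- c * s) \<partial>halfline) \<le> 1 / c"
    by (rule integrable_halfline_nonneg) (use ac_repD(1)[OF ac] eq assms in auto)
  then show i: "integrable halfline (\<lambda>s. exp (- c * s))" ..
  have "((\<lambda>t. exp (- c * t)) \<longlongrightarrow> 0) at_top"
    using assms by (intro filterlim_compose[OF exp_at_bot] filterlim_tendsto_neg_mult_at_bot[OF tendsto_const _ filterlim_ident]) auto
  then have "((\<lambda>t. 1 / c - exp (- c * t) / c) \<longlongrightarrow> 1 / c - 0 / c) at_top" by (intro tendsto_intros) (use assms in auto)
  moreover have "\<forall>\<^sub>F t in at_top. 1 / c - exp (- c * t) / c = (\<integral>s. exp (- c * s) \<partial>upto_measure t)"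
    using eq by (auto intro: eventually_at_top_linorderI[of 0])
  ultimately have "((\<lambda>t. \<integral>s. exp (- c * s) \<partial>upto_measure t) \<longlongrightarrow> 1 / c) at_top"
    by (auto elim: Lim_transform_eventually)
  from tendsto_unique[OF _ integral_upto_tendsto[OF i] this] show "(\<integral>s. exp (- c * s) \<partial>halfline) = 1 / c" by simp
qed

text \<open>The real part of \<open>exp ((- \<eta> + i \<nu>) s) (p + i q)\<close>.\<close>

definition damped :: "real \<Rightarrow> real \<Rightarrow> 'a::real_vector \<Rightarrow> 'a \<Rightarrow> real \<Rightarrow> 'a" where
  "damped \<eta> \<nu> p q s = exp (- \<eta> * s) *\<^sub>R (cos (\<nu> * s) *\<^sub>R p - sin (\<nu> * s) *\<^sub>R q)"

lemma damped_continuous: "continuous_on UNIV (damped \<eta> \<nu> p q)" for p q :: "'a::real_normed_vector"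
  unfolding damped_def by (intro continuous_intros)

lemma damped_ac_rep:
  fixes p q :: "'a::euclidean_space"
  shows "ac_rep p (\<lambda>s. damped \<eta> \<nu> (- \<nu> *\<^sub>R q) (\<nu> *\<^sub>R p) s - \<eta> *\<^sub>R damped \<eta> \<nu> p q s) (damped \<eta> \<nu> p q)"
proof -
  have "ac_rep (damped \<eta> \<nu> p q 0) (\<lambda>s. damped \<eta> \<nu> (- \<nu> *\<^sub>R q) (\<nu> *\<^sub>R p) s - \<eta> *\<^sub>R damped \<eta> \<nu> p q s) (damped \<eta> \<nu> p q)"
  proof (rule ac_rep_derivative)
    show "continuous_on UNIV (\<lambda>s. damped \<eta> \<nu> (- \<nu> *\<^sub>R q) (\<nu> *\<^sub>R p) s - \<eta> *\<^sub>R damped \<eta> \<nu> p q s)"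
      by (intro continuous_intros damped_continuous)
    show "(damped \<eta> \<nu> p q has_vector_derivative damped \<eta> \<nu> (- \<nu> *\<^sub>R q) (\<nu> *\<^sub>R p) t - \<eta> *\<^sub>R damped \<eta> \<nu> p q t) (at t)" for t
      unfolding damped_def[abs_def]
      by (auto intro!: derivative_eq_intros simp: has_vector_derivative_def algebra_simps)
  qed
  then show ?thesis by (simp add: damped_def)
qed

text \<open>The pair \<open>(q, - p)\<close> is \<open>p + i q\<close> multiplied by
  \<open>- i\<close>, a quarter period later or earlier. Adding the two forms cancels the
  oscillating terms and leaves a pure exponential.\<close>

lemma damped_inner:
  fixes p q :: "real^'k" and N :: "real^'k^'k"
  assumes "transpose N = N"
  shows "damped \<eta> \<nu> p q s \<bullet> (N *v damped \<eta> \<nu> p q s) + damped \<eta> \<nu> q (- p) s \<bullet> (N *v damped \<eta> \<nu> q (- p) s)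
    = exp (- (2 * \<eta>) * s) * (p \<bullet> (N *v p) + q \<bullet> (N *v q))"
proof -
  define e c z where "e = exp (- \<eta> * s)" and "c = cos (\<nu> * s)" and "z = sin (\<nu> * s)"
  have cz: "z * z = 1 - c * c"
    unfolding c_def z_def using sin_cos_squared_add[of "\<nu> * s"] by (simp add: power2_eq_square algebra_simps)
  have ee: "exp (- (2 * \<eta>) * s) = e * e" by (simp add: e_def exp_add[symmetric])
  have sym: "q \<bullet> (N *v p) = p \<bullet> (N *v q)" using dot_matrix_symmetric[OF assms, of q p] by (simp add: inner_commute)
  have "damped \<eta> \<nu> p q s \<bullet> (N *v damped \<eta> \<nu> p q s) + damped \<eta> \<nu> q (- p) s \<bullet> (N *v damped \<eta> \<nu> q (- p) s)
    = e * e * ((c * c + z * z) * (p \<bullet> (N *v p)) + (c * c + z * z) * (q \<bullet> (N *v q)))"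
    unfolding damped_def e_def[symmetric] c_def[symmetric] z_def[symmetric]
    by (simp add: matrix_vector_mult_scaleR matrix_vector_mult_diff_distrib matrix_vector_right_distrib
        inner_diff_left inner_diff_right inner_add_left inner_add_right sym vec.neg) (simp add: algebra_simps)
  then show ?thesis unfolding ee cz by simp
qed

lemma damped_add: "damped \<eta> \<nu> p q s + damped \<eta> \<nu> p' q' s = damped \<eta> \<nu> (p + p') (q + q') s"
  by (simp add: damped_def algebra_simps)

lemma damped_matrix: "H *v damped \<eta> \<nu> p q s = damped \<eta> \<nu> (H *v p) (H *v q) s" for H :: "real^'n^'m"
  by (simp add: damped_def matrix_vector_mult_scaleR matrix_vector_mult_diff_distrib)

lemma damped_norm_square:
  fixes p q :: "real^'k"
  shows "(norm (damped \<eta> \<nu> p q s))\<^sup>2 + (norm (damped \<eta> \<nu> q (- p) s))\<^sup>2 = exp (- (2 * \<eta>) * s) * ((norm p)\<^sup>2 + (norm q)\<^sup>2)"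
  using damped_inner[of "mat 1" \<eta> \<nu> p q s] by (simp add: power2_norm_eq_inner transpose_mat)

lemma damped_square_integrable:
  fixes p q :: "real^'k"
  assumes "0 < \<eta>" shows "square_integrable halfline (damped \<eta> \<nu> p q)"
proof (rule square_integrable_bound)
  show "damped \<eta> \<nu> p q \<in> borel_measurable halfline"
    by (rule continuous_halfline_measurable[OF continuous_on_subset[OF damped_continuous]]) simp
  show "integrable halfline (\<lambda>s. exp (- (2 * \<eta>) * s) * ((norm p)\<^sup>2 + (norm q)\<^sup>2))"
    by (intro integrable_mult_left exp_halfline) (use assms in simp)
  show "AE s in halfline. (norm (damped \<eta> \<nu> p q s))\<^sup>2 \<le> exp (- (2 * \<eta>) * s) * ((norm p)\<^sup>2 + (norm q)\<^sup>2)"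
    unfolding damped_norm_square[of \<eta> \<nu> p q, symmetric] by simp
qed

lemma damped_quad_integral:
  fixes p q :: "real^'k"
  assumes "0 < \<eta>" "transpose N = N"
  shows "(\<integral>s. damped \<eta> \<nu> p q s \<bullet> (N *v damped \<eta> \<nu> p q s) \<partial>halfline)
    + (\<integral>s. damped \<eta> \<nu> q (- p) s \<bullet> (N *v damped \<eta> \<nu> q (- p) s) \<partial>halfline)
    = (p \<bullet> (N *v p) + q \<bullet> (N *v q)) / (2 * \<eta>)"
proof -
  note s = damped_square_integrable[OF assms(1)]
  have i: "integrable halfline (\<lambda>s. damped \<eta> \<nu> p q s \<bullet> (N *v damped \<eta> \<nu> p q s))" for p q :: "real^'k"
    by (intro integrable_inner_square_integrable square_integrable_mult_vec s)
  have "(\<integral>s. damped \<eta> \<nu> p q s \<bullet> (N *v damped \<eta> \<nu> p q s) \<partial>halfline)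
    + (\<integral>s. damped \<eta> \<nu> q (- p) s \<bullet> (N *v damped \<eta> \<nu> q (- p) s) \<partial>halfline)
    = (\<integral>s. exp (- (2 * \<eta>) * s) * (p \<bullet> (N *v p) + q \<bullet> (N *v q)) \<partial>halfline)"
    unfolding damped_inner[OF assms(2), of \<eta> \<nu> p q, symmetric] by (rule Bochner_Integration.integral_add[OF i i, symmetric])
  also have "\<dots> = (p \<bullet> (N *v p) + q \<bullet> (N *v q)) / (2 * \<eta>)"
    using exp_halfline(2)[of "2 * \<eta>"] assms(1) by simp
  finally show ?thesis .
qed

lemma quad_perturb:
  fixes \<Theta> :: "real^'n^'n"
  assumes "transpose \<Theta> = \<Theta>" "\<And>v. norm (\<Theta> *v v) \<le> K * norm v" "0 < \<kappa>"
  shows "(\<phi> + r) \<bullet> (\<Theta> *v (\<phi> + r)) \<le> \<phi> \<bullet> (\<Theta> *v \<phi>) + \<kappa> * (norm \<phi>)\<^sup>2 + (K\<^sup>2 / \<kappa> + K) * (norm r)\<^sup>2"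
proof -
  have "(\<phi> + r) \<bullet> (\<Theta> *v (\<phi> + r)) = \<phi> \<bullet> (\<Theta> *v \<phi>) + 2 * (r \<bullet> (\<Theta> *v \<phi>)) + r \<bullet> (\<Theta> *v r)"
    using dot_matrix_symmetric[OF assms(1), of \<phi> r]
    by (simp add: matrix_vector_right_distrib inner_add_left inner_add_right inner_commute)
  moreover have "2 * (r \<bullet> (\<Theta> *v \<phi>)) \<le> \<kappa> * (norm \<phi>)\<^sup>2 + K\<^sup>2 / \<kappa> * (norm r)\<^sup>2"
    using dot_matrix_bound[OF assms(3,2), of r \<phi>] by (simp add: abs_le_iff)
  moreover have "r \<bullet> (\<Theta> *v r) \<le> K * (norm r)\<^sup>2"
    using norm_cauchy_schwarz[of r "\<Theta> *v r"] mult_left_mono[OF assms(2)[of r], of "norm r"]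
    by (simp add: power2_eq_square mult_ac)
  ultimately show ?thesis by (simp add: distrib_right)
qed

context lq_problem
begin

text \<open>The equations are the real form of \<open>i \<nu> z = A z + b v\<close> with
  \<open>z = p + i q\<close>, \<open>v = U + i V\<close>. The damped stationary oscillation misses
  the forced equation only by \<open>\<eta>\<close> times itself and the initial condition by
  \<open>p\<close>.\<close>

lemma damped_response:
  assumes eq: "A *v p + b *v U = - \<nu> *\<^sub>R q" "A *v q + b *v V = \<nu> *\<^sub>R p" and \<eta>: "0 < \<eta>"
  shows "ac_rep (- p) (\<lambda>s. A *v (response (damped \<eta> \<nu> U V) s - damped \<eta> \<nu> p q s) + \<eta> *\<^sub>R damped \<eta> \<nu> p q s)
    (\<lambda>s. response (damped \<eta> \<nu> U V) s - damped \<eta> \<nu> p q s)"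
proof (rule ac_rep_cong[OF ac_rep_diff[OF response_ac_rep[OF damped_square_integrable[OF \<eta>]] damped_ac_rep]])
  fix s :: real
  have "damped \<eta> \<nu> (- \<nu> *\<^sub>R q) (\<nu> *\<^sub>R p) s = A *v damped \<eta> \<nu> p q s + b *v damped \<eta> \<nu> U V s"
    unfolding damped_matrix damped_add eq ..
  then show "A *v response (damped \<eta> \<nu> U V) s + b *v damped \<eta> \<nu> U V s
      - (damped \<eta> \<nu> (- \<nu> *\<^sub>R q) (\<nu> *\<^sub>R p) s - \<eta> *\<^sub>R damped \<eta> \<nu> p q s)
     = A *v (response (damped \<eta> \<nu> U V) s - damped \<eta> \<nu> p q s) + \<eta> *\<^sub>R damped \<eta> \<nu> p q s"
    by (simp add: matrix_vector_mult_diff_distrib)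
qed auto

text \<open>The response to a slowly damped oscillation is the damped stationary oscillation up to a
  remainder that stays bounded in \<open>L\<^sup>2\<close> as the damping \<open>\<eta>\<close> tends to zero.\<close>

lemma frequency_condition_necessary:
  assumes nonneg: "\<And>u. square_integrable halfline u \<Longrightarrow> 0 \<le> quad_cost u (response u)"
    and eq: "A *v p + b *v U = - \<nu> *\<^sub>R q" "A *v q + b *v V = \<nu> *\<^sub>R p"
  shows "0 \<le> p \<bullet> (\<Theta> *v p) + q \<bullet> (\<Theta> *v q) + U \<bullet> (\<Gamma> *v U) + V \<bullet> (\<Gamma> *v V)" (is "0 \<le> ?F")
proof -
  obtain c where c: "0 \<le> c" "\<And>d0 f d. ac_rep d0 (\<lambda>s. A *v d s + f s) d \<Longrightarrow> square_integrable halfline f \<Longrightarrow>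
       square_integrable halfline d \<and>
       (\<integral>s. (norm (d s))\<^sup>2 \<partial>halfline) \<le> c * ((norm d0)\<^sup>2 + (\<integral>s. (norm (f s))\<^sup>2 \<partial>halfline))"
    by (rule l2_stability, rule that)
  obtain K where K: "0 \<le> K" "\<And>v. norm (\<Theta> *v v) \<le> K * norm v" using matrix_vector_bound[of \<Theta>] by blast
  define P where "P = (norm p)\<^sup>2 + (norm q)\<^sup>2"
  have main: "0 \<le> ?F + \<kappa> * P + 2 * \<eta> * ((K\<^sup>2 / \<kappa> + K) * (2 * c * P))" if k: "0 < \<kappa>" and e: "0 < \<eta>" "\<eta> \<le> 1" for \<kappa> \<eta>
  proof -
    let ?D = "\<lambda>p q. damped \<eta> \<nu> p q"
    let ?C = "K\<^sup>2 / \<kappa> + K"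
    have C0: "0 \<le> ?C" using K(1) k by simp
    note sD = damped_square_integrable[OF e(1), of \<nu>]
    \<comment> \<open>\<open>I\<close> is the energy of the remainder. Perturbing the form in the
      state with parameter \<open>\<kappa>\<close> separates it from the stationary part.\<close>
    have one: "\<exists>I. quad_cost (?D U V) (response (?D U V)) \<le> (\<integral>s. ?D p q s \<bullet> (\<Theta> *v ?D p q s) \<partial>halfline)
        + \<kappa> * (\<integral>s. (norm (?D p q s))\<^sup>2 \<partial>halfline) + ?C * I + (\<integral>s. ?D U V s \<bullet> (\<Gamma> *v ?D U V s) \<partial>halfline)
        \<and> I \<le> c * ((norm p)\<^sup>2 + \<eta>\<^sup>2 * (\<integral>s. (norm (?D p q s))\<^sup>2 \<partial>halfline))"
      if eq: "A *v p + b *v U = - \<nu> *\<^sub>R q" "A *v q + b *v V = \<nu> *\<^sub>R p" for p q U V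
    proof -
      let ?r = "\<lambda>s. response (?D U V) s - ?D p q s"
      note cr = c(2)[OF damped_response[OF eq e(1)] square_integrable_scaleR[OF sD]]
      have sr: "square_integrable halfline ?r" using cr by blast
      have i: "integrable halfline (\<lambda>s. ?D p q s \<bullet> (\<Theta> *v ?D p q s))" "integrable halfline (\<lambda>s. ?D U V s \<bullet> (\<Gamma> *v ?D U V s))"
        "integrable halfline (\<lambda>s. (norm (?D p q s))\<^sup>2)" "integrable halfline (\<lambda>s. (norm (?r s))\<^sup>2)"
        by (intro integrable_inner_square_integrable square_integrable_mult_vec sD square_integrableD(2) sr)+
      have "quad_cost (?D U V) (response (?D U V))
        \<le> (\<integral>s. ?D p q s \<bullet> (\<Theta> *v ?D p q s) + \<kappa> * (norm (?D p q s))\<^sup>2 + ?C * (norm (?r s))\<^sup>2 + ?D U V s \<bullet> (\<Gamma> *v ?D U V s) \<partial>halfline)"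
        unfolding quad_cost_def
      proof (rule integral_mono)
        show "integrable halfline (\<lambda>s. response (?D U V) s \<bullet> (\<Theta> *v response (?D U V) s) + ?D U V s \<bullet> (\<Gamma> *v ?D U V s))"
          by (rule quad_cost_integrable[OF sD response_square_integrable[OF sD]])
        show "integrable halfline (\<lambda>s. ?D p q s \<bullet> (\<Theta> *v ?D p q s) + \<kappa> * (norm (?D p q s))\<^sup>2 + ?C * (norm (?r s))\<^sup>2 + ?D U V s \<bullet> (\<Gamma> *v ?D U V s))"
          by (intro Bochner_Integration.integrable_add integrable_mult_right i)
        show "response (?D U V) s \<bullet> (\<Theta> *v response (?D U V) s) + ?D U V s \<bullet> (\<Gamma> *v ?D U V s)
          \<le> ?D p q s \<bullet> (\<Theta> *v ?D p q s) + \<kappa> * (norm (?D p q s))\<^sup>2 + ?C * (norm (?r s))\<^sup>2 + ?D U V s \<bullet> (\<Gamma> *v ?D U V s)" for s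
          using quad_perturb[OF \<Theta>_sym K(2) k, of "?D p q s" "?r s"] by simp
      qed
      also have "\<dots> = (\<integral>s. ?D p q s \<bullet> (\<Theta> *v ?D p q s) \<partial>halfline) + \<kappa> * (\<integral>s. (norm (?D p q s))\<^sup>2 \<partial>halfline)
         + ?C * (\<integral>s. (norm (?r s))\<^sup>2 \<partial>halfline) + (\<integral>s. ?D U V s \<bullet> (\<Gamma> *v ?D U V s) \<partial>halfline)"
        by (simp only: Bochner_Integration.integral_add Bochner_Integration.integrable_add integrable_mult_right i
          Bochner_Integration.integral_mult_right_zero)
      finally show ?thesis
        using cr by (intro exI[of _ "\<integral>s. (norm (?r s))\<^sup>2 \<partial>halfline"]) (simp add: power_mult_distrib)
    qed
    obtain I1 where I1: "quad_cost (?D U V) (response (?D U V)) \<le> (\<integral>s. ?D p q s \<bullet> (\<Theta> *v ?D p q s) \<partial>halfline)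
        + \<kappa> * (\<integral>s. (norm (?D p q s))\<^sup>2 \<partial>halfline) + ?C * I1 + (\<integral>s. ?D U V s \<bullet> (\<Gamma> *v ?D U V s) \<partial>halfline)"
        "I1 \<le> c * ((norm p)\<^sup>2 + \<eta>\<^sup>2 * (\<integral>s. (norm (?D p q s))\<^sup>2 \<partial>halfline))"
      using one[OF eq] by blast
    \<comment> \<open>Multiplication by \<open>- i\<close> preserves the stationary equations, so
      the shifted pair is a test oscillation as well.\<close>
    have eq': "A *v q + b *v V = - \<nu> *\<^sub>R (- p)" "A *v (- p) + b *v (- U) = \<nu> *\<^sub>R q"
    proof -
      have "A *v (- p) + b *v (- U) = - (A *v p + b *v U)" by (simp add: vec.neg)
      then show "A *v q + b *v V = - \<nu> *\<^sub>R (- p)" "A *v (- p) + b *v (- U) = \<nu> *\<^sub>R q"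
        unfolding eq by simp_all
    qed
    obtain I2 where I2: "quad_cost (?D V (- U)) (response (?D V (- U))) \<le> (\<integral>s. ?D q (- p) s \<bullet> (\<Theta> *v ?D q (- p) s) \<partial>halfline)
        + \<kappa> * (\<integral>s. (norm (?D q (- p) s))\<^sup>2 \<partial>halfline) + ?C * I2 + (\<integral>s. ?D V (- U) s \<bullet> (\<Gamma> *v ?D V (- U) s) \<partial>halfline)"
        "I2 \<le> c * ((norm q)\<^sup>2 + \<eta>\<^sup>2 * (\<integral>s. (norm (?D q (- p) s))\<^sup>2 \<partial>halfline))"
      using one[OF eq'] by blast
    note q1 = damped_quad_integral[OF e(1) \<Theta>_sym, of \<nu> p q] and q2 = damped_quad_integral[OF e(1) \<Gamma>_sym, of \<nu> U V]
    have q3: "(\<integral>s. (norm (?D p q s))\<^sup>2 \<partial>halfline) + (\<integral>s. (norm (?D q (- p) s))\<^sup>2 \<partial>halfline) = P / (2 * \<eta>)"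
      using damped_quad_integral[OF e(1), of "mat 1" \<nu> p q] by (simp add: power2_norm_eq_inner transpose_mat P_def)
    have "I1 + I2 \<le> c * (P + \<eta>\<^sup>2 * ((\<integral>s. (norm (?D p q s))\<^sup>2 \<partial>halfline) + (\<integral>s. (norm (?D q (- p) s))\<^sup>2 \<partial>halfline)))"
      using I1(2) I2(2) by (simp add: P_def algebra_simps)
    \<comment> \<open>The forcing of the remainder has size \<open>\<eta>\<close> while the
      oscillation has energy \<open>P / (2 * \<eta>)\<close>; with the squared factor a term of
      order \<open>\<eta>\<close> remains.\<close>
    also have "\<dots> = c * (P + \<eta> / 2 * P)" unfolding q3 using e(1) by (simp add: power2_eq_square)
    also have "\<dots> \<le> c * (2 * P)"
    proof (rule mult_left_mono[OF _ c(1)])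
      have "\<eta> / 2 * P \<le> 1 * P" using e by (intro mult_right_mono) (auto simp: P_def)
      then show "P + \<eta> / 2 * P \<le> 2 * P" by simp
    qed
    also have "c * (2 * P) = 2 * c * P" by simp
    finally have "?C * (I1 + I2) \<le> ?C * (2 * c * P)" by (rule mult_left_mono[OF _ C0])
    then have I: "?C * I1 + ?C * I2 \<le> ?C * (2 * c * P)" by (simp only: distrib_left)
    have "0 \<le> quad_cost (?D U V) (response (?D U V)) + quad_cost (?D V (- U)) (response (?D V (- U)))"
      by (intro add_nonneg_nonneg nonneg sD)
    also have "\<dots> \<le> (p \<bullet> (\<Theta> *v p) + q \<bullet> (\<Theta> *v q)) / (2 * \<eta>) + \<kappa> * (P / (2 * \<eta>)) + ?C * (2 * c * P)
        + (U \<bullet> (\<Gamma> *v U) + V \<bullet> (\<Gamma> *v V)) / (2 * \<eta>)"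
      using I1(1) I2(1) I unfolding q1[symmetric] q2[symmetric] q3[symmetric] distrib_left[of \<kappa>] by linarith
    also have "\<dots> = (?F + \<kappa> * P + 2 * \<eta> * (?C * (2 * c * P))) / (2 * \<eta>)"
      using e(1) by (simp add: add_divide_distrib)
    finally show ?thesis using e(1) by (simp add: zero_le_divide_iff)
  qed
  \<comment> \<open>The order of limits matters: the remainder carries
    \<open>K\<^sup>2 / \<kappa>\<close>, so \<open>\<eta>\<close> tends to 0 at fixed
    \<open>\<kappa>\<close>, and \<open>\<kappa>\<close> afterwards.\<close>
  have "0 \<le> ?F + \<kappa> * P" if k: "0 < \<kappa>" for \<kappa>
  proof (rule tendsto_lowerbound)
    have "((\<lambda>\<eta>. ?F + \<kappa> * P + 2 * \<eta> * ((K\<^sup>2 / \<kappa> + K) * (2 * c * P)))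
        \<longlongrightarrow> ?F + \<kappa> * P + 2 * 0 * ((K\<^sup>2 / \<kappa> + K) * (2 * c * P))) (at_right 0)"
      by (intro tendsto_intros)
    then show "((\<lambda>\<eta>. ?F + \<kappa> * P + 2 * \<eta> * ((K\<^sup>2 / \<kappa> + K) * (2 * c * P))) \<longlongrightarrow> ?F + \<kappa> * P) (at_right 0)" by simp
    show "\<forall>\<^sub>F \<eta> in at_right 0. 0 \<le> ?F + \<kappa> * P + 2 * \<eta> * ((K\<^sup>2 / \<kappa> + K) * (2 * c * P))"
      unfolding eventually_at_right_field using main[OF k] by (intro exI[of _ 1]) auto
  qed simp
  moreover have "((\<lambda>\<kappa>. ?F + \<kappa> * P) \<longlongrightarrow> ?F + 0 * P) (at_right 0)" by (intro tendsto_intros)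
  ultimately have "0 \<le> ?F + 0 * P"
    by (intro tendsto_lowerbound[of _ _ "at_right 0"])
      (auto simp: eventually_at_right_field intro!: zero_less_one exI[of _ "1 :: real"])
  then show ?thesis by simp
qed

text \<open>Multiplying by \<open>exp (\<kappa> t)\<close> replaces \<open>A\<close> by
  \<open>A + \<kappa>\<close>, for which \<open>H\<close> is still a Lyapunov function when
  \<open>\<kappa>\<close> is small. The forcing stops at \<open>T\<close>, so it remains square
  integrable with the weight, and the weighted solution is bounded.\<close>

lemma exponential_decay:
  assumes d: "ac_rep y (\<lambda>s. A *v d s + g s) d" and g: "square_integrable halfline g" and z: "\<And>s. T < s \<Longrightarrow> g s = 0"
  obtains C \<kappa> where "0 < \<kappa>" "\<And>t. 0 \<le> t \<Longrightarrow> norm (d t) \<le> C * exp (- \<kappa> * t)"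
proof -
  obtain K where K: "0 \<le> K" "\<And>v. norm (H *v v) \<le> K * norm v" using matrix_vector_bound[of H] by blast
  obtain \<mu> where \<mu>: "0 < \<mu>" "\<And>v. \<mu> * (norm v)\<^sup>2 \<le> v \<bullet> (H *v v)"
    by (rule positive_definite_bound[OF H_pos], assumption, rule that)
  \<comment> \<open>The shift costs at most \<open>2 * \<kappa> * K \<le> 1 / 2\<close>, half of the
    dissipation.\<close>
  define \<kappa> where "\<kappa> = 1 / (4 * (K + 1))"
  have \<kappa>0: "0 < \<kappa>" using K(1) by (simp add: \<kappa>_def)
  have \<kappa>K: "2 * \<kappa> * K \<le> 1 / 2" using K(1) by (simp add: \<kappa>_def field_simps)
  define e where "e t = exp (\<kappa> * t) *\<^sub>R d t" for t
  define f where "f t = exp (\<kappa> * t) *\<^sub>R g t" for t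
  let ?A = "A + \<kappa> *\<^sub>R mat 1"
  have "ac_rep (exp (\<kappa> * 0)) (\<lambda>t. \<kappa> * exp (\<kappa> * t)) (\<lambda>t. exp (\<kappa> * t))"
    by (rule ac_rep_derivative) (auto intro!: continuous_intros derivative_eq_intros
        simp: has_real_derivative_iff_has_vector_derivative[symmetric])
  then have "ac_rep (1 :: real) (\<lambda>t. \<kappa> * exp (\<kappa> * t)) (\<lambda>t. exp (\<kappa> * t))" by simp
  from ac_rep_bilinear[OF bounded_bilinear_scaleR this d]
  have e: "ac_rep y (\<lambda>s. ?A *v e s + f s) e"
    by (rule ac_rep_cong) (auto simp: e_def f_def matrix_vector_mult_add_rdistrib matrix_vector_mult_scaleR
        scaleR_matrix_vector_assoc[symmetric] scaleR_add_right)
  have fs: "square_integrable halfline f"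
  proof (rule square_integrable_bound)
    have "(\<lambda>t. exp (\<kappa> * t)) \<in> borel_measurable halfline"
      by (rule continuous_halfline_measurable) (intro continuous_intros)
    then show "f \<in> borel_measurable halfline"
      unfolding f_def[abs_def] using square_integrableD(1)[OF g] by (intro borel_measurable_scaleR)
    show "integrable halfline (\<lambda>t. (exp (\<kappa> * T))\<^sup>2 * (norm (g t))\<^sup>2)"
      by (intro integrable_mult_right square_integrableD(2) g)
    show "AE t in halfline. (norm (f t))\<^sup>2 \<le> (exp (\<kappa> * T))\<^sup>2 * (norm (g t))\<^sup>2"
    proof (rule AE_I2)
      fix t
      show "(norm (f t))\<^sup>2 \<le> (exp (\<kappa> * T))\<^sup>2 * (norm (g t))\<^sup>2"
        using z[of t] \<kappa>0 by (cases "T < t") (auto simp: f_def power_mult_distrib intro!: mult_right_mono power_mono)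
    qed
  qed
  define R where "R = y \<bullet> (H *v y) + 2 * K\<^sup>2 / (1/2) * (\<integral>s. (norm (f s))\<^sup>2 \<partial>halfline)"
  have bound: "\<mu> * (norm (e t))\<^sup>2 \<le> R" if t: "0 \<le> t" for t
  proof -
    have "e t \<bullet> (H *v e t) + (1/2) / 2 * (\<integral>s. (norm (e s))\<^sup>2 \<partial>upto_measure t)
      \<le> y \<bullet> (H *v y) + 2 * K\<^sup>2 / (1/2) * (\<integral>s. (norm (f s))\<^sup>2 \<partial>upto_measure t)"
    proof (rule energy_estimate[OF H_sym K(2) _ _ e square_integrable_halfline_upto[OF fs] t])
      fix v
      have "v \<bullet> (H *v v) \<le> K * (norm v)\<^sup>2"
        using norm_cauchy_schwarz[of v "H *v v"] mult_left_mono[OF K(2)[of v], of "norm v"]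
        by (simp add: power2_eq_square mult_ac)
      then have "2 * \<kappa> * (v \<bullet> (H *v v)) \<le> 2 * \<kappa> * (K * (norm v)\<^sup>2)" using \<kappa>0 by (intro mult_left_mono) auto
      also have "\<dots> = 2 * \<kappa> * K * (norm v)\<^sup>2" by simp
      also have "\<dots> \<le> 1 / 2 * (norm v)\<^sup>2" by (rule mult_right_mono[OF \<kappa>K]) simp
      finally have "2 * \<kappa> * (v \<bullet> (H *v v)) \<le> 1 / 2 * (norm v)\<^sup>2" .
      moreover have "2 * ((?A *v v) \<bullet> (H *v v)) = 2 * ((A *v v) \<bullet> (H *v v)) + 2 * \<kappa> * (v \<bullet> (H *v v))"
        by (simp add: matrix_vector_mult_add_rdistrib scaleR_matrix_vector_assoc[symmetric] inner_add_left distrib_left)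
      ultimately show "2 * ((?A *v v) \<bullet> (H *v v)) \<le> - (1/2) * (norm v)\<^sup>2" using H_lyap[of v] by simp
    qed simp
    moreover have "0 \<le> (1/2) / 2 * (\<integral>s. (norm (e s))\<^sup>2 \<partial>upto_measure t)" by simp
    moreover have "2 * K\<^sup>2 / (1/2) * (\<integral>s. (norm (f s))\<^sup>2 \<partial>upto_measure t) \<le> 2 * K\<^sup>2 / (1/2) * (\<integral>s. (norm (f s))\<^sup>2 \<partial>halfline)"
    proof (rule mult_left_mono)
      have "integrable lborel (\<lambda>s. indicat_real {0<..t} s *\<^sub>R (norm (f s))\<^sup>2)"
        using integrable_halfline_upto[OF square_integrableD(2)[OF fs]] by (simp only: upto_integrable_iff)
      moreover have "integrable lborel (\<lambda>s. indicat_real {0<..} s *\<^sub>R (norm (f s))\<^sup>2)"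
        using square_integrableD(2)[OF fs] by (simp only: halfline_integrable_iff)
      ultimately show "(\<integral>s. (norm (f s))\<^sup>2 \<partial>upto_measure t) \<le> (\<integral>s. (norm (f s))\<^sup>2 \<partial>halfline)"
        unfolding upto_integral halfline_integral by (rule integral_mono) (auto simp: indicator_def)
    qed simp
    ultimately show ?thesis using \<mu>(2)[of "e t"] unfolding R_def by linarith
  qed
  show thesis
  proof (rule that[OF \<kappa>0])
    fix t :: real assume t: "0 \<le> t"
    have "(norm (e t))\<^sup>2 \<le> R / \<mu>" using bound[OF t] \<mu>(1) by (simp add: field_simps)
    then have "norm (e t) \<le> sqrt (R / \<mu>)" by (rule real_le_rsqrt)
    then show "norm (d t) \<le> sqrt (R / \<mu>) * exp (- \<kappa> * t)"
      by (simp add: e_def exp_minus field_simps)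
  qed
qed

end

section \<open>Cosine and sine transforms on the half line\<close>

definition zero_ext :: "(real \<Rightarrow> 'a::real_vector) \<Rightarrow> real \<Rightarrow> 'a" where
  "zero_ext f t = indicator {0<..} t *\<^sub>R f t"

text \<open>Conditions at positive times only: the jump of the extension by zero sits at the single
  point 0, so each component of the extension is \<open>nice\<close> on the whole line.\<close>

definition nice_halfline :: "(real \<Rightarrow> real^'k) \<Rightarrow> bool" where
  "nice_halfline f \<longleftrightarrow> integrable halfline f \<and> (\<exists>B. \<forall>t>0. norm (f t) \<le> B) \<and>
     (AE t in lborel. 0 < t \<longrightarrow> isCont f t)"

definition cos_vec :: "(real \<Rightarrow> real^'k) \<Rightarrow> real \<Rightarrow> real^'k" where
  "cos_vec f \<nu> = (\<integral>t. cos (\<nu> * t) *\<^sub>R f t \<partial>halfline)"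

definition sin_vec :: "(real \<Rightarrow> real^'k) \<Rightarrow> real \<Rightarrow> real^'k" where
  "sin_vec f \<nu> = (\<integral>t. sin (\<nu> * t) *\<^sub>R f t \<partial>halfline)"

lemma nice_halfline_component:
  assumes "nice_halfline f" shows "nice (\<lambda>t. zero_ext f t $ i)"
  unfolding nice_def
proof (intro conjI)
  have "integrable lborel (zero_ext f)"
    using assms unfolding nice_halfline_def halfline_integrable_iff zero_ext_def[abs_def] by blast
  then show "integrable lborel (\<lambda>t. zero_ext f t $ i)"
    by (rule integrable_bounded_linear[OF bounded_linear_vec_nth])
  obtain B where B: "\<And>t. 0 < t \<Longrightarrow> norm (f t) \<le> B" using assms by (auto simp: nice_halfline_def)
  have "\<bar>zero_ext f t $ i\<bar> \<le> max B 0" for t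
    using B[of t] component_le_norm_cart[of "f t" i] by (cases "0 < t") (auto simp: zero_ext_def)
  then show "\<exists>B. \<forall>t. \<bar>zero_ext f t $ i\<bar> \<le> B" by blast
  have "AE t in lborel. 0 < t \<longrightarrow> isCont f t" using assms by (simp add: nice_halfline_def)
  then show "AE t in lborel. isCont (\<lambda>t. zero_ext f t $ i) t"
    using AE_lborel_singleton[of 0]
  proof eventually_elim
    case (elim t)
    show ?case
    proof (cases "0 < t")
      case True
      then have "\<forall>\<^sub>F s in nhds t. zero_ext f s $ i = f s $ i"
        by (intro eventually_nhds_in_open[of "{0<..}", THEN eventually_mono]) (auto simp: zero_ext_def)
      moreover have "isCont (\<lambda>s. f s $ i) t" using elim True by (intro continuous_intros) auto
      ultimately show ?thesis by (subst isCont_cong)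
    next
      case False
      then have "\<forall>\<^sub>F s in nhds t. zero_ext f s $ i = 0"
        using elim(2) by (intro eventually_nhds_in_open[of "{..<0}", THEN eventually_mono]) (auto simp: zero_ext_def)
      then show ?thesis by (subst isCont_cong) auto
    qed
  qed
qed

lemma transform_component:
  assumes "integrable halfline f"
  shows "cos_vec f \<nu> $ i = cos_transform (\<lambda>t. zero_ext f t $ i) \<nu>"
    and "sin_vec f \<nu> $ i = sin_transform (\<lambda>t. zero_ext f t $ i) \<nu>"
proof -
  have i: "integrable halfline (\<lambda>t. c t *\<^sub>R f t)" if "continuous_on UNIV c" "\<And>t. \<bar>c t\<bar> \<le> 1" for c :: "real \<Rightarrow> real"
  proof (rule Bochner_Integration.integrable_bound[OF assms])
    have "c \<in> borel_measurable halfline"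
      by (rule continuous_halfline_measurable[OF continuous_on_subset[OF that(1)]]) simp
    then show "(\<lambda>t. c t *\<^sub>R f t) \<in> borel_measurable halfline" using assms by (intro borel_measurable_scaleR) auto
    show "AE t in halfline. norm (c t *\<^sub>R f t) \<le> norm (f t)"
      using that(2) by (auto intro!: mult_left_le_one_le)
  qed
  have cs: "continuous_on UNIV (\<lambda>t. cos (\<nu> * t))" "continuous_on UNIV (\<lambda>t. sin (\<nu> * t))"
    by (intro continuous_intros)+
  have "cos_vec f \<nu> $ i = (\<integral>t. (cos (\<nu> * t) *\<^sub>R f t) $ i \<partial>halfline)"
    unfolding cos_vec_def by (rule integral_bounded_linear[OF bounded_linear_vec_nth i, symmetric]) (use cs in auto)
  then show "cos_vec f \<nu> $ i = cos_transform (\<lambda>t. zero_ext f t $ i) \<nu>"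
    unfolding halfline_integral cos_transform_def zero_ext_def by (simp add: mult_ac)
  have "sin_vec f \<nu> $ i = (\<integral>t. (sin (\<nu> * t) *\<^sub>R f t) $ i \<partial>halfline)"
    unfolding sin_vec_def by (rule integral_bounded_linear[OF bounded_linear_vec_nth i, symmetric]) (use cs in auto)
  then show "sin_vec f \<nu> $ i = sin_transform (\<lambda>t. zero_ext f t $ i) \<nu>"
    unfolding halfline_integral sin_transform_def zero_ext_def by (simp add: mult_ac)
qed

lemma inner_matrix_sum: "x \<bullet> (N *v y) = (\<Sum>i\<in>UNIV. \<Sum>j\<in>UNIV. N $ i $ j * (x $ i * y $ j))" for N :: "real^'n^'m"
  unfolding inner_vec_def matrix_vector_mult_def by (simp add: sum_distrib_left mult_ac)

text \<open>Parseval for each pair of components, weighted with the entries of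
  \<open>N\<close>.\<close>

lemma parseval_matrix:
  fixes f :: "real \<Rightarrow> real^'m" and g :: "real \<Rightarrow> real^'n" and N :: "real^'n^'m"
  assumes f: "nice_halfline f" and g: "nice_halfline g"
  shows "integrable lborel (\<lambda>\<nu>. cos_vec f \<nu> \<bullet> (N *v cos_vec g \<nu>) + sin_vec f \<nu> \<bullet> (N *v sin_vec g \<nu>))"
    and "(\<integral>\<nu>. cos_vec f \<nu> \<bullet> (N *v cos_vec g \<nu>) + sin_vec f \<nu> \<bullet> (N *v sin_vec g \<nu>) \<partial>lborel)
      = 2 * pi * (\<integral>t. f t \<bullet> (N *v g t) \<partial>halfline)"
proof -
  let ?f = "\<lambda>i t. zero_ext f t $ i" and ?g = "\<lambda>i t. zero_ext g t $ i"
  note nf = nice_halfline_component[OF f] and ng = nice_halfline_component[OF g]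
  have fi: "integrable halfline f" "integrable halfline g" using f g by (auto simp: nice_halfline_def)
  have eq: "cos_vec f \<nu> \<bullet> (N *v cos_vec g \<nu>) + sin_vec f \<nu> \<bullet> (N *v sin_vec g \<nu>)
    = (\<Sum>i\<in>UNIV. \<Sum>j\<in>UNIV. N $ i $ j * spectral_product (?f i) (?g j) \<nu>)" for \<nu>
    unfolding inner_matrix_sum transform_component[OF fi(1)] transform_component[OF fi(2)]
    by (simp add: spectral_product_def distrib_left sum.distrib)
  note P = parseval(5)[OF nf ng] parseval(6)[OF nf ng]
  show "integrable lborel (\<lambda>\<nu>. cos_vec f \<nu> \<bullet> (N *v cos_vec g \<nu>) + sin_vec f \<nu> \<bullet> (N *v sin_vec g \<nu>))"
    unfolding eq by (intro Bochner_Integration.integrable_sum integrable_mult_right P)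
  have fg: "integrable lborel (\<lambda>t. ?f i t * ?g j t)" for i j
  proof -
    obtain B where "\<And>t. \<bar>?f i t\<bar> \<le> B" using nf[of i] by (auto simp: nice_def)
    then show ?thesis using nf[of i] ng[of j] by (intro integrable_bounded_mult[where B=B]) (auto simp: nice_def)
  qed
  have "(\<integral>\<nu>. cos_vec f \<nu> \<bullet> (N *v cos_vec g \<nu>) + sin_vec f \<nu> \<bullet> (N *v sin_vec g \<nu>) \<partial>lborel)
    = (\<Sum>i\<in>UNIV. \<Sum>j\<in>UNIV. N $ i $ j * (2 * pi * (\<integral>t. ?f i t * ?g j t \<partial>lborel)))"
    unfolding eq
    by (simp only: Bochner_Integration.integral_sum Bochner_Integration.integrable_sum integrable_mult_right P
        Bochner_Integration.integral_mult_right_zero)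
  also have "\<dots> = 2 * pi * (\<Sum>i\<in>UNIV. \<Sum>j\<in>UNIV. (\<integral>t. N $ i $ j * (?f i t * ?g j t) \<partial>lborel))"
    unfolding Bochner_Integration.integral_mult_right_zero sum_distrib_left by (simp only: mult_ac)
  also have "(\<Sum>i\<in>UNIV. \<Sum>j\<in>UNIV. (\<integral>t. N $ i $ j * (?f i t * ?g j t) \<partial>lborel))
    = (\<integral>t. (\<Sum>i\<in>UNIV. \<Sum>j\<in>UNIV. N $ i $ j * (?f i t * ?g j t)) \<partial>lborel)"
    by (simp only: Bochner_Integration.integral_sum Bochner_Integration.integrable_sum integrable_mult_right fg)
  also have "\<dots> = (\<integral>t. f t \<bullet> (N *v g t) \<partial>halfline)"
    unfolding halfline_integral inner_matrix_sum
    by (intro Bochner_Integration.integral_cong refl) (auto simp: zero_ext_def indicator_def)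
  finally show "(\<integral>\<nu>. cos_vec f \<nu> \<bullet> (N *v cos_vec g \<nu>) + sin_vec f \<nu> \<bullet> (N *v sin_vec g \<nu>) \<partial>lborel)
      = 2 * pi * (\<integral>t. f t \<bullet> (N *v g t) \<partial>halfline)" .
qed

lemma exp_bound_nice:
  fixes d :: "real \<Rightarrow> real^'k"
  assumes d: "continuous_on {0..} d" and k: "0 < \<kappa>" and le: "\<And>t. 0 \<le> t \<Longrightarrow> norm (d t) \<le> C * exp (- \<kappa> * t)"
  shows "nice_halfline d" and "(d \<longlongrightarrow> 0) at_top"
proof -
  have C: "0 \<le> C" using order_trans[OF norm_ge_zero le[of 0]] by simp
  show "nice_halfline d"
    unfolding nice_halfline_def
  proof (intro conjI exI[of _ C] allI impI)
    show "integrable halfline d"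
    proof (rule Bochner_Integration.integrable_bound)
      show "integrable halfline (\<lambda>t. C * exp (- \<kappa> * t))" by (intro integrable_mult_right exp_halfline k)
      show "d \<in> borel_measurable halfline" by (rule continuous_halfline_measurable[OF d])
      show "AE t in halfline. norm (d t) \<le> norm (C * exp (- \<kappa> * t))"
        using le C by (intro AE_I2) (auto simp: space_restrict_space)
    qed
    show "norm (d t) \<le> C" if "0 < t" for t
    proof -
      have "C * exp (- \<kappa> * t) \<le> C * 1" using that k C by (intro mult_left_mono) auto
      then show ?thesis using le[of t] that by simp
    qed
    show "AE t in lborel. 0 < t \<longrightarrow> isCont d t"
    proof (intro AE_I2 impI)
      fix t :: real assume "0 < t"
      then show "isCont d t"
        using continuous_on_interior[OF d, of t] by simp
    qed
  qed
  have "((\<lambda>t. exp (- \<kappa> * t)) \<longlongrightarrow> 0) at_top"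
    using k by (intro filterlim_compose[OF exp_at_bot] filterlim_tendsto_neg_mult_at_bot[OF tendsto_const _ filterlim_ident]) auto
  then have "((\<lambda>t. C * exp (- \<kappa> * t)) \<longlongrightarrow> C * 0) at_top" by (intro tendsto_intros)
  then have "((\<lambda>t. C * exp (- \<kappa> * t)) \<longlongrightarrow> 0) at_top" by simp
  then show "(d \<longlongrightarrow> 0) at_top"
    by (rule Lim_null_comparison[rotated], intro eventually_at_top_linorderI[of 0] le)
qed

lemma integrable_trig_halfline:
  fixes f :: "real \<Rightarrow> real^'k"
  assumes "integrable halfline f" "continuous_on UNIV c" "\<And>t. \<bar>c t\<bar> \<le> 1"
  shows "integrable halfline (\<lambda>t. c t *\<^sub>R f t)"
proof (rule Bochner_Integration.integrable_bound[OF assms(1)])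
  have "c \<in> borel_measurable halfline"
    by (rule continuous_halfline_measurable[OF continuous_on_subset[OF assms(2)]]) simp
  then show "(\<lambda>t. c t *\<^sub>R f t) \<in> borel_measurable halfline" using assms by (intro borel_measurable_scaleR) auto
  show "AE t in halfline. norm (c t *\<^sub>R f t) \<le> norm (f t)"
    using assms(3) by (auto intro!: mult_left_le_one_le)
qed

text \<open>The real form of \<open>(i\<nu> - A) (\<F> d) \<nu> = y + (\<F> g) \<nu>\<close>, where \<open>\<F> f \<nu> = cos_vec f \<nu> - i sin_vec f \<nu>\<close>.\<close>

lemma transform_of_solution:
  fixes A :: "real^'n^'n"
  assumes d: "ac_rep y (\<lambda>s. A *v d s + g s) d" and di: "integrable halfline d" and gi: "integrable halfline g"
    and lim: "(d \<longlongrightarrow> 0) at_top"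
  shows "A *v cos_vec d \<nu> + cos_vec g \<nu> = \<nu> *\<^sub>R sin_vec d \<nu> - y"
    and "A *v sin_vec d \<nu> + sin_vec g \<nu> = - \<nu> *\<^sub>R cos_vec d \<nu>"
proof -
  have cs: "continuous_on UNIV (\<lambda>t. cos (\<nu> * t))" "continuous_on UNIV (\<lambda>t. sin (\<nu> * t))"
    by (intro continuous_intros)+
  note ic = integrable_trig_halfline[OF _ cs(1) abs_cos_le_one] and isn = integrable_trig_halfline[OF _ cs(2) abs_sin_le_one]
  have Ai: "integrable halfline (\<lambda>s. A *v f s)" if "integrable halfline f" for f
    by (rule integrable_bounded_linear[OF bounded_linear_matrix_vector that])
  have zero: "((\<lambda>t. c t *\<^sub>R d t) \<longlongrightarrow> 0) at_top" if "\<And>t. \<bar>c t\<bar> \<le> 1" for c :: "real \<Rightarrow> real"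
    by (rule Lim_null_comparison[OF _ tendsto_norm_zero[OF lim]])
      (use that in \<open>auto intro!: always_eventually mult_left_le_one_le\<close>)
  have ccos: "ac_rep (cos (\<nu> * 0)) (\<lambda>s. - (\<nu> * sin (\<nu> * s))) (\<lambda>s. cos (\<nu> * s))"
    by (rule ac_rep_derivative) (auto intro!: continuous_intros derivative_eq_intros
        simp: has_real_derivative_iff_has_vector_derivative[symmetric])
  have csin: "ac_rep (sin (\<nu> * 0)) (\<lambda>s. \<nu> * cos (\<nu> * s)) (\<lambda>s. sin (\<nu> * s))"
    by (rule ac_rep_derivative) (auto intro!: continuous_intros derivative_eq_intros
        simp: has_real_derivative_iff_has_vector_derivative[symmetric])
  \<comment> \<open>A represented function that vanishes at infinity has initial value and total
    integral adding up to zero. Applied to \<open>d\<close> times cosine and sine, this is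
    integration by parts.\<close>
  have lim_eq: "0 = y' + (\<integral>s. k s \<partial>halfline)"
    if "ac_rep y' k f" "integrable halfline k" "(f \<longlongrightarrow> 0) at_top" for y' and k f :: "real \<Rightarrow> real^'n"
  proof (rule tendsto_unique[OF _ that(3)])
    have "((\<lambda>t. y' + (\<integral>s. k s \<partial>upto_measure t)) \<longlongrightarrow> y' + (\<integral>s. k s \<partial>halfline)) at_top"
      by (intro tendsto_intros integral_upto_tendsto that)
    moreover have "\<forall>\<^sub>F t in at_top. y' + (\<integral>s. k s \<partial>upto_measure t) = f t"
      using ac_repD(2)[OF that(1)] by (auto intro: eventually_at_top_linorderI[of 0])
    ultimately show "(f \<longlongrightarrow> y' + (\<integral>s. k s \<partial>halfline)) at_top" by (rule Lim_transform_eventually)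
  qed simp
  note i1 = isn[OF di] ic[OF Ai[OF di]] ic[OF gi] and i2 = ic[OF di] isn[OF Ai[OF di]] isn[OF gi]
  have e1: "cos_vec (\<lambda>s. A *v d s) \<nu> = A *v cos_vec d \<nu>" "sin_vec (\<lambda>s. A *v d s) \<nu> = A *v sin_vec d \<nu>"
    unfolding cos_vec_def sin_vec_def matrix_vector_mult_scaleR[symmetric]
    by (rule integral_bounded_linear[OF bounded_linear_matrix_vector], rule ic[OF di] isn[OF di])+
  have "ac_rep (1 *\<^sub>R y) (\<lambda>s. - \<nu> *\<^sub>R (sin (\<nu> * s) *\<^sub>R d s) + (cos (\<nu> * s) *\<^sub>R (A *v d s) + cos (\<nu> * s) *\<^sub>R g s))
      (\<lambda>s. cos (\<nu> * s) *\<^sub>R d s)"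
    by (rule ac_rep_cong[OF ac_rep_bilinear[OF bounded_bilinear_scaleR ccos d]]) (auto simp: scaleR_add_right)
  from lim_eq[OF this _ zero] have "0 = 1 *\<^sub>R y + (- \<nu> *\<^sub>R sin_vec d \<nu> + (cos_vec (\<lambda>s. A *v d s) \<nu> + cos_vec g \<nu>))"
    unfolding cos_vec_def sin_vec_def
    by (simp only: Bochner_Integration.integral_add Bochner_Integration.integrable_add integrable_scaleR_right i1
        integral_scaleR_right abs_cos_le_one)
  then show "A *v cos_vec d \<nu> + cos_vec g \<nu> = \<nu> *\<^sub>R sin_vec d \<nu> - y"
    unfolding e1 by (simp add: algebra_simps eq_neg_iff_add_eq_0) 
  have "ac_rep (0 *\<^sub>R y) (\<lambda>s. \<nu> *\<^sub>R (cos (\<nu> * s) *\<^sub>R d s) + (sin (\<nu> * s) *\<^sub>R (A *v d s) + sin (\<nu> * s) *\<^sub>R g s))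
      (\<lambda>s. sin (\<nu> * s) *\<^sub>R d s)"
    by (rule ac_rep_cong[OF ac_rep_bilinear[OF bounded_bilinear_scaleR csin d]]) (auto simp: scaleR_add_right)
  from lim_eq[OF this _ zero] have "0 = 0 *\<^sub>R y + (\<nu> *\<^sub>R cos_vec d \<nu> + (sin_vec (\<lambda>s. A *v d s) \<nu> + sin_vec g \<nu>))"
    unfolding cos_vec_def sin_vec_def
    by (simp only: Bochner_Integration.integral_add Bochner_Integration.integrable_add integrable_scaleR_right i2
        integral_scaleR_right abs_sin_le_one)
  then show "A *v sin_vec d \<nu> + sin_vec g \<nu> = - \<nu> *\<^sub>R cos_vec d \<nu>"
    unfolding e1 by (simp add: algebra_simps eq_neg_iff_add_eq_0)
qed

lemma cos_vec_matrix:
  fixes b :: "real^'m^'n"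
  assumes "integrable halfline u"
  shows "cos_vec (\<lambda>s. b *v u s) \<nu> = b *v cos_vec u \<nu>" "sin_vec (\<lambda>s. b *v u s) \<nu> = b *v sin_vec u \<nu>"
proof -
  have cs: "continuous_on UNIV (\<lambda>t. cos (\<nu> * t))" "continuous_on UNIV (\<lambda>t. sin (\<nu> * t))"
    by (intro continuous_intros)+
  show "cos_vec (\<lambda>s. b *v u s) \<nu> = b *v cos_vec u \<nu>"
    unfolding cos_vec_def matrix_vector_mult_scaleR[symmetric]
    by (rule integral_bounded_linear[OF bounded_linear_matrix_vector integrable_trig_halfline[OF assms cs(1) abs_cos_le_one]])
  show "sin_vec (\<lambda>s. b *v u s) \<nu> = b *v sin_vec u \<nu>"
    unfolding sin_vec_def matrix_vector_mult_scaleR[symmetric]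
    by (rule integral_bounded_linear[OF bounded_linear_matrix_vector integrable_trig_halfline[OF assms cs(2) abs_sin_le_one]])
qed

section \<open>Approximation of controls\<close>

lemma indicator_integrable_halfline: "integrable halfline (\<lambda>s. indicat_real {0<..T} s * c)"
proof -
  have "emeasure lborel {0<..T} < \<infinity>" by (cases "0 \<le> T") auto
  then have "integrable lborel (\<lambda>s. indicat_real {0<..T} s * c)"
    by (intro integrable_mult_left integrable_real_indicator) auto
  moreover have "(\<lambda>s. indicat_real {0<..} s *\<^sub>R (indicat_real {0<..T} s * c)) = (\<lambda>s. indicat_real {0<..T} s * c)"
    by (auto simp: indicator_def)
  ultimately show ?thesis unfolding halfline_integrable_iff by (simp only:)
qed

lemma bounded_support_square_integrable:
  fixes u :: "real \<Rightarrow> real^'k"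
  assumes m: "u \<in> borel_measurable halfline" and b: "\<And>s. norm (u s) \<le> B" and z: "\<And>s. T < s \<Longrightarrow> u s = 0"
  shows "square_integrable halfline u" and "integrable halfline u"
proof -
  note i = indicator_integrable_halfline
  have B: "0 \<le> B" using order_trans[OF norm_ge_zero b] by blast
  have "(norm (u s))\<^sup>2 \<le> indicat_real {0<..T} s * B\<^sup>2" "norm (u s) \<le> indicat_real {0<..T} s * B" if "0 < s" for s
    using b[of s] z[of s] that by (auto simp: indicator_def intro!: power_mono)
  then have ae: "AE s in halfline. (norm (u s))\<^sup>2 \<le> indicat_real {0<..T} s * B\<^sup>2"
    "AE s in halfline. norm (u s) \<le> norm (indicat_real {0<..T} s * B)"
    using B by (auto intro!: AE_I2 simp: space_restrict_space)
  show "square_integrable halfline u" by (rule square_integrable_bound[OF m i ae(1)])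
  show "integrable halfline u" by (rule Bochner_Integration.integrable_bound[OF i m ae(2)])
qed

text \<open>A measurable function is an almost everywhere limit of continuous ones. Clipping them to
  a ball and cutting them off at \<open>T\<close> makes dominated convergence apply and keeps the
  only possible discontinuity inside the half line at \<open>T\<close>.\<close>

lemma continuous_approximation:
  fixes u :: "real \<Rightarrow> real^'k"
  assumes m: "u \<in> borel_measurable halfline" and b: "\<And>s. norm (u s) \<le> B" and z: "\<And>s. T < s \<Longrightarrow> u s = 0"
  obtains v where "\<And>k. nice_halfline (v k)" "\<And>k s. T < s \<Longrightarrow> v k s = 0" "l2_tendsto halfline v u"
proof -
  \<comment> \<open>A positive radius, so that the quotient in \<open>clip\<close> is
    continuous.\<close>
  define B' where "B' = max B 1"
  have B': "0 < B'" "\<And>s. norm (u s) \<le> B'" using b by (auto simp: B'_def le_max_iff_disj)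
  define clip where "clip v = (B' / max B' (norm v)) *\<^sub>R v" for v :: "real^'k"
  have clip_cont: "continuous_on UNIV clip"
    unfolding clip_def[abs_def] using B'(1) by (intro continuous_intros) (auto simp: max_def)
  have clip_le: "norm (clip v) \<le> B'" for v
    using B'(1) by (auto simp: clip_def max_def field_simps)
  have clip_id: "norm v \<le> B' \<Longrightarrow> clip v = v" for v
    using B'(1) by (simp add: clip_def max_def)
  let ?u = "\<lambda>s. indicator {0<..} s *\<^sub>R u s"
  have "?u \<in> borel_measurable lborel"
    using m by (subst (asm) borel_measurable_restrict_space_iff) auto
  then have "?u \<in> borel_measurable lebesgue" by (rule measurable_completion)
  then have "?u measurable_on {0<..}"
    by (rule lebesgue_measurable_imp_measurable_on) auto
  then obtain N g where N: "negligible N" and g: "\<And>n. continuous_on UNIV (g n)"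
    and lim': "\<And>x. x \<notin> N \<Longrightarrow> (\<lambda>n. g n x) \<longlonglongrightarrow> (if x \<in> {0<..} then ?u x else 0)"
    unfolding measurable_on_def by blast
  have lim: "(\<lambda>n. g n x) \<longlonglongrightarrow> u x" if "x \<notin> N" "0 < x" for x
    using lim'[OF that(1)] that(2) by simp
  define v where "v n s = indicator {0<..T} s *\<^sub>R clip (g n s)" for n :: nat and s
  have cg: "continuous_on UNIV (\<lambda>s. clip (g n s))" for n
    using continuous_on_compose[OF g[of n] continuous_on_subset[OF clip_cont]] by (simp add: comp_def)
  have vm: "v n \<in> borel_measurable halfline" for n
  proof -
    have "(\<lambda>s. clip (g n s)) \<in> borel_measurable borel" by (rule borel_measurable_continuous_onI[OF cg])
    then have "v n \<in> borel_measurable borel" unfolding v_def by (intro borel_measurable_scaleR borel_measurable_indicator) auto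
    then show ?thesis by (intro measurable_restrict_space1) simp
  qed
  have vb: "norm (v n s) \<le> B'" for n s using clip_le B'(1) by (auto simp: v_def indicator_def)
  have vz: "T < s \<Longrightarrow> v n s = 0" for n s by (simp add: v_def)
  note vs = bounded_support_square_integrable[OF vm vb vz] and us = bounded_support_square_integrable[OF m b z]
  have nice: "nice_halfline (v n)" for n
    unfolding nice_halfline_def
  proof (intro conjI exI[of _ B'] allI impI vb vs(2))
    show "AE t in lborel. 0 < t \<longrightarrow> isCont (v n) t"
      using AE_lborel_singleton[of T]
    proof (eventually_elim, intro impI)
      fix t :: real assume t: "t \<noteq> T" "0 < t"
      have c: "isCont (\<lambda>s. clip (g n s)) t" using cg[of n] by (simp add: continuous_on_eq_continuous_at)
      show "isCont (v n) t"
      proof (cases "t < T")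
        case True
        then have "\<forall>\<^sub>F s in nhds t. v n s = clip (g n s)"
          using t by (intro eventually_nhds_in_open[of "{0<..<T}", THEN eventually_mono]) (auto simp: v_def)
        then show ?thesis using c by (subst isCont_cong)
      next
        case False
        then have "\<forall>\<^sub>F s in nhds t. v n s = 0"
          using t by (intro eventually_nhds_in_open[of "{T<..}", THEN eventually_mono]) (auto simp: v_def)
        then show ?thesis by (subst isCont_cong) auto
      qed
    qed
  qed
  have "l2_tendsto halfline v u"
    unfolding l2_tendsto_def
  proof (intro conjI allI vs(1) us(1))
    have "N \<in> null_sets lebesgue" using N by (simp add: negligible_iff_null_sets)
    then have "AE s in lebesgue. s \<notin> N" by (rule AE_not_in)
    then have aeN: "AE s in lborel. s \<notin> N" by (simp add: AE_completion_iff)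
    have "AE s in halfline. s \<notin> N" using aeN by (subst AE_restrict_space_iff) auto
    then have ae: "AE s in halfline. (\<lambda>n. v n s) \<longlonglongrightarrow> u s"
      using AE_space
    proof eventually_elim
      case (elim s)
      then have s: "0 < s" by (simp add: space_restrict_space)
      have "(\<lambda>n. clip (g n s)) \<longlonglongrightarrow> clip (u s)"
        using lim[OF elim(1) s] by (intro continuous_on_tendsto_compose[OF clip_cont]) auto
      then have "(\<lambda>n. v n s) \<longlonglongrightarrow> indicator {0<..T} s *\<^sub>R u s"
        unfolding v_def clip_id[OF B'(2)] by (intro tendsto_intros)
      moreover have "indicator {0<..T} s *\<^sub>R u s = u s" using s z[of s] by (auto simp: indicator_def)
      ultimately show ?case by simp
    qed
    have "(\<lambda>n. \<integral>s. (norm (v n s - u s))\<^sup>2 \<partial>halfline) \<longlonglongrightarrow> (\<integral>s. 0 \<partial>halfline)"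
    proof (rule integral_dominated_convergence[where w="\<lambda>s. indicat_real {0<..T} s * (2 * B')\<^sup>2"])
      show "(\<lambda>s. (norm (v n s - u s))\<^sup>2) \<in> borel_measurable halfline" for n
        using vm[of n] m by measurable
      show "integrable halfline (\<lambda>s. indicat_real {0<..T} s * (2 * B')\<^sup>2)" by (rule indicator_integrable_halfline)
      show "AE s in halfline. (\<lambda>n. (norm (v n s - u s))\<^sup>2) \<longlonglongrightarrow> 0"
        using ae
      proof eventually_elim
        case (elim s)
        have "(\<lambda>n. (norm (v n s - u s))\<^sup>2) \<longlonglongrightarrow> (norm (u s - u s))\<^sup>2" by (intro tendsto_intros elim)
        then show ?case by simp
      qed
      show "AE s in halfline. norm ((norm (v n s - u s))\<^sup>2) \<le> indicat_real {0<..T} s * (2 * B')\<^sup>2" for n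
      proof (rule AE_I2)
        fix s assume s: "s \<in> space halfline"
        have "norm (v n s - u s) \<le> 2 * B'" using norm_triangle_ineq4[of "v n s" "u s"] vb[of n s] B'(2)[of s] by simp
        then have "(norm (v n s - u s))\<^sup>2 \<le> (2 * B')\<^sup>2" by (intro power_mono) auto
        then show "norm ((norm (v n s - u s))\<^sup>2) \<le> indicat_real {0<..T} s * (2 * B')\<^sup>2"
          using s vz[of s n] z[of s] by (auto simp: indicator_def space_restrict_space)
      qed
    qed simp
    then show "(\<lambda>n. \<integral>s. (norm (v n s - u s))\<^sup>2 \<partial>halfline) \<longlonglongrightarrow> 0" by simp
  qed
  with nice vz show thesis by (rule that)
qed

lemma bounded_approximation:
  fixes u :: "real \<Rightarrow> real^'k"
  assumes u: "square_integrable halfline u"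
  defines "v \<equiv> \<lambda>(k::nat) s. if s \<le> real k \<and> norm (u s) \<le> real k then u s else 0"
  shows "l2_tendsto halfline v u" "v k \<in> borel_measurable halfline"
proof -
  have um[measurable]: "u \<in> borel_measurable halfline" using u by (simp add: square_integrable_def)
  have [measurable]: "(\<lambda>s. s) \<in> borel_measurable halfline" by (rule measurable_restrict_space1) simp
  show vm: "v k \<in> borel_measurable halfline" for k unfolding v_def by measurable
  have vs: "square_integrable halfline (v k)" for k
    by (rule square_integrable_bound[OF vm square_integrableD(2)[OF u]]) (auto simp: v_def)
  show "l2_tendsto halfline v u"
    unfolding l2_tendsto_def
  proof (intro conjI allI vs u)
    have "(\<lambda>n. \<integral>s. (norm (v n s - u s))\<^sup>2 \<partial>halfline) \<longlonglongrightarrow> (\<integral>s. 0 \<partial>halfline)"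
    proof (rule integral_dominated_convergence[where w="\<lambda>s. (norm (u s))\<^sup>2"])
      show "(\<lambda>s. (norm (v n s - u s))\<^sup>2) \<in> borel_measurable halfline" for n
        using vm[of n] by measurable
      show "AE s in halfline. (\<lambda>n. (norm (v n s - u s))\<^sup>2) \<longlonglongrightarrow> 0"
      proof (rule AE_I2, rule tendsto_eventually)
        fix s
        obtain N :: nat where N: "max s (norm (u s)) \<le> real N" using real_arch_simple by blast
        then show "\<forall>\<^sub>F n in sequentially. (norm (v n s - u s))\<^sup>2 = 0"
          by (intro eventually_sequentiallyI[of N]) (auto simp: v_def)
      qed
    qed (use square_integrableD(2)[OF u] in \<open>auto simp: v_def\<close>)
    then show "(\<lambda>n. \<integral>s. (norm (v n s - u s))\<^sup>2 \<partial>halfline) \<longlonglongrightarrow> 0" by simp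
  qed
qed

lemma uminus_matrix_vector: "(- B) *v v = - (B *v v)" for B :: "real^'m^'n"
  by (simp add: matrix_vector_mult_def vec_eq_iff sum_negf)

section \<open>Coercivity and the minimizer\<close>

context lq_problem
begin

lemma response_diff_ac_rep:
  assumes "square_integrable halfline u" "square_integrable halfline v"
  shows "ac_rep 0 (\<lambda>s. A *v (m u s - m v s) + (b *v u s - b *v v s)) (\<lambda>t. m u t - m v t)"
  by (rule ac_rep_cong[OF ac_rep_diff[OF traj[OF assms(1)] traj[OF assms(2)]]])
    (auto simp: matrix_vector_mult_diff_distrib)

text \<open>Differences of trajectories start at 0, so \<open>l2_stability\<close> bounds them by
  the differences of the controls.\<close>

lemma traj_l2_tendsto:
  assumes "l2_tendsto halfline u v"
  shows "l2_tendsto halfline (\<lambda>k. m (u k)) (m v)"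
    and "l2_tendsto halfline (\<lambda>k. response (u k)) (response v)"
proof -
  note s = l2_tendstoD(1)[OF assms] l2_tendstoD(2)[OF assms]
  obtain c where c: "0 \<le> c" "\<And>d0 f d. ac_rep d0 (\<lambda>s. A *v d s + f s) d \<Longrightarrow> square_integrable halfline f \<Longrightarrow>
       square_integrable halfline d \<and>
       (\<integral>s. (norm (d s))\<^sup>2 \<partial>halfline) \<le> c * ((norm d0)\<^sup>2 + (\<integral>s. (norm (f s))\<^sup>2 \<partial>halfline))"
    by (rule l2_stability, rule that)
  have le: "(\<integral>s. (norm (m (u k) s - m v s))\<^sup>2 \<partial>halfline) \<le> c * (\<integral>s. (norm (b *v u k s - b *v v s))\<^sup>2 \<partial>halfline)" for k
  proof -
    have "square_integrable halfline (\<lambda>s. b *v u k s - b *v v s)"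
      by (intro square_integrable_diff square_integrable_mult_vec s)
    from c(2)[OF response_diff_ac_rep[OF s(1) s(2)] this] show ?thesis by simp
  qed
  have lim: "(\<lambda>k. c * (\<integral>s. (norm (b *v u k s - b *v v s))\<^sup>2 \<partial>halfline)) \<longlonglongrightarrow> 0"
    using tendsto_mult[OF tendsto_const l2_tendstoD(3)[OF l2_tendsto_mult_vec[OF assms, of b]], of c] by simp
  show "l2_tendsto halfline (\<lambda>k. m (u k)) (m v)"
    by (rule l2_tendstoI_bound[OF traj_square_integrable[OF s(1)] traj_square_integrable[OF s(2)] le lim])
  show "l2_tendsto halfline (\<lambda>k. response (u k)) (response v)"
    by (rule l2_tendstoI_bound[OF response_square_integrable[OF s(1)] response_square_integrable[OF s(2)] _ lim])
      (use le in \<open>simp add: response_def\<close>)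
qed

lemma quad_cost_tendsto:
  assumes "l2_tendsto halfline u v" "l2_tendsto halfline d e"
  shows "(\<lambda>k. quad_cost (u k) (d k)) \<longlonglongrightarrow> quad_cost v e"
proof -
  have split: "quad_cost u d = (\<integral>s. d s \<bullet> (\<Theta> *v d s) \<partial>halfline) + (\<integral>s. u s \<bullet> (\<Gamma> *v u s) \<partial>halfline)"
    if "square_integrable halfline u" "square_integrable halfline d" for u d
    unfolding quad_cost_def using that
    by (intro Bochner_Integration.integral_add integrable_inner_square_integrable square_integrable_mult_vec)
  have "(\<lambda>k. (\<integral>s. d k s \<bullet> (\<Theta> *v d k s) \<partial>halfline) + (\<integral>s. u k s \<bullet> (\<Gamma> *v u k s) \<partial>halfline))
    \<longlonglongrightarrow> (\<integral>s. e s \<bullet> (\<Theta> *v e s) \<partial>halfline) + (\<integral>s. v s \<bullet> (\<Gamma> *v v s) \<partial>halfline)"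
    by (intro tendsto_add l2_tendsto_inner assms l2_tendsto_mult_vec)
  then show ?thesis
    using split l2_tendstoD(1)[OF assms(1)] l2_tendstoD(1)[OF assms(2)] l2_tendstoD(2)[OF assms(1)] l2_tendstoD(2)[OF assms(2)]
    by simp
qed

text \<open>The frequency inequality in real terms: the premises say that \<open>p + i q\<close> is
  the stationary response to \<open>U + i V\<close> at frequency \<open>\<nu>\<close>. No inverse
  matrix has to be handled in the deterministic problem.\<close>

definition freq_bound :: "real \<Rightarrow> bool" where
  "freq_bound \<delta> \<longleftrightarrow> (\<forall>\<nu> p q U V. A *v p + b *v U = - \<nu> *\<^sub>R q \<and> A *v q + b *v V = \<nu> *\<^sub>R p \<longrightarrow>
     \<delta> * ((norm U)\<^sup>2 + (norm V)\<^sup>2)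
       \<le> p \<bullet> (\<Theta> *v p) + q \<bullet> (\<Theta> *v q) + U \<bullet> (\<Gamma> *v U) + V \<bullet> (\<Gamma> *v V))"

text \<open>The frequency inequality is integrated over all frequencies and translated back by
  Parseval. The control vanishes after \<open>T\<close>, so its response decays exponentially and is
  admissible for Parseval.\<close>

lemma coercive_nice:
  assumes fb: "freq_bound \<delta>" and u: "square_integrable halfline u" "nice_halfline u" and z: "\<And>s. T < s \<Longrightarrow> u s = 0"
  shows "\<delta> * (\<integral>s. (norm (u s))\<^sup>2 \<partial>halfline) \<le> quad_cost u (response u)"
proof -
  let ?d = "response u"
  note ac = response_ac_rep[OF u(1)]
  obtain C \<kappa> where k0: "0 < \<kappa>" and kle: "\<And>t. 0 \<le> t \<Longrightarrow> norm (?d t) \<le> C * exp (- \<kappa> * t)"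
    by (rule exponential_decay[OF ac square_integrable_mult_vec[OF u(1)], of T]) (simp add: z, blast)
  have dn: "nice_halfline ?d" "(?d \<longlongrightarrow> 0) at_top"
    by (rule exp_bound_nice[OF ac_rep_continuous[OF ac] k0], rule kle, assumption)+
  have ui: "integrable halfline u" and di: "integrable halfline ?d" using u(2) dn(1) by (auto simp: nice_halfline_def)
  have bi: "integrable halfline (\<lambda>s. b *v u s)" by (rule integrable_bounded_linear[OF bounded_linear_matrix_vector ui])
  note T = transform_of_solution[OF ac di bi dn(2), unfolded cos_vec_matrix[OF ui]]
  note P1 = parseval_matrix[OF dn(1) dn(1), of \<Theta>] and P2 = parseval_matrix[OF u(2) u(2), of \<Gamma>]
    and P3 = parseval_matrix[OF u(2) u(2), of "mat 1", unfolded matrix_vector_mul_lid]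
  have le: "\<delta> * (cos_vec u \<nu> \<bullet> cos_vec u \<nu> + sin_vec u \<nu> \<bullet> sin_vec u \<nu>)
     \<le> (cos_vec ?d \<nu> \<bullet> (\<Theta> *v cos_vec ?d \<nu>) + sin_vec ?d \<nu> \<bullet> (\<Theta> *v sin_vec ?d \<nu>))
       + (cos_vec u \<nu> \<bullet> (\<Gamma> *v cos_vec u \<nu>) + sin_vec u \<nu> \<bullet> (\<Gamma> *v sin_vec u \<nu>))" for \<nu>
  proof -
    \<comment> \<open>The transform is \<open>cos_vec - i sin_vec\<close>, so the imaginary parts
      inserted into the frequency inequality are the negative sine transforms.\<close>
    have e1: "A *v cos_vec ?d \<nu> + b *v cos_vec u \<nu> = - \<nu> *\<^sub>R (- sin_vec ?d \<nu>)" using T(1)[of \<nu>] by simp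
    have "A *v (- sin_vec ?d \<nu>) + b *v (- sin_vec u \<nu>) = - (A *v sin_vec ?d \<nu> + b *v sin_vec u \<nu>)"
      by (simp add: vec.neg)
    also have "A *v sin_vec ?d \<nu> + b *v sin_vec u \<nu> = - \<nu> *\<^sub>R cos_vec ?d \<nu>" by (rule T(2))
    also have "- (- \<nu> *\<^sub>R cos_vec ?d \<nu>) = \<nu> *\<^sub>R cos_vec ?d \<nu>" by simp
    finally have e2: "A *v (- sin_vec ?d \<nu>) + b *v (- sin_vec u \<nu>) = \<nu> *\<^sub>R cos_vec ?d \<nu>" .
    have "\<delta> * ((norm (cos_vec u \<nu>))\<^sup>2 + (norm (- sin_vec u \<nu>))\<^sup>2)
      \<le> cos_vec ?d \<nu> \<bullet> (\<Theta> *v cos_vec ?d \<nu>) + (- sin_vec ?d \<nu>) \<bullet> (\<Theta> *v (- sin_vec ?d \<nu>))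
       + cos_vec u \<nu> \<bullet> (\<Gamma> *v cos_vec u \<nu>) + (- sin_vec u \<nu>) \<bullet> (\<Gamma> *v (- sin_vec u \<nu>))"
      using fb e1 e2 unfolding freq_bound_def by blast
    then show ?thesis by (simp add: vec.neg power2_norm_eq_inner)
  qed
  have "(\<integral>\<nu>. \<delta> * (cos_vec u \<nu> \<bullet> cos_vec u \<nu> + sin_vec u \<nu> \<bullet> sin_vec u \<nu>) \<partial>lborel)
     \<le> (\<integral>\<nu>. (cos_vec ?d \<nu> \<bullet> (\<Theta> *v cos_vec ?d \<nu>) + sin_vec ?d \<nu> \<bullet> (\<Theta> *v sin_vec ?d \<nu>))
       + (cos_vec u \<nu> \<bullet> (\<Gamma> *v cos_vec u \<nu>) + sin_vec u \<nu> \<bullet> (\<Gamma> *v sin_vec u \<nu>)) \<partial>lborel)"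
    by (rule integral_mono[OF integrable_mult_right[OF P3(1)] Bochner_Integration.integrable_add[OF P1(1) P2(1)]])
      (rule le)
  then have "\<delta> * (2 * pi * (\<integral>t. u t \<bullet> u t \<partial>halfline))
     \<le> 2 * pi * (\<integral>t. ?d t \<bullet> (\<Theta> *v ?d t) \<partial>halfline) + 2 * pi * (\<integral>t. u t \<bullet> (\<Gamma> *v u t) \<partial>halfline)"
    unfolding Bochner_Integration.integral_add[OF P1(1) P2(1)] Bochner_Integration.integral_mult_right_zero
      P1(2) P2(2) P3(2) .
  also have "\<dots> = 2 * pi * quad_cost u ?d"
  proof -
    have "quad_cost u ?d = (\<integral>t. ?d t \<bullet> (\<Theta> *v ?d t) \<partial>halfline) + (\<integral>t. u t \<bullet> (\<Gamma> *v u t) \<partial>halfline)"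
      unfolding quad_cost_def
      by (intro Bochner_Integration.integral_add integrable_inner_square_integrable square_integrable_mult_vec u
          response_square_integrable)
    then show ?thesis by (simp add: distrib_left)
  qed
  finally have "2 * pi * (\<delta> * (\<integral>t. u t \<bullet> u t \<partial>halfline)) \<le> 2 * pi * quad_cost u ?d" by (simp only: mult_ac)
  then show ?thesis by (simp add: power2_norm_eq_inner)
qed

lemma coercive_closed:
  assumes "l2_tendsto halfline u v" "\<And>k. \<delta> * (\<integral>s. (norm (u k s))\<^sup>2 \<partial>halfline) \<le> quad_cost (u k) (response (u k))"
  shows "\<delta> * (\<integral>s. (norm (v s))\<^sup>2 \<partial>halfline) \<le> quad_cost v (response v)"
proof (rule LIMSEQ_le)
  show "(\<lambda>k. quad_cost (u k) (response (u k))) \<longlonglongrightarrow> quad_cost v (response v)"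
    by (rule quad_cost_tendsto[OF assms(1) traj_l2_tendsto(2)[OF assms(1)]])
  show "(\<lambda>k. \<delta> * (\<integral>s. (norm (u k s))\<^sup>2 \<partial>halfline)) \<longlonglongrightarrow> \<delta> * (\<integral>s. (norm (v s))\<^sup>2 \<partial>halfline)"
    unfolding power2_norm_eq_inner by (intro tendsto_intros l2_tendsto_inner assms)
qed (use assms(2) in auto)

text \<open>Two density steps: truncation in time and size first, then continuous approximation of a
  truncated control. Both sides are continuous in the control.\<close>

lemma coercive:
  assumes fb: "freq_bound \<delta>" and u: "square_integrable halfline u"
  shows "\<delta> * (\<integral>s. (norm (u s))\<^sup>2 \<partial>halfline) \<le> quad_cost u (response u)"
proof (rule coercive_closed[OF bounded_approximation(1)[OF u]])
  fix k :: nat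
  define v where "v s = (if s \<le> real k \<and> norm (u s) \<le> real k then u s else 0)" for s
  have vm: "v \<in> borel_measurable halfline"
    using bounded_approximation(2)[OF u, of k] by (simp add: v_def[abs_def])
  have vb: "norm (v s) \<le> real k" for s by (simp add: v_def)
  have vz: "real k < s \<Longrightarrow> v s = 0" for s by (simp add: v_def)
  obtain g where g: "\<And>n. nice_halfline (g n)" "\<And>n s. real k < s \<Longrightarrow> g n s = 0" "l2_tendsto halfline g v"
    by (rule continuous_approximation[OF vm vb vz], assumption, rule that)
  have "\<delta> * (\<integral>s. (norm (v s))\<^sup>2 \<partial>halfline) \<le> quad_cost v (response v)"
    by (rule coercive_closed[OF g(3)], rule coercive_nice[OF fb l2_tendstoD(1)[OF g(3)] g(1) g(2)])
  then show "\<delta> * (\<integral>s. (norm (if s \<le> real k \<and> norm (u s) \<le> real k then u s else 0))\<^sup>2 \<partial>halfline)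
     \<le> quad_cost (\<lambda>s. if s \<le> real k \<and> norm (u s) \<le> real k then u s else 0)
        (response (\<lambda>s. if s \<le> real k \<and> norm (u s) \<le> real k then u s else 0))"
    by (simp only: v_def[abs_def])
qed

definition total_cost :: "(real \<Rightarrow> real^'m) \<Rightarrow> real" where
  "total_cost u = quad_cost u (m u)"

text \<open>The trajectory is the response plus the free motion. The weight may be indefinite;
  splitting off the free motion costs a small multiple of the response energy, which coercivity pays
  for, and a constant.\<close>

lemma total_cost_bounded_below:
  assumes fb: "freq_bound \<delta>" and \<delta>: "0 < \<delta>"
  obtains \<beta> where "\<And>u :: real \<Rightarrow> real^'m. square_integrable halfline u \<Longrightarrow> \<beta> \<le> total_cost u"
proof -
  obtain c where c: "0 \<le> c" "\<And>d0 f d. ac_rep d0 (\<lambda>s. A *v d s + f s) d \<Longrightarrow> square_integrable halfline f \<Longrightarrow>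
       square_integrable halfline d \<and>
       (\<integral>s. (norm (d s))\<^sup>2 \<partial>halfline) \<le> c * ((norm d0)\<^sup>2 + (\<integral>s. (norm (f s))\<^sup>2 \<partial>halfline))"
    by (rule l2_stability, rule that)
  obtain K where K: "0 \<le> K" "\<And>v. norm (\<Theta> *v v) \<le> K * norm v" using matrix_vector_bound[of \<Theta>] by blast
  obtain B where B: "0 \<le> B" "\<And>v. norm (b *v v) \<le> B * norm v" using matrix_vector_bound[of b] by blast
  \<comment> \<open>\<open>c * B\<^sup>2\<close> bounds the response energy per control energy, so
    the loss is at most \<open>\<delta>\<close> times the control energy; the summand 1 avoids a
    zero denominator.\<close>
  define \<kappa> where "\<kappa> = \<delta> / (c * B\<^sup>2 + 1)"
  have cB: "0 < c * B\<^sup>2 + 1" using c(1) by (simp add: add_nonneg_pos)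
  have \<kappa>: "0 < \<kappa>" "\<kappa> * (c * B\<^sup>2) \<le> \<delta>"
  proof -
    show "0 < \<kappa>" unfolding \<kappa>_def using \<delta> cB by simp
    have "\<kappa> * (c * B\<^sup>2 + 1) = \<delta>" unfolding \<kappa>_def using cB by simp
    then show "\<kappa> * (c * B\<^sup>2) \<le> \<delta>" using \<open>0 < \<kappa>\<close> by (simp add: distrib_left)
  qed
  let ?e = "m (\<lambda>_. 0)" and ?C = "K\<^sup>2 / \<kappa> + K"
  have se: "square_integrable halfline ?e" by (rule traj_square_integrable) simp
  show thesis
  proof (rule that)
    fix u :: "real \<Rightarrow> real^'m" assume u: "square_integrable halfline u"
    let ?n = "response u"
    note sn = response_square_integrable[OF u]
    note i = square_integrableD(2)[OF sn] square_integrableD(2)[OF se] quad_cost_integrable[OF u sn]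
    have "quad_cost u ?n - \<kappa> * (\<integral>s. (norm (?n s))\<^sup>2 \<partial>halfline) - ?C * (\<integral>s. (norm (?e s))\<^sup>2 \<partial>halfline)
      = (\<integral>s. (?n s \<bullet> (\<Theta> *v ?n s) + u s \<bullet> (\<Gamma> *v u s)) - \<kappa> * (norm (?n s))\<^sup>2 - ?C * (norm (?e s))\<^sup>2 \<partial>halfline)"
      unfolding quad_cost_def
      by (simp only: Bochner_Integration.integral_diff Bochner_Integration.integrable_diff integrable_mult_right i
          Bochner_Integration.integral_mult_right_zero)
    also have "\<dots> \<le> total_cost u"
      unfolding total_cost_def quad_cost_def
    proof (rule integral_mono)
      show "integrable halfline (\<lambda>s. (?n s \<bullet> (\<Theta> *v ?n s) + u s \<bullet> (\<Gamma> *v u s)) - \<kappa> * (norm (?n s))\<^sup>2 - ?C * (norm (?e s))\<^sup>2)"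
        by (intro Bochner_Integration.integrable_diff integrable_mult_right i)
      show "integrable halfline (\<lambda>s. m u s \<bullet> (\<Theta> *v m u s) + u s \<bullet> (\<Gamma> *v u s))"
        by (rule quad_cost_integrable[OF u traj_square_integrable[OF u]])
      fix s
      \<comment> \<open>\<open>quad_perturb\<close> is an upper bound; applied to
        \<open>- \<Theta>\<close> it yields the lower bound wanted here.\<close>
      have "transpose (- \<Theta>) = - \<Theta>" using \<Theta>_sym by (simp add: transpose_def vec_eq_iff)
      moreover have "norm ((- \<Theta>) *v v) \<le> K * norm v" for v
        using K(2)[of v] by (simp add: uminus_matrix_vector)
      ultimately have "(?n s + ?e s) \<bullet> ((- \<Theta>) *v (?n s + ?e s))
        \<le> ?n s \<bullet> ((- \<Theta>) *v ?n s) + \<kappa> * (norm (?n s))\<^sup>2 + ?C * (norm (?e s))\<^sup>2"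
        by (rule quad_perturb[OF _ _ \<kappa>(1)])
      then show "(?n s \<bullet> (\<Theta> *v ?n s) + u s \<bullet> (\<Gamma> *v u s)) - \<kappa> * (norm (?n s))\<^sup>2 - ?C * (norm (?e s))\<^sup>2
        \<le> m u s \<bullet> (\<Theta> *v m u s) + u s \<bullet> (\<Gamma> *v u s)"
        by (simp add: uminus_matrix_vector response_def)
    qed
    finally have 1: "quad_cost u ?n - \<kappa> * (\<integral>s. (norm (?n s))\<^sup>2 \<partial>halfline) - ?C * (\<integral>s. (norm (?e s))\<^sup>2 \<partial>halfline) \<le> total_cost u" .
    have sbu: "square_integrable halfline (\<lambda>s. b *v u s)" by (rule square_integrable_mult_vec[OF u])
    have "(\<integral>s. (norm (b *v u s))\<^sup>2 \<partial>halfline) \<le> (\<integral>s. B\<^sup>2 * (norm (u s))\<^sup>2 \<partial>halfline)"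
    proof (rule integral_mono)
      show "(norm (b *v u s))\<^sup>2 \<le> B\<^sup>2 * (norm (u s))\<^sup>2" for s
        using power_mono[OF B(2)[of "u s"], of 2] by (simp add: power_mult_distrib)
    qed (intro integrable_mult_right square_integrableD(2) u sbu)+
    then have "c * (\<integral>s. (norm (b *v u s))\<^sup>2 \<partial>halfline) \<le> c * (B\<^sup>2 * (\<integral>s. (norm (u s))\<^sup>2 \<partial>halfline))"
      using c(1) by (intro mult_left_mono) simp_all
    moreover have "(\<integral>s. (norm (?n s))\<^sup>2 \<partial>halfline) \<le> c * (\<integral>s. (norm (b *v u s))\<^sup>2 \<partial>halfline)"
      using c(2)[OF response_ac_rep[OF u] sbu] by simp
    ultimately have "(\<integral>s. (norm (?n s))\<^sup>2 \<partial>halfline) \<le> c * B\<^sup>2 * (\<integral>s. (norm (u s))\<^sup>2 \<partial>halfline)" by simp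
    then have "\<kappa> * (\<integral>s. (norm (?n s))\<^sup>2 \<partial>halfline) \<le> \<kappa> * (c * B\<^sup>2 * (\<integral>s. (norm (u s))\<^sup>2 \<partial>halfline))"
      using \<kappa>(1) by (intro mult_left_mono) auto
    also have "\<dots> = \<kappa> * (c * B\<^sup>2) * (\<integral>s. (norm (u s))\<^sup>2 \<partial>halfline)" by simp
    also have "\<dots> \<le> \<delta> * (\<integral>s. (norm (u s))\<^sup>2 \<partial>halfline)" by (rule mult_right_mono[OF \<kappa>(2)]) simp
    also have "\<dots> \<le> quad_cost u ?n" by (rule coercive[OF fb u])
    finally show "- ?C * (\<integral>s. (norm (?e s))\<^sup>2 \<partial>halfline) \<le> total_cost u" using 1 by linarith
  qed
qed

text \<open>The parallelogram identity around the midpoint: the midpoint costs at least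
  \<open>I\<close>, and half the difference has quadratic cost at least \<open>\<delta> / 4\<close>
  times the squared distance.\<close>

lemma near_minimizers_close:
  assumes fb: "freq_bound \<delta>" and u: "square_integrable halfline u" and v: "square_integrable halfline v"
    and low: "\<And>u :: real \<Rightarrow> real^'m. square_integrable halfline u \<Longrightarrow> I \<le> total_cost u"
  shows "\<delta> / 2 * (\<integral>s. (norm (u s - v s))\<^sup>2 \<partial>halfline) \<le> total_cost u - I + (total_cost v - I)"
proof -
  let ?p = "\<lambda>s. (1/2) *\<^sub>R (u s + v s)" and ?d = "\<lambda>s. (1/2) *\<^sub>R (u s - v s)"
  have sp: "square_integrable halfline ?p" and sd: "square_integrable halfline ?d" using u v by auto
  have eq: "(\<lambda>s. ?p s + ?d s) = u" "(\<lambda>s. ?p s - ?d s) = v"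
    by (simp_all add: fun_eq_iff vec_eq_iff field_simps)
  have "total_cost u + total_cost v = 2 * total_cost ?p + 2 * quad_cost ?d (response ?d)"
    using cost_parallelogram[OF sd sp] unfolding eq total_cost_def .
  moreover have "(\<integral>s. (norm (?d s))\<^sup>2 \<partial>halfline) = 1 / 4 * (\<integral>s. (norm (u s - v s))\<^sup>2 \<partial>halfline)"
    by (simp add: power_mult_distrib power2_eq_square)
  moreover have "\<delta> * (\<integral>s. (norm (?d s))\<^sup>2 \<partial>halfline) \<le> quad_cost ?d (response ?d)" by (rule coercive[OF fb sd])
  ultimately have "\<delta> * (1 / 4 * (\<integral>s. (norm (u s - v s))\<^sup>2 \<partial>halfline)) \<le> quad_cost ?d (response ?d)"
    "total_cost u + total_cost v = 2 * total_cost ?p + 2 * quad_cost ?d (response ?d)" by (simp_all only:)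
  then show ?thesis using low[OF sp] by (simp add: algebra_simps)
qed

text \<open>Excess costs below \<open>(1/2)^k\<close> make the minimizing sequence Cauchy at the
  rate demanded by \<open>l2_complete\<close>. Continuity of the cost identifies the limit as a
  minimizer, and the distance estimate for near minimizers gives uniqueness.\<close>

theorem minimizer_exists:
  assumes fb: "freq_bound \<delta>" and \<delta>: "0 < \<delta>"
  obtains u0 where "square_integrable halfline u0" "\<And>u. square_integrable halfline u \<Longrightarrow> total_cost u0 \<le> total_cost u"
    "\<And>u1. square_integrable halfline u1 \<Longrightarrow> (\<And>u. square_integrable halfline u \<Longrightarrow> total_cost u1 \<le> total_cost u) \<Longrightarrow>
       (AE s in halfline. u1 s = u0 s)"
proof -
  obtain \<beta> where \<beta>: "\<And>u. square_integrable halfline u \<Longrightarrow> \<beta> \<le> total_cost u"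
    by (rule total_cost_bounded_below[OF fb \<delta>], rule that)
  let ?S = "Collect (square_integrable halfline) :: (real \<Rightarrow> real^'m) set"
  define I where "I = (INF u\<in>?S. total_cost u)"
  have bdd: "bdd_below (total_cost ` ?S)" using \<beta> by (auto simp: bdd_below_def)
  have ne: "?S \<noteq> {}" using square_integrable_zero by blast
  have low: "I \<le> total_cost u" if "square_integrable halfline u" for u
    unfolding I_def by (rule cINF_lower[OF bdd]) (use that in simp)
  have "\<exists>u. square_integrable halfline u \<and> total_cost u < I + (1/2)^k" for k :: nat
  proof -
    have "Inf (total_cost ` ?S) < I + (1/2)^k" unfolding I_def by simp
    then show ?thesis using cInf_lessD[of "total_cost ` ?S"] ne by blast
  qed
  then obtain u where u: "\<And>k. square_integrable halfline (u k)" "\<And>k::nat. total_cost (u k) < I + (1/2)^k" by metis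
  have cauchy: "(\<integral>s. (norm (u l s - u j s))\<^sup>2 \<partial>halfline) \<le> 4 / \<delta> * (1/2)^j" if "j \<le> l" for j l
  proof -
    have "(1/2::real)^l \<le> (1/2)^j" using that by (intro power_decreasing) auto
    then have "\<delta> / 2 * (\<integral>s. (norm (u l s - u j s))\<^sup>2 \<partial>halfline) \<le> 2 * (1/2)^j"
      using near_minimizers_close[OF fb u(1) u(1) low, of l j] u(2)[of l] u(2)[of j] by linarith
    then have "(\<integral>s. (norm (u l s - u j s))\<^sup>2 \<partial>halfline) \<le> 2 * (1/2)^j / (\<delta> / 2)"
      using \<delta> by (subst pos_le_divide_eq) (auto simp: mult.commute)
    then show ?thesis by (simp add: field_simps)
  qed
  define u0 where "u0 s = lim (\<lambda>j. u j s)" for s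
  note lc = l2_complete(2,3)[OF u(1) cauchy, folded u0_def]
  have s0: "square_integrable halfline u0" using lc(1) by (simp add: u0_def[abs_def])
  have lim: "l2_tendsto halfline u u0"
  proof (rule l2_tendstoI_bound[OF u(1) s0])
    show "(\<integral>s. (norm (u j s - u0 s))\<^sup>2 \<partial>halfline) \<le> 4 / \<delta> * (1/2)^j" for j
      using lc(2)[of j] by (simp only: norm_minus_commute)
    have "(\<lambda>j. 4 / \<delta> * (1/2)^j) \<longlonglongrightarrow> 4 / \<delta> * 0" by (intro tendsto_intros LIMSEQ_realpow_zero) auto
    then show "(\<lambda>j. 4 / \<delta> * (1/2)^j) \<longlonglongrightarrow> 0" by simp
  qed
  have "(\<lambda>k. total_cost (u k)) \<longlonglongrightarrow> total_cost u0"
    unfolding total_cost_def by (rule quad_cost_tendsto[OF lim traj_l2_tendsto(1)[OF lim]])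
  moreover have "(\<lambda>k. I + (1/2)^k) \<longlonglongrightarrow> I + 0" by (intro tendsto_intros LIMSEQ_realpow_zero) auto
  ultimately have "total_cost u0 \<le> I + 0"
    by (rule LIMSEQ_le) (use u(2) in \<open>auto intro: less_imp_le\<close>)
  then have min: "total_cost u0 \<le> total_cost v" if "square_integrable halfline v" for v using low[OF that] by simp
  show thesis
  proof (rule that[OF s0 min])
    fix u1 assume s1: "square_integrable halfline u1"
      and m1: "\<And>u. square_integrable halfline u \<Longrightarrow> total_cost u1 \<le> total_cost u"
    have "total_cost u1 = total_cost u0" using m1[OF s0] min[OF s1] by simp
    then have "\<delta> / 2 * (\<integral>s. (norm (u1 s - u0 s))\<^sup>2 \<partial>halfline) \<le> 0"
      using near_minimizers_close[OF fb s1 s0 min] by simp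
    then have "(\<integral>s. (norm (u1 s - u0 s))\<^sup>2 \<partial>halfline) \<le> 0" using \<delta> by (simp add: mult_le_0_iff)
    then have "(\<integral>s. (norm (u1 s - u0 s))\<^sup>2 \<partial>halfline) = 0" by (intro antisym) auto
    then have "AE s in halfline. (norm (u1 s - u0 s))\<^sup>2 = 0"
      by (subst (asm) integral_nonneg_eq_0_iff_AE[OF square_integrableD(2)[OF square_integrable_diff[OF s1 s0]]]) auto
    then show "AE s in halfline. u1 s = u0 s" by eventually_elim simp
  qed
qed

end

section \<open>The Lyapunov operator of the stochastic system\<close>

text \<open>The generator of the uncontrolled stochastic system on quadratic forms:
  \<open>x \<bullet> (H *v x)\<close> has expected rate of change
  \<open>x \<bullet> (lyapunov A C H *v x)\<close>.\<close>

definition lyapunov :: "real^'n^'n \<Rightarrow> real^'n^'n \<Rightarrow> real^'n^'n \<Rightarrow> real^'n^'n" where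
  "lyapunov A C H = transpose A ** H + H ** A + transpose C ** H ** C"

lemma inner_lyapunov:
  fixes x y :: "real^'n"
  shows "x \<bullet> (lyapunov A C H *v y) = (A *v x) \<bullet> (H *v y) + x \<bullet> (H *v (A *v y)) + (C *v x) \<bullet> (H *v (C *v y))"
proof -
  have "x \<bullet> (transpose B *v z) = (B *v x) \<bullet> z" for B :: "real^'n^'n" and z
    using dot_matrix_transpose[of x "transpose B" z] by (simp only: transpose_transpose)
  then show ?thesis
    unfolding lyapunov_def matrix_vector_mult_add_rdistrib inner_add_right matrix_vector_mul_assoc[symmetric] by simp
qed

lemma matrix_eq_inner: "(\<And>x y. x \<bullet> (H *v y) = x \<bullet> (K *v y)) \<Longrightarrow> H = K" for H K :: "real^'n^'m"
  by (metis matrix_eq vector_eq_ldot)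

lemma linear_lyapunov: "linear (lyapunov A C)"
proof (rule linearI)
  show "lyapunov A C (H + K) = lyapunov A C H + lyapunov A C K" for H K
    by (rule matrix_eq_inner)
      (simp only: inner_lyapunov matrix_vector_mult_add_rdistrib inner_add_right add_ac)
  have s: "(r *\<^sub>R H) *v v = r *\<^sub>R (H *v v)" for r and H :: "real^'a^'a" and v
    by (simp add: scaleR_matrix_vector_assoc)
  show "lyapunov A C (r *\<^sub>R H) = r *\<^sub>R lyapunov A C H" for r H
    by (rule matrix_eq_inner) (simp only: inner_lyapunov s inner_scaleR_right distrib_left)
qed

lemma lyapunov_transpose: "lyapunov A C (transpose H) = transpose (lyapunov A C H)"
proof (rule matrix_eq_inner)
  fix x y :: "real^'a"
  have t: "x \<bullet> (transpose B *v y) = y \<bullet> (B *v x)" for B :: "real^'a^'a" and x y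
    using dot_matrix_transpose[of x "transpose B" y] by (simp add: inner_commute)
  show "x \<bullet> (lyapunov A C (transpose H) *v y) = x \<bullet> (transpose (lyapunov A C H) *v y)"
    unfolding t inner_lyapunov by (simp add: inner_commute add_ac)
qed

text \<open>A null vector of a nonnegative form lies in the kernel: moving from \<open>v\<close> a
  little along \<open>- (H *v v)\<close> would otherwise make the form negative.\<close>

lemma psd_null:
  fixes H :: "real^'n^'n"
  assumes sym: "transpose H = H" and nn: "\<And>v. 0 \<le> v \<bullet> (H *v v)" and z: "v \<bullet> (H *v v) = 0"
  shows "H *v v = 0"
proof (rule ccontr)
  let ?z = "H *v v" and ?k = "(H *v v) \<bullet> (H *v (H *v v))"
  assume "?z \<noteq> 0"
  then have n: "0 < ?z \<bullet> ?z" by simp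
  have k: "0 \<le> ?k" by (rule nn)
  \<comment> \<open>Small enough for the quadratic term to be at most half of the linear gain; the
    summand 1 covers \<open>?k = 0\<close>.\<close>
  define \<tau> where "\<tau> = (?z \<bullet> ?z) / (?k + 1)"
  have \<tau>: "0 < \<tau>" using n k by (simp add: \<tau>_def)
  have "0 \<le> (v - \<tau> *\<^sub>R ?z) \<bullet> (H *v (v - \<tau> *\<^sub>R ?z))" by (rule nn)
  also have "\<dots> = - 2 * \<tau> * (?z \<bullet> ?z) + \<tau> * (\<tau> * ?k)"
    using z dot_matrix_symmetric[OF sym, of v ?z]
    by (simp add: matrix_vector_mult_diff_distrib matrix_vector_mult_scaleR inner_diff inner_commute algebra_simps)
  finally have "\<tau> * (2 * (?z \<bullet> ?z)) \<le> \<tau> * (\<tau> * ?k)" by simp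
  then have "2 * (?z \<bullet> ?z) \<le> \<tau> * ?k" using \<tau> by simp
  also have "\<dots> \<le> \<tau> * (?k + 1)" using \<tau> by simp
  also have "\<dots> = ?z \<bullet> ?z" using k by (simp add: \<tau>_def)
  finally show False using n by simp
qed

text \<open>Integrability of \<open>f\<close> gives \<open>m\<close> a limit at infinity, and
  integrability of \<open>m\<close> itself forces this limit to be zero.\<close>

lemma ac_rep_total:
  fixes m :: "real \<Rightarrow> real"
  assumes ac: "ac_rep y f m" and f: "integrable halfline f" and m: "integrable halfline m"
  shows "y + (\<integral>s. f s \<partial>halfline) = 0"
proof (rule ccontr)
  let ?l = "y + (\<integral>s. f s \<partial>halfline)"
  assume l: "?l \<noteq> 0"
  have "((\<lambda>t. y + (\<integral>s. f s \<partial>upto_measure t)) \<longlongrightarrow> ?l) at_top"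
    by (intro tendsto_intros integral_upto_tendsto f)
  moreover have "\<forall>\<^sub>F t in at_top. y + (\<integral>s. f s \<partial>upto_measure t) = m t"
    using ac_repD(2)[OF ac] by (auto intro: eventually_at_top_linorderI[of 0])
  ultimately have "(m \<longlongrightarrow> ?l) at_top" by (rule Lim_transform_eventually)
  then have "((\<lambda>t. \<bar>m t\<bar>) \<longlongrightarrow> \<bar>?l\<bar>) at_top" by (rule tendsto_rabs)
  then have "\<forall>\<^sub>F t in at_top. \<bar>?l\<bar> / 2 < \<bar>m t\<bar>" by (rule order_tendstoD) (use l in auto)
  then obtain T where T: "\<And>t. T \<le> t \<Longrightarrow> \<bar>?l\<bar> / 2 < \<bar>m t\<bar>" by (auto simp: eventually_at_top_linorder)
  define J where "J = (\<integral>s. \<bar>m s\<bar> \<partial>halfline)"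
  define S where "S = max T 0"
  \<comment> \<open>On \<open>(S, R]\<close> the function exceeds half the limit in modulus; this
    length makes its integral at least \<open>J + \<bar>?l\<bar> / 2\<close>, more than the total
    \<open>J\<close>.\<close>
  define R where "R = S + 2 * J / \<bar>?l\<bar> + 1"
  have J: "0 \<le> J" unfolding J_def by simp
  have S: "0 \<le> S" "T \<le> S" by (auto simp: S_def)
  have R: "S \<le> R" using J l by (simp add: R_def)
  have "indicat_real {S<..R} s * (\<bar>?l\<bar> / 2) \<le> \<bar>m s\<bar>" for s
    using T[of s] S by (auto simp: indicator_def)
  moreover have fin: "emeasure lborel {S<..R} < \<infinity>" using R by simp
  then have i: "integrable lborel (\<lambda>s. indicat_real {S<..R} s * (\<bar>?l\<bar> / 2))"
    by (intro integrable_mult_left integrable_real_indicator) auto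
  moreover have e: "(\<lambda>s. indicat_real {0<..} s *\<^sub>R (indicat_real {S<..R} s * (\<bar>?l\<bar> / 2))) = (\<lambda>s. indicat_real {S<..R} s * (\<bar>?l\<bar> / 2))"
    using S by (auto simp: indicator_def)
  then have "integrable halfline (\<lambda>s. indicat_real {S<..R} s * (\<bar>?l\<bar> / 2))"
    using i unfolding halfline_integrable_iff by (simp only:)
  ultimately have "(\<integral>s. indicat_real {S<..R} s * (\<bar>?l\<bar> / 2) \<partial>halfline) \<le> J"
    unfolding J_def by (intro integral_mono integrable_abs[OF m]) blast+
  moreover have "(\<integral>s. indicat_real {S<..R} s * (\<bar>?l\<bar> / 2) \<partial>halfline) = (R - S) * (\<bar>?l\<bar> / 2)"
  proof -
    have "(\<integral>s. indicat_real {S<..R} s * c \<partial>halfline) = (R - S) * c" for c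
    proof -
      have "(\<lambda>s. indicat_real {0<..} s *\<^sub>R (indicat_real {S<..R} s * c)) = (\<lambda>s. indicat_real {S<..R} s * c)"
        using S by (auto simp: indicator_def)
      then show ?thesis unfolding halfline_integral using R by simp
    qed
    then show ?thesis .
  qed
  moreover have "(R - S) * (\<bar>?l\<bar> / 2) = J + \<bar>?l\<bar> / 2" using l by (simp add: R_def field_simps)
  ultimately show False using l by simp
qed

context wiener_space
begin

text \<open>Controls are deterministic and leave the expectation, so they meet only the means of the
  states; what remains is collected in the Lyapunov operator.\<close>

lemma moment_identity:
  fixes H :: "real^'n^'n"
  assumes sol: "ito_solution M F w A b C a u x" and a: "adapted_l2 0 a" and u: "square_integrable halfline u"
    and sol': "ito_solution M F w A b C a' u' x'" and a': "adapted_l2 0 a'" and u': "square_integrable halfline u'"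
  shows "ac_rep (\<integral>\<omega>. a \<omega> \<bullet> (H *v a' \<omega>) \<partial>M)
    (\<lambda>s. (\<integral>\<omega>. x s \<omega> \<bullet> (lyapunov A C H *v x' s \<omega>) \<partial>M)
       + (b *v u s) \<bullet> (H *v (\<integral>\<omega>. x' s \<omega> \<partial>M)) + (\<integral>\<omega>. x s \<omega> \<partial>M) \<bullet> (H *v (b *v u' s)))
    (\<lambda>t. \<integral>\<omega>. x t \<omega> \<bullet> (H *v x' t \<omega>) \<partial>M)"
proof (rule ac_rep_cong[OF ito_solution_second_moment[OF assms]])
  fix s :: real assume s: "0 < s"
  have x: "square_integrable M (x s)" "square_integrable M (x' s)"
    using ito_solution_square_integrable(7)[OF sol a u, of s] ito_solution_square_integrable(7)[OF sol' a' u', of s] s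
    by (auto simp: adapted_l2_def)
  note xi = integrable_of_square_integrable[OF finite_measure_axioms x(1)] integrable_of_square_integrable[OF finite_measure_axioms x(2)]
  note i = integrable_inner_square_integrable[OF square_integrable_mult_vec[OF x(1)] square_integrable_mult_vec[OF square_integrable_mult_vec[OF x(2)]]]
    integrable_inner_square_integrable[OF square_integrable_mult_vec[OF x(1)] square_integrable_mult_vec[OF x(2)]]
    integrable_inner_square_integrable[OF x(1) square_integrable_mult_vec[OF square_integrable_mult_vec[OF x(2)]]]
  have l: "integrable M (\<lambda>\<omega>. c \<bullet> (H *v x' s \<omega>))" "(\<integral>\<omega>. c \<bullet> (H *v x' s \<omega>) \<partial>M) = c \<bullet> (H *v (\<integral>\<omega>. x' s \<omega> \<partial>M))"
    "integrable M (\<lambda>\<omega>. x s \<omega> \<bullet> c)" "(\<integral>\<omega>. x s \<omega> \<bullet> c \<partial>M) = (\<integral>\<omega>. x s \<omega> \<partial>M) \<bullet> c" for c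
    using integrable_bounded_linear[OF bounded_linear_compose[OF bounded_linear_inner_right bounded_linear_matrix_vector] xi(2)]
      integral_bounded_linear[OF bounded_linear_compose[OF bounded_linear_inner_right bounded_linear_matrix_vector] xi(2)]
      integrable_bounded_linear[OF bounded_linear_inner_left xi(1)] integral_bounded_linear[OF bounded_linear_inner_left xi(1)]
    by auto
  show "(\<integral>\<omega>. drift A b u x s \<omega> \<bullet> (H *v x' s \<omega>) \<partial>M) + (\<integral>\<omega>. x s \<omega> \<bullet> (H *v drift A b u' x' s \<omega>) \<partial>M)
       + (\<integral>\<omega>. (C *v x s \<omega>) \<bullet> (H *v (C *v x' s \<omega>)) \<partial>M)
    = (\<integral>\<omega>. x s \<omega> \<bullet> (lyapunov A C H *v x' s \<omega>) \<partial>M)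
       + (b *v u s) \<bullet> (H *v (\<integral>\<omega>. x' s \<omega> \<partial>M)) + (\<integral>\<omega>. x s \<omega> \<partial>M) \<bullet> (H *v (b *v u' s))"
    unfolding drift_def matrix_vector_right_distrib inner_add_left inner_add_right inner_lyapunov
    by (simp only: Bochner_Integration.integral_add Bochner_Integration.integrable_add i l)
qed simp_all

lemma moment_bound:
  assumes "square_integrable M f" "square_integrable M g"
  shows "\<bar>\<integral>\<omega>. f \<omega> \<bullet> g \<omega> \<partial>M\<bar> \<le> ((\<integral>\<omega>. (norm (f \<omega>))\<^sup>2 \<partial>M) + (\<integral>\<omega>. (norm (g \<omega>))\<^sup>2 \<partial>M)) / 2"
proof -
  note i = square_integrableD(2)[OF assms(1)] square_integrableD(2)[OF assms(2)]
  have "\<bar>\<integral>\<omega>. f \<omega> \<bullet> g \<omega> \<partial>M\<bar> \<le> (\<integral>\<omega>. \<bar>f \<omega> \<bullet> g \<omega>\<bar> \<partial>M)" by (rule integral_abs_bound)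
  also have "\<dots> \<le> (\<integral>\<omega>. ((norm (f \<omega>))\<^sup>2 + (norm (g \<omega>))\<^sup>2) / 2 \<partial>M)"
    using assms i by (intro integral_mono integrable_abs integrable_inner_square_integrable inner_le_squares
        integrable_divide Bochner_Integration.integrable_add)
  also have "\<dots> = ((\<integral>\<omega>. (norm (f \<omega>))\<^sup>2 \<partial>M) + (\<integral>\<omega>. (norm (g \<omega>))\<^sup>2 \<partial>M)) / 2" using i by simp
  finally show ?thesis .
qed

end

section \<open>The uncontrolled motion and invertibility of the Lyapunov operator\<close>

locale stable_system = wiener_space M F w
  for M :: "'w measure" and F :: "real \<Rightarrow> 'w measure" and w :: "real \<Rightarrow> 'w \<Rightarrow> real" +
  fixes A C :: "real^'n^'n" and b :: "real^'m^'n"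
  assumes stable: "mean_square_exp_stable M F w A b C"
begin

abbreviation flow :: "real^'n \<Rightarrow> real \<Rightarrow> 'w \<Rightarrow> real^'n" where
  "flow v \<equiv> euler_limit A C v"

definition mean_flow :: "real^'n \<Rightarrow> real \<Rightarrow> real^'n" where
  "mean_flow v t = (\<integral>\<omega>. flow v t \<omega> \<partial>M)"

lemma flow_solution: "ito_solution M F w A b C (\<lambda>\<omega>. v) (\<lambda>_. 0) (flow v)"
  by (rule ito_solution_exists)

lemma const_adapted: "adapted_l2 0 (\<lambda>\<omega>. v)" for v :: "real^'k"
  using initial_state_const[of v] by (simp add: initial_state_def adapted_l2_def)

lemma flow_square_integrable: "0 \<le> t \<Longrightarrow> square_integrable M (flow v t)"
  using ito_solution_square_integrable(7)[OF flow_solution const_adapted, of t] by (simp add: adapted_l2_def)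

text \<open>The stability hypothesis applied to constant initial states and to the solutions
  constructed for them.\<close>

lemma flow_decay:
  obtains c \<epsilon> where "0 < c" "0 < \<epsilon>" "\<And>v t. 0 < t \<Longrightarrow> rms M (flow v t) \<le> c * exp (- \<epsilon> * t) * norm v"
proof -
  obtain c \<epsilon> where c: "0 < c" "0 < \<epsilon>"
    and d: "\<And>a x t. initial_state M F w a \<Longrightarrow> ito_solution M F w A b C a (\<lambda>_. 0) x \<Longrightarrow> 0 < t \<Longrightarrow>
      rms M (x t) \<le> c * exp (- \<epsilon> * t) * rms M a"
    using stable unfolding mean_square_exp_stable_def by blast
  have "rms M (\<lambda>\<omega>. v) = norm v" for v :: "real^'n" by (simp add: rms_def prob_space)
  then show thesis using d[OF initial_state_const flow_solution] by (intro that[OF c]) simp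
qed

lemma flow_energy_tendsto: "((\<lambda>t. \<integral>\<omega>. (norm (flow v t \<omega>))\<^sup>2 \<partial>M) \<longlongrightarrow> 0) at_top"
proof -
  obtain c \<epsilon> where c: "0 < c" "0 < \<epsilon>" and d: "\<And>v t. 0 < t \<Longrightarrow> rms M (flow v t) \<le> c * exp (- \<epsilon> * t) * norm v"
    by (rule flow_decay, rule that)
  have "((\<lambda>t. exp (- \<epsilon> * t)) \<longlongrightarrow> 0) at_top" using c(2) by real_asymp
  then have "((\<lambda>t. (c * exp (- \<epsilon> * t) * norm v)\<^sup>2) \<longlongrightarrow> (c * 0 * norm v)\<^sup>2) at_top" by (intro tendsto_intros)
  then have l: "((\<lambda>t. (c * exp (- \<epsilon> * t) * norm v)\<^sup>2) \<longlongrightarrow> 0) at_top" by simp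
  have "(\<integral>\<omega>. (norm (flow v t \<omega>))\<^sup>2 \<partial>M) \<le> (c * exp (- \<epsilon> * t) * norm v)\<^sup>2" if "0 < t" for t
  proof -
    have "(rms M (flow v t))\<^sup>2 \<le> (c * exp (- \<epsilon> * t) * norm v)\<^sup>2"
      using d[OF that] by (rule power_mono) (simp add: rms_def)
    then show ?thesis by (simp add: rms_def)
  qed
  then show ?thesis
    by (intro Lim_null_comparison[OF eventually_at_top_linorderI[of 1] l]) auto
qed

lemma flow_moment_tendsto: "((\<lambda>t. \<integral>\<omega>. flow v t \<omega> \<bullet> (H *v flow v' t \<omega>) \<partial>M) \<longlongrightarrow> 0) at_top"
proof -
  obtain K where K: "0 \<le> K" "\<And>v. norm (H *v v) \<le> K * norm v" using matrix_vector_bound[of H] by blast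
  have "((\<lambda>t. ((\<integral>\<omega>. (norm (flow v t \<omega>))\<^sup>2 \<partial>M) + K\<^sup>2 * (\<integral>\<omega>. (norm (flow v' t \<omega>))\<^sup>2 \<partial>M)) / 2) \<longlongrightarrow> (0 + K\<^sup>2 * 0) / 2) at_top"
    by (intro tendsto_intros flow_energy_tendsto) simp
  then have l: "((\<lambda>t. ((\<integral>\<omega>. (norm (flow v t \<omega>))\<^sup>2 \<partial>M) + K\<^sup>2 * (\<integral>\<omega>. (norm (flow v' t \<omega>))\<^sup>2 \<partial>M)) / 2) \<longlongrightarrow> 0) at_top"
    by simp
  have "norm (\<integral>\<omega>. flow v t \<omega> \<bullet> (H *v flow v' t \<omega>) \<partial>M)
      \<le> ((\<integral>\<omega>. (norm (flow v t \<omega>))\<^sup>2 \<partial>M) + K\<^sup>2 * (\<integral>\<omega>. (norm (flow v' t \<omega>))\<^sup>2 \<partial>M)) / 2" if t: "0 \<le> t" for t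
  proof -
    note s = flow_square_integrable[OF t, of v] square_integrable_mult_vec[OF flow_square_integrable[OF t, of v'], of H]
      flow_square_integrable[OF t, of v']
    have "(\<integral>\<omega>. (norm (H *v flow v' t \<omega>))\<^sup>2 \<partial>M) \<le> (\<integral>\<omega>. K\<^sup>2 * (norm (flow v' t \<omega>))\<^sup>2 \<partial>M)"
      by (intro integral_mono integrable_mult_right square_integrableD(2) s norm_square_le K)
    then show ?thesis using moment_bound[OF s(1) s(2)] by simp
  qed
  then show ?thesis by (intro Lim_null_comparison[OF eventually_at_top_linorderI[of 0] l])
qed

text \<open>Polarized in the initial vectors, so that it determines all entries of a matrix,
  including matrices not yet known to be symmetric.\<close>

lemma flow_moment_identity:
  "ac_rep (v \<bullet> (H *v v')) (\<lambda>s. \<integral>\<omega>. flow v s \<omega> \<bullet> (lyapunov A C H *v flow v' s \<omega>) \<partial>M)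
     (\<lambda>t. \<integral>\<omega>. flow v t \<omega> \<bullet> (H *v flow v' t \<omega>) \<partial>M)"
  by (rule ac_rep_cong[OF moment_identity[OF flow_solution const_adapted _ flow_solution const_adapted, where H=H]])
    (simp_all add: prob_space square_integrable_zero)

text \<open>If the operator annihilates \<open>H\<close>, the mixed moment is constant in time;
  stability sends it to zero, so its initial value \<open>v \<bullet> (H *v v')\<close> is
  zero.\<close>

lemma lyapunov_zero:
  assumes "lyapunov A C H = 0" shows "H = 0"
proof (rule matrix_eq_inner)
  fix v v'
  have "(\<integral>\<omega>. flow v t \<omega> \<bullet> (H *v flow v' t \<omega>) \<partial>M) = v \<bullet> (H *v v')" if "0 \<le> t" for t
    using ac_repD(2)[OF flow_moment_identity[where v=v and H=H and v'=v'] that] by (simp add: assms)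
  then have "\<forall>\<^sub>F t in at_top. (\<integral>\<omega>. flow v t \<omega> \<bullet> (H *v flow v' t \<omega>) \<partial>M) = v \<bullet> (H *v v')"
    by (auto intro: eventually_at_top_linorderI[of 0])
  from tendsto_cong[OF this] flow_moment_tendsto[where v=v and H=H and v'=v'] show "v \<bullet> (H *v v') = v \<bullet> (0 *v v')"
    by (simp add: tendsto_const_iff)
qed

lemma inj_lyapunov: "inj (lyapunov A C)"
  using lyapunov_zero by (simp add: linear_injective_0[OF linear_lyapunov])

text \<open>Injectivity in finite dimension gives a solution, and uniqueness makes it symmetric. The
  moment with weight \<open>H\<close> decreases to its limit 0, so \<open>H\<close> is
  nonnegative.\<close>

lemma lyapunov_solution:
  obtains H where "transpose H = H" "lyapunov A C H = - mat 1" "\<And>v. v \<noteq> 0 \<Longrightarrow> 0 < v \<bullet> (H *v v)"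
    "\<And>v. 2 * ((A *v v) \<bullet> (H *v v)) \<le> - (norm v)\<^sup>2"
proof -
  obtain H where H: "lyapunov A C H = - mat 1"
    using linear_injective_imp_surjective[OF linear_lyapunov inj_lyapunov] by (metis surjD)
  have "lyapunov A C (transpose H) = lyapunov A C H"
    unfolding lyapunov_transpose H by (simp add: transpose_def vec_eq_iff mat_def)
  then have sym: "transpose H = H" using inj_lyapunov by (simp add: inj_eq)
  have L: "lyapunov A C H *v v = - v" for v by (simp add: H uminus_matrix_vector)
  have nn: "0 \<le> v \<bullet> (H *v v)" for v
  proof (rule tendsto_upperbound[OF flow_moment_tendsto[where v=v and H=H and v'=v] eventually_at_top_linorderI[of 0]])
    fix t :: real assume t: "0 \<le> t"
    have "(\<integral>s. (\<integral>\<omega>. flow v s \<omega> \<bullet> (lyapunov A C H *v flow v s \<omega>) \<partial>M) \<partial>upto_measure t) \<le> 0"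
      unfolding L by (simp add: integral_nonneg)
    then show "(\<integral>\<omega>. flow v t \<omega> \<bullet> (H *v flow v t \<omega>) \<partial>M) \<le> v \<bullet> (H *v v)"
      using ac_repD(2)[OF flow_moment_identity[where v=v and H=H and v'=v] t] by simp
  qed simp
  have eq: "2 * ((A *v v) \<bullet> (H *v v)) + (C *v v) \<bullet> (H *v (C *v v)) = - (norm v)\<^sup>2" for v
    using inner_lyapunov[of v A C H v] dot_matrix_symmetric[OF sym, of v "A *v v"]
    by (simp add: L power2_norm_eq_inner inner_commute)
  \<comment> \<open>A null vector would lie in the kernel, and the Lyapunov equation would make the
    form negative at \<open>C *v v\<close>.\<close>
  have pos: "0 < v \<bullet> (H *v v)" if "v \<noteq> 0" for v
  proof (rule ccontr)
    assume "\<not> 0 < v \<bullet> (H *v v)"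
    then have "v \<bullet> (H *v v) = 0" using nn[of v] by simp
    then have "H *v v = 0" by (rule psd_null[OF sym nn])
    then have "(C *v v) \<bullet> (H *v (C *v v)) = - (norm v)\<^sup>2" using eq[of v] by simp
    moreover have "0 < (norm v)\<^sup>2" using that by simp
    ultimately show False using nn[of "C *v v"] by linarith
  qed
  have "2 * ((A *v v) \<bullet> (H *v v)) \<le> - (norm v)\<^sup>2" for v using eq[of v] nn[of "C *v v"] by linarith
  with sym H pos show thesis by (rule that)
qed

end

section \<open>The resolvent on the imaginary axis\<close>

definition re_vec :: "complex^'k \<Rightarrow> real^'k" where "re_vec z = (\<chi> i. Re (z $ i))"
definition im_vec :: "complex^'k \<Rightarrow> real^'k" where "im_vec z = (\<chi> i. Im (z $ i))"
definition re_mat :: "complex^'k^'l \<Rightarrow> real^'k^'l" where "re_mat Z = (\<chi> i j. Re (Z $ i $ j))"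
definition im_mat :: "complex^'k^'l \<Rightarrow> real^'k^'l" where "im_mat Z = (\<chi> i j. Im (Z $ i $ j))"
definition complex_vec :: "real^'k \<Rightarrow> real^'k \<Rightarrow> complex^'k" where "complex_vec p q = (\<chi> i. Complex (p $ i) (q $ i))"

lemma complex_vec_parts [simp]: "re_vec (complex_vec p q) = p" "im_vec (complex_vec p q) = q"
  by (simp_all add: re_vec_def im_vec_def complex_vec_def vec_eq_iff)

lemma complex_vec_eqI: "re_vec y = re_vec z \<Longrightarrow> im_vec y = im_vec z \<Longrightarrow> y = z"
  by (simp add: re_vec_def im_vec_def vec_eq_iff complex_eq_iff)

lemma complex_mat_eqI: "re_mat Y = re_mat Z \<Longrightarrow> im_mat Y = im_mat Z \<Longrightarrow> Y = Z"
  by (simp add: re_mat_def im_mat_def vec_eq_iff complex_eq_iff)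

lemma re_cmat_vec: "re_vec (cmat B *v z) = B *v re_vec z"
  and im_cmat_vec: "im_vec (cmat B *v z) = B *v im_vec z"
  by (simp_all add: re_vec_def im_vec_def matrix_vector_mult_def vec_eq_iff)

lemma norm_complex_vec: "(norm z)\<^sup>2 = (norm (re_vec z))\<^sup>2 + (norm (im_vec z))\<^sup>2"
  unfolding norm_vec_def L2_set_def re_vec_def im_vec_def
  by (simp add: sum_nonneg sum.distrib[symmetric] cmod_power2)

text \<open>A Hurwitz matrix has no eigenvalue on the imaginary axis, so the inverse is genuine and
  the equation can be multiplied out and split into real and imaginary parts.\<close>

lemma resolvent_eq_iff:
  fixes A :: "real^'n^'n"
  assumes h: "hurwitz A"
  shows "resolvent A \<nu> *v u = z \<longleftrightarrow>
    A *v re_vec z + re_vec u = - \<nu> *\<^sub>R im_vec z \<and> A *v im_vec z + im_vec u = \<nu> *\<^sub>R re_vec z"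
proof -
  let ?B = "mat (\<i> * complex_of_real \<nu>) - cmat A"
  have B: "?B *v z = (\<i> * complex_of_real \<nu>) *s z - cmat A *v z" for z
    unfolding matrix_vector_mult_diff_rdistrib
    by (simp add: matrix_vector_mult_def mat_def vec_eq_iff if_distrib if_distribR cong: if_cong)
  have "z = 0" if "?B *v z = 0" for z
  proof (rule ccontr)
    assume "z \<noteq> 0"
    moreover have "cmat A *v z = (\<i> * complex_of_real \<nu>) *s z" using that unfolding B by simp
    ultimately have "Re (\<i> * complex_of_real \<nu>) < 0" using h unfolding hurwitz_def by blast
    then show False by simp
  qed
  then have "invertible ?B"
    by (simp add: invertible_left_inverse matrix_left_invertible_ker)
  then have inv: "resolvent A \<nu> ** ?B = mat 1" "?B ** resolvent A \<nu> = mat 1"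
    using someI_ex[of "\<lambda>B. ?B ** B = mat 1 \<and> B ** ?B = mat 1"]
    unfolding resolvent_def matrix_inv_def invertible_def by blast+
  have "resolvent A \<nu> *v u = z \<longleftrightarrow> u = ?B *v z"
    using inv by (metis matrix_vector_mul_assoc matrix_vector_mul_lid)
  also have "\<dots> \<longleftrightarrow> re_vec u = re_vec (?B *v z) \<and> im_vec u = im_vec (?B *v z)"
    using complex_vec_eqI[of u "?B *v z"] by auto
  also have "re_vec (?B *v z) = - \<nu> *\<^sub>R im_vec z - A *v re_vec z"
    unfolding B re_cmat_vec[symmetric] by (simp add: re_vec_def im_vec_def vec_eq_iff)
  also have "im_vec (?B *v z) = \<nu> *\<^sub>R re_vec z - A *v im_vec z"
    unfolding B im_cmat_vec[symmetric] by (simp add: re_vec_def im_vec_def vec_eq_iff)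
  finally show ?thesis by (simp add: eq_diff_eq add.commute)
qed

text \<open>The resolvent is the Fourier transform of the motion \<open>d' = A d\<close>; its column
  \<open>k\<close> belongs to the motion started at the basis vector \<open>k\<close>.\<close>

lemma resolvent_column:
  fixes A :: "real^'n^'n"
  assumes h: "hurwitz A" and d: "ac_rep (axis k 1) (\<lambda>s. A *v d s) d" "nice_halfline d" "(d \<longlongrightarrow> 0) at_top"
  shows "resolvent A \<nu> $ i $ k = complex_vec (cos_vec d \<nu>) (- sin_vec d \<nu>) $ i"
proof -
  have d': "ac_rep (axis k 1) (\<lambda>s. A *v d s + 0) d" using d(1) by simp
  have z: "cos_vec (\<lambda>_. 0) \<nu> = (0 :: real^'n)" "sin_vec (\<lambda>_. 0) \<nu> = (0 :: real^'n)"
    by (simp_all add: cos_vec_def sin_vec_def)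
  have di: "integrable halfline d" using d(2) by (simp add: nice_halfline_def)
  note T = transform_of_solution[OF d' di integrable_zero d(3), of \<nu>, unfolded z add_0_right]
  have e: "re_vec (axis k 1) = axis k 1" "im_vec (axis k 1) = 0"
    by (simp_all add: re_vec_def im_vec_def axis_def vec_eq_iff)
  have "resolvent A \<nu> *v axis k 1 = complex_vec (cos_vec d \<nu>) (- sin_vec d \<nu>)"
    unfolding resolvent_eq_iff[OF h] complex_vec_parts e using T by (simp add: vec.neg)
  moreover have "(resolvent A \<nu> *v axis k 1) $ i = resolvent A \<nu> $ i $ k"
    by (simp add: matrix_vector_mult_def axis_def if_distrib cong: if_cong)
  ultimately show ?thesis by simp
qed

text \<open>The form is bilinear, without conjugation. In its applications the conjugate is already
  part of \<open>x\<close>: as \<open>cnj\<close> in \<open>qform\<close>, and as the reflected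
  frequency in the integral equation.\<close>

lemma complex_form_parts:
  fixes \<Theta> :: "complex^'l^'k"
  shows "Re (\<Sum>i\<in>UNIV. \<Sum>j\<in>UNIV. \<Theta> $ i $ j * (x $ i * y $ j))
      = re_vec x \<bullet> (re_mat \<Theta> *v re_vec y) - im_vec x \<bullet> (re_mat \<Theta> *v im_vec y)
        - re_vec x \<bullet> (im_mat \<Theta> *v im_vec y) - im_vec x \<bullet> (im_mat \<Theta> *v re_vec y)"
    and "Im (\<Sum>i\<in>UNIV. \<Sum>j\<in>UNIV. \<Theta> $ i $ j * (x $ i * y $ j))
      = re_vec x \<bullet> (re_mat \<Theta> *v im_vec y) + im_vec x \<bullet> (re_mat \<Theta> *v re_vec y)
        + re_vec x \<bullet> (im_mat \<Theta> *v re_vec y) - im_vec x \<bullet> (im_mat \<Theta> *v im_vec y)"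
  unfolding inner_matrix_sum sum.distrib[symmetric] sum_subtractf[symmetric] Re_sum Im_sum
  by (intro sum.cong refl; simp add: re_vec_def im_vec_def re_mat_def im_mat_def algebra_simps)+

text \<open>Conjugation flips the sign of the imaginary part of the first argument; the remaining
  mixed terms cancel by symmetry.\<close>

lemma qform_real:
  fixes \<Theta> :: "real^'k^'k"
  assumes "transpose \<Theta> = \<Theta>"
  shows "qform (cmat \<Theta>) z = complex_of_real (re_vec z \<bullet> (\<Theta> *v re_vec z) + im_vec z \<bullet> (\<Theta> *v im_vec z))"
proof -
  let ?c = "complex_vec (re_vec z) (- im_vec z)"
  have c: "cnj (z $ i) = ?c $ i" for i by (simp add: complex_vec_def re_vec_def im_vec_def complex_eq_iff)
  have q: "qform (cmat \<Theta>) z = (\<Sum>i\<in>UNIV. \<Sum>j\<in>UNIV. cmat \<Theta> $ i $ j * (?c $ i * z $ j))"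
    unfolding qform_def matrix_vector_mult_def c by (simp add: sum_distrib_left mult_ac)
  have m: "re_mat (cmat \<Theta>) = \<Theta>" "im_mat (cmat \<Theta>) = 0" by (simp_all add: re_mat_def im_mat_def vec_eq_iff)
  show ?thesis
    unfolding q using dot_matrix_symmetric[OF assms, of "re_vec z" "im_vec z"]
    by (intro complex_eqI) (simp_all only: complex_form_parts m complex_vec_parts, simp_all add: inner_commute)
qed

lemma freq_form_real:
  fixes \<Theta> :: "real^'n^'n" and \<Gamma> :: "real^'m^'m"
  assumes "transpose \<Theta> = \<Theta>" "transpose \<Gamma> = \<Gamma>"
  shows "freq_form (cmat \<Theta>) \<Gamma> x u = complex_of_real (re_vec x \<bullet> (\<Theta> *v re_vec x) + im_vec x \<bullet> (\<Theta> *v im_vec x)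
    + re_vec u \<bullet> (\<Gamma> *v re_vec u) + im_vec u \<bullet> (\<Gamma> *v im_vec u))"
  unfolding freq_form_def qform_real[OF assms(1)] qform_real[OF assms(2)] of_real_add by (simp only: add_ac)

section \<open>The equation for \<open>\<Theta>\<close>\<close>

lemma cos_vec_even: "cos_vec f (- \<nu>) = cos_vec f \<nu>" and sin_vec_odd: "sin_vec f (- \<nu>) = - sin_vec f \<nu>"
  by (simp_all add: cos_vec_def sin_vec_def)

lemma odd_integral:
  fixes f :: "real \<Rightarrow> real"
  assumes "\<And>x. f (- x) = - f x" shows "(\<integral>x. f x \<partial>lborel) = 0"
  using lborel_integral_real_affine[of "-1" f 0] assms by simp

text \<open>The cosine transform is even and the sine transform odd in the frequency, so these
  integrable products are odd.\<close>

lemma parseval_matrix_cross: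
  fixes f :: "real \<Rightarrow> real^'m" and g :: "real \<Rightarrow> real^'n" and N :: "real^'n^'m"
  assumes f: "nice_halfline f" and g: "nice_halfline g"
  shows "has_bochner_integral lborel (\<lambda>\<nu>. cos_vec f \<nu> \<bullet> (N *v sin_vec g \<nu>)) 0"
    and "has_bochner_integral lborel (\<lambda>\<nu>. sin_vec f \<nu> \<bullet> (N *v cos_vec g \<nu>)) 0"
proof -
  have fi: "integrable halfline f" "integrable halfline g" using f g by (auto simp: nice_halfline_def)
  note p = parseval(3,4)[OF nice_halfline_component[OF f] nice_halfline_component[OF g]]
  have "integrable lborel (\<lambda>\<nu>. cos_vec f \<nu> \<bullet> (N *v sin_vec g \<nu>))" "integrable lborel (\<lambda>\<nu>. sin_vec f \<nu> \<bullet> (N *v cos_vec g \<nu>))"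
    unfolding inner_matrix_sum transform_component[OF fi(1)] transform_component[OF fi(2)]
    by (intro Bochner_Integration.integrable_sum integrable_mult_right p)+
  then show "has_bochner_integral lborel (\<lambda>\<nu>. cos_vec f \<nu> \<bullet> (N *v sin_vec g \<nu>)) 0"
    "has_bochner_integral lborel (\<lambda>\<nu>. sin_vec f \<nu> \<bullet> (N *v cos_vec g \<nu>)) 0"
    by (auto simp: has_bochner_integral_iff cos_vec_even sin_vec_odd vec.neg intro!: odd_integral)
qed

lemma has_bochner_integral_vec:
  fixes f :: "'a \<Rightarrow> ('b::euclidean_space)^'k"
  assumes "\<And>i. has_bochner_integral N (\<lambda>x. f x $ i) (y $ i)"
  shows "has_bochner_integral N f y"
proof -
  have e: "v = (\<Sum>i\<in>UNIV. axis i (v $ i))" for v :: "'b^'k"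
    by (simp add: vec_eq_iff axis_def if_distrib cong: if_cong)
  have "linear (axis i :: 'b \<Rightarrow> 'b^'k)" for i by (rule linearI) (auto simp: axis_def vec_eq_iff)
  then have bl: "bounded_linear (axis i :: 'b \<Rightarrow> 'b^'k)" for i by (rule linear_conv_bounded_linear[THEN iffD1])
  have "has_bochner_integral N (\<lambda>x. \<Sum>i\<in>UNIV. axis i (f x $ i)) (\<Sum>i\<in>UNIV. axis i (y $ i))"
    by (rule has_bochner_integral_sum, rule has_bochner_integral_bounded_linear[OF bl assms])
  then show ?thesis unfolding e[symmetric] .
qed

lemma has_bochner_integral_Complex:
  assumes "has_bochner_integral N f x" "has_bochner_integral N g y"
  shows "has_bochner_integral N (\<lambda>t. Complex (f t) (g t)) (Complex x y)"
  unfolding Complex_eq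
  by (rule has_bochner_integral_add[OF has_bochner_integral_bounded_linear[OF bounded_linear_of_real assms(1)]
      has_bochner_integral_mult_right[OF has_bochner_integral_bounded_linear[OF bounded_linear_of_real assms(2)]]])

text \<open>When \<open>d k\<close> is the motion of \<open>d' = A d\<close> from the basis vector
  \<open>k\<close>, this is the integral over positive times of the transpose of
  \<open>exp (t A)\<close> times \<open>T\<close> times \<open>exp (t A)\<close>.\<close>

definition gram :: "('n \<Rightarrow> real \<Rightarrow> real^'n) \<Rightarrow> real^'n^'n \<Rightarrow> real^'n^'n" where
  "gram d T = (\<chi> p q. \<integral>t. d p t \<bullet> (T *v d q t) \<partial>halfline)"

lemma triple_product_component:
  fixes P Q R :: "complex^'n^'n"
  shows "(transpose P ** Q ** R) $ p $ q = (\<Sum>i\<in>UNIV. \<Sum>j\<in>UNIV. Q $ i $ j * (P $ i $ p * R $ j $ q))"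
  unfolding matrix_matrix_mult_def transpose_def
  by (simp add: sum_distrib_left sum_distrib_right mult_ac) (rule sum.swap)

lemma theta_equation_parts:
  fixes A C G :: "real^'n^'n"
  assumes h: "hurwitz A" and \<Theta>: "theta_equation A C G \<Theta>"
    and d: "\<And>k. ac_rep (axis k 1) (\<lambda>s. A *v d k s) (d k)" "\<And>k. nice_halfline (d k)" "\<And>k. (d k \<longlongrightarrow> 0) at_top"
  shows "re_mat \<Theta> = G + transpose C ** gram d (re_mat \<Theta>) ** C"
    and "im_mat \<Theta> = transpose C ** gram d (im_mat \<Theta>) ** C"
proof -
  define K where "K \<nu> = transpose (resolvent A (- \<nu>)) ** \<Theta> ** resolvent A \<nu>" for \<nu>
  define S where "S = (\<chi> p q. Complex (gram d (re_mat \<Theta>) $ p $ q) (gram d (im_mat \<Theta>) $ p $ q))"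

  let ?c = "\<lambda>k \<nu>. cos_vec (d k) \<nu>" and ?s = "\<lambda>k \<nu>. sin_vec (d k) \<nu>"
  note col = resolvent_column[OF h d]
  have K: "K \<nu> $ p $ q = Complex
      ((?c p \<nu> \<bullet> (re_mat \<Theta> *v ?c q \<nu>) + ?s p \<nu> \<bullet> (re_mat \<Theta> *v ?s q \<nu>))
         + (?c p \<nu> \<bullet> (im_mat \<Theta> *v ?s q \<nu>) - ?s p \<nu> \<bullet> (im_mat \<Theta> *v ?c q \<nu>)))
      ((?c p \<nu> \<bullet> (im_mat \<Theta> *v ?c q \<nu>) + ?s p \<nu> \<bullet> (im_mat \<Theta> *v ?s q \<nu>))
         + (?s p \<nu> \<bullet> (re_mat \<Theta> *v ?c q \<nu>) - ?c p \<nu> \<bullet> (re_mat \<Theta> *v ?s q \<nu>)))" for \<nu> p q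
    unfolding K_def triple_product_component col
    by (intro complex_eqI) (simp_all only: complex_form_parts complex_vec_parts, simp_all add: vec.neg cos_vec_even sin_vec_odd)
  have main: "has_bochner_integral lborel (\<lambda>\<nu>. ?c p \<nu> \<bullet> (T *v ?c q \<nu>) + ?s p \<nu> \<bullet> (T *v ?s q \<nu>)) (2 * pi * gram d T $ p $ q)" for p q T
    using parseval_matrix[OF d(2) d(2), of p T q] by (simp add: has_bochner_integral_iff gram_def)
  have "has_bochner_integral lborel (\<lambda>\<nu>. K \<nu> $ p $ q)
     (Complex (2 * pi * gram d (re_mat \<Theta>) $ p $ q + (0 - 0)) (2 * pi * gram d (im_mat \<Theta>) $ p $ q + (0 - 0)))" for p q
    unfolding K
    by (intro has_bochner_integral_Complex has_bochner_integral_add has_bochner_integral_diff main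
        parseval_matrix_cross d(2))
  moreover have "Complex (2 * pi * gram d (re_mat \<Theta>) $ p $ q + (0 - 0)) (2 * pi * gram d (im_mat \<Theta>) $ p $ q + (0 - 0))
     = ((2 * pi) *\<^sub>R S) $ p $ q" for p q
    by (simp add: S_def complex_eq_iff)
  ultimately have KS: "has_bochner_integral lborel K ((2 * pi) *\<^sub>R S)"
    by (intro has_bochner_integral_vec) simp
  \<comment> \<open>The outer multiplications by \<open>C\<close> form a linear map and leave the
    integral.\<close>
  define L where "L X = transpose (cmat C) ** X ** cmat C" for X :: "complex^'n^'n"
  have "linear L"
    unfolding L_def
    by (rule linearI) (simp_all add: vec_eq_iff matrix_matrix_mult_def distrib_left distrib_right sum.distrib
        scaleR_sum_right[symmetric])
  then have "has_bochner_integral lborel (\<lambda>\<nu>. L (K \<nu>)) (L ((2 * pi) *\<^sub>R S))"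
    by (rule has_bochner_integral_bounded_linear[OF linear_conv_bounded_linear[THEN iffD1] KS])
  then have "(\<integral>\<nu>. L (K \<nu>) \<partial>lborel) = (2 * pi) *\<^sub>R L S"
    using \<open>linear L\<close> by (simp add: has_bochner_integral_iff linear_scale)
  moreover have "L (K \<nu>) = transpose (cmat C) ** transpose (resolvent A (- \<nu>)) ** \<Theta> ** resolvent A \<nu> ** cmat C" for \<nu>
    by (simp add: L_def K_def matrix_mul_assoc)
  ultimately have eq: "\<Theta> = cmat G + L S"
    using \<Theta> by (simp add: theta_equation_def)
  have t: "transpose (cmat C) = cmat (transpose C)" by (simp add: transpose_def vec_eq_iff)
  have "re_mat (L S) = transpose C ** re_mat S ** C" "im_mat (L S) = transpose C ** im_mat S ** C"
    unfolding L_def t by (simp_all add: re_mat_def im_mat_def matrix_matrix_mult_def vec_eq_iff)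
  moreover have "re_mat S = gram d (re_mat \<Theta>)" "im_mat S = gram d (im_mat \<Theta>)"
    by (simp_all add: S_def re_mat_def im_mat_def vec_eq_iff)
  moreover have "re_mat (cmat G + L S) = G + re_mat (L S)" "im_mat (cmat G + L S) = im_mat (L S)"
    by (simp_all add: re_mat_def im_mat_def vec_eq_iff)
  ultimately show "re_mat \<Theta> = G + transpose C ** gram d (re_mat \<Theta>) ** C"
    "im_mat \<Theta> = transpose C ** gram d (im_mat \<Theta>) ** C"
    using eq by metis+
qed

section \<open>Reduction to the deterministic problem\<close>

lemma inner_conjugate: "x \<bullet> ((transpose C ** H ** C) *v y) = (C *v x) \<bullet> (H *v (C *v y))"
  for C H :: "real^'n^'n"
  using dot_matrix_transpose[of x "transpose C" "H *v (C *v y)"]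
  unfolding matrix_vector_mul_assoc[symmetric] by (simp only: transpose_transpose)

lemma transpose_uminus: "transpose (- H) = - transpose H" for H :: "real^'n^'m"
  by (simp add: transpose_def vec_eq_iff)

lemma integral_upto_le_halfline:
  fixes h :: "real \<Rightarrow> real"
  assumes "integrable halfline h"
  shows "(\<integral>s. h s \<partial>upto_measure t) \<le> (\<integral>s. \<bar>h s\<bar> \<partial>halfline)"
  unfolding upto_integral halfline_integral
  using assms integrable_abs[OF assms] integrable_halfline_upto[OF assms, of t]
  by (intro integral_mono) (auto simp: halfline_integrable_iff upto_integrable_iff indicator_def)

locale control_system = stable_system M F w A C b
  for M :: "'w measure" and F :: "real \<Rightarrow> 'w measure" and w :: "real \<Rightarrow> 'w \<Rightarrow> real"
    and A C :: "real^'n^'n" and b :: "real^'m^'n" +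
  fixes G :: "real^'n^'n" and \<Gamma> :: "real^'m^'m" and a :: "'w \<Rightarrow> real^'n"
    and x :: "(real \<Rightarrow> real^'m) \<Rightarrow> real \<Rightarrow> 'w \<Rightarrow> real^'n" and \<Theta> :: "complex^'n^'n"
  assumes G_sym: "transpose G = G" and \<Gamma>_sym: "transpose \<Gamma> = \<Gamma>"
    and init: "initial_state M F w a"
    and sol: "\<And>u. square_integrable halfline u \<Longrightarrow> ito_solution M F w A b C a u (x u)"
    and hurwitz: "hurwitz A" and \<Theta>_eq: "theta_equation A C G \<Theta>"
begin

lemma init_adapted: "adapted_l2 0 a"
  using init by (simp add: initial_state_def adapted_l2_def)

text \<open>A fixed choice of Lyapunov matrix, since the deterministic problem is to be interpreted
  with a definite term.\<close>

definition P :: "real^'n^'n" where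
  "P = (SOME H. transpose H = H \<and> lyapunov A C H = - mat 1 \<and> (\<forall>v. v \<noteq> 0 \<longrightarrow> 0 < v \<bullet> (H *v v)) \<and>
     (\<forall>v. 2 * ((A *v v) \<bullet> (H *v v)) \<le> - (norm v)\<^sup>2))"

lemma P: "transpose P = P" "lyapunov A C P = - mat 1" "v \<noteq> 0 \<Longrightarrow> 0 < v \<bullet> (P *v v)"
    "2 * ((A *v v) \<bullet> (P *v v)) \<le> - (norm v)\<^sup>2"
proof -
  obtain H where "transpose H = H" "lyapunov A C H = - mat 1" "\<And>v. v \<noteq> 0 \<Longrightarrow> 0 < v \<bullet> (H *v v)"
    "\<And>v. 2 * ((A *v v) \<bullet> (H *v v)) \<le> - (norm v)\<^sup>2" by (rule lyapunov_solution, rule that)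
  then have "\<exists>H. transpose H = H \<and> lyapunov A C H = - mat 1 \<and> (\<forall>v. v \<noteq> 0 \<longrightarrow> 0 < v \<bullet> (H *v v)) \<and>
     (\<forall>v. 2 * ((A *v v) \<bullet> (H *v v)) \<le> - (norm v)\<^sup>2)" by blast
  from someI_ex[OF this, folded P_def]
  show "transpose P = P" "lyapunov A C P = - mat 1" "v \<noteq> 0 \<Longrightarrow> 0 < v \<bullet> (P *v v)"
    "2 * ((A *v v) \<bullet> (P *v v)) \<le> - (norm v)\<^sup>2" by blast+
qed

definition state_mean :: "(real \<Rightarrow> real^'m) \<Rightarrow> real \<Rightarrow> real^'n" where
  "state_mean u t = (\<integral>\<omega>. x u t \<omega> \<partial>M)"

lemma state_mean_rep:
  assumes "square_integrable halfline u"
  shows "ac_rep (\<integral>\<omega>. a \<omega> \<partial>M) (\<lambda>s. A *v state_mean u s + b *v u s) (state_mean u)"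
  unfolding state_mean_def[abs_def] by (rule ito_solution_mean[OF sol[OF assms] init_adapted assms])

text \<open>An instance with weight zero: it supplies stability, uniqueness and decay of means while
  reality and symmetry of \<Theta> are still to be proved.\<close>

sublocale energy: lq_problem A P 0 \<Gamma> b "\<integral>\<omega>. a \<omega> \<partial>M" state_mean
  by unfold_locales (fact P \<Gamma>_sym state_mean_rep | simp add: transpose_def vec_eq_iff)+

subsection \<open>The mean flow\<close>

lemma mean_flow_rep: "ac_rep v (\<lambda>s. A *v mean_flow v s) (mean_flow v)"
  by (rule ac_rep_cong[OF ito_solution_mean[OF flow_solution const_adapted square_integrable_zero]])
    (simp_all add: mean_flow_def prob_space)

lemma mean_flow_rep': "ac_rep v (\<lambda>s. A *v mean_flow v s + 0) (mean_flow v)"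
  using mean_flow_rep by simp

lemma mean_flow_square_integrable: "square_integrable halfline (mean_flow v)"
proof -
  obtain c where "\<And>d0 f d. ac_rep d0 (\<lambda>s. A *v d s + f s) d \<Longrightarrow> square_integrable halfline f \<Longrightarrow>
       square_integrable halfline d \<and>
       (\<integral>s. (norm (d s))\<^sup>2 \<partial>halfline) \<le> c * ((norm d0)\<^sup>2 + (\<integral>s. (norm (f s))\<^sup>2 \<partial>halfline))"
    by (rule energy.l2_stability, rule that)
  from this[OF mean_flow_rep' square_integrable_zero] show ?thesis by blast
qed

lemma mean_flow_nice: "nice_halfline (mean_flow v)" "(mean_flow v \<longlongrightarrow> 0) at_top"
proof -
  obtain c \<kappa> where k: "0 < \<kappa>" and le: "\<And>t. 0 \<le> t \<Longrightarrow> norm (mean_flow v t) \<le> c * exp (- \<kappa> * t)"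
    by (rule energy.exponential_decay[OF mean_flow_rep' square_integrable_zero, of 0]) (simp, blast)
  show "nice_halfline (mean_flow v)" "(mean_flow v \<longlongrightarrow> 0) at_top"
    by (rule exp_bound_nice[OF ac_rep_continuous[OF mean_flow_rep] k], rule le, assumption)+
qed

lemma mean_flow_unique:
  assumes "ac_rep v (\<lambda>s. A *v d s) d" "0 \<le> t" shows "mean_flow v t = d t"
proof (rule energy.ac_rep_unique[OF mean_flow_rep' _ assms(2)])
  show "ac_rep v (\<lambda>s. A *v d s + 0) d" using assms(1) by simp
qed

text \<open>Linearity in the initial vector, by uniqueness; it lets the matrix \<open>gram\<close>,
  built from basis vectors, be evaluated at arbitrary vectors.\<close>

lemma mean_flow_expansion:
  assumes "0 \<le> t" shows "mean_flow v t = (\<Sum>k\<in>UNIV. v $ k *\<^sub>R mean_flow (axis k 1) t)"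
proof (rule mean_flow_unique[OF _ assms])
  have "ac_rep (\<Sum>k\<in>UNIV. v $ k *\<^sub>R axis k 1) (\<lambda>s. \<Sum>k\<in>UNIV. v $ k *\<^sub>R (A *v mean_flow (axis k 1) s))
     (\<lambda>t. \<Sum>k\<in>UNIV. v $ k *\<^sub>R mean_flow (axis k 1) t)"
    by (intro ac_rep_sum ac_rep_scaleR mean_flow_rep)
  moreover have "(\<Sum>k\<in>UNIV. v $ k *\<^sub>R axis k 1) = v"
    by (simp add: vec_eq_iff axis_def if_distrib cong: if_cong)
  ultimately show "ac_rep v (\<lambda>s. A *v (\<Sum>k\<in>UNIV. v $ k *\<^sub>R mean_flow (axis k 1) s)) (\<lambda>t. \<Sum>k\<in>UNIV. v $ k *\<^sub>R mean_flow (axis k 1) t)"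
    by (simp add: linear_sum[OF matrix_vector_mul_linear] matrix_vector_mult_scaleR)
qed

text \<open>Applying \<open>A\<close> to a motion yields the motion from the image of its initial
  vector.\<close>

lemma mean_flow_generator:
  assumes "0 \<le> t" shows "mean_flow (A *v v) t = A *v mean_flow v t"
  by (rule mean_flow_unique[OF ac_rep_bounded_linear[OF bounded_linear_matrix_vector mean_flow_rep] assms])

abbreviation flow_gram :: "real^'n^'n \<Rightarrow> real^'n^'n" where
  "flow_gram T \<equiv> gram (\<lambda>k. mean_flow (axis k 1)) T"

lemma inner_flow_gram: "v \<bullet> (flow_gram T *v v') = (\<integral>t. mean_flow v t \<bullet> (T *v mean_flow v' t) \<partial>halfline)"
proof -
  let ?d = "\<lambda>k. mean_flow (axis k 1)"
  have i: "integrable halfline (\<lambda>t. ?d p t \<bullet> (T *v ?d q t))" for p q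
    by (intro integrable_inner_square_integrable square_integrable_mult_vec mean_flow_square_integrable)
  have "(\<integral>t. mean_flow v t \<bullet> (T *v mean_flow v' t) \<partial>halfline)
    = (\<integral>t. (\<Sum>p\<in>UNIV. \<Sum>q\<in>UNIV. (v $ p * v' $ q) * (?d p t \<bullet> (T *v ?d q t))) \<partial>halfline)"
  proof (rule Bochner_Integration.integral_cong[OF refl])
    fix t assume "t \<in> space halfline"
    then have t: "0 \<le> t" by (simp add: space_restrict_space)
    show "mean_flow v t \<bullet> (T *v mean_flow v' t) = (\<Sum>p\<in>UNIV. \<Sum>q\<in>UNIV. (v $ p * v' $ q) * (?d p t \<bullet> (T *v ?d q t)))"
      unfolding mean_flow_expansion[OF t, of v] mean_flow_expansion[OF t, of v']
      by (simp add: linear_sum[OF matrix_vector_mul_linear] matrix_vector_mult_scaleR inner_sum_left inner_sum_right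
          sum_distrib_left mult_ac) (rule sum.swap)
  qed
  also have "\<dots> = (\<Sum>p\<in>UNIV. \<Sum>q\<in>UNIV. (v $ p * v' $ q) * (\<integral>t. ?d p t \<bullet> (T *v ?d q t) \<partial>halfline))"
    by (simp only: Bochner_Integration.integral_sum Bochner_Integration.integrable_sum integrable_mult_right i
        Bochner_Integration.integral_mult_right_zero)
  also have "\<dots> = v \<bullet> (flow_gram T *v v')"
    unfolding inner_matrix_sum[of v "flow_gram T" v'] by (simp add: gram_def mult_ac)
  finally show ?thesis ..
qed

text \<open>The derivative of \<open>mean_flow v t \<bullet> (T *v mean_flow v' t)\<close> is
  integrated over the half line; by \<open>ac_rep_total\<close> only the initial value
  remains.\<close>

lemma flow_gram_lyapunov: "(A *v v) \<bullet> (flow_gram T *v v') + v \<bullet> (flow_gram T *v (A *v v')) = - (v \<bullet> (T *v v'))"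
proof -
  have i: "integrable halfline (\<lambda>t. mean_flow v t \<bullet> (T *v mean_flow v' t))" for v v'
    by (intro integrable_inner_square_integrable square_integrable_mult_vec mean_flow_square_integrable)
  have "ac_rep (v \<bullet> (T *v v'))
      (\<lambda>t. mean_flow (A *v v) t \<bullet> (T *v mean_flow v' t) + mean_flow v t \<bullet> (T *v mean_flow (A *v v') t))
      (\<lambda>t. mean_flow v t \<bullet> (T *v mean_flow v' t))"
    by (rule ac_rep_cong[OF ac_rep_inner_matrix[OF mean_flow_rep mean_flow_rep]]) (simp_all add: mean_flow_generator)
  from ac_rep_total[OF this Bochner_Integration.integrable_add[OF i i] i] show ?thesis
    unfolding inner_flow_gram by (simp add: Bochner_Integration.integral_add[OF i i])
qed

subsection \<open>Reality and symmetry of \<open>\<Theta>\<close>\<close>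

abbreviation \<Theta>r :: "real^'n^'n" where "\<Theta>r \<equiv> re_mat \<Theta>"

abbreviation S :: "real^'n^'n" where "S \<equiv> flow_gram \<Theta>r"

lemma \<Theta>_parts: "\<Theta>r = G + transpose C ** S ** C" "im_mat \<Theta> = transpose C ** flow_gram (im_mat \<Theta>) ** C"
  using theta_equation_parts[OF hurwitz \<Theta>_eq mean_flow_rep mean_flow_nice] by blast+

lemma inner_\<Theta>r: "v \<bullet> (\<Theta>r *v v') = v \<bullet> (G *v v') + (C *v v) \<bullet> (S *v (C *v v'))"
  by (subst \<Theta>_parts(1)) (simp only: matrix_vector_mult_add_rdistrib inner_add_right inner_conjugate)

text \<open>The Gram matrix satisfies the deterministic Lyapunov equation with right side
  \<open>- \<Theta>r\<close>, and the conjugated term in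
  \<open>\<Theta>r = G + transpose C ** S ** C\<close> completes the stochastic operator.\<close>

lemma lyapunov_S: "lyapunov A C S = - G"
proof (rule matrix_eq_inner)
  show "v \<bullet> (lyapunov A C S *v v') = v \<bullet> (- G *v v')" for v v'
    using flow_gram_lyapunov[of v \<Theta>r v'] by (simp only: inner_lyapunov inner_\<Theta>r uminus_matrix_vector inner_minus_right)
qed

text \<open>The imaginary part solves the equation with \<open>G = 0\<close>, so its Gram matrix is
  annihilated by the Lyapunov operator.\<close>

lemma im_\<Theta>: "im_mat \<Theta> = 0"
proof -
  let ?S = "flow_gram (im_mat \<Theta>)"
  have eq: "v \<bullet> (im_mat \<Theta> *v v') = (C *v v) \<bullet> (?S *v (C *v v'))" for v v'
    by (subst \<Theta>_parts(2)) (rule inner_conjugate)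
  have "lyapunov A C ?S = 0"
  proof (rule matrix_eq_inner)
    show "v \<bullet> (lyapunov A C ?S *v v') = v \<bullet> (0 *v v')" for v v'
      using flow_gram_lyapunov[of v "im_mat \<Theta>" v'] by (simp add: inner_lyapunov eq)
  qed
  then have "?S = 0" by (rule lyapunov_zero)
  then show ?thesis by (intro matrix_eq_inner) (simp only: eq, simp)
qed

text \<open>The transpose solves the same Lyapunov equation because \<open>G\<close> is symmetric;
  injectivity identifies the two.\<close>

lemma S_sym: "transpose S = S"
proof -
  have "lyapunov A C (transpose S) = lyapunov A C S"
    by (simp only: lyapunov_transpose lyapunov_S transpose_uminus G_sym)
  then show ?thesis using inj_lyapunov by (simp add: inj_eq)
qed

lemma \<Theta>r_sym: "transpose \<Theta>r = \<Theta>r"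
proof (rule matrix_eq_inner)
  fix v v'
  have "v \<bullet> (transpose \<Theta>r *v v') = v' \<bullet> (\<Theta>r *v v)"
    using dot_matrix_transpose[of v "transpose \<Theta>r" v'] by (simp only: transpose_transpose inner_commute)
  then show "v \<bullet> (transpose \<Theta>r *v v') = v \<bullet> (\<Theta>r *v v')"
    unfolding inner_\<Theta>r using dot_matrix_symmetric[OF G_sym, of v v'] dot_matrix_symmetric[OF S_sym, of "C *v v" "C *v v'"]
    by (simp only: inner_commute)
qed

lemma \<Theta>_real: "\<Theta> = cmat \<Theta>r"
  by (rule complex_mat_eqI) (simp_all only: im_\<Theta>, simp_all add: re_mat_def im_mat_def vec_eq_iff)

sublocale lq: lq_problem A P \<Theta>r \<Gamma> b "\<integral>\<omega>. a \<omega> \<partial>M" state_mean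
  by unfold_locales (fact P \<Gamma>_sym \<Theta>r_sym state_mean_rep)+

subsection \<open>The cost functional\<close>

context
  fixes u :: "real \<Rightarrow> real^'m"
  assumes u: "square_integrable halfline u"
begin

lemma state_square_integrable: "0 \<le> t \<Longrightarrow> square_integrable M (x u t)"
  using ito_solution_square_integrable(7)[OF sol[OF u] init_adapted u, of t] by (simp add: adapted_l2_def)

definition forcing :: "real^'n^'n \<Rightarrow> real \<Rightarrow> real" where
  "forcing H s = (b *v u s) \<bullet> (H *v state_mean u s) + state_mean u s \<bullet> (H *v (b *v u s))"

lemma state_moment:
  "ac_rep (\<integral>\<omega>. a \<omega> \<bullet> (H *v a \<omega>) \<partial>M)
    (\<lambda>s. (\<integral>\<omega>. x u s \<omega> \<bullet> (lyapunov A C H *v x u s \<omega>) \<partial>M) + forcing H s)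
    (\<lambda>t. \<integral>\<omega>. x u t \<omega> \<bullet> (H *v x u t \<omega>) \<partial>M)"
  using moment_identity[OF sol[OF u] init_adapted u sol[OF u] init_adapted u, where H=H]
  by (simp only: forcing_def state_mean_def[symmetric] add.assoc)

lemma forcing_integrable: "integrable halfline (forcing H)"
  unfolding forcing_def[abs_def]
  by (intro Bochner_Integration.integrable_add integrable_inner_square_integrable square_integrable_mult_vec u
      energy.traj_square_integrable)

text \<open>With weight \<open>P\<close> the state dissipates exactly its mean square, and the
  moment itself is nonnegative; so the time integral is bounded by the initial moment and the
  integrable influence of the control.\<close>

lemma state_energy_integrable: "integrable halfline (\<lambda>s. \<integral>\<omega>. (norm (x u s \<omega>))\<^sup>2 \<partial>M)"
proof -
  let ?X = "\<lambda>s. \<integral>\<omega>. (norm (x u s \<omega>))\<^sup>2 \<partial>M" and ?E = "\<integral>\<omega>. a \<omega> \<bullet> (P *v a \<omega>) \<partial>M"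
  have L: "lyapunov A C P *v v = - v" for v by (simp add: P(2) uminus_matrix_vector)
  have nn: "0 \<le> v \<bullet> (P *v v)" for v using P(3)[of v] by (cases "v = 0") (auto intro: less_imp_le)
  have "integrable halfline ?X \<and> (\<integral>s. ?X s \<partial>halfline) \<le> ?E + (\<integral>s. \<bar>forcing P s\<bar> \<partial>halfline)"
  proof (rule integrable_halfline_nonneg)
    fix t :: real assume t: "0 \<le> t"
    note q = ito_solution_square_integrable(1)[OF sol[OF u] init_adapted u t]
    show Xi: "integrable (upto_measure t) ?X"
      using time_prob_inner(2)[OF q q] by (simp only: power2_norm_eq_inner)
    note fi = integrable_halfline_upto[OF forcing_integrable]
    have "0 \<le> (\<integral>\<omega>. x u t \<omega> \<bullet> (P *v x u t \<omega>) \<partial>M)"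
      by (rule Bochner_Integration.integral_nonneg) (rule nn)
    also have "\<dots> = ?E + (\<integral>s. - ?X s + forcing P s \<partial>upto_measure t)"
      using ac_repD(2)[OF state_moment[of P] t] by (simp add: L power2_norm_eq_inner)
    also have "\<dots> = ?E - (\<integral>s. ?X s \<partial>upto_measure t) + (\<integral>s. forcing P s \<partial>upto_measure t)"
      using Xi fi by simp
    finally show "(\<integral>s. ?X s \<partial>upto_measure t) \<le> ?E + (\<integral>s. \<bar>forcing P s\<bar> \<partial>halfline)"
      using integral_upto_le_halfline[OF forcing_integrable[of P], of t] by linarith
  qed (simp add: integral_nonneg)
  then show ?thesis ..
qed

lemma state_moment_integrable: "integrable halfline (\<lambda>s. \<integral>\<omega>. x u s \<omega> \<bullet> (H *v x u s \<omega>) \<partial>M)"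
proof -
  let ?X = "\<lambda>s. \<integral>\<omega>. (norm (x u s \<omega>))\<^sup>2 \<partial>M"
  obtain K where K: "0 \<le> K" "\<And>v. norm (H *v v) \<le> K * norm v" using matrix_vector_bound[of H] by blast
  show ?thesis
  proof (rule Bochner_Integration.integrable_bound[OF integrable_mult_right[OF state_energy_integrable, of "(1 + K\<^sup>2) / 2"]])
    show "(\<lambda>s. \<integral>\<omega>. x u s \<omega> \<bullet> (H *v x u s \<omega>) \<partial>M) \<in> borel_measurable halfline"
      by (rule continuous_halfline_measurable[OF ac_rep_continuous[OF state_moment]])
    show "AE s in halfline. norm (\<integral>\<omega>. x u s \<omega> \<bullet> (H *v x u s \<omega>) \<partial>M) \<le> norm ((1 + K\<^sup>2) / 2 * ?X s)"
    proof (rule AE_I2)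
      fix s assume "s \<in> space halfline"
      then have s: "0 \<le> s" by (simp add: space_restrict_space)
      note q = state_square_integrable[OF s] square_integrable_mult_vec[OF state_square_integrable[OF s], of H]
      have "(\<integral>\<omega>. (norm (H *v x u s \<omega>))\<^sup>2 \<partial>M) \<le> (\<integral>\<omega>. K\<^sup>2 * (norm (x u s \<omega>))\<^sup>2 \<partial>M)"
        by (intro integral_mono integrable_mult_right square_integrableD(2) q norm_square_le K)
      then have "\<bar>\<integral>\<omega>. x u s \<omega> \<bullet> (H *v x u s \<omega>) \<partial>M\<bar> \<le> (?X s + K\<^sup>2 * ?X s) / 2"
        using moment_bound[OF q] by simp
      also have "\<dots> = (1 + K\<^sup>2) / 2 * ?X s" by (simp add: algebra_simps)
      finally show "norm (\<integral>\<omega>. x u s \<omega> \<bullet> (H *v x u s \<omega>) \<partial>M) \<le> norm ((1 + K\<^sup>2) / 2 * ?X s)" by simp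
    qed
  qed
qed

text \<open>The control enters both derivatives through the same term \<open>forcing S\<close>,
  which cancels in the difference. The remaining constant depends on the initial state alone, so
  stochastic and deterministic problem have the same minimizers.\<close>

lemma cost_eq:
  "cost M G \<Gamma> (x u) u = lq.total_cost u
     + ((\<integral>\<omega>. a \<omega> \<bullet> (S *v a \<omega>) \<partial>M) - (\<integral>\<omega>. a \<omega> \<partial>M) \<bullet> (S *v (\<integral>\<omega>. a \<omega> \<partial>M)))"
proof -
  let ?m = "state_mean u" and ?g = "\<lambda>s. \<integral>\<omega>. x u s \<omega> \<bullet> (G *v x u s \<omega>) \<partial>M"
    and ?c = "(\<integral>\<omega>. a \<omega> \<bullet> (S *v a \<omega>) \<partial>M) - (\<integral>\<omega>. a \<omega> \<partial>M) \<bullet> (S *v (\<integral>\<omega>. a \<omega> \<partial>M))"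
  note sm = energy.traj_square_integrable[OF u]
  have im: "integrable halfline (\<lambda>s. ?m s \<bullet> (H *v ?m s))" for H
    by (intro integrable_inner_square_integrable square_integrable_mult_vec sm)
  have iu: "integrable halfline (\<lambda>s. u s \<bullet> (\<Gamma> *v u s))"
    by (intro integrable_inner_square_integrable square_integrable_mult_vec u)
  note ig = state_moment_integrable[of G]
  have "ac_rep ?c (\<lambda>s. ?m s \<bullet> (\<Theta>r *v ?m s) - ?g s) (\<lambda>t. (\<integral>\<omega>. x u t \<omega> \<bullet> (S *v x u t \<omega>) \<partial>M) - ?m t \<bullet> (S *v ?m t))"
  proof (rule ac_rep_cong[OF ac_rep_diff[OF state_moment[of S] ac_rep_inner_matrix[OF state_mean_rep[OF u] state_mean_rep[OF u], of S]]])
    fix s :: real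
    have "(\<integral>\<omega>. x u s \<omega> \<bullet> (lyapunov A C S *v x u s \<omega>) \<partial>M) = - ?g s"
      by (simp add: lyapunov_S uminus_matrix_vector)
    then show "(\<integral>\<omega>. x u s \<omega> \<bullet> (lyapunov A C S *v x u s \<omega>) \<partial>M) + forcing S s
        - ((A *v ?m s + b *v u s) \<bullet> (S *v ?m s) + ?m s \<bullet> (S *v (A *v ?m s + b *v u s)))
      = ?m s \<bullet> (\<Theta>r *v ?m s) - ?g s"
      using flow_gram_lyapunov[of "?m s" \<Theta>r "?m s"]
      by (simp add: forcing_def matrix_vector_right_distrib inner_add_left inner_add_right)
  qed simp_all
  from ac_rep_total[OF this Bochner_Integration.integrable_diff[OF im ig]
      Bochner_Integration.integrable_diff[OF state_moment_integrable im]]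
  have "?c + (\<integral>s. ?m s \<bullet> (\<Theta>r *v ?m s) \<partial>halfline) - (\<integral>s. ?g s \<partial>halfline) = 0"
    unfolding Bochner_Integration.integral_diff[OF im ig] by (simp only: add_diff_eq)
  moreover have "cost M G \<Gamma> (x u) u = (\<integral>s. ?g s + u s \<bullet> (\<Gamma> *v u s) \<partial>halfline)"
    by (simp add: cost_def set_lebesgue_integral_def halfline_integral)
  moreover have "lq.total_cost u = (\<integral>s. ?m s \<bullet> (\<Theta>r *v ?m s) + u s \<bullet> (\<Gamma> *v u s) \<partial>halfline)"
    by (simp only: lq.total_cost_def lq.quad_cost_def)
  ultimately show ?thesis
    unfolding Bochner_Integration.integral_add[OF ig iu] Bochner_Integration.integral_add[OF im iu] by linarith
qed

end

lemma optimal_control_iff: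
  "optimal_control M G \<Gamma> x u0 \<longleftrightarrow> square_integrable halfline u0 \<and>
     (\<forall>u. square_integrable halfline u \<longrightarrow> lq.total_cost u0 \<le> lq.total_cost u)"
  unfolding optimal_control_def Ball_def controls_iff using cost_eq by auto

lemma freq_form_eq:
  "freq_form \<Theta> \<Gamma> z u = complex_of_real (re_vec z \<bullet> (\<Theta>r *v re_vec z) + im_vec z \<bullet> (\<Theta>r *v im_vec z)
    + re_vec u \<bullet> (\<Gamma> *v re_vec u) + im_vec u \<bullet> (\<Gamma> *v im_vec u))"
  by (subst \<Theta>_real) (rule freq_form_real[OF \<Theta>r_sym \<Gamma>_sym])

lemma frequency_condition:
  assumes "optimal_control M G \<Gamma> x u0"
  shows "0 \<le> freq_form \<Theta> \<Gamma> (resolvent A \<nu> *v (cmat b *v u)) u"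
proof -
  let ?z = "resolvent A \<nu> *v (cmat b *v u)"
  have nonneg: "0 \<le> lq.quad_cost v (lq.response v)" if "square_integrable halfline v" for v
    using assms unfolding optimal_control_iff lq.total_cost_def
    by (intro lq.optimal_imp_nonneg[OF _ _ that, of u0]) blast+
  have "A *v re_vec ?z + b *v re_vec u = - \<nu> *\<^sub>R im_vec ?z" "A *v im_vec ?z + b *v im_vec u = \<nu> *\<^sub>R re_vec ?z"
    using iffD1[OF resolvent_eq_iff[OF hurwitz, of \<nu> "cmat b *v u" ?z] refl]
    unfolding re_cmat_vec im_cmat_vec by blast+
  from lq.frequency_condition_necessary[OF nonneg this] show ?thesis
    unfolding freq_form_eq by (simp add: less_eq_complex_def)
qed

lemma optimal_control_exists:
  assumes \<delta>: "0 < \<delta>" and le: "\<And>\<nu> u. complex_of_real (\<delta> * (norm u)\<^sup>2) \<le> freq_form \<Theta> \<Gamma> (resolvent A \<nu> *v (cmat b *v u)) u"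
  shows "\<exists>u0. optimal_control M G \<Gamma> x u0 \<and>
    (\<forall>u1. optimal_control M G \<Gamma> x u1 \<longrightarrow> (AE t in lborel. t > 0 \<longrightarrow> u1 t = u0 t))"
proof -
  have fb: "lq.freq_bound \<delta>"
    unfolding lq.freq_bound_def
  proof (intro allI impI, elim conjE)
    fix \<nu> p q U V assume e: "A *v p + b *v U = - \<nu> *\<^sub>R q" "A *v q + b *v V = \<nu> *\<^sub>R p"
    \<comment> \<open>Real solutions of the stationary equations are read as one complex resolvent
      equation, which makes the assumed inequality available.\<close>
    have "resolvent A \<nu> *v (cmat b *v complex_vec U V) = complex_vec p q"
      unfolding resolvent_eq_iff[OF hurwitz] re_cmat_vec im_cmat_vec complex_vec_parts using e by blast
    with le[of "complex_vec U V" \<nu>]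
    show "\<delta> * ((norm U)\<^sup>2 + (norm V)\<^sup>2) \<le> p \<bullet> (\<Theta>r *v p) + q \<bullet> (\<Theta>r *v q) + U \<bullet> (\<Gamma> *v U) + V \<bullet> (\<Gamma> *v V)"
      unfolding freq_form_eq norm_complex_vec by (simp only: complex_vec_parts less_eq_complex_def Re_complex_of_real)
  qed
  show ?thesis
  proof (rule lq.minimizer_exists[OF fb \<delta>])
    fix u0 assume u0: "square_integrable halfline u0" "\<And>u. square_integrable halfline u \<Longrightarrow> lq.total_cost u0 \<le> lq.total_cost u"
      "\<And>u1. square_integrable halfline u1 \<Longrightarrow> (\<And>u. square_integrable halfline u \<Longrightarrow> lq.total_cost u1 \<le> lq.total_cost u) \<Longrightarrow>
         (AE s in halfline. u1 s = u0 s)"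
    have "AE t in lborel. t > 0 \<longrightarrow> u1 t = u0 t" if "optimal_control M G \<Gamma> x u1" for u1
    proof -
      have "AE s in halfline. u1 s = u0 s" using that unfolding optimal_control_iff by (intro u0(3)) blast+
      then show ?thesis by (subst (asm) AE_restrict_space_iff) auto
    qed
    moreover have "optimal_control M G \<Gamma> x u0" unfolding optimal_control_iff using u0(1,2) by blast
    ultimately show ?thesis by blast
  qed
qed

end

theorem theorem1:
  fixes M :: "'w measure" and F :: "real \<Rightarrow> 'w measure" and w :: "real \<Rightarrow> 'w \<Rightarrow> real"
    and A C G :: "real^'n^'n" and b :: "real^'m^'n" and \<Gamma> :: "real^'m^'m"
    and a :: "'w \<Rightarrow> real^'n" and x :: "(real \<Rightarrow> real^'m) \<Rightarrow> real \<Rightarrow> 'w \<Rightarrow> real^'n"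
    and \<Theta> :: "complex^'n^'n"
  assumes "prob_space M" and "nonneg_filtration M F" and "wiener_process M F w"
    and "transpose G = G" and "transpose \<Gamma> = \<Gamma>"
    and "initial_state M F w a"
    and "\<And>u. u \<in> controls \<Longrightarrow> ito_solution M F w A b C a u (x u)"
    and "hurwitz A" and "mean_square_exp_stable M F w A b C"
    and "theta_equation A C G \<Theta>"
  shows "((\<exists>u0. optimal_control M G \<Gamma> x u0) \<longrightarrow>
           (\<forall>\<nu> u. 0 \<le> freq_form \<Theta> \<Gamma> (resolvent A \<nu> *v (cmat b *v u)) u)) \<and>
         ((\<exists>\<delta>>0. \<forall>\<nu> u. complex_of_real (\<delta> * (norm u)\<^sup>2)
                \<le> freq_form \<Theta> \<Gamma> (resolvent A \<nu> *v (cmat b *v u)) u) \<longrightarrow>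
           (\<exists>u0. optimal_control M G \<Gamma> x u0 \<and>
              (\<forall>u1. optimal_control M G \<Gamma> x u1 \<longrightarrow> (AE t in lborel. t > 0 \<longrightarrow> u1 t = u0 t))))"
proof -
  interpret wiener_space M F w by (rule wiener_space.intro[OF assms(1-3)])
  interpret control_system M F w A C b G \<Gamma> a x \<Theta>
    by unfold_locales (fact assms, fact assms, fact assms, fact assms, rule assms(7), simp add: controls_iff, (fact assms)+)
  show ?thesis
  proof (intro conjI impI allI)
    show "0 \<le> freq_form \<Theta> \<Gamma> (resolvent A \<nu> *v (cmat b *v u)) u" if "\<exists>u0. optimal_control M G \<Gamma> x u0" for \<nu> u
      using that by (elim exE) (rule frequency_condition)
    assume "\<exists>\<delta>>0. \<forall>\<nu> u. complex_of_real (\<delta> * (norm u)\<^sup>2)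
                \<le> freq_form \<Theta> \<Gamma> (resolvent A \<nu> *v (cmat b *v u)) u"
    then show "\<exists>u0. optimal_control M G \<Gamma> x u0 \<and>
              (\<forall>u1. optimal_control M G \<Gamma> x u1 \<longrightarrow> (AE t in lborel. t > 0 \<longrightarrow> u1 t = u0 t))"
      by (elim exE conjE) (rule optimal_control_exists, assumption, (drule spec)+, assumption)
  qed
qed

end
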